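(* Let $b_1,b_2\in C^1[0,1]$ be real-valued velocity fields such that $b_i(x)\neq 0$ for all $x\in[0,1]$, $i=1,2$, and such that there exists some $x^*\in[0,1]$ with $b_1(x^* )\neq b_2(x^* )$. Consider the two-speed model $$\begin{cases}\partial_t p_1+\partial_x(b_1(x)p_1)=-p_1+p_2,& x\in(0,1),\ t>0,\\ \partial_t p_2+\partial_x(b_2(x)p_2)=p_1-p_2,& x\in(0,1),\ t>0,\\ b_i(0)p_i(t,0)=b_i(1)p_i(t,1),& i=1,2,\ t>0,\\ p_i(0,x)=p_{i,\mathrm{init}}(x),& x\in[0,1],\ i=1,2.\end{cases}$$ 1. There exists a positive steady state $p_\infty=(p_{1,\infty},p_{2,\infty})$ of this system, which is unique subject to the normalization condition $\int_0^1(p_{1,\infty}(x)+p_{2,\infty}(x))\,dx=1$. 2. For initial data $p_{\mathrm{init}}=(p_{1,\mathrm{init}},p_{2,\mathrm{init}})\in (L^2[0,1])^2$, there exists a unique (mild) solution $p(t)=(p_1(t,\cdot),p_2(t,\cdot))$ of the system, which converges to the steady state exponentially. More precisely, there exist $C=e^{\pi/2}>1$ and $\alpha>0$ such that $$\|p(t)-\Pi p(t)\|\leq Ce^{-\alpha t}\|p(0)-\Pi p(0)\|,\qquad \forall t\geq 0,$$ where $$\Pi p(t):=\left(\int_0^1(p_1(t,w)+p_2(t,w))\,dw\right)p_\infty=\left(\int_0^1(p_{1,\mathrm{init}}(w)+p_{2,\mathrm{init}}(w))\,dw\right)p_\infty .$$ Here the norm is $\|p\|:=\left(\sum_{i=1,2}\int_0^1|p_i|^2p_{i,\infty}^{-1}\,dx\right)^{1/2}$,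 defined using the steady state $p_\infty$, and it is equivalent to the usual $L^2$ norm.
   Context: A steady state is a time-independent solution $p=(p_1,p_2)$ of the system, i.e. $\partial_x(b_1p_1)=-p_1+p_2$ and $\partial_x(b_2p_2)=p_1-p_2$ on $(0,1)$, with $b_i(0)p_i(0)=b_i(1)p_i(1)$ for $i=1,2$. It is positive if $p_i(x)>0$ for all $x\in[0,1]$, $i=1,2$. Let $p_\infty$ be the normalized positive steady state of part 1, and let $X:=L^2([0,1],p_{1,\infty}^{-1}dx)\times L^2([0,1],p_{2,\infty}^{-1}dx)$, the complex Hilbert space with inner product $(p,q)=\sum_{i=1,2}\int_0^1 p_i\bar q_i p_{i,\infty}^{-1}dx$ and the norm $\|\cdot\|$ above. Define the unbounded operator $A:D(A)\to X$ by $(Ap)_1=-\partial_x(b_1p_1)-p_1+p_2$, $(Ap)_2=-\partial_x(b_2p_2)-p_2+p_1$, with domain $D(A)=\{p=(p_1,p_2)\in X:\ b_ip_i\in H^1(0,1),\ b_i(0)p_i(0)=b_i(1)p_i(1),\ i=1,2\}$. Mild solutions are those defined via the $C^0$ semigroup $(e^{tA})_{t\ge0}$ on $X$ generated by $A$, i.e. $p(t)=e^{tA}p_{\mathrm{init}}$. *)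

theory Defs
  imports "HOL-Analysis.Analysis"
begin

abbreviation unit_measure :: "real measure" where
  "unit_measure \<equiv> lebesgue_on {0..1}"

(* One-sided derivatives at the endpoints, so the values of f outside [0,1] play no role. *)
definition C1_unit :: "(real \<Rightarrow> real) \<Rightarrow> bool" where
  "C1_unit f \<longleftrightarrow>
     (\<exists>f'. (\<forall>x\<in>{0..1}. (f has_real_derivative f' x) (at x within {0..1}))
         \<and> continuous_on {0..1} f')"

(* b i p i is only asked to be differentiable on the open interval; continuity on [0,1] is what
   gives the boundary condition its meaning. *)
definition steady_state :: "(2 \<Rightarrow> real \<Rightarrow> real) \<Rightarrow> (2 \<Rightarrow> real \<Rightarrow> real) \<Rightarrow> bool" where
  "steady_state b p \<longleftrightarrow>
     (\<forall>i. continuous_on {0..1} (p i))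
   \<and> (\<forall>x\<in>{0<..<1}. ((\<lambda>y. b 1 y * p 1 y) has_real_derivative (- p 1 x + p 2 x)) (at x))
   \<and> (\<forall>x\<in>{0<..<1}. ((\<lambda>y. b 2 y * p 2 y) has_real_derivative (p 1 x - p 2 x)) (at x))
   \<and> (\<forall>i. b i 0 * p i 0 = b i 1 * p i 1)"

definition normalized_positive_steady_state ::
    "(2 \<Rightarrow> real \<Rightarrow> real) \<Rightarrow> (2 \<Rightarrow> real \<Rightarrow> real) \<Rightarrow> bool" where
  "normalized_positive_steady_state b p \<longleftrightarrow>
     steady_state b p \<and> (\<forall>i. \<forall>x\<in>{0..1}. 0 < p i x)
   \<and> (LINT x|unit_measure. p 1 x + p 2 x) = 1"

text \<open>
  Elements of the \<open>L\<^sup>2\<close> spaces are represented by functions, and two functions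
  represent the same element iff they agree almost everywhere on the unit interval. All notions
  below are invariant under this identification.
\<close>

definition L2 :: "real measure \<Rightarrow> (real \<Rightarrow> complex) set" where
  "L2 M = {f \<in> borel_measurable M. integrable M (\<lambda>x. (cmod (f x))\<^sup>2)}"

type_synonym profile = "2 \<Rightarrow> real \<Rightarrow> complex"

definition ae_eq :: "profile \<Rightarrow> profile \<Rightarrow> bool" where
  "ae_eq p q \<longleftrightarrow> (\<forall>i. AE x in unit_measure. p i x = q i x)"

definition L2_pairs :: "profile set" where
  "L2_pairs = {p. \<forall>i. p i \<in> L2 unit_measure}"

definition L2_norm :: "profile \<Rightarrow> real" where
  "L2_norm p = sqrt (\<Sum>i\<in>UNIV. LINT x|unit_measure. (cmod (p i x))\<^sup>2)"

(* w is meant to be the normalized positive steady state, here and below. *)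
definition X_space :: "(2 \<Rightarrow> real \<Rightarrow> real) \<Rightarrow> profile set" where
  "X_space w = {p. \<forall>i. p i \<in> L2 (density unit_measure (\<lambda>x. ennreal (inverse (w i x))))}"

definition X_norm :: "(2 \<Rightarrow> real \<Rightarrow> real) \<Rightarrow> profile \<Rightarrow> real" where
  "X_norm w p = sqrt (\<Sum>i\<in>UNIV. LINT x|unit_measure. (cmod (p i x))\<^sup>2 * inverse (w i x))"

definition test_function :: "(real \<Rightarrow> real) \<Rightarrow> bool" where
  "test_function \<phi> \<longleftrightarrow>
     (\<forall>n x. ((deriv ^^ n) \<phi>) differentiable (at x))
   \<and> (\<exists>a c. 0 < a \<and> c < 1 \<and> (\<forall>x. x \<notin> {a..c} \<longrightarrow> \<phi> x = 0))"

definition is_weak_deriv :: "(real \<Rightarrow> complex) \<Rightarrow> (real \<Rightarrow> complex) \<Rightarrow> bool" where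
  "is_weak_deriv f g \<longleftrightarrow>
     (\<forall>\<phi>. test_function \<phi> \<longrightarrow>
        (LINT x|unit_measure. f x * complex_of_real (deriv \<phi> x))
        = - (LINT x|unit_measure. g x * complex_of_real (\<phi> x)))"

definition H1 :: "(real \<Rightarrow> complex) set" where
  "H1 = {f \<in> L2 unit_measure. \<exists>g \<in> L2 unit_measure. is_weak_deriv f g}"

(* For f in H1 this is determined up to almost everywhere equality. *)
definition weak_deriv :: "(real \<Rightarrow> complex) \<Rightarrow> real \<Rightarrow> complex" where
  "weak_deriv f = (SOME g. g \<in> L2 unit_measure \<and> is_weak_deriv f g)"

(* The boundary values of f are those of its continuous representative, which exists for f in H1
   and is unique on [0,1]. *)
definition periodic_trace :: "(real \<Rightarrow> complex) \<Rightarrow> bool" where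
  "periodic_trace f \<longleftrightarrow>
     (\<exists>F. continuous_on {0..1} F \<and> (AE x in unit_measure. F x = f x) \<and> F 0 = F 1)"

definition flux :: "(2 \<Rightarrow> real \<Rightarrow> real) \<Rightarrow> profile \<Rightarrow> profile" where
  "flux b p = (\<lambda>i x. complex_of_real (b i x) * p i x)"

definition A_dom :: "(2 \<Rightarrow> real \<Rightarrow> real) \<Rightarrow> (2 \<Rightarrow> real \<Rightarrow> real) \<Rightarrow> profile set" where
  "A_dom b w = {p \<in> X_space w. \<forall>i. flux b p i \<in> H1 \<and> periodic_trace (flux b p i)}"

definition A_op :: "(2 \<Rightarrow> real \<Rightarrow> real) \<Rightarrow> profile \<Rightarrow> profile" where
  "A_op b p = (\<lambda>i x. if i = 1 then - weak_deriv (flux b p 1) x - p 1 x + p 2 x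
                            else - weak_deriv (flux b p 2) x - p 2 x + p 1 x)"

definition bounded_operator_on_X ::
    "(2 \<Rightarrow> real \<Rightarrow> real) \<Rightarrow> (profile \<Rightarrow> profile) \<Rightarrow> bool" where
  "bounded_operator_on_X w S \<longleftrightarrow>
     (\<forall>p\<in>X_space w. S p \<in> X_space w)
   \<and> (\<forall>p\<in>X_space w. \<forall>q\<in>X_space w.
        ae_eq (S (\<lambda>i x. p i x + q i x)) (\<lambda>i x. S p i x + S q i x))
   \<and> (\<forall>c. \<forall>p\<in>X_space w. ae_eq (S (\<lambda>i x. c * p i x)) (\<lambda>i x. c * S p i x))
   \<and> (\<exists>K. \<forall>p\<in>X_space w. X_norm w (S p) \<le> K * X_norm w p)"

definition C0_semigroup ::
    "(2 \<Rightarrow> real \<Rightarrow> real) \<Rightarrow> (real \<Rightarrow> profile \<Rightarrow> profile) \<Rightarrow> bool" where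
  "C0_semigroup w T \<longleftrightarrow>
     (\<forall>t\<ge>0. bounded_operator_on_X w (T t))
   \<and> (\<forall>p\<in>X_space w. ae_eq (T 0 p) p)
   \<and> (\<forall>s\<ge>0. \<forall>t\<ge>0. \<forall>p\<in>X_space w. ae_eq (T (s + t) p) (T s (T t p)))
   \<and> (\<forall>p\<in>X_space w. ((\<lambda>t. X_norm w (\<lambda>i x. T t p i x - p i x)) \<longlongrightarrow> 0) (at_right 0))"

(* g represents the right derivative of T t p at t = 0, in the norm of X. *)
definition generator_limit ::
    "(2 \<Rightarrow> real \<Rightarrow> real) \<Rightarrow> (real \<Rightarrow> profile \<Rightarrow> profile) \<Rightarrow> profile \<Rightarrow> profile \<Rightarrow> bool" where
  "generator_limit w T p g \<longleftrightarrow>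
     ((\<lambda>h. X_norm w (\<lambda>i x. (T h p i x - p i x) / complex_of_real h - g i x)) \<longlongrightarrow> 0) (at_right 0)"

definition A_generates ::
    "(2 \<Rightarrow> real \<Rightarrow> real) \<Rightarrow> (2 \<Rightarrow> real \<Rightarrow> real) \<Rightarrow> (real \<Rightarrow> profile \<Rightarrow> profile) \<Rightarrow> bool" where
  "A_generates b w T \<longleftrightarrow>
     C0_semigroup w T
   \<and> A_dom b w = {p \<in> X_space w. \<exists>g\<in>X_space w. generator_limit w T p g}
   \<and> (\<forall>p\<in>A_dom b w. generator_limit w T p (A_op b p))"

definition mild_solution ::
    "(2 \<Rightarrow> real \<Rightarrow> real) \<Rightarrow> (2 \<Rightarrow> real \<Rightarrow> real) \<Rightarrow> profile \<Rightarrow> (real \<Rightarrow> profile) \<Rightarrow> bool" where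
  "mild_solution b w p0 p \<longleftrightarrow>
     p0 \<in> X_space w \<and> (\<exists>T. A_generates b w T \<and> (\<forall>t\<ge>0. ae_eq (p t) (T t p0)))"

definition mass :: "profile \<Rightarrow> complex" where
  "mass p = (LINT x|unit_measure. p 1 x + p 2 x)"

definition Proj :: "(2 \<Rightarrow> real \<Rightarrow> real) \<Rightarrow> profile \<Rightarrow> profile" where
  "Proj w p = (\<lambda>i x. mass p * complex_of_real (w i x))"

end

theory Submission
  imports Defs "HOL-Computational_Algebra.Polynomial"
begin

text \<open>
For a steady state the fluxes \<open>J\<^sub>i = b\<^sub>i p\<^sub>i\<close> satisfy a linear
system in which \<open>J\<^sub>1 + J\<^sub>2\<close> is constant, so it reduces to one scalar periodic problem that
an integrating factor solves explicitly; the formula shows that \<open>J\<^sub>i\<close> and \<open>b\<^sub>i\<close>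
have signs that can be made equal by one common factor (\<open>steady_state_exists\<close>). If \<open>q\<close> is a second
steady state and \<open>f\<^sub>i = q\<^sub>i / p\<^sub>i\<close>, then \<open>\<Sum> J\<^sub>i f\<^sub>i\<^sup>2\<close> is periodic and has derivative
\<open>- (p\<^sub>1 + p\<^sub>2) (f\<^sub>1 - f\<^sub>2)\<^sup>2\<close>, hence \<open>f\<^sub>1 = f\<^sub>2\<close> is constant (\<open>steady_state_unique\<close>).

For the well-posedness, note that in the variables \<open>f\<^sub>i = p\<^sub>i / w\<^sub>i\<close>, with \<open>w\<close> the steady state, the operator reads
\<open>(A p)\<^sub>i = - J\<^sub>i f\<^sub>i' + w\<^sub>j (f\<^sub>j - f\<^sub>i)\<close>, where \<open>j\<close> is the other index, and the same computation gives
\<open>Re (A p, p) = - 1/2 \<integral> (w\<^sub>1 + w\<^sub>2) |f\<^sub>1 - f\<^sub>2|\<^sup>2 \<le> 0\<close> (\<open>energy_identity\<close>).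
For large \<open>l\<close> the equation \<open>l p - A p = g\<close> is solvable: uncoupled, it is a scalar periodic
equation for each flux, and the coupling is a small perturbation handled by a contraction argument
(\<open>A_surjective\<close>). A Hille--Yosida argument in a real Hilbert space then
yields a contraction semigroup whose generator is exactly \<open>A\<close>, and it is the only strongly continuous
semigroup with this generator (\<open>generated_semigroup_unique\<close>). The domain, which is given by weak
derivatives and continuous representatives, is described by periodic absolutely continuous fluxes with
square integrable derivative; the link is the lemma of du Bois-Reymond.

As to the decay, the energy identity controls only the difference \<open>g = f\<^sub>1 - f\<^sub>2\<close>. Control of the rest comes from
the commutator of the two transport operators: where \<open>b\<^sub>1 \<noteq> b\<^sub>2\<close>, a solution with \<open>g = 0\<close> cannot keep a
nonconstant \<open>f\<^sub>1\<close>. Quantitatively, let \<open>h\<close> be \<open>f\<^sub>1\<close> minus a weighted mean. A bounded symmetric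
form \<open>psi\<close> is constructed with
\<open>\<sigma> psi (p, A p) \<ge> \<mu> \<parallel>h\<parallel>\<^sup>2 - C (\<parallel>g\<parallel> \<parallel>h\<parallel> + \<parallel>g\<parallel>\<^sup>2)\<close> for some sign \<open>\<sigma>\<close> (\<open>psi_lower_bound\<close>). For \<open>\<Lambda>\<close> large, the form
\<open>\<Lambda> (p, q) - \<sigma> psi (p, q)\<close> is therefore equivalent to the inner product and strictly decreasing
along solutions of mass zero, whose norm is bounded by a multiple of \<open>\<parallel>h\<parallel> + \<parallel>g\<parallel>\<close> (\<open>poincare\<close>). This gives a bound
\<open>M e\<^sup>-\<^sup>a\<^sup>t\<close> with some uncontrolled \<open>M\<close>. Since the semigroup is also contractive, interpolation between the two bounds
replaces \<open>M\<close> by any prescribed constant greater than one, at the expense of the rate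
(\<open>exponential_decay\<close>); the constant of the theorem is one such choice.
\<close>

section \<open>Linear flows and strongly continuous semigroups\<close>

text \<open>
The solution of the linear equation is the exponential series \<open>\<Sum> t\<^sup>n / n! B\<^sup>n x\<close>, which may be
differentiated term by term because it and its derivative converge uniformly on bounded intervals.
\<close>
lemma bounded_linear_flow_exists:
  fixes B :: "'a::banach \<Rightarrow> 'a"
  assumes "bounded_linear B"
  shows "\<exists>u. u 0 = x \<and> (\<forall>t. (u has_vector_derivative B (u t)) (at t))"
proof -
  interpret B: bounded_linear B by fact
  define c where "c n = (B ^^ n) x" for n
  have c_Suc: "c (Suc n) = B (c n)" for n by (simp add: c_def)
  obtain K where K: "K > 0" "\<And>y. norm (B y) \<le> norm y * K" using B.pos_bounded by blast
  have cb: "norm (c n) \<le> K ^ n * norm x" for n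
  proof (induction n)
    case (Suc n)
    have "norm (c (Suc n)) \<le> norm (c n) * K" unfolding c_Suc by (rule K)
    also have "\<dots> \<le> (K ^ n * norm x) * K" using Suc K by (intro mult_right_mono) auto
    finally show ?case by (simp add: algebra_simps)
  qed (simp add: c_def)
  define f where "f n t = (t ^ n / fact n) *\<^sub>R c n" for n and t :: real
  define v where "v t = (\<Sum>n. (t ^ n / fact n) *\<^sub>R c (Suc n))" for t :: real
  define u where "u t = (\<Sum>n. f n t)" for t
  have fb: "norm (f n t) \<le> (r * K) ^ n / fact n * norm x" if "\<bar>t\<bar> \<le> r" for n t r
  proof -
    have "norm (f n t) = \<bar>t\<bar> ^ n / fact n * norm (c n)" by (simp add: f_def power_abs)
    also have "\<dots> \<le> r ^ n / fact n * (K ^ n * norm x)"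
      using that by (intro mult_mono divide_right_mono power_mono cb) auto
    finally show ?thesis by (simp add: power_mult_distrib)
  qed
  have sE: "summable (\<lambda>n. y ^ n / fact n * a)" for y a :: real
    using summable_exp[of y] by (intro summable_mult2) (simp add: field_simps)
  have sf: "summable (\<lambda>n. f n t)" for t
    by (rule summable_comparison_test'[where N = 0, OF sE[of "\<bar>t\<bar> * K" "norm x"]]) (rule fb[OF order_refl])
  have Bu: "B (u t) = v t" for t
    unfolding u_def v_def by (subst B.suminf[OF sf]) (simp add: f_def B.scaleR c_Suc)
  have vul: "uniform_limit (cball 0 r) (\<lambda>n t. \<Sum>i<n. (t ^ i / fact i) *\<^sub>R c (Suc i)) v sequentially" for r
    unfolding v_def
  proof (rule Weierstrass_m_test)
    show "summable (\<lambda>n. (r * K) ^ n / fact n * (norm x * K))" by (rule sE)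
    fix n t assume "t \<in> cball (0::real) r"
    then have t: "\<bar>t\<bar> \<le> r" by simp
    have "norm ((t ^ n / fact n) *\<^sub>R c (Suc n)) = norm (B (f n t))"
      by (simp add: f_def B.scaleR c_Suc)
    also have "\<dots> \<le> norm (f n t) * K" by (rule K)
    also have "\<dots> \<le> ((r * K) ^ n / fact n * norm x) * K" using fb[OF t] K by (intro mult_right_mono) auto
    finally show "norm ((t ^ n / fact n) *\<^sub>R c (Suc n)) \<le> (r * K) ^ n / fact n * (norm x * K)"
      by (simp add: algebra_simps)
  qed
  define f' where "f' n t h = h *\<^sub>R (if n = 0 then 0 else (t ^ (n - 1) / fact (n - 1)) *\<^sub>R c n)" for n and t h :: real
  have fder: "(f n has_derivative f' n t) (at t within S)" for n t S
  proof (cases n)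
    case 0
    then show ?thesis by (simp add: f_def[abs_def] f'_def[abs_def])
  next
    case (Suc m)
    have "((\<lambda>t. t ^ Suc m / fact (Suc m)) has_real_derivative (t ^ m / fact m)) (at t within S)"
    proof -
      have "((\<lambda>t. t ^ Suc m / fact (Suc m)) has_real_derivative (of_nat (Suc m) * t ^ m / fact (Suc m))) (at t within S)"
        using DERIV_cdivide[OF DERIV_pow[of "Suc m" t S], of "fact (Suc m)"] by (simp del: of_nat_Suc fact_Suc)
      moreover have "of_nat (Suc m) * t ^ m / fact (Suc m) = t ^ m / fact m"
        by (simp add: fact_Suc del: of_nat_Suc)
      ultimately show ?thesis by simp
    qed
    then have "((\<lambda>t. (t ^ Suc m / fact (Suc m)) *\<^sub>R c (Suc m)) has_derivative (\<lambda>h. (t ^ m / fact m * h) *\<^sub>R c (Suc m))) (at t within S)"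
      unfolding has_field_derivative_def by (rule has_derivative_scaleR_left)
    then show ?thesis unfolding f_def[abs_def] f'_def[abs_def] Suc by (simp add: algebra_simps)
  qed
  have key: "(u has_vector_derivative B (u t)) (at t)" for t
  proof -
    define r where "r = \<bar>t\<bar> + 1"
    have "\<exists>g. \<forall>x\<in>cball 0 r. (\<lambda>n. f n x) sums (g x) \<and> (g has_derivative (\<lambda>h. h *\<^sub>R v x)) (at x within cball 0 r)"
    proof (rule has_derivative_series[where x = t])
      show "(f n has_derivative f' n y) (at y within cball 0 r)" for n y by (rule fder)
      show "t \<in> cball 0 r" by (simp add: r_def)
      show "(\<lambda>n. f n t) sums u t" unfolding u_def using sf by (rule summable_sums)
      fix e :: real assume e: "e > 0"
      from uniform_limitD[OF vul[of r] e] obtain N where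
        N: "\<And>n y. n \<ge> N \<Longrightarrow> y \<in> cball 0 r \<Longrightarrow> dist (\<Sum>i<n. (y ^ i / fact i) *\<^sub>R c (Suc i)) (v y) < e"
        unfolding eventually_sequentially by blast
      show "\<forall>\<^sub>F n in sequentially. \<forall>x\<in>cball 0 r. \<forall>h. norm ((\<Sum>i<n. f' i x h) - h *\<^sub>R v x) \<le> e * norm h"
        unfolding eventually_sequentially
      proof (intro exI allI impI ballI)
        fix n and y h :: real assume n: "Suc N \<le> n" and y: "y \<in> cball 0 r"
        then obtain m where m: "n = Suc m" "m \<ge> N" by (cases n) auto
        have "(\<Sum>i<n. f' i y h) = h *\<^sub>R (\<Sum>i<m. (y ^ i / fact i) *\<^sub>R c (Suc i))"
          unfolding m(1) sum.lessThan_Suc_shift by (simp add: f'_def scaleR_sum_right)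
        then have "norm ((\<Sum>i<n. f' i y h) - h *\<^sub>R v y)
            = \<bar>h\<bar> * dist (\<Sum>i<m. (y ^ i / fact i) *\<^sub>R c (Suc i)) (v y)"
          by (simp add: dist_norm flip: scaleR_right_diff_distrib)
        also have "\<dots> \<le> \<bar>h\<bar> * e" using N[OF m(2) y] by (intro mult_left_mono) auto
        finally show "norm ((\<Sum>i<n. f' i y h) - h *\<^sub>R v y) \<le> e * norm h" by (simp add: mult.commute)
      qed
    qed simp
    then obtain g where g: "\<And>y. y \<in> cball 0 r \<Longrightarrow> (\<lambda>n. f n y) sums (g y)"
      "\<And>y. y \<in> cball 0 r \<Longrightarrow> (g has_derivative (\<lambda>h. h *\<^sub>R v y)) (at y within cball 0 r)" by blast
    have gu: "g y = u y" if "y \<in> cball 0 r" for y unfolding u_def using g(1)[OF that] by (simp add: sums_iff)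
    have tb: "t \<in> ball 0 r" by (simp add: r_def)
    have "(g has_derivative (\<lambda>h. h *\<^sub>R v t)) (at t within ball 0 r)"
      by (rule has_derivative_subset[OF g(2)]) (use tb in auto)
    then have "(g has_derivative (\<lambda>h. h *\<^sub>R v t)) (at t)"
      using tb by (simp add: at_within_open[OF tb])
    then have "(u has_derivative (\<lambda>h. h *\<^sub>R v t)) (at t)"
      by (rule has_derivative_transform_within_open[OF _ open_ball tb]) (use gu in auto)
    then show ?thesis unfolding has_vector_derivative_def Bu .
  qed
  show ?thesis
  proof (intro exI[of _ u] conjI allI)
    have "(\<Sum>n. f n 0) = (\<Sum>n\<in>{0}. f n 0)" by (rule suminf_finite) (auto simp: f_def)
    then show "u 0 = x" unfolding u_def by (simp add: f_def c_def)
  qed (rule key)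
qed

text \<open>
Formally \<open>\<parallel>z\<parallel>' = (z', z) / \<parallel>z\<parallel> \<le> M\<close>. It is used with \<open>M = 0\<close> for contraction and uniqueness, and with
\<open>M > 0\<close> to compare two approximating flows.
\<close>
lemma norm_growth_bound:
  fixes z :: "real \<Rightarrow> 'a::real_inner"
  assumes der: "\<And>s. 0 \<le> s \<Longrightarrow> s \<le> t \<Longrightarrow> (z has_vector_derivative z' s) (at s within {0..t})"
    and le: "\<And>s. 0 \<le> s \<Longrightarrow> s \<le> t \<Longrightarrow> inner (z' s) (z s) \<le> M * norm (z s)"
    and "0 \<le> M" "0 \<le> t"
  shows "norm (z t) \<le> norm (z 0) + M * t"
proof (rule field_le_epsilon)
  fix e :: real assume e: "e > 0"
  \<comment> \<open>A smooth substitute for the norm, which is not differentiable at zero.\<close>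
  define q where "q s = sqrt (inner (z s) (z s) + e\<^sup>2)" for s
  have pos: "0 < inner (z s) (z s) + e\<^sup>2" for s using e by (simp add: add_nonneg_pos)
  have zq: "norm (z s) \<le> q s" for s
    unfolding q_def norm_eq_sqrt_inner by (intro real_sqrt_le_mono) simp
  have dq: "(q has_real_derivative inner (z' s) (z s) / q s) (at s within {0..t})" if "0 \<le> s" "s \<le> t" for s
  proof -
    have "((\<lambda>s. inner (z s) (z s) + e\<^sup>2) has_real_derivative 2 * inner (z' s) (z s)) (at s within {0..t})"
      using der[OF that] unfolding has_vector_derivative_def has_field_derivative_def
      by (auto intro!: derivative_eq_intros simp: inner_commute)
    from DERIV_chain2[OF DERIV_real_sqrt[OF pos[of s]] this] show ?thesis
      unfolding q_def by (simp add: field_simps)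
  qed
  have "q t - q 0 \<le> M * t - M * 0"
  proof (cases "t = 0")
    case False
    have "\<exists>x\<in>{0<..<t}. (M * t - q t) - (M * 0 - q 0) = (t - 0) * (M - inner (z' x) (z x) / q x)"
    proof (rule mvt_simple[of 0 t "\<lambda>s. M * s - q s" "\<lambda>x h. h * (M - inner (z' x) (z x) / q x)"])
      show "0 < t" using False assms by simp
      fix x assume "0 \<le> x" "x \<le> t"
      from dq[OF this] show "((\<lambda>s. M * s - q s) has_derivative (\<lambda>h. h * (M - inner (z' x) (z x) / q x))) (at x within {0..t})"
        unfolding has_field_derivative_def by (auto intro!: derivative_eq_intros simp: algebra_simps)
    qed
    then obtain x where x: "0 < x" "x < t" and
      eq: "(M * t - q t) - (M * 0 - q 0) = (t - 0) * (M - inner (z' x) (z x) / q x)" by auto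
    have "inner (z' x) (z x) \<le> M * q x"
      using le[of x] zq[of x] x \<open>0 \<le> M\<close> by (meson less_imp_le mult_left_mono order_trans)
    moreover have "q x > 0" unfolding q_def using pos by simp
    ultimately have "inner (z' x) (z x) / q x \<le> M" by (simp add: divide_le_eq)
    then have "(t - 0) * (M - inner (z' x) (z x) / q x) \<ge> 0" using \<open>0 \<le> t\<close> by simp
    then show ?thesis using eq by linarith
  qed simp
  moreover have "q 0 \<le> norm (z 0) + e"
    unfolding q_def using e
    by (intro real_le_lsqrt) (auto simp: power2_sum power2_norm_eq_inner)
  ultimately show "norm (z t) \<le> norm (z 0) + M * t + e" using zq[of t] by simp
qed

locale c0_semigroup =
  fixes T :: "real \<Rightarrow> 'a::banach \<Rightarrow> 'a"
  assumes bl: "0 \<le> t \<Longrightarrow> bounded_linear (T t)"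
    and T_0: "T 0 x = x"
    and T_add: "0 \<le> s \<Longrightarrow> 0 \<le> t \<Longrightarrow> T (s + t) x = T s (T t x)"
    and T_right: "((\<lambda>h. T h x) \<longlongrightarrow> x) (at_right 0)"
begin

text \<open>
A uniform boundedness argument: strong continuity at zero makes the space a countable union of closed sets on
each of which the operators with small time are bounded, so by Baire one of these sets contains a ball.
\<close>
lemma bounded_near_0:
  obtains \<delta> K where "\<delta> > 0" "K \<ge> 1" "\<And>h y. 0 \<le> h \<Longrightarrow> h \<le> \<delta> \<Longrightarrow> norm (T h y) \<le> K * norm y"
proof -
  \<comment> \<open>The same index controls the time interval and the bound, which keeps the union countable.\<close>
  define F where "F n = {x. \<forall>h\<in>{0..1 / real (Suc n)}. norm (T h x) \<le> real (Suc n)}" for n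
  have cl: "closed (F n)" for n
  proof -
    have "F n = (\<Inter>h\<in>{0..1 / real (Suc n)}. {x. norm (T h x) \<le> real (Suc n)})" by (auto simp: F_def)
    moreover have "closed {x. norm (T h x) \<le> real (Suc n)}" if "h \<in> {0..1 / real (Suc n)}" for h
      using bl[of h] that
      by (intro closed_Collect_le continuous_intros linear_continuous_on[unfolded continuous_on_eq_continuous_within]) 
        (auto intro: bounded_linear.continuous_on)
    ultimately show ?thesis by auto
  qed
  have un: "(\<Union>n. F n) = UNIV"
  proof (intro set_eqI iffI UNIV_I)
    fix x :: 'a
    have "\<forall>\<^sub>F h in at_right 0. dist (T h x) x < 1" using T_right[of x] by (rule tendstoD) simp
    then obtain d where d: "d > 0" "\<And>h. 0 < h \<Longrightarrow> h < d \<Longrightarrow> dist (T h x) x < 1"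
      unfolding eventually_at_right_field by blast
    obtain n1 where n1: "1 / real (Suc n1) < d" using d(1) by (metis nat_approx_posE)
    obtain n2 where n2: "norm x + 1 \<le> real n2" using real_arch_simple by blast
    define n where "n = max n1 n2"
    have "1 / real (Suc n) \<le> 1 / real (Suc n1)" by (simp add: n_def frac_le)
    with n1 have n: "1 / real (Suc n) < d" by simp
    have "norm (T h x) \<le> real (Suc n)" if h: "h \<in> {0..1 / real (Suc n)}" for h
    proof (cases "h = 0")
      case True then show ?thesis using n2 by (simp add: T_0 n_def)
    next
      case False
      then have "dist (T h x) x < 1" using d(2)[of h] h n by auto
      then have "norm (T h x) < norm x + 1" by (smt (verit) dist_norm norm_triangle_sub)
      then show ?thesis using n2 by (simp add: n_def)
    qed
    then show "x \<in> (\<Union>n. F n)" by (intro UN_I[of n]) (auto simp only: F_def)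
  qed
  have "\<exists>n. interior (F n) \<noteq> {}"
  proof (rule ccontr)
    assume "\<not> ?thesis"
    then have "euclidean interior_of (\<Union>(range F)) = {}"
      using cl by (intro Baire_category_alt) (auto simp: completely_metrizable_space_euclidean)
    then show False using un by simp
  qed
  then obtain n x0 where "x0 \<in> interior (F n)" by blast
  then obtain r where r: "r > 0" "cball x0 r \<subseteq> F n" by (metis mem_interior_cball)
  show thesis
  proof (rule that)
    show "0 < 1 / real (Suc n)" by simp
    show "1 \<le> max 1 (2 * real (Suc n) / r)" by simp
    fix h y assume h: "0 \<le> h" "h \<le> 1 / real (Suc n)"
    interpret Th: bounded_linear "T h" using bl h by simp
    show "norm (T h y) \<le> max 1 (2 * real (Suc n) / r) * norm y"
    proof (cases "y = 0")
      case False
      define z where "z = (r / norm y) *\<^sub>R y"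
      have "norm z = r" using False r by (simp add: z_def)
      then have "x0 + z \<in> F n" "x0 \<in> F n" using r by (auto simp: dist_norm intro!: subsetD[OF r(2)])
      then have "norm (T h (x0 + z)) \<le> real (Suc n)" "norm (T h x0) \<le> real (Suc n)" using h by (auto simp: F_def)
      moreover have "T h z = T h (x0 + z) - T h x0" by (simp add: Th.add)
      ultimately have "norm (T h z) \<le> 2 * real (Suc n)" by (smt (verit) norm_triangle_ineq4)
      moreover have "norm (T h z) = r / norm y * norm (T h y)" using r by (simp add: z_def Th.scaleR)
      ultimately have "norm (T h y) \<le> (2 * real (Suc n) / r) * norm y" using r False by (simp add: field_simps)
      also have "\<dots> \<le> max 1 (2 * real (Suc n) / r) * norm y" by (intro mult_right_mono) auto
      finally show ?thesis .
    qed (simp add: Th.zero)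
  qed
qed

lemma locally_bounded:
  obtains K where "K \<ge> 1" "\<And>h y. 0 \<le> h \<Longrightarrow> h \<le> r \<Longrightarrow> norm (T h y) \<le> K * norm y"
proof -
  obtain \<delta> K where d: "\<delta> > 0" "K \<ge> 1" and K: "\<And>h y. 0 \<le> h \<Longrightarrow> h \<le> \<delta> \<Longrightarrow> norm (T h y) \<le> K * norm y"
    by (rule bounded_near_0) blast
  have step: "norm (T h y) \<le> K ^ Suc n * norm y" if "0 \<le> h" "h \<le> \<delta> * real (Suc n)" for n h y
    using that
  proof (induction n arbitrary: h y)
    case (Suc n)
    show ?case
    proof (cases "h \<le> \<delta>")
      case True
      have "norm (T h y) \<le> K * norm y" using K True Suc by simp
      also have "\<dots> \<le> K ^ Suc (Suc n) * norm y"
        using d power_increasing[of 1 "Suc (Suc n)" K] by (intro mult_right_mono) auto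
      finally show ?thesis .
    next
      case False
      have "norm (T h y) = norm (T (h - \<delta>) (T \<delta> y))" using T_add[of "h - \<delta>" \<delta> y] False d by simp
      also have "\<dots> \<le> K ^ Suc n * norm (T \<delta> y)"
        using Suc.prems False d by (intro Suc.IH) (auto simp: algebra_simps)
      also have "\<dots> \<le> K ^ Suc n * (K * norm y)" using d K by (intro mult_left_mono) auto
      finally show ?thesis by (simp add: algebra_simps)
    qed
  qed (use K in simp)
  obtain n where "r / \<delta> \<le> real n" using real_arch_simple by blast
  then have "r \<le> \<delta> * real (Suc n)" using d by (simp add: field_simps)
  then show thesis using that[of "K ^ Suc n"] step[of _ n] one_le_power[OF d(2), of "Suc n"] by (meson order_trans)
qed

text \<open>
A right derivative at time zero propagates along the orbit. For the derivative from the left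
one needs the operators to be bounded uniformly on bounded time intervals.
\<close>
lemma T_derivative:
  assumes gen: "((\<lambda>h. (T h x - x) /\<^sub>R h) \<longlongrightarrow> y) (at_right 0)" and t: "0 \<le> t"
  shows "((\<lambda>t. T t x) has_vector_derivative T t y) (at t within {0..})"
proof -
  obtain K where K: "K \<ge> 1" "\<And>h y. 0 \<le> h \<Longrightarrow> h \<le> t \<Longrightarrow> norm (T h y) \<le> K * norm y"
    using locally_bounded by blast
  define E where "E h = norm (T h y - y) + norm ((T h x - x) /\<^sub>R h - y)" for h
  have E: "(E \<longlongrightarrow> 0) (at_right 0)"
    unfolding E_def using tendsto_add[OF tendsto_norm_zero[OF LIM_zero[OF T_right[of y]]] tendsto_norm_zero[OF LIM_zero[OF gen]]] by simp
  have est: "norm (T s x - T t x - (s - t) *\<^sub>R T t y) \<le> \<bar>s - t\<bar> * (K * E \<bar>s - t\<bar>)" if s: "s \<ge> 0" "s \<noteq> t" for s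
  proof (cases "s > t")
    case True
    define h where "h = s - t"
    have h: "h > 0" "s = t + h" using True by (auto simp: h_def)
    interpret Tt: bounded_linear "T t" using bl t by simp
    have "T s x - T t x - (s - t) *\<^sub>R T t y = T t (h *\<^sub>R ((T h x - x) /\<^sub>R h - y))"
      using h t by (simp add: T_add Tt.diff Tt.scaleR scaleR_right_diff_distrib)
    also have "norm \<dots> \<le> K * norm (h *\<^sub>R ((T h x - x) /\<^sub>R h - y))" using t by (intro K) auto
    also have "\<dots> = h * (K * norm ((T h x - x) /\<^sub>R h - y))" using h by simp
    also have "\<dots> \<le> h * (K * E h)" using h K unfolding E_def by (intro mult_left_mono) auto
    finally show ?thesis using h by simp
  next
    case False
    define h where "h = t - s"
    have h: "h > 0" "t = s + h" using False s by (auto simp: h_def)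
    interpret Ts: bounded_linear "T s" using bl s by simp
    have Ts_comm: "T h (T s z) = T s (T h z)" for z using T_add[of s h z] T_add[of h s z] s h by (simp add: add.commute)
    \<comment> \<open>From the left, the base point of the difference quotient is the moving time \<open>s\<close>; the term \<open>T h y - y\<close> corrects for this.\<close>
    have "T s x - T t x - (s - t) *\<^sub>R T t y = T s (h *\<^sub>R ((T h y - y) - ((T h x - x) /\<^sub>R h - y)))"
      using h s by (simp add: add.commute[of s h] T_add Ts.diff Ts.add Ts.scaleR Ts_comm)
        (simp add: algebra_simps)
    also have "norm \<dots> \<le> K * norm (h *\<^sub>R ((T h y - y) - ((T h x - x) /\<^sub>R h - y)))" using s h by (intro K) auto
    also have "\<dots> = h * (K * norm ((T h y - y) - ((T h x - x) /\<^sub>R h - y)))" using h by simp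
    also have "\<dots> \<le> h * (K * E h)" using h K unfolding E_def by (intro mult_left_mono norm_triangle_ineq4) auto
    finally show ?thesis using h by simp
  qed
  have lim: "((\<lambda>s. K * E \<bar>s - t\<bar>) \<longlongrightarrow> 0) (at t within {0..})"
  proof -
    have "filterlim (\<lambda>s. \<bar>s - t\<bar>) (at_right 0) (at t within {0..})"
      unfolding filterlim_at by (auto intro!: tendsto_eq_intros simp: eventually_at_filter)
    from filterlim_compose[OF E this] show ?thesis by (auto intro!: tendsto_eq_intros)
  qed
  show ?thesis
    unfolding has_vector_derivative_def has_derivative_iff_norm
  proof (intro conjI bounded_linear_intros)
    show "((\<lambda>s. norm (T s x - T t x - (s - t) *\<^sub>R T t y) / norm (s - t)) \<longlongrightarrow> 0) (at t within {0..})"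
    proof (rule Lim_null_comparison[OF _ lim])
      show "\<forall>\<^sub>F s in at t within {0..}. norm (norm (T s x - T t x - (s - t) *\<^sub>R T t y) / norm (s - t)) \<le> K * E \<bar>s - t\<bar>"
        unfolding eventually_at_filter
        by (rule eventuallyI) (use est in \<open>auto simp: divide_le_eq mult.commute\<close>)
    qed
  qed
qed

end

section \<open>Dissipative operators generate contraction semigroups\<close>

text \<open>
The parallelogram law makes every minimizing sequence for the distance to \<open>y\<close> a Cauchy sequence. The lemma serves to
show that the domain of an m-dissipative operator is dense.
\<close>
lemma orthogonal_projection_exists:
  fixes S :: "'a::{real_inner,banach} set"
  assumes "subspace S" "closed S"
  obtains m where "m \<in> S" "\<And>z. z \<in> S \<Longrightarrow> inner (y - m) z = 0"
proof -
  define d where "d = infdist y S"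
  have S0: "0 \<in> S" using assms subspace_0 by blast
  have "\<exists>x\<in>S. dist y x < d + 1 / real (Suc n)" for n
  proof -
    have "(INF a\<in>S. dist y a) < d + 1 / real (Suc n)" using S0 by (auto simp: d_def infdist_def)
    then show ?thesis using S0 by (subst (asm) cINF_less_iff) (auto intro!: bdd_belowI2[of _ 0])
  qed
  then obtain x where x: "\<And>n. x n \<in> S" "\<And>n. dist y (x n) < d + 1 / real (Suc n)" by metis
  have d0: "d \<ge> 0" by (simp add: d_def infdist_nonneg)
  have dl: "d \<le> dist y z" if "z \<in> S" for z using infdist_le[OF that] by (simp add: d_def)
  have par: "(norm (x n - x m))\<^sup>2 \<le> 4 * ((d + 1 / real (Suc N))\<^sup>2 - d\<^sup>2)" if "n \<ge> N" "m \<ge> N" for n m N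
  proof -
    have b: "norm (y - x k) \<le> d + 1 / real (Suc N)" if "k \<ge> N" for k
    proof -
      have "1 / real (Suc k) \<le> 1 / real (Suc N)" using that by (simp add: frac_le)
      then show ?thesis using x(2)[of k] by (simp add: dist_norm)
    qed
    have "(1/2) *\<^sub>R (x n + x m) \<in> S" using x assms by (simp add: subspace_add subspace_scale)
    from dl[OF this] have "d \<le> norm ((1/2) *\<^sub>R ((y - x n) + (y - x m)))" by (simp add: dist_norm algebra_simps flip: scaleR_add_left)
    then have "2 * d \<le> norm ((y - x n) + (y - x m))" by simp
    then have "(2 * d)\<^sup>2 \<le> (norm ((y - x n) + (y - x m)))\<^sup>2" using d0 by (intro power_mono) auto
    moreover have "(norm (x n - x m))\<^sup>2 + (norm ((y - x n) + (y - x m)))\<^sup>2 = 2 * (norm (y - x n))\<^sup>2 + 2 * (norm (y - x m))\<^sup>2"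
      by (simp add: power2_norm_eq_inner inner_diff inner_add inner_commute algebra_simps)
    moreover have "(norm (y - x n))\<^sup>2 \<le> (d + 1 / real (Suc N))\<^sup>2" "(norm (y - x m))\<^sup>2 \<le> (d + 1 / real (Suc N))\<^sup>2"
      using b that by (auto intro!: power_mono)
    ultimately show ?thesis by (simp add: power_mult_distrib)
  qed
  have lim0: "(\<lambda>N. 4 * ((d + 1 / real (Suc N))\<^sup>2 - d\<^sup>2)) \<longlonglongrightarrow> 0"
  proof -
    have "(\<lambda>N. 1 / real (Suc N)) \<longlonglongrightarrow> 0" by (rule LIMSEQ_Suc[OF lim_1_over_n])
    then have "(\<lambda>N. 4 * ((d + 1 / real (Suc N))\<^sup>2 - d\<^sup>2)) \<longlonglongrightarrow> 4 * ((d + 0)\<^sup>2 - d\<^sup>2)"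
      by (intro tendsto_intros)
    then show ?thesis by simp
  qed
  have "Cauchy x"
  proof (rule metric_CauchyI)
    fix e :: real assume e: "e > 0"
    then have "\<forall>\<^sub>F N in sequentially. 4 * ((d + 1 / real (Suc N))\<^sup>2 - d\<^sup>2) < e\<^sup>2" using order_tendstoD(2)[OF lim0, of "e\<^sup>2"] by simp
    then obtain N where N: "4 * ((d + 1 / real (Suc N))\<^sup>2 - d\<^sup>2) < e\<^sup>2" unfolding eventually_sequentially by blast
    have "dist (x m) (x n) < e" if "m \<ge> N" "n \<ge> N" for m n
      using par[OF that] N e by (smt (verit) dist_norm norm_ge_zero power2_less_imp_less)
    then show "\<exists>N. \<forall>m\<ge>N. \<forall>n\<ge>N. dist (x m) (x n) < e" by blast
  qed
  then obtain m where m: "x \<longlonglongrightarrow> m" using Cauchy_convergent convergent_def by blast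
  have mS: "m \<in> S" using closed_sequentially[OF assms(2)] x m by blast
  have dm: "norm (y - m) \<le> d"
  proof (rule LIMSEQ_le)
    show "(\<lambda>n. dist y (x n)) \<longlonglongrightarrow> norm (y - m)" using m unfolding dist_norm by (auto intro!: tendsto_intros)
    show "(\<lambda>n. d + 1 / real (Suc n)) \<longlonglongrightarrow> d"
      using tendsto_add[OF tendsto_const LIMSEQ_Suc[OF lim_1_over_n[where 'a=real]], of d] by simp
    show "\<exists>N. \<forall>n\<ge>N. dist y (x n) \<le> d + 1 / real (Suc n)" using x(2) by (meson less_imp_le)
  qed
  have "inner (y - m) z = 0" if z: "z \<in> S" for z
  proof (cases "z = 0")
    case False
    define t where "t = inner (y - m) z / inner z z"
    have zz: "inner z z > 0" using False by simp
    have "m + t *\<^sub>R z \<in> S" using mS z assms by (simp add: subspace_add subspace_scale)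
    from dl[OF this] dm have "(norm (y - m))\<^sup>2 \<le> (norm (y - (m + t *\<^sub>R z)))\<^sup>2" by (intro power_mono) (auto simp: dist_norm)
    also have "y - (m + t *\<^sub>R z) = (y - m) - t *\<^sub>R z" by simp
    also have "(norm \<dots>)\<^sup>2 = (norm (y - m))\<^sup>2 - 2 * t * inner (y - m) z + t * t * inner z z"
      by (simp add: power2_norm_eq_inner inner_diff_left inner_diff_right inner_commute)
    also have "\<dots> = (norm (y - m))\<^sup>2 - (inner (y - m) z)\<^sup>2 / inner z z"
      using zz by (simp add: t_def power2_eq_square field_simps)
    finally have "(inner (y - m) z)\<^sup>2 / inner z z \<le> 0" by simp
    then show ?thesis using zz by (simp add: divide_le_0_iff not_less)
  qed simp
  then show thesis using that mS by blast
qed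

text \<open>
The scalars are real: a complex Hilbert space enters as a real one with inner product \<open>Re (x, y)\<close>, and
complex linearity of the generated semigroup is recovered from \<open>T_commute\<close>. Surjectivity is
required for all large parameters, which is what the contraction argument for the concrete operator gives.
\<close>
locale m_dissipative =
  fixes D :: "'a::{real_inner,banach} set" and A :: "'a \<Rightarrow> 'a"
  assumes D: "subspace D"
    and A_add: "x \<in> D \<Longrightarrow> y \<in> D \<Longrightarrow> A (x + y) = A x + A y"
    and A_scale: "x \<in> D \<Longrightarrow> A (c *\<^sub>R x) = c *\<^sub>R A x"
    and dissipative: "x \<in> D \<Longrightarrow> inner (A x) x \<le> 0"
    and surjective: "\<exists>\<Lambda>. \<forall>l\<ge>\<Lambda>. \<forall>f. \<exists>x\<in>D. l *\<^sub>R x - A x = f"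
begin

lemma A_diff: "x \<in> D \<Longrightarrow> y \<in> D \<Longrightarrow> A (x - y) = A x - A y"
  using A_add[of x "(-1) *\<^sub>R y"] A_scale[of y "-1"] D subspace_scale[OF D, of y "-1"] by simp

lemma D_diff: "x \<in> D \<Longrightarrow> y \<in> D \<Longrightarrow> x - y \<in> D" and D_add: "x \<in> D \<Longrightarrow> y \<in> D \<Longrightarrow> x + y \<in> D"
  and D_scale: "x \<in> D \<Longrightarrow> c *\<^sub>R x \<in> D"
  using D by (auto intro: subspace_diff subspace_add subspace_scale)

lemma resolvent_bound: 
  assumes "x \<in> D" "0 < l"
  shows "norm x \<le> norm (l *\<^sub>R x - A x) / l"
proof (cases "x = 0")
  case False
  have "l * (norm x)\<^sup>2 \<le> inner (l *\<^sub>R x - A x) x"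
    using dissipative[OF assms(1)] by (simp add: inner_diff_left power2_norm_eq_inner)
  also have "\<dots> \<le> norm (l *\<^sub>R x - A x) * norm x" by (rule norm_cauchy_schwarz)
  finally have "(l * norm x) * norm x \<le> norm (l *\<^sub>R x - A x) * norm x" by (simp add: power2_eq_square)
  then have "l * norm x \<le> norm (l *\<^sub>R x - A x)" using False by simp
  then show ?thesis using assms by (simp add: field_simps)
qed (use assms in simp)

lemma resolvent_inj:
  assumes "x \<in> D" "y \<in> D" "0 < l" "l *\<^sub>R x - A x = l *\<^sub>R y - A y"
  shows "x = y"
proof -
  have "l *\<^sub>R (x - y) - A (x - y) = 0" using assms by (simp add: A_diff algebra_simps)
  with resolvent_bound[OF D_diff[OF assms(1,2)] assms(3)] show ?thesis by simp
qed

text \<open>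
A parameter beyond which the resolvent equation is solvable, taken at least one for positivity.
\<close>
definition lam0 :: real where
  "lam0 = (SOME L. 1 \<le> L \<and> (\<forall>l\<ge>L. \<forall>f. \<exists>x\<in>D. l *\<^sub>R x - A x = f))"

lemma lam0: "1 \<le> lam0" "lam0 \<le> l \<Longrightarrow> \<exists>x\<in>D. l *\<^sub>R x - A x = f"
proof -
  obtain L where "\<forall>l\<ge>L. \<forall>f. \<exists>x\<in>D. l *\<^sub>R x - A x = f" using surjective by blast
  then have "\<exists>L. 1 \<le> L \<and> (\<forall>l\<ge>L. \<forall>f. \<exists>x\<in>D. l *\<^sub>R x - A x = f)" by (intro exI[of _ "max L 1"]) auto
  from someI_ex[OF this] show "1 \<le> lam0" "lam0 \<le> l \<Longrightarrow> \<exists>x\<in>D. l *\<^sub>R x - A x = f"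
    unfolding lam0_def by blast+
qed

definition lam :: "nat \<Rightarrow> real" where "lam n = lam0 + real n"

text \<open>
The resolvent at the parameters \<open>lam n\<close>, a sequence that tends to infinity.
\<close>
definition R :: "nat \<Rightarrow> 'a \<Rightarrow> 'a" where
  "R n f = (SOME x. x \<in> D \<and> lam n *\<^sub>R x - A x = f)"

lemma lam_pos: "0 < lam n" "lam0 \<le> lam n" "lam n \<noteq> 0"
  using lam0(1) by (auto simp: lam_def add_pos_nonneg)

lemma R_D: "R n f \<in> D" and R_eq: "lam n *\<^sub>R R n f - A (R n f) = f"
  using lam0(2)[OF lam_pos(2), of n f] someI_ex[of "\<lambda>x. x \<in> D \<and> lam n *\<^sub>R x - A x = f"] unfolding R_def by blast+

lemma R_unique: "x \<in> D \<Longrightarrow> lam n *\<^sub>R x - A x = f \<Longrightarrow> R n f = x"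
  using resolvent_inj[OF R_D _ lam_pos(1)] R_eq by metis

lemma R_bound: "norm (R n f) \<le> norm f / lam n"
  using resolvent_bound[OF R_D lam_pos(1)] R_eq by metis

lemma R_add: "R n (f + g) = R n f + R n g"
  by (rule R_unique) (use R_eq[of n f] R_eq[of n g] in \<open>auto simp: R_D D_add A_add algebra_simps\<close>)

lemma R_scale: "R n (c *\<^sub>R f) = c *\<^sub>R R n f"
proof (rule R_unique)
  have "lam n *\<^sub>R c *\<^sub>R R n f - A (c *\<^sub>R R n f) = c *\<^sub>R (lam n *\<^sub>R R n f - A (R n f))"
    by (simp add: A_scale R_D algebra_simps)
  then show "lam n *\<^sub>R c *\<^sub>R R n f - A (c *\<^sub>R R n f) = c *\<^sub>R f" by (simp only: R_eq)
qed (simp add: R_D D_scale)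

lemma R_bounded_linear: "bounded_linear (R n)"
proof (rule bounded_linear_intro[of _ "1 / lam n"])
  show "norm (R n x) \<le> norm x * (1 / lam n)" for x using R_bound[of n x] by simp
qed (auto simp: R_add R_scale)

lemma R_A: "x \<in> D \<Longrightarrow> lam n *\<^sub>R R n x = x + R n (A x)"
proof -
  assume x: "x \<in> D"
  have "R n (lam n *\<^sub>R x - A x) = x" by (rule R_unique[OF x refl])
  then show ?thesis using bounded_linear.linear[OF R_bounded_linear, THEN linear_diff, of n "lam n *\<^sub>R x" "A x"]
    by (simp add: R_scale algebra_simps)
qed

lemma R_identity: "R m f - R n f = (lam n - lam m) *\<^sub>R R n (R m f)"
proof -
  have "lam n *\<^sub>R R m f - A (R m f) = f + (lam n - lam m) *\<^sub>R R m f"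
    using R_eq[of m f] by (simp add: algebra_simps)
  from R_unique[OF R_D this] show ?thesis by (simp only: R_add R_scale) (simp add: algebra_simps)
qed

lemma R_commute: "R m (R n f) = R n (R m f)"
proof (cases "m = n")
  case False
  then have "lam n - lam m \<noteq> 0" by (simp add: lam_def)
  moreover have "(lam n - lam m) *\<^sub>R R n (R m f) = (lam n - lam m) *\<^sub>R R m (R n f)"
    unfolding R_identity[symmetric] using R_identity[where m = n and n = m and f = f]
    by (metis minus_diff_eq scaleR_minus_left)
  ultimately show ?thesis by simp
qed simp

text \<open>
If \<open>y - m\<close> is orthogonal to the closure of the domain, solve \<open>l x - A x = y - m\<close>; pairing with \<open>x\<close> and
dissipativity force \<open>x = 0\<close>.
\<close>
lemma D_dense: "closure D = UNIV"
proof (intro set_eqI iffI UNIV_I)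
  fix y :: 'a
  have cs: "subspace (closure D)"
  proof (rule subspaceI)
    show "0 \<in> closure D" using subspace_0[OF D] closure_subset by blast
    show "x + y \<in> closure D" if xy: "x \<in> closure D" "y \<in> closure D" for x y
    proof -
      obtain a where "\<And>n. a n \<in> D" "a \<longlonglongrightarrow> x"
        using xy(1) unfolding closure_sequential by blast
      moreover obtain b where "\<And>n. b n \<in> D" "b \<longlonglongrightarrow> y"
        using xy(2) unfolding closure_sequential by blast
      ultimately show ?thesis unfolding closure_sequential
        by (intro exI[of _ "\<lambda>n. a n + b n"]) (auto intro: D_add tendsto_add)
    qed
    show "c *\<^sub>R x \<in> closure D" if xy: "x \<in> closure D" for x c
    proof -
      obtain a where "\<And>n. a n \<in> D" "a \<longlonglongrightarrow> x" using xy unfolding closure_sequential by blast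
      then show ?thesis unfolding closure_sequential
        by (intro exI[of _ "\<lambda>n. c *\<^sub>R a n"]) (auto intro: D_scale tendsto_scaleR)
    qed
  qed
  obtain m where m: "m \<in> closure D" "\<And>z. z \<in> closure D \<Longrightarrow> inner (y - m) z = 0"
    using orthogonal_projection_exists[OF cs closed_closure] by blast
  define x where "x = R 0 (y - m)"
  have x: "x \<in> D" "lam 0 *\<^sub>R x - A x = y - m" using R_D R_eq by (auto simp: x_def)
  have "inner (y - m) x = 0" using m(2) x closure_subset by blast
  then have "lam 0 * inner x x \<le> 0" using dissipative[OF x(1)] unfolding x(2)[symmetric] by (simp add: inner_diff_left)
  then have "x = 0"
  proof -
    have "inner (x) (x) \<le> 0" using \<open>lam 0 * inner (x) (x) \<le> 0\<close> lam_pos(1)[of 0] by (simp only: mult_le_0_iff) linarith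
    then have "inner (x) (x) = 0" using inner_ge_zero[of "x"] by linarith
    then show ?thesis by (simp only: inner_eq_zero_iff)
  qed
  have "A 0 = 0" using A_scale[of 0 0] D subspace_0 by auto
  with x \<open>x = 0\<close> have "y = m" by simp
  with m show "y \<in> closure D" by simp
qed

lemma dense_approx:
  assumes "e > 0" obtains z where "z \<in> D" "norm (x - z) < e"
  using D_dense assms closure_approachable[of x D] by (metis UNIV_I dist_norm norm_minus_commute)

lemma lam_at_top: "filterlim lam at_top sequentially"
  unfolding lam_def[abs_def] by (intro filterlim_tendsto_add_at_top[OF tendsto_const] filterlim_real_sequentially)

lemma R_tendsto: "(\<lambda>n. lam n *\<^sub>R R n y) \<longlonglongrightarrow> y"
proof (rule LIMSEQ_I)
  fix e :: real assume e: "e > 0"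
  obtain z where z: "z \<in> D" "norm (y - z) < e / 3" using dense_approx[of "e/3" y] e by auto
  have "(\<lambda>n. norm (A z) / lam n) \<longlonglongrightarrow> 0" by (rule real_tendsto_divide_at_top[OF tendsto_const lam_at_top])
  from order_tendstoD(2)[OF this, of "e/3"] e obtain N where N: "\<And>n. n \<ge> N \<Longrightarrow> norm (A z) / lam n < e / 3"
    unfolding eventually_sequentially by auto
  have "norm (lam n *\<^sub>R R n y - y) < e" if "n \<ge> N" for n
  proof -
    have yz: "y = (y - z) + z" by simp
    have "lam n *\<^sub>R R n y = lam n *\<^sub>R R n (y - z) + lam n *\<^sub>R R n z"
      by (subst yz) (simp only: R_add scaleR_add_right)
    then have "lam n *\<^sub>R R n y - y = lam n *\<^sub>R R n (y - z) + (R n (A z) - (y - z))"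
      by (simp add: R_A[OF z(1)])
    also have "norm \<dots> \<le> norm (lam n *\<^sub>R R n (y - z)) + (norm (R n (A z)) + norm (y - z))"
      by (rule order_trans[OF norm_triangle_ineq add_left_mono[OF norm_triangle_ineq4]])
    also have "norm (lam n *\<^sub>R R n (y - z)) \<le> norm (y - z)"
      using R_bound[of n "y - z"] lam_pos(1)[of n] by (simp add: field_simps)
    also have "norm (R n (A z)) < e / 3" using R_bound[of n "A z"] N[OF that] by linarith
    finally show ?thesis using z by simp
  qed
  then show "\<exists>N. \<forall>n\<ge>N. norm (lam n *\<^sub>R R n y - y) < e" by blast
qed

text \<open>
The Yosida approximation \<open>l (l R - 1) = l A R\<close>: bounded, dissipative and convergent to \<open>A\<close> on the domain.
\<close>
definition Y :: "nat \<Rightarrow> 'a \<Rightarrow> 'a" where "Y n x = lam n *\<^sub>R (lam n *\<^sub>R R n x - x)"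

lemma Y_bounded_linear: "bounded_linear (Y n)"
  unfolding Y_def[abs_def]
  by (intro bounded_linear_const_scaleR bounded_linear_sub R_bounded_linear bounded_linear_ident)

lemma Y_dissipative: "inner (Y n x) x \<le> 0"
proof -
  define r where "r = R n x"
  have x: "x = lam n *\<^sub>R r - A r" by (simp add: R_eq r_def)
  have "lam n *\<^sub>R r - x = A r" by (subst x) simp
  then have "Y n x = lam n *\<^sub>R A r" unfolding Y_def r_def[symmetric] by simp
  then have "inner (Y n x) x = lam n * (lam n * inner (A r) r - inner (A r) (A r))"
    by (subst (2) x) (simp add: inner_diff_right algebra_simps)
  also have "\<dots> \<le> 0"
  proof (rule mult_nonneg_nonpos)
    have "lam n * inner (A r) r \<le> 0" using dissipative[OF R_D] lam_pos(1)[of n]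
      by (intro mult_nonneg_nonpos) (auto simp: r_def)
    moreover have "inner (A r) (A r) \<ge> 0" by simp
    ultimately show "lam n * inner (A r) r - inner (A r) (A r) \<le> 0" by linarith
  qed (use lam_pos(1)[of n] in simp)
  finally show ?thesis .
qed

lemma Y_commute: "Y m (Y n x) = Y n (Y m x)"
proof -
  have RY: "R n (Y m x) = Y m (R n x)"
    unfolding Y_def R_scale linear_diff[OF bounded_linear.linear[OF R_bounded_linear]] R_commute[of n m] ..
  have "Y m (Y n x) = lam n *\<^sub>R (lam n *\<^sub>R Y m (R n x) - Y m x)"
    unfolding Y_def[of n] linear_scale[OF bounded_linear.linear[OF Y_bounded_linear]]
      linear_diff[OF bounded_linear.linear[OF Y_bounded_linear]] ..
  also have "\<dots> = Y n (Y m x)" unfolding RY[symmetric] Y_def[of n] ..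
  finally show ?thesis .
qed

lemma Y_tendsto: "x \<in> D \<Longrightarrow> (\<lambda>n. Y n x) \<longlonglongrightarrow> A x"
  using R_tendsto[of "A x"] unfolding Y_def by (simp only: R_A add_diff_cancel_left')

text \<open>
The flow generated by the \<open>n\<close>-th Yosida approximation.
\<close>
definition E :: "nat \<Rightarrow> real \<Rightarrow> 'a \<Rightarrow> 'a" where
  "E n t x = (SOME u. u 0 = x \<and> (\<forall>t. (u has_vector_derivative Y n (u t)) (at t))) t"

lemma E_0: "E n 0 x = x" and E_deriv: "((\<lambda>t. E n t x) has_vector_derivative Y n (E n t x)) (at t within S)"
proof -
  have u: "(\<lambda>t. E n t x) 0 = x \<and> (\<forall>t. ((\<lambda>t. E n t x) has_vector_derivative Y n (E n t x)) (at t))"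
    unfolding E_def by (rule someI_ex[OF bounded_linear_flow_exists[OF Y_bounded_linear]])
  show "E n 0 x = x" using u by blast
  show "((\<lambda>t. E n t x) has_vector_derivative Y n (E n t x)) (at t within S)"
    by (rule has_vector_derivative_at_within) (use u in blast)
qed

lemma flow_contraction:
  assumes "\<And>t. 0 \<le> t \<Longrightarrow> (u has_vector_derivative Y n (u t)) (at t within {0..})" "0 \<le> t"
  shows "norm (u t) \<le> norm (u 0)"
proof -
  have "norm (u t) \<le> norm (u 0) + 0 * t"
  proof (rule norm_growth_bound)
    show "(u has_vector_derivative Y n (u s)) (at s within {0..t})" if "0 \<le> s" "s \<le> t" for s
      by (rule has_vector_derivative_within_subset[OF assms(1)[OF that(1)]]) auto
  qed (use Y_dissipative assms in auto)
  then show ?thesis by simp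
qed

lemma flow_unique:
  assumes "\<And>t. 0 \<le> t \<Longrightarrow> (u has_vector_derivative Y n (u t)) (at t within {0..})" "0 \<le> t"
  shows "u t = E n t (u 0)"
proof -
  have "((\<lambda>t. u t - E n t (u 0)) has_vector_derivative Y n (u s - E n s (u 0))) (at s within {0..})" if "0 \<le> s" for s
    using has_vector_derivative_diff[OF assms(1)[OF that] E_deriv]
    by (simp add: linear_diff[OF bounded_linear.linear[OF Y_bounded_linear]])
  from flow_contraction[OF this assms(2)] show ?thesis by (simp add: E_0)
qed

lemma E_contraction: "0 \<le> t \<Longrightarrow> norm (E n t x) \<le> norm x"
  using flow_contraction[of "\<lambda>t. E n t x" n t] E_deriv by (simp add: E_0)

lemma E_add: "0 \<le> t \<Longrightarrow> E n t (x + y) = E n t x + E n t y"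
  using flow_unique[of "\<lambda>t. E n t x + E n t y" n t] has_vector_derivative_add[OF E_deriv E_deriv]
  by (simp add: E_0 linear_add[OF bounded_linear.linear[OF Y_bounded_linear]])

text \<open>
By uniqueness of the flow, everything that commutes with the approximating operator commutes with its flow. Linearity in the
initial value and, in the limit, \<open>T_commute\<close> come from this.
\<close>
lemma E_linear_commute:
  assumes "bounded_linear C" "\<And>x. C (Y n x) = Y n (C x)" "0 \<le> t"
  shows "E n t (C x) = C (E n t x)"
proof -
  have "((\<lambda>t. C (E n t x)) has_vector_derivative Y n (C (E n s x))) (at s within {0..})" for s
    using bounded_linear.has_vector_derivative[OF assms(1) E_deriv[where n = n and x = x and t = s and S = "{0..}"]]
    by (simp add: assms(2))
  from flow_unique[OF this assms(3)] show ?thesis by (simp add: E_0)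
qed

lemma E_scale: "0 \<le> t \<Longrightarrow> E n t (c *\<^sub>R x) = c *\<^sub>R E n t x"
  by (rule E_linear_commute[OF bounded_linear_scaleR_right])
    (simp add: linear_scale[OF bounded_linear.linear[OF Y_bounded_linear]])

lemma E_diff: "0 \<le> t \<Longrightarrow> E n t (x - y) = E n t x - E n t y"
  using E_add[of t n x "(-1) *\<^sub>R y"] E_scale[of t n "-1" y] by simp

lemma E_semigroup: "0 \<le> s \<Longrightarrow> 0 \<le> t \<Longrightarrow> E n (s + t) x = E n s (E n t x)"
proof -
  assume st: "0 \<le> s" "0 \<le> t"
  have "((\<lambda>s. E n (s + t) x) has_vector_derivative Y n (E n (r + t) x)) (at r within {0..})" for r
  proof -
    have "((\<lambda>s. s + t) has_vector_derivative 1) (at r)" by (auto intro!: derivative_eq_intros)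
    from vector_diff_chain_at[OF this E_deriv[of n x]] show ?thesis 
      by (auto simp: o_def intro: has_vector_derivative_at_within)
  qed
  from flow_unique[OF this st(1)] show ?thesis by simp
qed

lemma E_Y: "0 \<le> t \<Longrightarrow> E n t (Y n x) = Y n (E n t x)"
  by (rule E_linear_commute[OF Y_bounded_linear]) auto

text \<open>
The approximations commute with each other, so the difference of two flows solves the dissipative equation
with source \<open>E m s (Y m x - Y n x)\<close>, whose norm does not grow.
\<close>
lemma E_E_diff: 
  assumes "0 \<le> t" shows "norm (E m t x - E n t x) \<le> norm (Y m x - Y n x) * t"
proof -
  have "norm (E m t x - E n t x) \<le> norm (E m 0 x - E n 0 x) + norm (Y m x - Y n x) * t"
  proof (rule norm_growth_bound)
    fix s assume s: "0 \<le> s" "s \<le> t"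
    show "((\<lambda>t. E m t x - E n t x) has_vector_derivative Y m (E m s x) - Y n (E n s x)) (at s within {0..t})"
      by (intro has_vector_derivative_diff E_deriv)
    define z where "z = E m s x - E n s x"
    have YY: "Y m (E m s x) - Y n (E m s x) = E m s (Y m x - Y n x)"
      using E_linear_commute[OF Y_bounded_linear, of n m s x] s E_Y[of s m x] E_diff[OF s(1)]
      by (simp add: Y_commute)
    have "Y m (E m s x) - Y n (E n s x) = E m s (Y m x - Y n x) + Y n z"
      unfolding z_def linear_diff[OF bounded_linear.linear[OF Y_bounded_linear]] YY[symmetric] by simp
    then have "inner (Y m (E m s x) - Y n (E n s x)) z = inner (E m s (Y m x - Y n x)) z + inner (Y n z) z"
      by (simp add: inner_add_left)
    also have "\<dots> \<le> norm (E m s (Y m x - Y n x)) * norm z + 0"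
      by (intro add_mono norm_cauchy_schwarz Y_dissipative)
    also have "\<dots> \<le> norm (Y m x - Y n x) * norm z + 0"
      using E_contraction[OF s(1)] by (intro add_mono mult_right_mono) auto
    finally show "inner (Y m (E m s x) - Y n (E n s x)) (E m s x - E n s x) \<le> norm (Y m x - Y n x) * norm (E m s x - E n s x)"
      by (simp add: z_def)
  qed (use assms in auto)
  then show ?thesis by (simp add: E_0)
qed

definition T :: "real \<Rightarrow> 'a \<Rightarrow> 'a" where "T t x = lim (\<lambda>n. E n t x)"

text \<open>
On the domain \<open>E_E_diff\<close> gives a Cauchy sequence, uniformly on bounded times; contractivity and density extend this to all initial values.
\<close>
lemma E_uniform: "uniform_limit {0..r} (\<lambda>n t. E n t x) (\<lambda>t. T t x) sequentially"
proof -
  have "uniformly_convergent_on {0..r} (\<lambda>n t. E n t x)"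
  proof (cases "r \<ge> 0")
    case False then show ?thesis by (auto simp: uniformly_convergent_on_def uniform_limit_iff)
  next
    case r: True
    show ?thesis
    proof (rule Cauchy_uniformly_convergent, rule uniformly_Cauchy_onI)
      fix e :: real assume e: "e > 0"
      obtain z where z: "z \<in> D" "norm (x - z) < e / 4" using dense_approx[of "e/4" x] e by auto
      have "Cauchy (\<lambda>n. Y n z)" using Y_tendsto[OF z(1)] by (rule LIMSEQ_imp_Cauchy)
      then obtain N where N: "\<And>m n. m \<ge> N \<Longrightarrow> n \<ge> N \<Longrightarrow> dist (Y m z) (Y n z) < e / (2 * (r + 1))"
        using e r unfolding Cauchy_def by (metis add_nonneg_pos divide_pos_pos mult_pos_pos zero_less_numeral zero_less_one)
      have "dist (E m t x) (E n t x) < e" if t: "t \<in> {0..r}" and mn: "m \<ge> N" "n \<ge> N" for m n t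
      proof -
        have b: "norm (E k t x - E k t z) < e / 4" for k
          using E_contraction[of t k "x - z"] E_diff[of t k x z] t z by simp
        have "norm (E m t z - E n t z) \<le> norm (Y m z - Y n z) * t" using t by (intro E_E_diff) auto
        also have "\<dots> \<le> e / (2 * (r + 1)) * (r + 1)"
          using N[OF mn] t e by (intro mult_mono) (auto simp: dist_norm)
        also have "\<dots> = e / 2" using r by (simp add: field_simps)
        finally have c: "norm (E m t z - E n t z) \<le> e / 2" .
        have "E m t x - E n t x = (E m t x - E m t z) + (E m t z - E n t z) - (E n t x - E n t z)" by simp
        also have "norm \<dots> \<le> norm (E m t x - E m t z) + norm (E m t z - E n t z) + norm (E n t x - E n t z)"
          by (rule norm_triangle_le_diff) (use norm_triangle_ineq[of "E m t x - E m t z" "E m t z - E n t z"] in linarith)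
        also have "\<dots> < e" using b[of m] b[of n] c by linarith
        finally show ?thesis by (simp add: dist_norm)
      qed
      then show "\<exists>M. \<forall>x'\<in>{0..r}. \<forall>m\<ge>M. \<forall>n\<ge>M. dist (E m x' x) (E n x' x) < e" by blast
    qed
  qed
  then show ?thesis unfolding uniformly_convergent_uniform_limit_iff T_def .
qed

lemma E_tendsto: "0 \<le> t \<Longrightarrow> (\<lambda>n. E n t x) \<longlonglongrightarrow> T t x"
  using tendsto_uniform_limitI[OF E_uniform[where r = t], of t] by simp

lemma T_contraction: "0 \<le> t \<Longrightarrow> norm (T t x) \<le> norm x"
  by (rule LIMSEQ_le_const2[OF tendsto_norm[OF E_tendsto]]) (auto intro: E_contraction)

lemma T_plus: "0 \<le> t \<Longrightarrow> T t (x + y) = T t x + T t y"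
  by (rule LIMSEQ_unique[OF E_tendsto]) (auto simp: E_add intro!: tendsto_add E_tendsto)

text \<open>
A bounded operator that commutes with the generator commutes with the resolvents, hence with the Yosida approximations and their flows.
\<close>
lemma T_commute:
  assumes "bounded_linear C" "\<And>x. x \<in> D \<Longrightarrow> C x \<in> D \<and> A (C x) = C (A x)" "0 \<le> t"
  shows "T t (C x) = C (T t x)"
proof (rule LIMSEQ_unique[OF E_tendsto[OF assms(3)]])
  interpret C: bounded_linear C by fact
  have "R n (C x) = C (R n x)" for n x
    by (rule R_unique) (use assms(2)[OF R_D, of n x] R_eq[of n x] in \<open>auto simp flip: C.scaleR C.diff\<close>)
  then have "C (Y n x) = Y n (C x)" for n x by (simp add: Y_def C.diff C.scaleR)
  then have "E n t (C x) = C (E n t x)" for n by (intro E_linear_commute assms) auto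
  then show "(\<lambda>n. E n t (C x)) \<longlonglongrightarrow> C (T t x)" using C.tendsto[OF E_tendsto[OF assms(3)]] by simp
qed

lemma T_scale: "0 \<le> t \<Longrightarrow> T t (c *\<^sub>R x) = c *\<^sub>R T t x"
  by (rule T_commute[OF bounded_linear_scaleR_right]) (auto simp: D_scale A_scale)

lemma T_bounded_linear: "0 \<le> t \<Longrightarrow> bounded_linear (T t)"
  by (rule bounded_linear_intro[of _ 1]) (auto simp: T_plus T_scale T_contraction)

lemma T_semigroup: assumes st: "0 \<le> s" "0 \<le> t" shows "T (s + t) x = T s (T t x)"
proof (rule LIMSEQ_unique[OF E_tendsto])
  have "(\<lambda>n. E n s (E n t x - T t x)) \<longlonglongrightarrow> 0"
    by (rule Lim_null_comparison[OF _ tendsto_norm_zero[OF LIM_zero[OF E_tendsto[OF st(2), of x]]]])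
      (intro always_eventually allI E_contraction st)
  from tendsto_add[OF this E_tendsto[OF st(1), of "T t x"]]
  show "(\<lambda>n. E n (s + t) x) \<longlonglongrightarrow> T s (T t x)" by (simp add: E_semigroup st E_diff)
qed (use st in simp)

lemma T_at_0: "T 0 x = x"
  by (rule LIMSEQ_unique[OF E_tendsto]) (auto simp: E_0)

lemma T_continuous: "continuous_on {0..r} (\<lambda>t. T t x)"
  by (rule uniform_limit_theorem[OF _ E_uniform])
    (auto intro!: always_eventually continuous_on_vector_derivative[OF E_deriv])

lemma T_tendsto_0: "((\<lambda>t. T t x) \<longlongrightarrow> x) (at_right 0)"
proof -
  have "((\<lambda>t. T t x) \<longlongrightarrow> T 0 x) (at 0 within {0..1})"
    using T_continuous[where r = 1] unfolding continuous_on_def by auto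
  then have "((\<lambda>t. T t x) \<longlongrightarrow> x) (at 0 within {0<..1})"
    unfolding T_at_0 by (rule tendsto_within_subset) auto
  moreover have "at 0 within {0<..1} = at_right (0::real)"
    by (rule at_within_nhd[of _ "{..<1}"]) auto
  ultimately show ?thesis by simp
qed

lemma T_c0_semigroup: "c0_semigroup T"
proof (rule c0_semigroup.intro)
  show "bounded_linear (T t)" if "0 \<le> t" for t using that by (rule T_bounded_linear)
  show "T 0 x = x" for x by (rule T_at_0)
  show "T (s + t) x = T s (T t x)" if "0 \<le> s" "0 \<le> t" for s t x using that by (rule T_semigroup)
  show "((\<lambda>h. T h x) \<longlongrightarrow> x) (at_right 0)" for x by (rule T_tendsto_0)
qed

sublocale sg: c0_semigroup T by (rule T_c0_semigroup)

text \<open>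
The mean value inequality for the approximating flows, in the limit; \<open>T s (A x)\<close> is
compared with \<open>A x\<close>.
\<close>
lemma T_increment:
  assumes x: "x \<in> D" and t: "0 \<le> t" and e: "\<And>s. 0 \<le> s \<Longrightarrow> s \<le> t \<Longrightarrow> norm (T s (A x) - A x) \<le> e"
  shows "norm (T t x - x - t *\<^sub>R A x) \<le> t * e"
proof (rule field_le_epsilon)
  fix d0 :: real assume d0: "d0 > 0"
  define d where "d = d0 / (3 * (t + 1))"
  have d: "d > 0" using d0 t by (simp add: d_def)
  have ev: "\<forall>\<^sub>F n in sequentially. norm (E n t x - x - t *\<^sub>R A x) \<le> t * (2 * d + e)"
    using uniform_limitD[OF E_uniform[where r = t and x = "A x"] d] tendstoD[OF Y_tendsto[OF x] d]
  proof eventually_elim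
    case (elim n)
    have "norm ((E n t x - t *\<^sub>R A x) - (E n 0 x - 0 *\<^sub>R A x)) \<le> (2 * d + e) * norm (t - 0)"
    proof (rule differentiable_bound[where f' = "\<lambda>s h. h *\<^sub>R (Y n (E n s x) - A x)" and S = "{0..t}"])
      fix s assume s: "s \<in> {0..t}"
      have "((\<lambda>s. E n s x - s *\<^sub>R A x) has_vector_derivative Y n (E n s x) - A x) (at s within {0..t})"
        by (auto intro!: derivative_eq_intros E_deriv)
      then show "((\<lambda>s. E n s x - s *\<^sub>R A x) has_derivative (\<lambda>h. h *\<^sub>R (Y n (E n s x) - A x))) (at s within {0..t})"
        by (simp add: has_vector_derivative_def)
      have "Y n (E n s x) - A x = E n s (Y n x - A x) + (E n s (A x) - T s (A x)) + (T s (A x) - A x)"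
        using s by (simp add: E_diff E_Y)
      also have "norm \<dots> \<le> norm (E n s (Y n x - A x)) + norm (E n s (A x) - T s (A x)) + norm (T s (A x) - A x)"
        by (rule order_trans[OF norm_triangle_ineq add_right_mono[OF norm_triangle_ineq]])
      also have "\<dots> \<le> d + d + e"
      proof (intro add_mono)
        show "norm (E n s (Y n x - A x)) \<le> d"
          using E_contraction[of s n "Y n x - A x"] elim(2) s by (simp add: dist_norm)
        show "norm (E n s (A x) - T s (A x)) \<le> d" using elim(1) s by (force simp: dist_norm)
      qed (use s e[of s] in auto)
      finally have "norm (Y n (E n s x) - A x) \<le> 2 * d + e" by simp
      then show "onorm (\<lambda>h. h *\<^sub>R (Y n (E n s x) - A x)) \<le> 2 * d + e"
        by (intro onorm_le) (simp add: mult.commute mult_left_mono)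
    qed (use t in auto)
    then show ?case using t by (simp add: E_0 algebra_simps)
  qed
  have "norm (T t x - x - t *\<^sub>R A x) \<le> t * (2 * d + e)"
    by (rule tendsto_upperbound[OF _ ev]) (auto intro!: tendsto_intros E_tendsto t)
  also have "\<dots> = 2 * (t * d) + t * e" by (simp add: algebra_simps)
  also have "t * d \<le> d0 / 3" using t d0 by (simp add: d_def field_simps)
  finally show "norm (T t x - x - t *\<^sub>R A x) \<le> t * e + d0" using d0 by simp
qed

lemma T_generator:
  assumes x: "x \<in> D"
  shows "((\<lambda>h. (T h x - x) /\<^sub>R h) \<longlongrightarrow> A x) (at_right 0)"
proof (rule tendstoI)
  fix e :: real assume e: "e > 0"
  then have "\<forall>\<^sub>F h in at_right 0. dist (T h (A x)) (A x) < e / 2" by (intro tendstoD[OF T_tendsto_0]) auto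
  then obtain d where d: "d > 0" "\<And>h. 0 < h \<Longrightarrow> h < d \<Longrightarrow> dist (T h (A x)) (A x) < e / 2"
    unfolding eventually_at_right_field by blast
  have "dist ((T h x - x) /\<^sub>R h) (A x) < e" if h: "0 < h" "h < d" for h
  proof -
    have "norm (T h x - x - h *\<^sub>R A x) \<le> h * (e / 2)"
    proof (rule T_increment[OF x])
      fix s assume "0 \<le> s" "s \<le> h"
      then show "norm (T s (A x) - A x) \<le> e / 2" using d(2)[of s] h e by (cases "s = 0") (auto simp: T_at_0 dist_norm)
    qed (use h in auto)
    moreover have "(T h x - x) /\<^sub>R h - A x = (T h x - x - h *\<^sub>R A x) /\<^sub>R h"
      using h by (simp add: scaleR_right_diff_distrib)
    moreover have "norm ((T h x - x - h *\<^sub>R A x) /\<^sub>R h) = norm (T h x - x - h *\<^sub>R A x) / h"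
      using h by (simp add: divide_inverse mult.commute)
    ultimately have "norm ((T h x - x) /\<^sub>R h - A x) \<le> e / 2" using h by (simp add: divide_le_eq mult.commute)
    then show ?thesis using e by (simp add: dist_norm)
  qed
  then show "\<forall>\<^sub>F h in at_right 0. dist ((T h x - x) /\<^sub>R h) (A x) < e"
    unfolding eventually_at_right_field using d(1) by blast
qed

text \<open>
The generator extends \<open>A\<close>; being dissipative, it cannot extend it properly, as \<open>A\<close> already
has a surjective resolvent.
\<close>
lemma generator_domain:
  assumes "((\<lambda>h. (T h x - x) /\<^sub>R h) \<longlongrightarrow> y) (at_right 0)"
  shows "x \<in> D"
proof -
  \<comment> \<open>If \<open>x\<close> is in the domain, with \<open>y = A x\<close>, then \<open>z = x\<close>; dissipativity of difference quotients shows this in general.\<close>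
  define z where "z = R 0 (lam 0 *\<^sub>R x - y)"
  have z: "z \<in> D" "lam 0 *\<^sub>R z - A z = lam 0 *\<^sub>R x - y" by (simp_all add: z_def R_D R_eq)
  have "((\<lambda>h. (T h x - x) /\<^sub>R h - (T h z - z) /\<^sub>R h) \<longlongrightarrow> y - A z) (at_right 0)"
    by (intro tendsto_diff assms T_generator z)
  from tendsto_inner[OF this tendsto_const[of "x - z"]]
  have "inner (y - A z) (x - z) \<le> 0"
  proof (rule tendsto_upperbound)
    show "\<forall>\<^sub>F h in at_right 0. inner ((T h x - x) /\<^sub>R h - (T h z - z) /\<^sub>R h) (x - z) \<le> 0"
      unfolding eventually_at_right_field
    proof (intro exI[of _ 1] conjI allI impI)
      fix h :: real assume h: "0 < h" "h < 1"
      have "inner (T h (x - z)) (x - z) \<le> norm (T h (x - z)) * norm (x - z)" by (rule norm_cauchy_schwarz)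
      also have "\<dots> \<le> norm (x - z) * norm (x - z)" using T_contraction h by (intro mult_right_mono) auto
      finally have "inner (T h (x - z) - (x - z)) (x - z) \<le> 0" by (simp add: inner_diff_left dot_square_norm power2_eq_square)
      moreover have "(T h x - x) /\<^sub>R h - (T h z - z) /\<^sub>R h = (T h (x - z) - (x - z)) /\<^sub>R h"
        using linear_diff[OF bounded_linear.linear[OF T_bounded_linear, of h], of x z] h
        by (simp add: scaleR_right_diff_distrib)
      ultimately show "inner ((T h x - x) /\<^sub>R h - (T h z - z) /\<^sub>R h) (x - z) \<le> 0"
        using h by (simp add: mult_nonneg_nonpos)
    qed simp
  qed simp
  moreover have "y - A z = lam 0 *\<^sub>R (x - z)" using z by (simp add: algebra_simps)
  ultimately have "lam 0 * inner (x - z) (x - z) \<le> 0" by simp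
  then have "x - z = 0"
  proof -
    have "inner (x - z) (x - z) \<le> 0" using \<open>lam 0 * inner (x - z) (x - z) \<le> 0\<close> lam_pos(1)[of 0] by (simp only: mult_le_0_iff) linarith
    then have "inner (x - z) (x - z) = 0" using inner_ge_zero[of "x - z"] by linarith
    then show ?thesis by (simp only: inner_eq_zero_iff)
  qed
  with z show ?thesis by simp
qed

lemma T_invariant: 
  assumes "x \<in> D" "0 \<le> t" shows "T t x \<in> D" "A (T t x) = T t (A x)"
proof -
  have *: "((\<lambda>h. (T h (T t x) - T t x) /\<^sub>R h) \<longlongrightarrow> T t (A x)) (at_right 0)"
  proof (rule tendsto_cong[THEN iffD1])
    interpret Tt: bounded_linear "T t" using assms T_bounded_linear by simp
    show "((\<lambda>h. T t ((T h x - x) /\<^sub>R h)) \<longlongrightarrow> T t (A x)) (at_right 0)" 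
      by (rule Tt.tendsto[OF T_generator[OF assms(1)]])
    show "\<forall>\<^sub>F h in at_right 0. T t ((T h x - x) /\<^sub>R h) = (T h (T t x) - T t x) /\<^sub>R h"
      unfolding eventually_at_right_field
      using assms T_semigroup[of _ t x] T_semigroup[of t _ x]
      by (intro exI[of _ 1]) (auto simp: Tt.scaleR Tt.diff add.commute)
  qed
  show "T t x \<in> D" by (rule generator_domain[OF *])
  show "A (T t x) = T t (A x)"
    by (rule tendsto_unique[OF trivial_limit_at_right_real T_generator[OF \<open>T t x \<in> D\<close>] *])
qed

lemma T_deriv: "x \<in> D \<Longrightarrow> 0 \<le> t \<Longrightarrow> ((\<lambda>t. T t x) has_vector_derivative A (T t x)) (at t within {0..})"
  using sg.T_derivative[OF T_generator] T_invariant(2) by simp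

text \<open>
For \<open>x\<close> in the domain both orbits stay in the domain and solve \<open>u' = A u\<close>, so their difference does not grow by
dissipativity. Density and boundedness of each \<open>S t\<close> do the rest.
\<close>
lemma generated_semigroup_unique:
  assumes "c0_semigroup S"
    and gen: "\<And>x. x \<in> D \<Longrightarrow> ((\<lambda>h. (S h x - x) /\<^sub>R h) \<longlongrightarrow> A x) (at_right 0)"
    and dom: "\<And>x y. ((\<lambda>h. (S h x - x) /\<^sub>R h) \<longlongrightarrow> y) (at_right 0) \<Longrightarrow> x \<in> D"
    and t: "0 \<le> t"
  shows "S t x = T t x"
proof -
  interpret S: c0_semigroup S by (rule assms(1))
  have SD: "S t z = T t z" if z: "z \<in> D" for z
  proof -
    have inv: "S s z \<in> D \<and> A (S s z) = S s (A z)" if s: "0 \<le> s" for s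
    proof -
      have *: "((\<lambda>h. (S h (S s z) - S s z) /\<^sub>R h) \<longlongrightarrow> S s (A z)) (at_right 0)"
      proof (rule tendsto_cong[THEN iffD1])
        interpret Ss: bounded_linear "S s" by (rule S.bl[OF s])
        show "((\<lambda>h. S s ((S h z - z) /\<^sub>R h)) \<longlongrightarrow> S s (A z)) (at_right 0)"
          by (rule Ss.tendsto[OF gen[OF z]])
        show "\<forall>\<^sub>F h in at_right 0. S s ((S h z - z) /\<^sub>R h) = (S h (S s z) - S s z) /\<^sub>R h"
          unfolding eventually_at_right_field using s S.T_add[of _ s z] S.T_add[of s _ z]
          by (intro exI[of _ 1]) (auto simp: Ss.scaleR Ss.diff add.commute)
      qed
      have "S s z \<in> D" by (rule dom[OF *])
      moreover have "A (S s z) = S s (A z)" by (rule tendsto_unique[OF trivial_limit_at_right_real gen[OF \<open>S s z \<in> D\<close>] *])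
      ultimately show ?thesis by simp
    qed
    have "norm (S t z - T t z) \<le> norm (S 0 z - T 0 z) + 0 * t"
    proof (rule norm_growth_bound)
      fix s assume s: "0 \<le> s" "s \<le> t"
      have "((\<lambda>t. S t z - T t z) has_vector_derivative A (S s z) - A (T s z)) (at s within {0..})"
        using S.T_derivative[OF gen[OF z] s(1)] T_deriv[OF z s(1)] inv[OF s(1)]
        has_vector_derivative_diff by simp
      then show "((\<lambda>t. S t z - T t z) has_vector_derivative A (S s z) - A (T s z)) (at s within {0..t})"
        by (rule has_vector_derivative_within_subset) auto
      show "inner (A (S s z) - A (T s z)) (S s z - T s z) \<le> 0 * norm (S s z - T s z)"
        using dissipative[OF D_diff, of "S s z" "T s z"] inv[OF s(1)] T_invariant(1)[OF z s(1)] by (simp add: A_diff)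
    qed (use t in auto)
    then show ?thesis by (simp add: T_at_0 S.T_0)
  qed
  interpret St: bounded_linear "S t" by (rule S.bl[OF t])
  interpret Tt: bounded_linear "T t" by (rule T_bounded_linear[OF t])
  have "closed {x. S t x = T t x}"
    by (intro closed_Collect_eq linear_continuous_on St.bounded_linear_axioms Tt.bounded_linear_axioms)
  moreover have "D \<subseteq> {x. S t x = T t x}" using SD by auto
  ultimately have "closure D \<subseteq> {x. S t x = T t x}" by (rule closure_minimal[rotated])
  then show ?thesis by (auto simp: D_dense)
qed

end

section \<open>Exponential decay from a Lyapunov form\<close>

text \<open>
On the invariant subspace that is the range of \<open>Q\<close>, the form \<open>B\<close> decays exponentially along orbits, whence a bound
\<open>M exp (- a t)\<close> with a constant that depends on \<open>B\<close>. Contractivity then allows \<open>M\<close>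
to be lowered to any \<open>M0 > 1\<close>.
\<close>
lemma (in m_dissipative) exponential_decay:
  assumes Q: "bounded_linear Q" "\<And>x. x \<in> D \<Longrightarrow> Q x \<in> D \<and> A (Q x) = Q (A x)" "\<And>x. Q (Q x) = Q x"
    and B: "bounded_bilinear B" "\<And>x y. B x y = (B y x :: real)"
    and lower: "0 < c" "\<And>x. c * (norm x)\<^sup>2 \<le> B x x"
    and neg: "0 < k" "\<And>x. x \<in> D \<Longrightarrow> Q x = x \<Longrightarrow> B x (A x) \<le> - k * (norm x)\<^sup>2"
    and "1 < M0"
  shows "\<exists>\<alpha>>0. \<forall>x. \<forall>t\<ge>0. norm (T t (Q x)) \<le> M0 * exp (- \<alpha> * t) * norm (Q x)"
proof -
  interpret B: bounded_bilinear B by (rule B(1))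
  interpret Q: bounded_linear Q by (rule Q(1))
  obtain K where K: "0 < K" "\<And>x y. norm (B x y) \<le> norm x * norm y * K" using B.pos_bounded by blast
  have K2: "B x x \<le> K * (norm x)\<^sup>2" for x using K(2)[of x x] by (simp add: power2_eq_square mult_ac)
  define a where "a = k / K"
  have a: "0 < a" using K neg by (simp add: a_def)
  have TQ: "T t (Q x) = Q (T t x)" if "0 \<le> t" for t x by (rule T_commute[OF Q(1,2) that])
  have decayD: "c * (norm (T t x))\<^sup>2 \<le> K * exp (- 2 * a * t) * (norm x)\<^sup>2"
    if x: "x \<in> D" "Q x = x" and t: "0 \<le> t" for x t
  proof -
    define q where "q s = exp (2 * a * s) * B (T s x) (T s x)" for s
    define q' where "q' s = exp (2 * a * s) * (2 * a * B (T s x) (T s x) + 2 * B (T s x) (A (T s x)))" for s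
    have der: "(q has_derivative (\<lambda>h. h * q' s)) (at s within {0..t})" if s: "0 \<le> s" for s
    proof -
      have "((\<lambda>t. T t x) has_derivative (\<lambda>h. h *\<^sub>R A (T s x))) (at s within {0..t})"
        using has_vector_derivative_within_subset[OF T_deriv[OF x(1) s], of "{0..t}"]
        by (simp add: has_vector_derivative_def)
      from B.FDERIV[OF this this]
      have "((\<lambda>s. B (T s x) (T s x)) has_derivative (\<lambda>h. h * (2 * B (T s x) (A (T s x))))) (at s within {0..t})"
        by (simp add: B.scaleR_left B.scaleR_right B(2)[of "A (T s x)"] algebra_simps)
      moreover have "((\<lambda>s. exp (2 * a * s)) has_derivative (\<lambda>h. h * (2 * a * exp (2 * a * s)))) (at s within {0..t})"
        by (auto intro!: derivative_eq_intros simp: mult_ac)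
      ultimately show ?thesis unfolding q_def q'_def
        by (rule has_derivative_eq_rhs[OF has_derivative_mult[rotated]]) (simp add: algebra_simps fun_eq_iff)
    qed
    have q'0: "q' s \<le> 0" if s: "0 \<le> s" for s
    proof -
      define y where "y = T s x"
      have y: "y \<in> D" "Q y = y" using T_invariant(1)[OF x(1) s] TQ[OF s, of x] x by (simp_all add: y_def)
      have "a * B y y \<le> a * (K * (norm y)\<^sup>2)" using a K2 by (intro mult_left_mono) auto
      also have "\<dots> = k * (norm y)\<^sup>2" using K by (simp add: a_def)
      also have "\<dots> \<le> - B y (A y)" using neg(2)[OF y] by simp
      finally have "2 * a * B y y + 2 * B y (A y) \<le> 0" by simp
      then show ?thesis unfolding q'_def y_def[symmetric] by (intro mult_nonneg_nonpos) auto
    qed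
    have "q t \<le> q 0"
    proof (cases "t = 0")
      case False
      then have "0 < t" using t by simp
      from mvt_simple[OF this, of q "\<lambda>s h. h * q' s"] der
      obtain s where "0 < s" "q t - q 0 = (t - 0) * q' s" by auto
      moreover have "(t - 0) * q' s \<le> 0" using t q'0[of s] \<open>0 < s\<close> by (intro mult_nonneg_nonpos) auto
      ultimately show ?thesis by linarith
    qed simp
    then have "exp (2 * a * t) * B (T t x) (T t x) \<le> B x x" by (simp add: q_def T_at_0)
    moreover have "exp (2 * a * t) * (c * (norm (T t x))\<^sup>2) \<le> exp (2 * a * t) * B (T t x) (T t x)"
      using lower by (intro mult_left_mono) auto
    ultimately have "exp (2 * a * t) * (c * (norm (T t x))\<^sup>2) \<le> K * (norm x)\<^sup>2" using K2[of x] by linarith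
    then have "exp (- 2 * a * t) * (exp (2 * a * t) * (c * (norm (T t x))\<^sup>2)) \<le> exp (- 2 * a * t) * (K * (norm x)\<^sup>2)"
      by (intro mult_left_mono) auto
    then show ?thesis by (simp add: mult_ac flip: mult.assoc exp_add)
  qed
  define M where "M = max M0 (sqrt (K / c))"
  have M: "1 < M" "M0 \<le> M" "sqrt (K / c) \<le> M" using \<open>1 < M0\<close> by (auto simp: M_def)
  have decayD': "norm (T t (Q x)) \<le> M * exp (- a * t) * norm (Q x)" if x: "x \<in> D" and t: "0 \<le> t" for x t
  proof -
    have "c * (norm (T t (Q x)))\<^sup>2 \<le> K * exp (- 2 * a * t) * (norm (Q x))\<^sup>2"
      using decayD[of "Q x" t] Q(2)[OF x] Q(3)[of x] t by simp
    then have "(norm (T t (Q x)))\<^sup>2 \<le> K / c * (exp (- a * t) * norm (Q x))\<^sup>2"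
      using lower by (simp add: field_simps power_mult_distrib flip: exp_double)
    also have "\<dots> = (sqrt (K / c) * (exp (- a * t) * norm (Q x)))\<^sup>2"
      using K lower by (simp add: power_mult_distrib)
    finally have "norm (T t (Q x)) \<le> sqrt (K / c) * (exp (- a * t) * norm (Q x))"
      by (rule power2_le_imp_le) (use K lower in auto)
    also have "\<dots> \<le> M * (exp (- a * t) * norm (Q x))" using M by (intro mult_right_mono) auto
    finally show ?thesis by (simp add: mult.assoc)
  qed
  have decay: "norm (T t (Q x)) \<le> M * exp (- a * t) * norm (Q x)" if t: "0 \<le> t" for x t
  proof -
    interpret Tt: bounded_linear "T t" by (rule T_bounded_linear[OF t])
    have "closed {x. norm (T t (Q x)) \<le> M * exp (- a * t) * norm (Q x)}"
      by (intro closed_Collect_le continuous_intros Tt.continuous_on Q.continuous_on)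
    moreover have "D \<subseteq> {x. norm (T t (Q x)) \<le> M * exp (- a * t) * norm (Q x)}" using decayD' t by blast
    ultimately have "closure D \<subseteq> {x. norm (T t (Q x)) \<le> M * exp (- a * t) * norm (Q x)}" by (rule closure_minimal[rotated])
    then show ?thesis unfolding D_dense by blast
  qed
  \<comment> \<open>The smaller of \<open>1\<close> and \<open>M exp (- a t)\<close> is at most the power \<open>\<theta>\<close> of the latter, and \<open>M\<close> to this power is \<open>M0\<close>.\<close>
  define \<theta> where "\<theta> = ln M0 / ln M"
  have \<theta>: "0 < \<theta>" "\<theta> \<le> 1" "\<theta> * ln M = ln M0" using M \<open>1 < M0\<close> by (auto simp: \<theta>_def)
  have "norm (T t (Q x)) \<le> M0 * exp (- (a * \<theta>) * t) * norm (Q x)" if t: "0 \<le> t" for x t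
  proof -
    have e: "M0 * exp (- (a * \<theta>) * t) = exp (\<theta> * (ln M - a * t))"
      using \<open>1 < M0\<close> \<theta>(3) by (simp add: right_diff_distrib exp_diff exp_minus field_simps)
    have e2: "M * exp (- a * t) = exp (ln M - a * t)" using M by (simp add: exp_diff exp_minus field_simps)
    show ?thesis
    proof (cases "0 \<le> ln M - a * t")
      case True
      then have "1 \<le> exp (\<theta> * (ln M - a * t))" using \<theta> by simp
      then have "1 * norm (Q x) \<le> exp (\<theta> * (ln M - a * t)) * norm (Q x)" by (intro mult_right_mono) auto
      then show ?thesis using T_contraction[OF t, of "Q x"] unfolding e by linarith
    next
      case False
      then have "1 * (ln M - a * t) \<le> \<theta> * (ln M - a * t)" using \<theta> by (intro mult_right_mono_neg) auto
      then have "exp (ln M - a * t) * norm (Q x) \<le> exp (\<theta> * (ln M - a * t)) * norm (Q x)"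
        by (intro mult_right_mono) auto
      then show ?thesis using decay[OF t, of x] unfolding e e2 by linarith
    qed
  qed
  then show ?thesis using a \<theta> by (intro exI[of _ "a * \<theta>"]) auto
qed

section \<open>The Hilbert space of square integrable functions on the unit interval\<close>

lemma finite_measure_unit: "finite_measure unit_measure" and emeasure_unit: "emeasure unit_measure {0..1} = 1"
proof -
  show "emeasure unit_measure {0..1} = 1" by (simp add: emeasure_restrict_space)
  then show "finite_measure unit_measure" by (intro finite_measureI) (simp add: space_restrict_space)
qed

interpretation um: finite_measure unit_measure by (rule finite_measure_unit)

lemma space_unit [simp]: "space unit_measure = {0..1}" by (simp add: space_restrict_space)

lemma measure_unit [simp]: "measure unit_measure {0..1} = 1"
  using emeasure_unit by (simp add: measure_def)

lemma L2D: 
  assumes "f \<in> L2 M"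
  shows "f \<in> borel_measurable M" "integrable M (\<lambda>x. (cmod (f x))\<^sup>2)"
  using assms by (auto simp: L2_def)

lemma L2_bound:
  assumes "f \<in> borel_measurable M" "g \<in> L2 M" "AE x in M. cmod (f x) \<le> C * cmod (g x)"
  shows "f \<in> L2 M"
proof -
  have "integrable M (\<lambda>x. (cmod (f x))\<^sup>2)"
  proof (rule Bochner_Integration.integrable_bound[of _ "\<lambda>x. C\<^sup>2 * (cmod (g x))\<^sup>2"])
    show "integrable M (\<lambda>x. C\<^sup>2 * (cmod (g x))\<^sup>2)" using assms(2) by (auto simp: L2_def)
    show "AE x in M. norm ((cmod (f x))\<^sup>2) \<le> norm (C\<^sup>2 * (cmod (g x))\<^sup>2)"
      using assms(3)
    proof eventually_elim
      case (elim x)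
      then have "(cmod (f x))\<^sup>2 \<le> (C * cmod (g x))\<^sup>2" by (intro power_mono) auto
      then show ?case by (simp add: power_mult_distrib)
    qed
  qed (use assms(1) in measurable)
  then show ?thesis using assms(1) by (simp add: L2_def)
qed

lemma L2_add: assumes "f \<in> L2 M" "g \<in> L2 M" shows "(\<lambda>x. f x + g x) \<in> L2 M"
proof -
  note [measurable] = L2D(1)[OF assms(1)] L2D(1)[OF assms(2)]
  have "integrable M (\<lambda>x. (cmod (f x + g x))\<^sup>2)"
  proof (rule Bochner_Integration.integrable_bound[of _ "\<lambda>x. 2 * (cmod (f x))\<^sup>2 + 2 * (cmod (g x))\<^sup>2"])
    show "integrable M (\<lambda>x. 2 * (cmod (f x))\<^sup>2 + 2 * (cmod (g x))\<^sup>2)" using assms by (auto simp: L2_def)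
    have "(cmod (f x + g x))\<^sup>2 \<le> 2 * (cmod (f x))\<^sup>2 + 2 * (cmod (g x))\<^sup>2" for x
    proof -
      have "(cmod (f x + g x))\<^sup>2 \<le> (cmod (f x) + cmod (g x))\<^sup>2" by (intro power_mono norm_triangle_ineq) auto
      also have "\<dots> \<le> 2 * (cmod (f x))\<^sup>2 + 2 * (cmod (g x))\<^sup>2"
        using sum_squares_bound[of "cmod (f x)" "cmod (g x)"] by (simp add: power2_sum)
      finally show ?thesis .
    qed
    then show "AE x in M. norm ((cmod (f x + g x))\<^sup>2) \<le> norm (2 * (cmod (f x))\<^sup>2 + 2 * (cmod (g x))\<^sup>2)"
      by (intro AE_I2) simp
  qed measurable
  then show ?thesis by (simp add: L2_def)
qed

lemma L2_cmult: assumes "f \<in> L2 M" shows "(\<lambda>x. c * f x) \<in> L2 M"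
  by (rule L2_bound[OF _ assms, of _ "cmod c"]) (use L2D(1)[OF assms] in \<open>auto simp: norm_mult\<close>)

lemma L2_zero: "(\<lambda>x. 0) \<in> L2 M" by (simp add: L2_def)

lemma L2_scaleR: assumes "f \<in> L2 M" shows "(\<lambda>x. c *\<^sub>R f x) \<in> L2 M"
  using L2_cmult[OF assms, of "complex_of_real c"] by (simp add: scaleR_conv_of_real)

lemma L2_uminus: assumes "f \<in> L2 M" shows "(\<lambda>x. - f x) \<in> L2 M"
  using L2_cmult[OF assms, of "-1"] by simp

lemma L2_diff: assumes "f \<in> L2 M" "g \<in> L2 M" shows "(\<lambda>x. f x - g x) \<in> L2 M"
  using L2_add[OF assms(1) L2_uminus[OF assms(2)]] by simp

lemma L2_integrable_inner: assumes "f \<in> L2 M" "g \<in> L2 M" shows "integrable M (\<lambda>x. f x \<bullet> g x)"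
proof (rule Bochner_Integration.integrable_bound[of _ "\<lambda>x. (cmod (f x))\<^sup>2 + (cmod (g x))\<^sup>2"])
  show "integrable M (\<lambda>x. (cmod (f x))\<^sup>2 + (cmod (g x))\<^sup>2)" using assms by (auto simp: L2_def)
  show "(\<lambda>x. f x \<bullet> g x) \<in> borel_measurable M" using L2D(1)[OF assms(1)] L2D(1)[OF assms(2)] by (intro borel_measurable_inner)
  have "\<bar>f x \<bullet> g x\<bar> \<le> (cmod (f x))\<^sup>2 + (cmod (g x))\<^sup>2" for x
  proof -
    have "\<bar>f x \<bullet> g x\<bar> \<le> cmod (f x) * cmod (g x)" by (rule Cauchy_Schwarz_ineq2)
    moreover have "0 \<le> cmod (f x) * cmod (g x)" by simp
    ultimately show ?thesis using sum_squares_bound[of "cmod (f x)" "cmod (g x)"] by linarith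
  qed
  then show "AE x in M. norm (f x \<bullet> g x) \<le> norm ((cmod (f x))\<^sup>2 + (cmod (g x))\<^sup>2)" by (intro AE_I2) simp
qed

text \<open>
Classes of square integrable functions modulo almost everywhere equality. Only the structure of a real Hilbert space is declared, as this is what the
abstract theory of dissipative operators refers to; multiplication by complex numbers becomes a bounded operator.
\<close>
quotient_type cl2 = "real \<Rightarrow> complex" / partial:
  "\<lambda>f g. f \<in> L2 unit_measure \<and> g \<in> L2 unit_measure \<and> (AE x in unit_measure. f x = g x)"
proof (rule part_equivpI)
  show "\<exists>f. f \<in> L2 unit_measure \<and> f \<in> L2 unit_measure \<and> (AE x in unit_measure. f x = f x)"
    using L2_zero by auto
  show "symp (\<lambda>f g. f \<in> L2 unit_measure \<and> g \<in> L2 unit_measure \<and> (AE x in unit_measure. f x = g x))"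
    by (rule sympI) (auto elim: AE_mp)
  show "transp (\<lambda>f g. f \<in> L2 unit_measure \<and> g \<in> L2 unit_measure \<and> (AE x in unit_measure. f x = g x))"
  proof (rule transpI, elim conjE, intro conjI)
    fix f g h :: "real \<Rightarrow> complex"
    assume "AE x in unit_measure. f x = g x" "AE x in unit_measure. g x = h x"
    then show "AE x in unit_measure. f x = h x" by eventually_elim simp
  qed
qed

instantiation cl2 :: real_inner
begin

lift_definition zero_cl2 :: cl2 is "\<lambda>x. 0" by (simp add: L2_zero)
lift_definition plus_cl2 :: "cl2 \<Rightarrow> cl2 \<Rightarrow> cl2" is "\<lambda>f g x. f x + g x"
  by (auto simp: L2_add elim!: AE_mp)
lift_definition minus_cl2 :: "cl2 \<Rightarrow> cl2 \<Rightarrow> cl2" is "\<lambda>f g x. f x - g x"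
  by (auto simp: L2_diff elim!: AE_mp)
lift_definition uminus_cl2 :: "cl2 \<Rightarrow> cl2" is "\<lambda>f x. - f x"
  by (auto simp: L2_uminus elim!: AE_mp)
lift_definition scaleR_cl2 :: "real \<Rightarrow> cl2 \<Rightarrow> cl2" is "\<lambda>c f x. c *\<^sub>R f x"
  by (auto simp: L2_scaleR elim!: AE_mp)
lift_definition inner_cl2 :: "cl2 \<Rightarrow> cl2 \<Rightarrow> real" is "\<lambda>f g. LINT x|unit_measure. f x \<bullet> g x"
proof -
  fix f f' g g' :: "real \<Rightarrow> complex"
  assume *: "f \<in> L2 unit_measure \<and> f' \<in> L2 unit_measure \<and> (AE x in unit_measure. f x = f' x)"
   "g \<in> L2 unit_measure \<and> g' \<in> L2 unit_measure \<and> (AE x in unit_measure. g x = g' x)"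
  show "(LINT x|unit_measure. f x \<bullet> g x) = (LINT x|unit_measure. f' x \<bullet> g' x)"
    by (rule integral_cong_AE) (use * in \<open>auto intro!: borel_measurable_inner simp: L2D elim!: AE_mp\<close>)
qed

definition norm_cl2 :: "cl2 \<Rightarrow> real" where "norm_cl2 f = sqrt (inner f f)"
definition sgn_cl2 :: "cl2 \<Rightarrow> cl2" where "sgn_cl2 f = scaleR (inverse (norm f)) f"
definition dist_cl2 :: "cl2 \<Rightarrow> cl2 \<Rightarrow> real" where "dist_cl2 f g = norm (f - g)"
definition uniformity_cl2 :: "(cl2 \<times> cl2) filter" where
  "uniformity_cl2 = (INF e\<in>{0 <..}. principal {(x, y). dist x y < e})"
definition open_cl2 :: "cl2 set \<Rightarrow> bool" where
  "open_cl2 U = (\<forall>x\<in>U. eventually (\<lambda>(x', y). x' = x \<longrightarrow> y \<in> U) uniformity)"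

instance
proof
  fix f g h :: cl2 and r s :: real
  show "f + g + h = f + (g + h)" by transfer (auto simp: L2_add add.assoc)
  show "f + g = g + f" by transfer (auto simp: L2_add add.commute)
  show "0 + f = f" by transfer auto
  show "- f + f = 0" by transfer (auto simp: L2_zero)
  show "f - g = f + - g" by transfer (auto simp: L2_diff)
  show "r *\<^sub>R (f + g) = r *\<^sub>R f + r *\<^sub>R g" by transfer (auto simp: L2_add L2_scaleR algebra_simps)
  show "(r + s) *\<^sub>R f = r *\<^sub>R f + s *\<^sub>R f" by transfer (auto simp: L2_add L2_scaleR algebra_simps)
  show "r *\<^sub>R s *\<^sub>R f = (r * s) *\<^sub>R f" by transfer (auto simp: L2_scaleR algebra_simps)
  show "1 *\<^sub>R f = f" by transfer auto
  show "inner f g = inner g f" by transfer (simp add: inner_commute)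
  show "inner (f + g) h = inner f h + inner g h"
    by transfer (auto simp: inner_add_left L2_integrable_inner intro!: Bochner_Integration.integral_add)
  show "inner (r *\<^sub>R f) g = r * inner f g" by transfer simp
  show "0 \<le> inner f f" by transfer (auto intro!: integral_nonneg_AE)
  show "(inner f f = 0) = (f = 0)"
  proof (transfer, goal_cases)
    case (1 f)
    have "(LINT x|unit_measure. f x \<bullet> f x) = 0 \<longleftrightarrow> (AE x in unit_measure. f x \<bullet> f x = 0)"
      by (rule integral_nonneg_eq_0_iff_AE) (use 1 in \<open>auto intro!: L2_integrable_inner\<close>)
    then show ?case using 1 by (simp add: L2_zero)
  qed
  show "dist f g = norm (f - g)" by (simp add: dist_cl2_def)
  show "sgn f = inverse (norm f) *\<^sub>R f" by (simp add: sgn_cl2_def)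
  show "norm f = sqrt (inner f f)" by (simp add: norm_cl2_def)
  show "(uniformity :: (cl2 \<times> cl2) filter) = (INF e\<in>{0 <..}. principal {(x, y). dist x y < e})"
    by (simp add: uniformity_cl2_def)
  fix U :: "cl2 set"
  show "open U = (\<forall>x\<in>U. eventually (\<lambda>(x', y). x' = x \<longrightarrow> y \<in> U) uniformity)" by (simp add: open_cl2_def)
qed

end

definition rep :: "cl2 \<Rightarrow> real \<Rightarrow> complex" where "rep = rep_cl2"
definition cls :: "(real \<Rightarrow> complex) \<Rightarrow> cl2" where "cls = abs_cl2"

lemma rep_L2: "rep f \<in> L2 unit_measure"
  using Quotient3_rep_reflp[OF Quotient3_cl2, of f] by (simp add: rep_def)

lemma cls_rep [simp]: "cls (rep f) = f"
  using Quotient3_abs_rep[OF Quotient3_cl2, of f] by (simp add: rep_def cls_def)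

lemma cls_eq_iff: "f \<in> L2 unit_measure \<Longrightarrow> g \<in> L2 unit_measure \<Longrightarrow> cls f = cls g \<longleftrightarrow> (AE x in unit_measure. f x = g x)"
  using Quotient3_rel[OF Quotient3_cl2, of f g] by (auto simp: cls_def)

lemma rep_cls: "f \<in> L2 unit_measure \<Longrightarrow> AE x in unit_measure. rep (cls f) x = f x"
  using cls_eq_iff[OF rep_L2, of f "cls f"] by simp

lemma cls_add: "f \<in> L2 unit_measure \<Longrightarrow> g \<in> L2 unit_measure \<Longrightarrow> cls (\<lambda>x. f x + g x) = cls f + cls g"
  unfolding cls_def by (rule plus_cl2.abs_eq[symmetric]) auto

lemma cls_diff: "f \<in> L2 unit_measure \<Longrightarrow> g \<in> L2 unit_measure \<Longrightarrow> cls (\<lambda>x. f x - g x) = cls f - cls g"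
  unfolding cls_def by (rule minus_cl2.abs_eq[symmetric]) auto

lemma cls_scaleR: "f \<in> L2 unit_measure \<Longrightarrow> cls (\<lambda>x. c *\<^sub>R f x) = c *\<^sub>R cls f"
  unfolding cls_def by (rule scaleR_cl2.abs_eq[symmetric]) auto

lemma cls_zero: "cls (\<lambda>x. 0) = 0"
  unfolding cls_def by (rule zero_cl2.abs_eq[symmetric])

lemma inner_cls: "f \<in> L2 unit_measure \<Longrightarrow> g \<in> L2 unit_measure \<Longrightarrow> inner (cls f) (cls g) = (LINT x|unit_measure. f x \<bullet> g x)"
  unfolding cls_def by (rule inner_cl2.abs_eq) auto

lemma norm_cls: "f \<in> L2 unit_measure \<Longrightarrow> (norm (cls f))\<^sup>2 = (LINT x|unit_measure. (cmod (f x))\<^sup>2)"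
  by (simp add: power2_norm_eq_inner inner_cls)

lemma L2_const: "(\<lambda>x. c) \<in> L2 unit_measure" by (simp add: L2_def)

lemma L2_integrable: assumes "f \<in> L2 unit_measure" shows "integrable unit_measure f"
proof (rule Bochner_Integration.integrable_bound[of _ "\<lambda>x. 1 + (cmod (f x))\<^sup>2"])
  show "integrable unit_measure (\<lambda>x. 1 + (cmod (f x))\<^sup>2)" using L2D(2)[OF assms] by auto
  have "cmod (f x) \<le> 1 + (cmod (f x))\<^sup>2" for x
    using sum_squares_bound[of 1 "cmod (f x)"] norm_ge_zero[of "f x"] zero_le_power2[of "cmod (f x)"]
    unfolding one_power2 by linarith
  then show "AE x in unit_measure. norm (f x) \<le> norm (1 + (cmod (f x))\<^sup>2)" by (intro AE_I2) simp
qed (use L2D(1)[OF assms] in simp)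

text \<open>
The Cauchy--Schwarz inequality against the constant one, the interval having measure one.
\<close>
lemma L2_L1_bound: assumes "f \<in> L2 unit_measure"
  shows "(LINT x|unit_measure. cmod (f x)) \<le> norm (cls f)"
proof -
  have g: "(\<lambda>x. complex_of_real (cmod (f x))) \<in> L2 unit_measure"
    using assms by (auto simp: L2_def)
  have "(LINT x|unit_measure. cmod (f x)) = inner (cls (\<lambda>x. complex_of_real (cmod (f x)))) (cls (\<lambda>x. 1))"
    by (simp add: inner_cls g L2_const inner_complex_def)
  also have "\<dots> \<le> norm (cls (\<lambda>x. complex_of_real (cmod (f x)))) * norm (cls (\<lambda>x. 1))"
    by (rule norm_cauchy_schwarz)
  also have "norm (cls (\<lambda>x. 1)) = 1"
    by (rule power2_eq_imp_eq) (use norm_cls[OF L2_const[of 1]] in auto)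
  also have "norm (cls (\<lambda>x. complex_of_real (cmod (f x)))) = norm (cls f)"
    by (rule power2_eq_imp_eq) (use norm_cls[OF g] norm_cls[OF assms] in auto)
  finally show ?thesis by simp
qed

instance cl2 :: banach
proof
  fix X :: "nat \<Rightarrow> cl2" assume X: "Cauchy X"
  define f where "f n = rep (X n)" for n
  have fL: "f n \<in> L2 unit_measure" for n by (simp add: f_def rep_L2)
  note [measurable] = L2D(1)[OF fL]
  have d: "norm (X i - X j) = norm (cls (\<lambda>x. f i x - f j x))" for i j by (simp add: cls_diff fL f_def rep_L2)
  have "\<exists>N. \<forall>i\<ge>N. \<forall>j\<ge>N. (LINT x|unit_measure. norm (f i x - f j x)) < e" if "e > 0" for e
  proof -
    obtain N where N: "\<And>i j. i \<ge> N \<Longrightarrow> j \<ge> N \<Longrightarrow> dist (X i) (X j) < e" using X \<open>e > 0\<close> unfolding Cauchy_def by blast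
    have "(LINT x|unit_measure. norm (f i x - f j x)) < e" if "i \<ge> N" "j \<ge> N" for i j
      using L2_L1_bound[OF L2_diff[OF fL fL], of i j] N[OF that] by (simp add: d dist_norm)
    then show ?thesis by blast
  qed
  from cauchy_L1_AE_cauchy_subseq[OF L2_integrable[OF fL] this]
  obtain r where r: "strict_mono r" "AE x in unit_measure. Cauchy (\<lambda>i. f (r i) x)" by blast
  define g where "g x = lim (\<lambda>i. f (r i) x)" for x
  have gm [measurable]: "g \<in> borel_measurable unit_measure" unfolding g_def[abs_def] by measurable
  have lim: "AE x in unit_measure. (\<lambda>i. f (r i) x) \<longlonglongrightarrow> g x"
    using r(2) by eventually_elim (simp add: g_def Cauchy_convergent convergent_LIMSEQ_iff[symmetric])
  have fatou: "(\<integral>\<^sup>+x. ennreal ((cmod (f m x - g x))\<^sup>2) \<partial>unit_measure) \<le> ennreal (e\<^sup>2)"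
    if N: "\<And>i j. i \<ge> N \<Longrightarrow> j \<ge> N \<Longrightarrow> dist (X i) (X j) < e" and m: "m \<ge> N" for m N e
  proof -
    have b: "(\<integral>\<^sup>+x. ennreal ((cmod (f m x - f (r i) x))\<^sup>2) \<partial>unit_measure) \<le> ennreal (e\<^sup>2)" if "i \<ge> N" for i
    proof -
      have "r i \<ge> N" using that seq_suble[OF r(1), of i] by linarith
      have "(\<integral>\<^sup>+x. ennreal ((cmod (f m x - f (r i) x))\<^sup>2) \<partial>unit_measure) = ennreal ((norm (X m - X (r i)))\<^sup>2)"
        using L2D(2)[OF L2_diff[OF fL fL], of m "r i"]
        by (simp add: d norm_cls L2_diff fL nn_integral_eq_integral)
      also have "\<dots> \<le> ennreal (e\<^sup>2)"
        using N[OF m \<open>r i \<ge> N\<close>] by (intro ennreal_leI power_mono) (auto simp: dist_norm)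
      finally show ?thesis .
    qed
    have "(\<integral>\<^sup>+x. ennreal ((cmod (f m x - g x))\<^sup>2) \<partial>unit_measure)
        = (\<integral>\<^sup>+x. liminf (\<lambda>i. ennreal ((cmod (f m x - f (r i) x))\<^sup>2)) \<partial>unit_measure)"
    proof (rule nn_integral_cong_AE)
      show "AE x in unit_measure. ennreal ((cmod (f m x - g x))\<^sup>2) = liminf (\<lambda>i. ennreal ((cmod (f m x - f (r i) x))\<^sup>2))"
        using lim
      proof eventually_elim
        case (elim x)
        have "(\<lambda>i. ennreal ((cmod (f m x - f (r i) x))\<^sup>2)) \<longlonglongrightarrow> ennreal ((cmod (f m x - g x))\<^sup>2)"
          using elim by (intro tendsto_ennrealI tendsto_intros)
        from lim_imp_Liminf[OF sequentially_bot this] show ?case by simp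
      qed
    qed
    also have "\<dots> \<le> liminf (\<lambda>i. (\<integral>\<^sup>+x. ennreal ((cmod (f m x - f (r i) x))\<^sup>2) \<partial>unit_measure))"
      by (rule nn_integral_liminf) measurable
    also have "\<dots> \<le> ennreal (e\<^sup>2)"
      by (rule Liminf_le) (use b in \<open>auto simp: eventually_sequentially intro!: exI[of _ N]\<close>)
    finally show ?thesis .
  qed
  have diffL2: "(\<lambda>x. f m x - g x) \<in> L2 unit_measure" 
    if N: "\<And>i j. i \<ge> N \<Longrightarrow> j \<ge> N \<Longrightarrow> dist (X i) (X j) < e" and m: "m \<ge> N" for m N e
  proof -
    have "integrable unit_measure (\<lambda>x. (cmod (f m x - g x))\<^sup>2)"
      by (rule integrableI_bounded) (use fatou[OF N m] in \<open>auto simp: top_unique less_top[symmetric]\<close>)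
    then show ?thesis by (simp add: L2_def)
  qed
  obtain N1 where N1: "\<And>i j. i \<ge> N1 \<Longrightarrow> j \<ge> N1 \<Longrightarrow> dist (X i) (X j) < 1" using X unfolding Cauchy_def by (metis zero_less_one)
  have "(\<lambda>x. f N1 x - g x) \<in> L2 unit_measure" by (rule diffL2[where N = N1 and e = 1]) (use N1 in auto)
  from L2_diff[OF fL[of N1] this] have gL: "g \<in> L2 unit_measure" by simp
  have "X \<longlonglongrightarrow> cls g"
  proof (rule metric_LIMSEQ_I)
    fix e :: real assume e: "e > 0"
    obtain N where N: "\<And>i j. i \<ge> N \<Longrightarrow> j \<ge> N \<Longrightarrow> dist (X i) (X j) < e / 2" using X e unfolding Cauchy_def by (meson half_gt_zero)
    have "dist (X m) (cls g) < e" if m: "m \<ge> N" for m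
    proof -
      have "ennreal ((norm (X m - cls g))\<^sup>2) = ennreal (LINT x|unit_measure. (cmod (f m x - g x))\<^sup>2)"
        using norm_cls[OF diffL2[OF N m]] by (simp add: cls_diff fL gL f_def rep_L2)
      also have "\<dots> = (\<integral>\<^sup>+x. ennreal ((cmod (f m x - g x))\<^sup>2) \<partial>unit_measure)"
        using L2D(2)[OF diffL2[OF N m]] by (intro nn_integral_eq_integral[symmetric]) auto
      also have "\<dots> \<le> ennreal ((e / 2)\<^sup>2)" by (rule fatou[OF N m])
      finally have "(norm (X m - cls g))\<^sup>2 \<le> (e / 2)\<^sup>2" by (subst (asm) ennreal_le_iff) auto
      then have "norm (X m - cls g) \<le> e / 2" using e by (auto intro: power2_le_imp_le)
      then show ?thesis using e by (simp add: dist_norm)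
    qed
    then show "\<exists>N. \<forall>m\<ge>N. dist (X m) (cls g) < e" by blast
  qed
  then show "convergent X" by (auto simp: convergent_def)
qed

section \<open>Absolutely continuous functions\<close>

text \<open>
Absolute continuity in the form of the fundamental theorem of calculus. The derivative is a second argument
since it is determined only up to null sets.
\<close>
definition ac_deriv :: "(real \<Rightarrow> 'e::euclidean_space) \<Rightarrow> (real \<Rightarrow> 'e) \<Rightarrow> bool" where
  "ac_deriv u u' \<longleftrightarrow> u' absolutely_integrable_on {0..1} \<and> (\<forall>x\<in>{0..1}. u x = u 0 + integral {0..x} u')"

lemma integrable_unit_iff: "integrable unit_measure f \<longleftrightarrow> f absolutely_integrable_on {0..1}"
  for f :: "real \<Rightarrow> 'e::euclidean_space"
  by (simp add: integrable_restrict_space set_integrable_def)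

lemma LINT_unit: "integrable unit_measure f \<Longrightarrow> (LINT x|unit_measure. f x) = integral {0..1} f"
  for f :: "real \<Rightarrow> 'e::euclidean_space"
  by (rule lebesgue_integral_eq_integral) auto

lemma continuous_integrable_unit:
  fixes f :: "real \<Rightarrow> 'e::euclidean_space"
  assumes "continuous_on {0..1} f" shows "integrable unit_measure f"
  using absolutely_integrable_continuous_real[OF assms] by (simp add: integrable_unit_iff)

lemma continuous_measurable_unit:
  fixes f :: "real \<Rightarrow> 'e::euclidean_space"
  assumes "continuous_on {0..1} f" shows "f \<in> borel_measurable unit_measure"
  using continuous_integrable_unit[OF assms] by (rule borel_measurable_integrable)

lemma ac_derivD:
  assumes "ac_deriv u u'"
  shows "u' absolutely_integrable_on {0..1}" "u' integrable_on {0..1}" "x \<in> {0..1} \<Longrightarrow> u x = u 0 + integral {0..x} u'"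
proof -
  show i: "u' absolutely_integrable_on {0..1}" using assms unfolding ac_deriv_def by (rule conjunct1)
  then show "u' integrable_on {0..1}" by (rule absolutely_integrable_on_def[THEN iffD1, THEN conjunct1])
  show "x \<in> {0..1} \<Longrightarrow> u x = u 0 + integral {0..x} u'" using assms unfolding ac_deriv_def by blast
qed

lemma ac_derivI:
  assumes "\<And>x. x \<in> {0..1} \<Longrightarrow> u x = u 0 + integral {0..x} u'" "u' absolutely_integrable_on {0..1}"
  shows "ac_deriv u u'"
  unfolding ac_deriv_def using assms by blast

lemma ac_deriv_continuous:
  assumes "ac_deriv u u'" shows "continuous_on {0..1} u"
proof -
  have "continuous_on {0..1} (\<lambda>x. u 0 + integral {0..x} u')"
    by (rule continuous_on_add[OF continuous_on_const indefinite_integral_continuous_1[OF ac_derivD(2)[OF assms]]])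
  then show ?thesis by (rule continuous_on_eq) (rule ac_derivD(3)[OF assms, symmetric])
qed

lemma ac_deriv_increment:
  assumes "ac_deriv u u'" "0 \<le> x" "x \<le> y" "y \<le> 1"
  shows "u y - u x = integral {x..y} u'"
proof -
  have "u' integrable_on {0..y}"
    by (rule integrable_on_subinterval[OF ac_derivD(2)[OF assms(1)]]) (use assms in auto)
  from Henstock_Kurzweil_Integration.integral_combine[OF assms(2,3) this]
  have I: "integral {0..y} u' = integral {0..x} u' + integral {x..y} u'" by (rule sym)
  have ux: "u x = u 0 + integral {0..x} u'" and uy: "u y = u 0 + integral {0..y} u'"
    by (rule ac_derivD(3)[OF assms(1)]; use assms in force)+
  show ?thesis unfolding ux uy I by simp
qed

lemma ac_deriv_integral: "ac_deriv u u' \<Longrightarrow> integral {0..1} u' = u 1 - u 0"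
  using ac_deriv_increment[of u u' 0 1] by simp

lemma ac_deriv_primitive:
  assumes "f absolutely_integrable_on {0..1}" shows "ac_deriv (\<lambda>x. c + integral {0..x} f) f"
  using assms by (simp add: ac_deriv_def)

lemma ac_deriv_cong:
  assumes "ac_deriv u u'" "\<And>x. x \<in> {0..1} \<Longrightarrow> u x = v x" "\<And>x. x \<in> {0..1} \<Longrightarrow> u' x = v' x"
  shows "ac_deriv v v'"
proof -
  have "v' absolutely_integrable_on {0..1}"
    using ac_derivD(1)[OF assms(1)] by (rule absolutely_integrable_spike[of _ _ "{}"]) (use assms in auto)
  moreover have "v x = v 0 + integral {0..x} v'" if "x \<in> {0..1}" for x
  proof -
    have "integral {0..x} u' = integral {0..x} v'" by (rule integral_cong) (use that assms in auto)
    then show ?thesis using ac_derivD(3)[OF assms(1) that] assms(2)[OF that] assms(2)[of 0] by simp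
  qed
  ultimately show ?thesis by (intro ac_derivI)
qed

lemma ac_deriv_linear:
  assumes "bounded_linear h" "ac_deriv u u'"
  shows "ac_deriv (\<lambda>x. h (u x)) (\<lambda>x. h (u' x))"
proof -
  interpret h: bounded_linear h by (rule assms(1))
  have "h (u x) = h (u 0) + integral {0..x} (\<lambda>x. h (u' x))" if x: "x \<in> {0..1}" for x
  proof -
    have "u' integrable_on {0..x}"
      by (rule integrable_on_subinterval[OF ac_derivD(2)[OF assms(2)]]) (use x in auto)
    from integral_linear[OF this assms(1)] show ?thesis
      using ac_derivD(3)[OF assms(2) x] by (simp add: h.add o_def)
  qed
  then show ?thesis using absolutely_integrable_linear[OF ac_derivD(1)[OF assms(2)] assms(1)]
    unfolding o_def by (rule ac_derivI)
qed

lemma ac_deriv_add: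
  assumes "ac_deriv u u'" "ac_deriv v v'"
  shows "ac_deriv (\<lambda>x. u x + v x) (\<lambda>x. u' x + v' x)"
proof -
  have "u x + v x = u 0 + v 0 + integral {0..x} (\<lambda>x. u' x + v' x)" if x: "x \<in> {0..1}" for x
  proof -
    have "u' integrable_on {0..x}" "v' integrable_on {0..x}"
      by (rule integrable_on_subinterval[OF ac_derivD(2)[OF assms(1)]] integrable_on_subinterval[OF ac_derivD(2)[OF assms(2)]];
          use x in auto)+
    from integral_add[OF this] show ?thesis
      using ac_derivD(3)[OF assms(1) x] ac_derivD(3)[OF assms(2) x] by simp
  qed
  then show ?thesis using set_integral_add(1)[OF ac_derivD(1)[OF assms(1)] ac_derivD(1)[OF assms(2)]]
    by (rule ac_derivI)
qed

lemma ac_deriv_diff: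
  assumes "ac_deriv u u'" "ac_deriv v v'"
  shows "ac_deriv (\<lambda>x. u x - v x) (\<lambda>x. u' x - v' x)"
  using ac_deriv_add[OF assms(1) ac_deriv_linear[OF bounded_linear_minus[OF bounded_linear_ident] assms(2)]] by simp

lemma ac_deriv_const: "ac_deriv (\<lambda>x. c) (\<lambda>x. 0)"
  by (simp add: ac_deriv_def)

lemma ac_deriv_C1:
  fixes u :: "real \<Rightarrow> 'e::euclidean_space"
  assumes "continuous_on {0..1} u" "continuous_on {0..1} u'"
    and "\<And>x. x \<in> {0<..<1} \<Longrightarrow> (u has_vector_derivative u' x) (at x)"
  shows "ac_deriv u u'"
proof -
  have "u x = u 0 + integral {0..x} u'" if x: "x \<in> {0..1}" for x
  proof -
    have "(u' has_integral (u x - u 0)) {0..x}"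
      by (rule fundamental_theorem_of_calculus_interior)
        (use x assms(3) in \<open>auto intro: continuous_on_subset[OF assms(1)]\<close>)
    then show ?thesis by (simp add: integral_unique)
  qed
  then show ?thesis using absolutely_integrable_continuous_real[OF assms(2)] by (rule ac_derivI)
qed

text \<open>
Bisection at a point where \<open>G\<close> equals the mean of its end values halves the bound, and so on: a function with increments
quadratic in those of a continuous function is constant. This replaces a differentiation theorem in the product rule.
\<close>
lemma constant_if_increment_quadratic:
  fixes F :: "real \<Rightarrow> 'a::real_normed_vector" and G :: "real \<Rightarrow> real"
  assumes G: "continuous_on {a..b} G"
    and le: "\<And>x y. a \<le> x \<Longrightarrow> x \<le> y \<Longrightarrow> y \<le> b \<Longrightarrow> norm (F y - F x) \<le> C * (G y - G x)\<^sup>2"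
    and "a \<le> x" "x \<le> y" "y \<le> b"
  shows "F x = F y"
proof -
  have half: "norm (F y - F x) \<le> C * (G y - G x)\<^sup>2 / 2 ^ n" if "a \<le> x" "x \<le> y" "y \<le> b" for x y n
    using that
  proof (induction n arbitrary: x y)
    case (Suc n)
    obtain z where z: "x \<le> z" "z \<le> y" "G z = (G x + G y) / 2"
    proof (cases "G x \<le> G y")
      case True
      then have "\<exists>z. x \<le> z \<and> z \<le> y \<and> G z = (G x + G y) / 2"
        by (intro IVT' continuous_on_subset[OF G]) (use Suc.prems in auto)
      then show ?thesis using that by blast
    next
      case False
      then have "\<exists>z. x \<le> z \<and> z \<le> y \<and> G z = (G x + G y) / 2"
        by (intro IVT2' continuous_on_subset[OF G]) (use Suc.prems in auto)
      then show ?thesis using that by blast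
    qed
    have 1: "norm (F z - F x) \<le> C * (G z - G x)\<^sup>2 / 2 ^ n" by (rule Suc.IH) (use z Suc.prems in auto)
    have 2: "norm (F y - F z) \<le> C * (G y - G z)\<^sup>2 / 2 ^ n" by (rule Suc.IH) (use z Suc.prems in auto)
    have "norm (F y - F x) \<le> norm (F z - F x) + norm (F y - F z)"
      using norm_triangle_ineq[of "F z - F x" "F y - F z"] by simp
    moreover have Gz: "G z - G x = (G y - G x) / 2" "G y - G z = (G y - G x) / 2" using z(3) by (auto simp: field_simps)
    ultimately have "norm (F y - F x) \<le> C * ((G y - G x) / 2)\<^sup>2 / 2 ^ n + C * ((G y - G x) / 2)\<^sup>2 / 2 ^ n"
      using 1 2 unfolding Gz by linarith
    also have "\<dots> = C * (G y - G x)\<^sup>2 / 2 ^ Suc n" by (simp add: power_divide)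
    finally show ?case .
  qed (use le in simp)
  have "(\<lambda>n. C * (G y - G x)\<^sup>2 / 2 ^ n) \<longlonglongrightarrow> 0"
    by (rule LIMSEQ_divide_realpow_zero) simp
  from LIMSEQ_le_const[OF this] have "norm (F y - F x) \<le> 0" using half[OF assms(3-5)] by blast
  then show ?thesis by simp
qed

text \<open>
The product rule. The difference \<open>F\<close> between the product and its presumed primitive has increments bounded by the square of
the increments of the primitive \<open>G\<close> of \<open>|u'| + |v'|\<close>.
\<close>
lemma ac_deriv_bilinear:
  fixes pr :: "'a::euclidean_space \<Rightarrow> 'b::euclidean_space \<Rightarrow> 'c::euclidean_space"
  assumes pr: "bounded_bilinear pr" and u: "ac_deriv u u'" and v: "ac_deriv v v'"
  shows "ac_deriv (\<lambda>x. pr (u x) (v x)) (\<lambda>x. pr (u x) (v' x) + pr (u' x) (v x))"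
proof -
  interpret pr: bounded_bilinear pr by (rule pr)
  interpret flip: bounded_bilinear "\<lambda>x y. pr y x" by (rule pr.flip)
  have bl: "bilinear pr" "bilinear (\<lambda>x y. pr y x)"
    using pr pr.flip by (simp_all add: bilinear_conv_bounded_bilinear)
  obtain K where K: "0 < K" "\<And>a b. norm (pr a b) \<le> norm a * norm b * K" using pr.pos_bounded by blast
  note cu = ac_deriv_continuous[OF u] and cv = ac_deriv_continuous[OF v]
  have bdd: "bounded (f ` {0..1})" if "continuous_on {0..1} f" for f :: "real \<Rightarrow> 'z::euclidean_space"
    using compact_continuous_image[OF that] by (simp add: compact_imp_bounded)
  have i1: "(\<lambda>x. pr (u x) (v' x)) absolutely_integrable_on {0..1}"
    by (rule absolutely_integrable_bounded_measurable_product[OF bl(1) continuous_measurable_unit[OF cu] _ bdd[OF cu] ac_derivD(1)[OF v]]) simp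
  have i2: "(\<lambda>x. pr (u' x) (v x)) absolutely_integrable_on {0..1}"
    by (rule absolutely_integrable_bounded_measurable_product[OF bl(2) continuous_measurable_unit[OF cv] _ bdd[OF cv] ac_derivD(1)[OF u]]) simp
  let ?d = "\<lambda>x. pr (u x) (v' x) + pr (u' x) (v x)"
  have i: "?d absolutely_integrable_on {0..1}" by (rule set_integral_add(1)[OF i1 i2])
  have sub: "f integrable_on {x..y}" if "f absolutely_integrable_on {0..1}" "0 \<le> x" "x \<le> y" "y \<le> 1"
    for f :: "real \<Rightarrow> 'z::euclidean_space" and x y
    by (rule integrable_on_subinterval[of _ "{0..1}"]) (use that in \<open>auto simp: absolutely_integrable_on_def\<close>)
  define g where "g s = norm (u' s) + norm (v' s)" for s
  have gi: "g absolutely_integrable_on {0..1}" unfolding g_def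
    by (intro set_integral_add(1) absolutely_integrable_norm[unfolded o_def] ac_derivD(1)[OF u] ac_derivD(1)[OF v])
  define G where "G x = integral {0..x} g" for x
  have G: "ac_deriv G g" using ac_deriv_primitive[OF gi, of 0] by (simp add: G_def[abs_def])
  define F where "F x = pr (u x) (v x) - integral {0..x} ?d" for x
  have nub: "norm (u y - u x) \<le> G y - G x" "norm (v y - v x) \<le> G y - G x" if "0 \<le> x" "x \<le> y" "y \<le> 1" for x y
  proof -
    show "norm (u y - u x) \<le> G y - G x"
      unfolding ac_deriv_increment[OF u that] ac_deriv_increment[OF G that]
      by (rule Henstock_Kurzweil_Integration.integral_norm_bound_integral) (use sub that ac_derivD(1)[OF u] gi in \<open>auto simp: g_def\<close>)
    show "norm (v y - v x) \<le> G y - G x"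
      unfolding ac_deriv_increment[OF v that] ac_deriv_increment[OF G that]
      by (rule Henstock_Kurzweil_Integration.integral_norm_bound_integral) (use sub that ac_derivD(1)[OF v] gi in \<open>auto simp: g_def\<close>)
  qed
  have est: "norm (F y - F x) \<le> K * (G y - G x)\<^sup>2" if xy: "0 \<le> x" "x \<le> y" "y \<le> 1" for x y
  proof -
    let ?e = "\<lambda>s. pr (u' s) (v y - v s) + pr (u x - u s) (v' s)"
    have Gd: "0 \<le> G y - G x" using nub(1)[OF xy] norm_ge_zero order_trans by blast
    have dd: "integral {0..y} ?d - integral {0..x} ?d = integral {x..y} ?d"
      using ac_deriv_increment[OF ac_deriv_primitive[OF i, of 0] xy] by simp
    have "(?d has_integral integral {x..y} ?d) {x..y}" using sub[OF i xy] by (rule integrable_integral)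
    moreover have "((\<lambda>s. pr (u' s) (v y)) has_integral pr (u y - u x) (v y)) {x..y}"
      unfolding ac_deriv_increment[OF u xy]
      using has_integral_linear[OF integrable_integral[OF sub[OF ac_derivD(1)[OF u] xy]] pr.bounded_linear_left[of "v y"]]
      by (simp add: o_def)
    moreover have "((\<lambda>s. pr (u x) (v' s)) has_integral pr (u x) (v y - v x)) {x..y}"
      unfolding ac_deriv_increment[OF v xy]
      using has_integral_linear[OF integrable_integral[OF sub[OF ac_derivD(1)[OF v] xy]] pr.bounded_linear_right[of "u x"]]
      by (simp add: o_def)
    ultimately have "((\<lambda>s. pr (u' s) (v y) + pr (u x) (v' s) - ?d s) has_integral
        (pr (u y - u x) (v y) + pr (u x) (v y - v x) - integral {x..y} ?d)) {x..y}"
      by (intro has_integral_diff has_integral_add)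
    moreover have "pr (u' s) (v y) + pr (u x) (v' s) - ?d s = ?e s" for s
      by (simp add: pr.diff_left pr.diff_right)
    moreover have "pr (u y - u x) (v y) + pr (u x) (v y - v x) - integral {x..y} ?d = F y - F x"
      unfolding F_def dd[symmetric] by (simp add: pr.diff_left pr.diff_right)
    ultimately have e: "(?e has_integral (F y - F x)) {x..y}" by simp
    have g: "((\<lambda>s. K * (G y - G x) * g s) has_integral K * (G y - G x) * (G y - G x)) {x..y}"
      unfolding ac_deriv_increment[OF G xy]
      by (intro has_integral_mult_right integrable_integral sub[OF gi xy])
    have b: "norm (?e s) \<le> K * (G y - G x) * g s" if s: "s \<in> {x..y}" for s
    proof -
      have m: "G y - G s \<le> G y - G x" "G s - G x \<le> G y - G x"
        using order_trans[OF norm_ge_zero nub(1)[of x s]] order_trans[OF norm_ge_zero nub(1)[of s y]] s xy by auto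
      have "norm (?e s) \<le> norm (u' s) * norm (v y - v s) * K + norm (u x - u s) * norm (v' s) * K"
        by (rule norm_triangle_le) (intro add_mono K)
      also have "\<dots> \<le> norm (u' s) * (G y - G x) * K + (G y - G x) * norm (v' s) * K"
        using nub(2)[of s y] nub(1)[of x s] s xy m K Gd
        by (intro add_mono mult_right_mono mult_left_mono) (auto simp: norm_minus_commute)
      finally show ?thesis by (simp add: g_def algebra_simps)
    qed
    have "norm (integral {x..y} ?e) \<le> integral {x..y} (\<lambda>s. K * (G y - G x) * g s)"
      by (rule Henstock_Kurzweil_Integration.integral_norm_bound_integral[OF has_integral_integrable[OF e]
            has_integral_integrable[OF g] b])
    then have "norm (F y - F x) \<le> K * (G y - G x) * (G y - G x)"
      unfolding integral_unique[OF e] integral_unique[OF g] .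
    then show ?thesis by (simp add: power2_eq_square mult.assoc)
  qed
  have "pr (u x) (v x) = pr (u 0) (v 0) + integral {0..x} ?d" if "x \<in> {0..1}" for x
    using constant_if_increment_quadratic[OF ac_deriv_continuous[OF G] est, of 0 x] that by (simp add: F_def)
  then show ?thesis using i by (rule ac_derivI)
qed

lemmas ac_deriv_scaleR = ac_deriv_bilinear[OF bounded_bilinear_scaleR]
lemmas ac_deriv_inner = ac_deriv_bilinear[OF bounded_bilinear_inner]

section \<open>Test functions and weak derivatives\<close>

lemma sets_unitI: "A \<in> sets lebesgue \<Longrightarrow> A \<inter> {0..1} \<in> sets unit_measure"
  by (auto simp: sets_restrict_space)

text \<open>
The integrals of \<open>g\<close> over initial segments vanish. Such segments are stable under intersection and
generate the Borel sets, so all integrals over measurable sets vanish.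
\<close>
lemma AE_zero_if_primitive_zero:
  fixes g :: "real \<Rightarrow> 'e::euclidean_space"
  assumes g: "integrable unit_measure g" and z: "\<And>x. x \<in> {0..1} \<Longrightarrow> integral {0..x} g = 0"
  shows "AE x in unit_measure. g x = 0"
proof (rule um.density_zero[OF g])
  fix A assume A: "A \<in> sets unit_measure"
  have gA: "integrable unit_measure (\<lambda>x. indicator B x *\<^sub>R g x)" if "B \<in> sets lebesgue" for B
    using integrable_mult_indicator[OF sets_unitI[OF that] g]
    by (rule Bochner_Integration.integrable_cong[OF refl, THEN iffD1, rotated]) (auto simp: indicator_def)
  have borel: "(LINT x|unit_measure. indicator B x *\<^sub>R g x) = 0" if "B \<in> sets borel" for B
  proof -
    have bs: "sets (borel :: real measure) = sigma_sets UNIV (range atMost)"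
      by (simp add: borel_eq_atMost)
    have stable: "Int_stable (range (atMost :: real \<Rightarrow> real set))"
      by (auto simp: Int_stable_def)
    have "B \<in> sigma_sets UNIV (range atMost)" using that bs by simp
    from stable subset_UNIV[of "range atMost", unfolded Pow_UNIV[symmetric]] this show ?thesis
    proof (induction rule: sigma_sets_induct_disjoint)
      case (basic B)
      then obtain a where B: "B = {..a}" by auto
      have i: "integrable unit_measure (\<lambda>x. indicator {..a} x *\<^sub>R g x)" by (rule gA) simp
      have "integral {0..1} (\<lambda>x. indicator {..a} x *\<^sub>R g x) = integral {0..min a 1} g"
      proof -
        have "integral {0..1} (\<lambda>x. indicator {..a} x *\<^sub>R g x) = integral {0..1} (\<lambda>x. if x \<in> {0..min a 1} then g x else 0)"
          by (rule integral_cong) (auto simp: indicator_def)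
        also have "\<dots> = integral {0..min a 1} g"
          using Henstock_Kurzweil_Integration.integral_restrict_Int[of "{0..1}" "{0..min a 1}" g] by (simp add: Int_absorb1)
        finally show ?thesis .
      qed
      also have "\<dots> = 0" using z[of "min a 1"] by (cases "0 \<le> a") auto
      finally show ?case unfolding B LINT_unit[OF i] .
    next
      case (compl B)
      have B: "B \<in> sets lebesgue" using compl(1) bs by (metis sets_completionI_sets sets_lborel)
      have "(LINT x|unit_measure. indicator (UNIV - B) x *\<^sub>R g x) = (LINT x|unit_measure. g x - indicator B x *\<^sub>R g x)"
        by (rule Bochner_Integration.integral_cong) (auto simp: indicator_def)
      also have "\<dots> = (LINT x|unit_measure. g x) - (LINT x|unit_measure. indicator B x *\<^sub>R g x)"
        by (rule Bochner_Integration.integral_diff[OF g gA[OF B]])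
      also have "\<dots> = 0" using compl z[of 1] LINT_unit[OF g] by simp
      finally show ?case .
    next
      case (union B)
      have B: "B i \<in> sets lebesgue" for i using union(2) bs by (metis rangeI sets_completionI_sets sets_lborel subsetD)
      have U: "(\<Union>i. B i) \<in> sets lebesgue" using B by auto
      have "(LINT x:(\<Union>i. B i \<inter> {0..1})|unit_measure. g x) = (\<Sum>i. (LINT x:(B i \<inter> {0..1})|unit_measure. g x))"
      proof (rule lebesgue_integral_countable_add)
        show "B i \<inter> {0..1} \<in> sets unit_measure" for i by (rule sets_unitI[OF B])
        show "B i \<inter> {0..1} \<inter> (B j \<inter> {0..1}) = {}" if "i \<noteq> j" for i j
          using union(1) that by (auto simp: disjoint_family_on_def)
        have "integrable unit_measure (\<lambda>x. indicator (\<Union>i. B i) x *\<^sub>R g x)" by (rule gA[OF U])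
        then show "set_integrable unit_measure (\<Union>i. B i \<inter> {0..1}) g"
          unfolding set_integrable_def
          by (rule Bochner_Integration.integrable_cong[OF refl, THEN iffD1, rotated]) (auto simp: indicator_def)
      qed
      moreover have "(LINT x:(C \<inter> {0..1})|unit_measure. g x) = (LINT x|unit_measure. indicator C x *\<^sub>R g x)" for C
        unfolding set_lebesgue_integral_def by (rule Bochner_Integration.integral_cong) (auto simp: indicator_def)
      moreover have "(\<Union>i. B i \<inter> {0..1}) = (\<Union>i. B i) \<inter> {0..1}" by auto
      ultimately show ?case using union(3) by simp
    qed simp
  qed
  have "A \<in> sets lebesgue" using A by (subst (asm) sets_restrict_space_iff) auto
  \<comment> \<open>Up to a null set, a Lebesgue set is Borel.\<close>
  from lebesgue_set_almost_fsigma[OF this]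
  obtain C T where CT: "fsigma C" "T \<in> null_sets lebesgue" "C \<union> T = A" by blast
  have "C \<in> sets borel" using CT(1) by cases auto
  have "AE x in lebesgue. x \<notin> T" using CT(2) by (rule AE_not_in)
  then have "AE x in unit_measure. x \<notin> T" by (subst AE_restrict_space_iff) auto
  then have "(LINT x:A|unit_measure. g x) = (LINT x|unit_measure. indicator C x *\<^sub>R g x)"
    unfolding set_lebesgue_integral_def
  proof (intro integral_cong_AE)
    show "(\<lambda>x. indicator A x *\<^sub>R g x) \<in> borel_measurable unit_measure" 
      using gA[OF \<open>A \<in> sets lebesgue\<close>] by (rule borel_measurable_integrable)
    show "(\<lambda>x. indicator C x *\<^sub>R g x) \<in> borel_measurable unit_measure"
      using gA[of C] \<open>C \<in> sets borel\<close> by (intro borel_measurable_integrable) auto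
    assume "AE x in unit_measure. x \<notin> T"
    then show "AE x in unit_measure. indicator A x *\<^sub>R g x = indicator C x *\<^sub>R g x"
      by eventually_elim (use CT(3) in \<open>auto simp: indicator_def\<close>)
  qed
  then show "(LINT x:A|unit_measure. g x) = 0" using borel[OF \<open>C \<in> sets borel\<close>] by simp
qed

text \<open>
For \<open>p = 1\<close> this is the standard smooth function \<open>exp (- 1 / x)\<close> that vanishes for \<open>x \<le> 0\<close>. Polynomials in \<open>1 / x\<close> as factors
make the family closed under differentiation.
\<close>
definition flat :: "real poly \<Rightarrow> real \<Rightarrow> real" where
  "flat p x = (if 0 < x then poly p (1 / x) * exp (- (1 / x)) else 0)"

definition flat_step :: "real poly \<Rightarrow> real poly" where
  "flat_step p = [:0, 0, 1:] * (p - pderiv p)"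

lemma poly_div_exp_tendsto_0: "((\<lambda>y. poly p y * exp (- y)) \<longlongrightarrow> (0::real)) at_top"
proof -
  have "((\<lambda>y. \<Sum>i\<le>degree p. coeff p i * (y ^ i / exp y)) \<longlongrightarrow> (\<Sum>i\<le>degree p. coeff p i * 0)) at_top"
    by (intro tendsto_sum tendsto_mult tendsto_const tendsto_power_div_exp_0)
  then show ?thesis by (simp add: poly_altdef sum_distrib_right exp_minus divide_inverse mult.assoc)
qed

lemma flat_DERIV: "(flat p has_real_derivative flat (flat_step p) x) (at x)"
proof (cases "x = 0")
  case False
  show ?thesis
  proof (cases "0 < x")
    case True
    have "((\<lambda>x. poly p (1 / x) * exp (- (1 / x))) has_real_derivative flat (flat_step p) x) (at x)"
      using True
      by (auto intro!: derivative_eq_intros poly_DERIV[THEN DERIV_chain2] 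
           simp: flat_def flat_step_def field_simps power2_eq_square)
    then show ?thesis
      by (rule has_field_derivative_transform_within_open[of _ _ _ "{0<..}"]) (use True in \<open>auto simp: flat_def\<close>)
  next
    case F: False
    have "((\<lambda>x. 0) has_real_derivative flat (flat_step p) x) (at x)" using F by (simp add: flat_def)
    then show ?thesis
      by (rule has_field_derivative_transform_within_open[of _ _ _ "{..<0}"]) (use False F in \<open>auto simp: flat_def\<close>)
  qed
next
  case True
  have "((\<lambda>h. flat p h / h) \<longlongrightarrow> 0) (at 0)"
  proof (rule filterlim_split_at)
    show "((\<lambda>h. flat p h / h) \<longlongrightarrow> 0) (at_left 0)"
      by (rule tendsto_eventually) (auto simp: eventually_at_left_field flat_def intro!: exI[of _ "-1"])
    have "((\<lambda>h. poly ([:0, 1:] * p) (inverse h) * exp (- inverse h)) \<longlongrightarrow> 0) (at_right 0)"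
      by (rule filterlim_compose[OF poly_div_exp_tendsto_0 filterlim_inverse_at_top_right])
    then show "((\<lambda>h. flat p h / h) \<longlongrightarrow> 0) (at_right 0)"
      by (rule Lim_transform_eventually)
        (auto simp: eventually_at_right_field flat_def field_simps intro!: exI[of _ 1])
  qed
  then show ?thesis using True by (simp add: has_field_derivative_iff flat_def)
qed

definition smooth :: "(real \<Rightarrow> real) \<Rightarrow> bool" where
  "smooth f \<longleftrightarrow> (\<forall>n x. ((deriv ^^ n) f) differentiable (at x))"

text \<open>
Smoothness without computing higher derivatives: it suffices to exhibit a family of functions that is closed under differentiation.
\<close>
lemma smooth_if_family_closed:
  assumes "f \<in> F" and F: "\<And>f. f \<in> F \<Longrightarrow> \<exists>f'\<in>F. \<forall>x. (f has_real_derivative f' x) (at x)"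
  shows "smooth f"
proof -
  have d: "deriv f \<in> F" if f: "f \<in> F" for f
  proof -
    from F[OF f] obtain f' where f': "f' \<in> F" "\<And>x. (f has_real_derivative f' x) (at x)" by blast
    then have "deriv f = f'" by (auto intro: DERIV_imp_deriv)
    with f' show ?thesis by simp
  qed
  have "(deriv ^^ n) f \<in> F" for n by (induction n) (auto simp: assms(1) d)
  then show ?thesis unfolding smooth_def using F by (meson real_differentiable_def)
qed

lemma smooth_if_deriv_smooth:
  assumes "\<And>x. (f has_real_derivative f' x) (at x)" "smooth f'"
  shows "smooth f"
proof -
  have f': "deriv f = f'" using assms(1) by (auto intro: DERIV_imp_deriv)
  have "((deriv ^^ n) f) differentiable (at x)" for n x
  proof (cases n)
    case 0 then show ?thesis using assms(1)[of x] by (auto simp: real_differentiable_def)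
  next
    case (Suc m)
    then have "(deriv ^^ n) f = (deriv ^^ m) f'" by (simp add: funpow_Suc_right f' del: funpow.simps)
    then show ?thesis using assms(2) by (simp add: smooth_def)
  qed
  then show ?thesis by (simp add: smooth_def)
qed

text \<open>
A family that contains the bump functions on \<open>(a, c)\<close> with steepness \<open>s\<close> and is closed under differentiation.
An entry \<open>(k, p, q)\<close> of the list is one product with coefficient \<open>k\<close>.
\<close>
definition flat_sum :: "real \<Rightarrow> real \<Rightarrow> real \<Rightarrow> (real \<times> real poly \<times> real poly) list \<Rightarrow> real \<Rightarrow> real" where
  "flat_sum s a c L x = (\<Sum>(k, p, q)\<leftarrow>L. k * (flat p ((x - a) * s) * flat q ((c - x) * s)))"

lemma flat_sum_smooth: "smooth (flat_sum s a c L)"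
proof (rule smooth_if_family_closed[of _ "range (flat_sum s a c)"])
  fix f assume "f \<in> range (flat_sum s a c)"
  then obtain L where f: "f = flat_sum s a c L" by blast
  have fl: "((\<lambda>x. flat p ((x - a) * s)) has_real_derivative flat (flat_step p) ((x - a) * s) * s) (at x)"
     "((\<lambda>x. flat p ((c - x) * s)) has_real_derivative flat (flat_step p) ((c - x) * s) * - s) (at x)" for p x
  proof -
    show "((\<lambda>x. flat p ((x - a) * s)) has_real_derivative flat (flat_step p) ((x - a) * s) * s) (at x)"
      by (rule DERIV_chain2[OF flat_DERIV]) (auto intro!: derivative_eq_intros)
    have "((\<lambda>x. (c - x) * s) has_real_derivative - s) (at x)" by (auto intro!: derivative_eq_intros)
    then show "((\<lambda>x. flat p ((c - x) * s)) has_real_derivative flat (flat_step p) ((c - x) * s) * - s) (at x)"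
      by (rule DERIV_chain2[OF flat_DERIV])
  qed
  have "\<exists>L'. \<forall>x. (flat_sum s a c L has_real_derivative flat_sum s a c L' x) (at x)"
  proof (induction L)
    case Nil
    have "(flat_sum s a c [] has_real_derivative flat_sum s a c [] x) (at x)" for x
      by (simp add: flat_sum_def[abs_def])
    then show ?case by blast
  next
    case (Cons t L)
    obtain k p q where t: "t = (k, p, q)" by (cases t)
    from Cons obtain L' where L': "\<And>x. (flat_sum s a c L has_real_derivative flat_sum s a c L' x) (at x)" by blast
    have "(flat_sum s a c (t # L) has_real_derivative
        flat_sum s a c ((k * s, flat_step p, q) # (- k * s, p, flat_step q) # L') x) (at x)" for x
    proof -
      have eq: "flat_sum s a c (t # L) = (\<lambda>x. k * (flat p ((x - a) * s) * flat q ((c - x) * s)) + flat_sum s a c L x)"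
        by (rule ext) (simp add: flat_sum_def t)
      show ?thesis unfolding eq
        by (rule DERIV_cong[OF DERIV_add[OF DERIV_cmult[OF DERIV_mult[OF fl]] L']])
          (simp add: flat_sum_def algebra_simps)
    qed
    then show ?case by blast
  qed
  then show "\<exists>f'\<in>range (flat_sum s a c). \<forall>x. (f has_real_derivative f' x) (at x)" using f by blast
qed simp

lemma smooth_differentiable: "smooth f \<Longrightarrow> (f has_real_derivative deriv f x) (at x)" 
  and smooth_deriv: "smooth f \<Longrightarrow> smooth (deriv f)"
proof -
  assume f: "smooth f"
  have "((deriv ^^ 0) f) differentiable (at x)" using f unfolding smooth_def by blast
  then show "(f has_real_derivative deriv f x) (at x)" by (auto simp: real_differentiable_def DERIV_imp_deriv)
  show "smooth (deriv f)" unfolding smooth_def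
  proof (intro allI)
    fix n x show "(deriv ^^ n) (deriv f) differentiable at x"
      using f[unfolded smooth_def, rule_format, of "Suc n" x] by (simp add: funpow_Suc_right del: funpow.simps)
  qed
qed

lemma smooth_continuous: "smooth f \<Longrightarrow> continuous_on S f"
  using smooth_differentiable by (meson DERIV_isCont continuous_at_imp_continuous_on)

lemma smooth_diff_cmult:
  assumes "smooth f" "smooth g" shows "smooth (\<lambda>x. f x - k * g x)"
proof (rule smooth_if_family_closed[of _ "{\<lambda>x. f x - k * g x |f g. smooth f \<and> smooth g}"])
  fix h assume "h \<in> {\<lambda>x. f x - k * g x |f g. smooth f \<and> smooth g}"
  then obtain f g where h: "h = (\<lambda>x. f x - k * g x)" "smooth f" "smooth g" by blast
  have "(h has_real_derivative deriv f x - k * deriv g x) (at x)" for x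
    unfolding h(1) by (intro DERIV_diff DERIV_cmult smooth_differentiable h)
  moreover have "(\<lambda>x. deriv f x - k * deriv g x) \<in> {\<lambda>x. f x - k * g x |f g. smooth f \<and> smooth g}"
    using h(2,3) smooth_deriv by blast
  ultimately show "\<exists>f'\<in>{\<lambda>x. f x - k * g x |f g. smooth f \<and> smooth g}. \<forall>x. (h has_real_derivative f' x) (at x)"
    by (rule_tac x = "\<lambda>x. deriv f x - k * deriv g x" in bexI) auto
qed (use assms in blast)

text \<open>
As \<open>s\<close> grows this tends to the indicator function of \<open>(a, c)\<close>.
\<close>
definition bump :: "real \<Rightarrow> real \<Rightarrow> real \<Rightarrow> real \<Rightarrow> real" where
  "bump s a c x = flat 1 ((x - a) * s) * flat 1 ((c - x) * s)"

lemma bump_smooth: "smooth (bump s a c)"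
proof -
  have "bump s a c = flat_sum s a c [(1, 1, 1)]" by (rule ext) (simp add: bump_def flat_sum_def)
  then show ?thesis using flat_sum_smooth by simp
qed

lemma flat_1: "0 \<le> flat 1 x" "flat 1 x \<le> 1" "x \<le> 0 \<Longrightarrow> flat 1 x = 0" "0 < x \<Longrightarrow> 0 < flat 1 x"
  by (auto simp: flat_def)

lemma bump_bounds: "0 \<le> bump s a c x" "bump s a c x \<le> 1"
  using flat_1(1,2) by (auto simp: bump_def intro: mult_le_one)

lemma bump_outside: "0 < s \<Longrightarrow> x \<notin> {a<..<c} \<Longrightarrow> bump s a c x = 0"
  by (auto simp: bump_def not_less intro!: flat_1(3) mult_nonpos_nonneg)

lemma flat_1_tendsto_1:
  assumes "filterlim z at_top F" shows "((\<lambda>n. flat 1 (z n)) \<longlongrightarrow> 1) F"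
proof -
  have "((\<lambda>n. exp (- inverse (z n))) \<longlongrightarrow> exp (- 0)) F"
    by (intro tendsto_intros tendsto_inverse_0_at_top assms)
  moreover have "\<forall>\<^sub>F n in F. exp (- inverse (z n)) = flat 1 (z n)"
    using filterlim_at_top_dense[THEN iffD1, OF assms, rule_format, of 0]
    by eventually_elim (simp add: flat_def inverse_eq_divide)
  ultimately show ?thesis by (auto intro: Lim_transform_eventually)
qed

text \<open>
The primitive vanishes to the left of the support, and to the right of it because the integral is zero.
\<close>
lemma test_function_primitive:
  assumes z: "smooth z" "\<And>x. x \<notin> {a..c} \<Longrightarrow> z x = 0" "0 < a" "c < 1" and int: "integral {0..1} z = 0"
  obtains \<phi> where "test_function \<phi>" "deriv \<phi> = z"
proof -
  define \<phi> where "\<phi> x = integral {0..x} z" for x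
  have phi0: "\<phi> x = 0" if "x < a" for x
  proof -
    have "integral {0..x} z = integral {0..x} (\<lambda>x. 0)" by (rule integral_cong) (use z(2) that in auto)
    then show ?thesis by (simp add: \<phi>_def)
  qed
  have der: "(\<phi> has_real_derivative z x) (at x)" for x
  proof (cases "x < a")
    case True
    have "((\<lambda>x. 0) has_real_derivative z x) (at x)" using True z(2)[of x] by simp
    then show ?thesis
      by (rule has_field_derivative_transform_within_open[of _ _ _ "{..<a}"]) (use True phi0 in auto)
  next
    case False
    have "(\<phi> has_real_derivative z x) (at x within {0..x + 1})"
      unfolding \<phi>_def by (rule integral_has_real_derivative) (use False z in \<open>auto intro: smooth_continuous\<close>)
    moreover have "at x within {0..x + 1} = at x" using False z(3) by (intro at_within_interior) auto
    ultimately show ?thesis by simp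
  qed
  have "\<phi> x = 0" if "c < x" for x
  proof -
    have "\<phi> x = \<phi> 1"
    proof (rule DERIV_isconst3[where f = \<phi> and a = c and b = "max x 1 + 1"])
      fix y assume "y \<in> {c<..<max x 1 + 1}"
      then show "(\<phi> has_real_derivative 0) (at y)" using der[of y] z(2)[of y] by simp
    qed (use that z(4) in auto)
    then show ?thesis using int by (simp add: \<phi>_def)
  qed
  then have out: "\<phi> x = 0" if "x \<notin> {a..c}" for x using that phi0 by (auto simp: not_le)
  have "smooth \<phi>" by (rule smooth_if_deriv_smooth[OF der z(1)])
  then have "test_function \<phi>" unfolding test_function_def smooth_def using out z(3,4) by blast
  moreover have "deriv \<phi> = z" using der by (auto intro: DERIV_imp_deriv)
  ultimately show thesis using that by blast
qed

text \<open>
Subtracting from a bump a multiple of one fixed bump makes its integral zero, so that it is the derivative of a test function. Hence the integral of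
\<open>f - K\<close> against every bump vanishes, where \<open>K\<close> is chosen to make this true for the fixed bump. Letting bumps approximate indicators of
\<open>(0, x)\<close> shows that the primitive of \<open>f - K\<close> vanishes.
\<close>
lemma du_Bois_Reymond:
  assumes f: "integrable unit_measure (f :: real \<Rightarrow> complex)"
    and z: "\<And>\<phi>. test_function \<phi> \<Longrightarrow> (LINT x|unit_measure. f x * complex_of_real (deriv \<phi> x)) = 0"
  obtains K where "AE x in unit_measure. f x = K"
proof -
  have bc: "continuous_on S (bump s a c)" for S s a c by (rule smooth_continuous[OF bump_smooth])
  define I where "I s a c = integral {0..1} (bump s a c)" for s a c
  define I0 where "I0 = I 1 (1/4) (3/4)"
  have "I0 \<noteq> 0"
  proof
    assume "I0 = 0"
    then have "\<forall>x\<in>cbox 0 1. bump 1 (1/4) (3/4) x = (0 :: real)"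
      unfolding I0_def I_def using bc bump_bounds(1)
      by (intro integral_cbox_eq_0_iff[THEN iffD1]) auto
    then have "bump 1 (1/4) (3/4) (1/2) = 0" by auto
    then show False using flat_1(4)[of "1/4"] by (simp add: bump_def)
  qed
  have fb: "integrable unit_measure (\<lambda>x. g x * complex_of_real (bump s a c x))"
    if "integrable unit_measure g" for g s a c
  proof (rule Bochner_Integration.integrable_bound[OF that])
    show "(\<lambda>x. g x * complex_of_real (bump s a c x)) \<in> borel_measurable unit_measure"
    proof -
      note [measurable] = borel_measurable_integrable[OF that] continuous_measurable_unit[OF bc]
      show ?thesis by measurable
    qed
    show "AE x in unit_measure. norm (g x * complex_of_real (bump s a c x)) \<le> norm (g x)"
      using bump_bounds by (intro AE_I2) (simp add: norm_mult mult_left_le)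
  qed
  \<comment> \<open>The bump on \<open>(1/4, 3/4)\<close> is the fixed reference.\<close>
  define K where "K = (LINT x|unit_measure. f x * complex_of_real (bump 1 (1/4) (3/4) x)) / complex_of_real I0"
  have Ib: "(LINT x|unit_measure. complex_of_real (bump s a c x)) = complex_of_real (I s a c)" for s a c
    using LINT_unit[OF continuous_integrable_unit[OF bc[of _ s a c]]] by (simp add: I_def)
  have key: "(LINT x|unit_measure. (f x - K) * complex_of_real (bump s a c x)) = 0"
    if sac: "0 < s" "0 < a" "c < 1" for s a c
  proof -
    define k where "k = I s a c / I0"
    define \<zeta> where "\<zeta> x = bump s a c x - k * bump 1 (1/4) (3/4) x" for x
    have b1: "bump s a c integrable_on {0..1}" "bump 1 (1/4) (3/4) integrable_on {0..1}"
      by (rule integrable_continuous_real[OF bc])+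
    have iz: "integral {0..1} \<zeta> = 0"
    proof -
      have "integral {0..1} \<zeta> = integral {0..1} (bump s a c) - integral {0..1} (\<lambda>x. k * bump 1 (1/4) (3/4) x)"
        unfolding \<zeta>_def
        by (rule Henstock_Kurzweil_Integration.integral_diff) (intro integrable_continuous_real continuous_intros bc)+
      also have "\<dots> = I s a c - k * I0" by (simp add: I_def I0_def)
      finally show ?thesis using \<open>I0 \<noteq> 0\<close> by (simp add: k_def)
    qed
    obtain \<phi> where \<phi>: "test_function \<phi>" "deriv \<phi> = \<zeta>"
    proof (rule test_function_primitive[of \<zeta> "min a (1/4)" "max c (3/4)"])
      show "smooth \<zeta>" unfolding \<zeta>_def by (intro smooth_diff_cmult bump_smooth)
      show "\<zeta> x = 0" if "x \<notin> {min a (1/4)..max c (3/4)}" for x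
      proof -
        have "x \<notin> {a<..<c}" "x \<notin> {1/4<..<3/4}" using that by (auto simp: min_def max_def split: if_splits)
        then show ?thesis using bump_outside[of s x a c] bump_outside[of 1 x "1/4" "3/4"] sac by (simp add: \<zeta>_def)
      qed
    qed (use sac iz in auto)
    have "0 = (LINT x|unit_measure. f x * complex_of_real (bump s a c x) - complex_of_real k * (f x * complex_of_real (bump 1 (1/4) (3/4) x)))"
      using z[OF \<phi>(1)] by (simp add: \<phi>(2) \<zeta>_def algebra_simps)
    also have "\<dots> = (LINT x|unit_measure. f x * complex_of_real (bump s a c x)) - complex_of_real k * (K * complex_of_real I0)"
      using fb[OF f] \<open>I0 \<noteq> 0\<close> by (simp add: K_def)
    finally have "(LINT x|unit_measure. f x * complex_of_real (bump s a c x)) = K * complex_of_real (I s a c)"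
      using \<open>I0 \<noteq> 0\<close> by (simp add: k_def)
    moreover have "(LINT x|unit_measure. (f x - K) * complex_of_real (bump s a c x)) =
        (LINT x|unit_measure. f x * complex_of_real (bump s a c x)) - K * (LINT x|unit_measure. complex_of_real (bump s a c x))"
      using fb[OF f] continuous_integrable_unit[OF bc] by (simp add: left_diff_distrib)
    ultimately show ?thesis unfolding Ib by simp
  qed
  have fK: "integrable unit_measure (\<lambda>x. f x - K)" using f by simp
  have idm: "(\<lambda>x :: real. x) \<in> borel_measurable unit_measure"
    by (rule continuous_measurable_unit) (rule continuous_on_id)
  have zero: "integral {0..x} (\<lambda>x. f x - K) = 0" if x: "x \<in> {0..1}" for x
  proof (cases "x = 0")
    case False
    then have x: "0 < x" "x \<le> 1" using x by auto
    define e where "e n = x / (real n + 3)" for n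
    have e0: "0 < e n" for n using x by (simp add: e_def)
    have elim: "e \<longlonglongrightarrow> 0" unfolding e_def
      by (rule real_tendsto_divide_at_top[OF tendsto_const])
        (intro filterlim_at_top_add_at_top filterlim_real_sequentially tendsto_const filterlim_tendsto_add_at_top[OF tendsto_const, of _ _ 3, unfolded add.commute[of 3]])
    \<comment> \<open>Bumps supported inside \<open>(0, x)\<close> that converge pointwise to its indicator function.\<close>
    define \<eta> where "\<eta> n = bump (real n + 1) (e n) (x - e n)" for n
    have lim: "(\<lambda>n. \<eta> n y) \<longlonglongrightarrow> (if y \<in> {0<..<x} then 1 else 0)" for y
    proof (cases "y \<in> {0<..<x}")
      case True
      have s: "filterlim (\<lambda>n. real n + 1) at_top sequentially"
        by (rule filterlim_at_top_mono[OF filterlim_real_sequentially]) auto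
      have "(\<lambda>n. y - e n) \<longlonglongrightarrow> y - 0" "(\<lambda>n. x - e n - y) \<longlonglongrightarrow> x - 0 - y" by (intro tendsto_intros elim)+
      then have "filterlim (\<lambda>n. (y - e n) * (real n + 1)) at_top sequentially" "filterlim (\<lambda>n. (x - e n - y) * (real n + 1)) at_top sequentially"
        using True by (auto intro: filterlim_tendsto_pos_mult_at_top[OF _ _ s])
      from tendsto_mult[OF this[THEN flat_1_tendsto_1]] show ?thesis using True by (simp add: \<eta>_def bump_def)
    next
      case False
      have "\<eta> n y = 0" for n unfolding \<eta>_def by (rule bump_outside) (use False e0[of n] in auto)
      then show ?thesis using False by auto
    qed
    have "(\<lambda>n. LINT y|unit_measure. (f y - K) * complex_of_real (\<eta> n y)) \<longlonglongrightarrow>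
        (LINT y|unit_measure. (f y - K) * complex_of_real (if y \<in> {0<..<x} then 1 else 0))"
    proof (rule integral_dominated_convergence[where w = "\<lambda>y. norm (f y - K)"])
      show "(\<lambda>y. (f y - K) * complex_of_real (\<eta> n y)) \<in> borel_measurable unit_measure" for n
        unfolding \<eta>_def by (rule borel_measurable_integrable[OF fb[OF fK]])
      show "(\<lambda>y. (f y - K) * complex_of_real (if y \<in> {0<..<x} then 1 else 0)) \<in> borel_measurable unit_measure"
      proof -
        note [measurable] = borel_measurable_integrable[OF fK] idm
        show ?thesis by measurable
      qed
      show "AE y in unit_measure. (\<lambda>n. (f y - K) * complex_of_real (\<eta> n y)) \<longlonglongrightarrow> (f y - K) * complex_of_real (if y \<in> {0<..<x} then 1 else 0)"
        by (intro AE_I2 tendsto_intros lim)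
      show "AE y in unit_measure. norm ((f y - K) * complex_of_real (\<eta> n y)) \<le> norm (f y - K)" for n
        using bump_bounds by (intro AE_I2) (simp add: norm_mult mult_left_le \<eta>_def)
    qed (use fK in simp)
    moreover have "(LINT y|unit_measure. (f y - K) * complex_of_real (\<eta> n y)) = 0" for n
      unfolding \<eta>_def by (rule key) (use e0[of n] x in auto)
    ultimately have L: "(LINT y|unit_measure. (f y - K) * complex_of_real (if y \<in> {0<..<x} then 1 else 0)) = 0"
      by (simp add: LIMSEQ_const_iff)
    have ii: "integrable unit_measure (\<lambda>y. (f y - K) * complex_of_real (if y \<in> {0<..<x} then 1 else 0))"
    proof (rule Bochner_Integration.integrable_bound[OF fK])
      note [measurable] = borel_measurable_integrable[OF fK] idm
      show "(\<lambda>y. (f y - K) * complex_of_real (if y \<in> {0<..<x} then 1 else 0)) \<in> borel_measurable unit_measure"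
        by measurable
    qed (auto intro!: AE_I2)
    have "integral {0..1} (\<lambda>y. (f y - K) * complex_of_real (if y \<in> {0<..<x} then 1 else 0)) = 0"
      using L LINT_unit[OF ii] by simp
    also have "integral {0..1} (\<lambda>y. (f y - K) * complex_of_real (if y \<in> {0<..<x} then 1 else 0))
        = integral {0..1} (\<lambda>y. if y \<in> {0..x} then f y - K else 0)"
      by (rule integral_spike[of "{0, x}"]) auto
    also have "\<dots> = integral {0..x} (\<lambda>y. f y - K)"       using Henstock_Kurzweil_Integration.integral_restrict_Int[of "{0..1}" "{0..x}" "\<lambda>y. f y - K"] x by (simp add: Int_absorb1)
    finally show ?thesis .
  qed simp
  have "AE x in unit_measure. f x - K = 0" by (rule AE_zero_if_primitive_zero[OF fK zero])
  then show thesis by (intro that[of K]) simp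
qed

lemma bounded_bilinear_complex_of_real: "bounded_bilinear (\<lambda>(z :: complex) (r :: real). z * complex_of_real r)"
  using bounded_bilinear.flip[OF bounded_bilinear_scaleR[where 'a = complex]]
  by (simp add: scaleR_conv_of_real mult.commute)

lemma test_functionD:
  assumes "test_function \<phi>"
  shows "smooth \<phi>" "\<phi> 0 = 0" "\<phi> 1 = 0"
  using assms unfolding test_function_def smooth_def by force+

lemma smooth_ac_deriv: "smooth \<phi> \<Longrightarrow> ac_deriv \<phi> (deriv \<phi>)"
  by (rule ac_deriv_C1)
    (auto intro: smooth_continuous smooth_deriv smooth_differentiable simp flip: has_real_derivative_iff_has_vector_derivative)

lemma ac_deriv_weak_deriv:
  assumes u: "ac_deriv u u'" shows "is_weak_deriv u u'"
  unfolding is_weak_deriv_def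
proof (intro allI impI)
  fix \<phi> assume t: "test_function \<phi>"
  note \<phi> = test_functionD[OF t]
  note ac = smooth_ac_deriv[OF \<phi>(1)]
  have bl: "bilinear (\<lambda>(z :: complex) (r :: real). z * complex_of_real r)" "bilinear (\<lambda>(r :: real) (z :: complex). z * complex_of_real r)"
    using bounded_bilinear_complex_of_real bounded_bilinear.flip[OF bounded_bilinear_complex_of_real]
    by (simp_all add: bilinear_conv_bounded_bilinear)
  have c1: "continuous_on {0..1} (\<lambda>x. u x * complex_of_real (deriv \<phi> x))"
    by (intro continuous_intros ac_deriv_continuous[OF u] smooth_continuous[OF smooth_deriv[OF \<phi>(1)]])
  have i1: "integrable unit_measure (\<lambda>x. u x * complex_of_real (deriv \<phi> x))" by (rule continuous_integrable_unit[OF c1])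
  have i2: "integrable unit_measure (\<lambda>x. u' x * complex_of_real (\<phi> x))"
    unfolding integrable_unit_iff
    by (rule absolutely_integrable_bounded_measurable_product[OF bl(2) continuous_measurable_unit _ _ ac_derivD(1)[OF u]])
      (auto intro!: smooth_continuous \<phi> compact_imp_bounded compact_continuous_image)
  have "integral {0..1} (\<lambda>x. u x * complex_of_real (deriv \<phi> x) + u' x * complex_of_real (\<phi> x)) = 0"
    using ac_deriv_integral[OF ac_deriv_bilinear[OF bounded_bilinear_complex_of_real u ac]] \<phi> by simp
  then have "(LINT x|unit_measure. u x * complex_of_real (deriv \<phi> x) + u' x * complex_of_real (\<phi> x)) = 0"
    using LINT_unit[OF Bochner_Integration.integrable_add[OF i1 i2]] by simp
  then show "(LINT x|unit_measure. u x * complex_of_real (deriv \<phi> x)) = - (LINT x|unit_measure. u' x * complex_of_real (\<phi> x))"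
    using i1 i2 by (simp add: eq_neg_iff_add_eq_0)
qed

text \<open>
The primitive of the weak derivative differs from \<open>f\<close> by a function with vanishing weak derivative, that is, by a constant.
\<close>
lemma weak_deriv_representative:
  assumes f: "f \<in> L2 unit_measure" and g: "g \<in> L2 unit_measure" and wd: "is_weak_deriv f g"
  obtains u where "ac_deriv u g" "AE x in unit_measure. f x = u x"
proof -
  have gi: "g absolutely_integrable_on {0..1}" using L2_integrable[OF g] by (simp add: integrable_unit_iff)
  define v where "v x = integral {0..x} g" for x
  have v: "ac_deriv v g" using ac_deriv_primitive[OF gi, of 0] by (simp add: v_def[abs_def])
  have vi: "integrable unit_measure v" by (rule continuous_integrable_unit[OF ac_deriv_continuous[OF v]])
  have fv: "integrable unit_measure (\<lambda>x. f x - v x)" using L2_integrable[OF f] vi by simp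
  obtain K where K: "AE x in unit_measure. f x - v x = K"
  proof (rule du_Bois_Reymond[OF fv])
    fix \<phi> assume t: "test_function \<phi>"
    have d: "continuous_on {0..1} (deriv \<phi>)" using smooth_continuous[OF smooth_deriv[OF test_functionD(1)[OF t]]] .
    have i: "integrable unit_measure (\<lambda>x. h x * complex_of_real (deriv \<phi> x))" if "integrable unit_measure h" for h
      unfolding integrable_unit_iff
      by (rule absolutely_integrable_bounded_measurable_product[where h = "\<lambda>(r :: real) (z :: complex). z * complex_of_real r"])
        (use that bounded_bilinear.flip[OF bounded_bilinear_complex_of_real] in
          \<open>auto intro!: continuous_measurable_unit d compact_imp_bounded compact_continuous_image simp: integrable_unit_iff bilinear_conv_bounded_bilinear\<close>)
    have "(LINT x|unit_measure. (f x - v x) * complex_of_real (deriv \<phi> x))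
        = (LINT x|unit_measure. f x * complex_of_real (deriv \<phi> x)) - (LINT x|unit_measure. v x * complex_of_real (deriv \<phi> x))"
      using i[OF L2_integrable[OF f]] i[OF vi] by (simp add: left_diff_distrib)
    also have "\<dots> = 0" using wd ac_deriv_weak_deriv[OF v] t by (simp add: is_weak_deriv_def)
    finally show "(LINT x|unit_measure. (f x - v x) * complex_of_real (deriv \<phi> x)) = 0" .
  qed
  show thesis
  proof (rule that)
    show "ac_deriv (\<lambda>x. v x + K) g" using ac_deriv_add[OF v ac_deriv_const[of K]] by simp
    show "AE x in unit_measure. f x = v x + K" using K by eventually_elim (simp add: algebra_simps)
  qed
qed

lemma continuous_AE_eq:
  fixes f g :: "real \<Rightarrow> complex"
  assumes f: "continuous_on {0..1} f" and g: "continuous_on {0..1} g"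
    and ae: "AE x in unit_measure. f x = g x" and x: "x \<in> {0..1}"
  shows "f x = g x"
proof -
  have c: "continuous_on {0..1} (\<lambda>x. (cmod (f x - g x))\<^sup>2)" by (intro continuous_intros f g)
  have "integral {0..1} (\<lambda>x. (cmod (f x - g x))\<^sup>2) = (LINT x|unit_measure. (cmod (f x - g x))\<^sup>2)"
    by (rule LINT_unit[symmetric, OF continuous_integrable_unit[OF c]])
  also have "\<dots> = 0" by (rule integral_eq_zero_AE) (use ae in \<open>eventually_elim, simp\<close>)
  finally have "\<forall>x\<in>cbox 0 1. (cmod (f x - g x))\<^sup>2 = 0"
    using c by (intro integral_cbox_eq_0_iff[THEN iffD1]) auto
  then show ?thesis using x by auto
qed

lemma ac_deriv_AE_unique:
  assumes u: "ac_deriv u g" and v: "ac_deriv v h" and ae: "AE x in unit_measure. u x = (v x :: complex)"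
  shows "AE x in unit_measure. g x = h x"
proof -
  have uv: "u x = v x" if "x \<in> {0..1}" for x
    by (rule continuous_AE_eq[OF ac_deriv_continuous[OF u] ac_deriv_continuous[OF v] ae that])
  have d: "ac_deriv (\<lambda>x. u x - v x) (\<lambda>x. g x - h x)" by (rule ac_deriv_diff[OF u v])
  have "AE x in unit_measure. g x - h x = 0"
  proof (rule AE_zero_if_primitive_zero)
    show "integrable unit_measure (\<lambda>x. g x - h x)" using ac_derivD(1)[OF d] by (simp add: integrable_unit_iff)
    show "integral {0..x} (\<lambda>x. g x - h x) = 0" if "x \<in> {0..1}" for x
      using ac_deriv_increment[OF d, of 0 x] uv[OF that] uv[of 0] that by simp
  qed
  then show ?thesis by simp
qed

text \<open>
This removes test functions from the description of the domain: what remains is a periodic absolutely continuous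
representative with square integrable derivative.
\<close>
lemma H1_periodic_iff:
  "f \<in> H1 \<and> periodic_trace f \<longleftrightarrow>
    f \<in> L2 unit_measure \<and> (\<exists>u u'. ac_deriv u u' \<and> u' \<in> L2 unit_measure \<and> u 0 = u 1 \<and> (AE x in unit_measure. f x = u x))"
proof
  assume "f \<in> H1 \<and> periodic_trace f"
  then obtain g F where f: "f \<in> L2 unit_measure" "g \<in> L2 unit_measure" "is_weak_deriv f g"
    and F: "continuous_on {0..1} F" "AE x in unit_measure. F x = f x" "F 0 = F 1"
    by (auto simp: H1_def periodic_trace_def)
  obtain u where u: "ac_deriv u g" "AE x in unit_measure. f x = u x" by (rule weak_deriv_representative[OF f])
  have "AE x in unit_measure. F x = u x" using F(2) u(2) by eventually_elim simp
  from continuous_AE_eq[OF F(1) ac_deriv_continuous[OF u(1)] this, of 0] continuous_AE_eq[OF F(1) ac_deriv_continuous[OF u(1)] this, of 1] F(3)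
  have "u 0 = u 1" by simp
  then show "f \<in> L2 unit_measure \<and> (\<exists>u u'. ac_deriv u u' \<and> u' \<in> L2 unit_measure \<and> u 0 = u 1 \<and> (AE x in unit_measure. f x = u x))"
    using f u by blast
next
  assume "f \<in> L2 unit_measure \<and> (\<exists>u u'. ac_deriv u u' \<and> u' \<in> L2 unit_measure \<and> u 0 = u 1 \<and> (AE x in unit_measure. f x = u x))"
  then obtain u u' where f: "f \<in> L2 unit_measure" and u: "ac_deriv u u'" "u' \<in> L2 unit_measure" "u 0 = u 1" "AE x in unit_measure. f x = u x" by blast
  have "is_weak_deriv f u'" unfolding is_weak_deriv_def
  proof (intro allI impI)
    fix \<phi> assume t: "test_function \<phi>"
    note [measurable] = L2D(1)[OF f] continuous_measurable_unit[OF ac_deriv_continuous[OF u(1)]]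
      continuous_measurable_unit[OF smooth_continuous[OF smooth_deriv[OF test_functionD(1)[OF t]]]]
    have "(LINT x|unit_measure. f x * complex_of_real (deriv \<phi> x)) = (LINT x|unit_measure. u x * complex_of_real (deriv \<phi> x))"
    proof (rule integral_cong_AE)
      show "AE x in unit_measure. f x * complex_of_real (deriv \<phi> x) = u x * complex_of_real (deriv \<phi> x)"
        using u(4) by eventually_elim simp
    qed measurable
    then show "(LINT x|unit_measure. f x * complex_of_real (deriv \<phi> x)) = - (LINT x|unit_measure. u' x * complex_of_real (\<phi> x))"
      using ac_deriv_weak_deriv[OF u(1)] t by (simp add: is_weak_deriv_def)
  qed
  then have "f \<in> H1" using f u by (auto simp: H1_def)
  moreover have "periodic_trace f" unfolding periodic_trace_def
    using ac_deriv_continuous[OF u(1)] u(3,4) by (intro exI[of _ u]) (auto elim: AE_mp)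
  ultimately show "f \<in> H1 \<and> periodic_trace f" by simp
qed

lemma weak_deriv_eq:
  assumes "f \<in> H1" and u: "ac_deriv u u'" "AE x in unit_measure. f x = u x"
  shows "weak_deriv f \<in> L2 unit_measure" "AE x in unit_measure. weak_deriv f x = u' x"
proof -
  from assms(1) have f: "f \<in> L2 unit_measure" and ex: "\<exists>g. g \<in> L2 unit_measure \<and> is_weak_deriv f g" by (auto simp: H1_def)
  from someI_ex[OF ex] have w: "weak_deriv f \<in> L2 unit_measure" "is_weak_deriv f (weak_deriv f)"
    unfolding weak_deriv_def by blast+
  show "weak_deriv f \<in> L2 unit_measure" by (rule w(1))
  obtain v where v: "ac_deriv v (weak_deriv f)" "AE x in unit_measure. f x = v x"
    by (rule weak_deriv_representative[OF f w])
  have "AE x in unit_measure. v x = u x" using v(2) u(2) by eventually_elim simp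
  from ac_deriv_AE_unique[OF v(1) u(1) this] show "AE x in unit_measure. weak_deriv f x = u' x" .
qed

section \<open>The steady state\<close>

lemma C1_unit_continuous: "C1_unit f \<Longrightarrow> continuous_on {0..1} f"
  unfolding C1_unit_def by (elim exE conjE, rule DERIV_continuous_on, drule bspec)

lemma nonvanishing_sign:
  fixes f :: "real \<Rightarrow> real"
  assumes f: "continuous_on {0..1} f" and nz: "\<And>x. x \<in> {0..1} \<Longrightarrow> f x \<noteq> 0"
  obtains \<sigma> where "\<sigma> = 1 \<or> \<sigma> = -1" "\<And>x. x \<in> {0..1} \<Longrightarrow> 0 < \<sigma> * f x"
proof -
  have conn: "connected (f ` {0..1})" by (rule connected_continuous_image[OF f]) simp
  have *: "0 < sgn (f 0) * f x" if x: "x \<in> {0..1}" for x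
  proof (rule ccontr)
    assume "\<not> ?thesis"
    then have "f x \<le> 0 \<and> 0 \<le> f 0 \<or> f 0 \<le> 0 \<and> 0 \<le> f x" by (auto simp: sgn_if mult_less_0_iff not_less split: if_splits)
    then have "0 \<in> f ` {0..1}"
      using connectedD_interval[OF conn, of "f x" "f 0" 0] connectedD_interval[OF conn, of "f 0" "f x" 0] x by auto
    then show False using nz by auto
  qed
  show thesis by (rule that[of "sgn (f 0)"]) (use * nz[of 0] in \<open>auto simp: sgn_if\<close>)
qed

lemma primitive_DERIV:
  fixes g :: "real \<Rightarrow> real"
  assumes "continuous_on {0..1} g" "x \<in> {0..1}"
  shows "((\<lambda>x. integral {0..x} g) has_real_derivative g x) (at x within {0..1})"
  using integral_has_real_derivative[OF assms] .

lemma DERIV_interior: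
  assumes "(f has_real_derivative d) (at x within {0..1})" "x \<in> {0<..<1}"
  shows "(f has_real_derivative d) (at x)"
proof -
  have "at x within {0..1} = at x" using assms(2) by (intro at_within_interior) auto
  with assms(1) show ?thesis by simp
qed

text \<open>
\<open>J\<close> is the periodic solution of \<open>J' = - (1 / b1 + 1 / b2) J + const / b2\<close>, normalized so that it remains meaningful
when \<open>m 1 = 0\<close>. Written as a combination of integrals with positive weights, it visibly has the sign of \<open>b2\<close>.
\<close>
lemma periodic_flux_exists:
  fixes b1 b2 :: "real \<Rightarrow> real"
  assumes c: "continuous_on {0..1} b1" "continuous_on {0..1} b2"
    and pos': "\<forall>x\<in>{0..1}. 0 < \<sigma> * b2 x" and nz': "\<forall>x\<in>{0..1}. b1 x \<noteq> 0"
    and m: "m = (\<lambda>x. integral {0..x} (\<lambda>x. 1 / b1 x + 1 / b2 x))"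
    and J: "J = (\<lambda>x. exp (- m x) * (exp (m 1) * integral {0..x} (\<lambda>x. exp (m x) / b2 x)
         + (integral {0..1} (\<lambda>x. exp (m x) / b2 x) - integral {0..x} (\<lambda>x. exp (m x) / b2 x))))"
  shows "\<And>x. x \<in> {0..1} \<Longrightarrow> (m has_real_derivative 1 / b1 x + 1 / b2 x) (at x within {0..1})"
    and "continuous_on {0..1} (\<lambda>x. exp (m x) / b2 x)"
    and "\<And>x. x \<in> {0..1} \<Longrightarrow> 0 < \<sigma> * J x" and "J 0 = J 1"
    and "\<And>x. x \<in> {0..1} \<Longrightarrow> (J has_real_derivative - (1 / b1 x + 1 / b2 x) * J x + (exp (m 1) - 1) / b2 x) (at x within {0..1})"
proof -
  have pos: "0 < \<sigma> * b2 x" and nz: "b1 x \<noteq> 0" if "x \<in> {0..1}" for x using pos' nz' that by auto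
  have nz2: "b2 x \<noteq> 0" if "x \<in> {0..1}" for x using pos[OF that] by auto
  have ca: "continuous_on {0..1} (\<lambda>x. 1 / b1 x + 1 / b2 x)" by (intro continuous_intros c) (use nz nz2 in auto)
  show dm: "(m has_real_derivative 1 / b1 x + 1 / b2 x) (at x within {0..1})" if "x \<in> {0..1}" for x
    unfolding m by (rule primitive_DERIV[OF ca that])
  have cm: "continuous_on {0..1} m" by (rule DERIV_continuous_on[OF dm])
  show ce: "continuous_on {0..1} (\<lambda>x. exp (m x) / b2 x)" by (intro continuous_intros cm c) (use nz2 in auto)
  define I where "I x = integral {0..x} (\<lambda>x. exp (m x) / b2 x)" for x
  have dI: "(I has_real_derivative exp (m x) / b2 x) (at x within {0..1})" if "x \<in> {0..1}" for x
    unfolding I_def by (rule primitive_DERIV[OF ce that])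
  have JI: "J = (\<lambda>x. exp (- m x) * (exp (m 1) * I x + (I 1 - I x)))" unfolding J I_def ..
  have mono: "\<sigma> * I x < \<sigma> * I y" if "0 \<le> x" "x < y" "y \<le> 1" for x y
  proof (rule DERIV_pos_imp_increasing_open[OF that(2)])
    fix z assume z: "x < z" "z < y"
    then have z': "z \<in> {0<..<1}" "z \<in> {0..1}" using that by auto
    have "((\<lambda>x. \<sigma> * I x) has_real_derivative \<sigma> * (exp (m z) / b2 z)) (at z)"
      by (intro DERIV_cmult DERIV_interior dI z')
    moreover have "\<sigma> * (exp (m z) / b2 z) > 0"
    proof -
      have "\<sigma> * (exp (m z) / b2 z) = (\<sigma> * b2 z) * (exp (m z) / (b2 z)\<^sup>2)" using nz2[OF z'(2)] by (simp add: power2_eq_square)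
      then show ?thesis using pos[OF z'(2)] nz2[OF z'(2)] by simp
    qed
    ultimately show "\<exists>y. ((\<lambda>x. \<sigma> * I x) has_real_derivative y) (at z) \<and> 0 < y" by blast
  next
    have "continuous_on {0..1} I" by (rule DERIV_continuous_on[OF dI])
    then have "continuous_on {x..y} I" by (rule continuous_on_subset) (use that in simp)
    then show "continuous_on {x..y} (\<lambda>x. \<sigma> * I x)" by (rule continuous_on_mult[OF continuous_on_const])
  qed
  have I0: "I 0 = 0" and m0: "m 0 = 0" by (simp_all add: I_def m)
  show "0 < \<sigma> * J x" if x: "x \<in> {0..1}" for x
  proof -
    have "0 < exp (m 1) * (\<sigma> * I x) + (\<sigma> * I 1 - \<sigma> * I x)"
    proof (cases "x = 0")
      case True then show ?thesis using mono[of 0 1] by (simp add: I0)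
    next
      case False
      then have "0 < \<sigma> * I x" "\<sigma> * I x \<le> \<sigma> * I 1" using mono[of 0 x] mono[of x 1] x by (cases "x = 1"; auto simp: I0)+
      then show ?thesis by (simp add: add_pos_nonneg)
    qed
    then have "0 < exp (- m x) * (exp (m 1) * (\<sigma> * I x) + (\<sigma> * I 1 - \<sigma> * I x))" by simp
    also have "\<dots> = \<sigma> * J x" by (simp add: JI algebra_simps)
    finally show ?thesis .
  qed
  show "J 0 = J 1" by (simp add: JI I0 m0 flip: exp_add mult.assoc)
  show "(J has_real_derivative - (1 / b1 x + 1 / b2 x) * J x + (exp (m 1) - 1) / b2 x) (at x within {0..1})" if x: "x \<in> {0..1}" for x
  proof -
    have e: "((\<lambda>x. exp (- m x)) has_real_derivative exp (- m x) * - (1 / b1 x + 1 / b2 x)) (at x within {0..1})"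
      by (rule DERIV_chain2[OF DERIV_exp DERIV_minus[OF dm[OF x]]])
    have i: "((\<lambda>x. exp (m 1) * I x + (I 1 - I x)) has_real_derivative exp (m 1) * (exp (m x) / b2 x) + (0 - exp (m x) / b2 x)) (at x within {0..1})"
      by (intro DERIV_add DERIV_cmult DERIV_diff DERIV_const dI x)
    have "exp (- m x) * (exp (m 1) * (exp (m x) / b2 x) + (0 - exp (m x) / b2 x)) = (exp (- m x) * exp (m x)) * ((exp (m 1) - 1) / b2 x)"
      by (simp add: algebra_simps diff_divide_distrib)
    then show ?thesis unfolding JI by (intro DERIV_cong[OF DERIV_mult[OF e i]]) (simp add: algebra_simps flip: exp_add)
  qed
qed

text \<open>
Let \<open>J1\<close> and \<open>J2\<close> be the periodic functions belonging to \<open>(b1, b2)\<close> and \<open>(b2, b1)\<close>. Their sum is the constant \<open>exp (m 1) - 1\<close>,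
which turns the two scalar equations into the steady state system for the densities \<open>Ji / bi\<close>. As \<open>J1\<close> has the sign of \<open>b2\<close> and \<open>J2\<close> that of
\<open>b1\<close>, the product of the two signs makes both densities positive.
\<close>
theorem steady_state_exists:
  assumes c: "\<And>i. continuous_on {0..1} (b i)" and nz: "\<And>i x. x \<in> {0..1} \<Longrightarrow> b i x \<noteq> 0"
  shows "\<exists>p. normalized_positive_steady_state b p"
proof -
  obtain s1 where s1: "s1 = 1 \<or> s1 = -1" "\<And>x. x \<in> {0..1} \<Longrightarrow> 0 < s1 * b 1 x" by (rule nonvanishing_sign[OF c nz]) auto
  obtain s2 where s2: "s2 = 1 \<or> s2 = -1" "\<And>x. x \<in> {0..1} \<Longrightarrow> 0 < s2 * b 2 x" by (rule nonvanishing_sign[OF c nz]) auto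
  define m where "m = (\<lambda>x. integral {0..x} (\<lambda>x. 1 / b 1 x + 1 / b 2 x))"
  have m': "m = (\<lambda>x. integral {0..x} (\<lambda>x. 1 / b 2 x + 1 / b 1 x))" by (simp add: m_def add.commute)
  define I where "I i x = integral {0..x} (\<lambda>x. exp (m x) / b i x)" for i x
  define J1 where "J1 = (\<lambda>x. exp (- m x) * (exp (m 1) * I 2 x + (I 2 1 - I 2 x)))"
  define J2 where "J2 = (\<lambda>x. exp (- m x) * (exp (m 1) * I 1 x + (I 1 1 - I 1 x)))"
  have pm: "\<forall>x\<in>{0..1}. 0 < s1 * b 1 x" "\<forall>x\<in>{0..1}. 0 < s2 * b 2 x" "\<forall>x\<in>{0..1}. b i x \<noteq> 0" for i
    using s1 s2 nz by auto
  note F1 = periodic_flux_exists[OF c c pm(2,3) m_def J1_def[unfolded I_def]]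
  note F2 = periodic_flux_exists[OF c c pm(1,3) m' J2_def[unfolded I_def]]
  have sum: "J1 x + J2 x = exp (m 1) - 1" if x: "x \<in> {0..1}" for x
  proof -
    have "I 1 y + I 2 y = exp (m y) - 1" if y: "y \<in> {0..1}" for y
    proof -
      have "((\<lambda>x. exp (m x)) has_vector_derivative exp (m x) * (1 / b 1 x + 1 / b 2 x)) (at x within {0..y})" if "x \<in> {0..y}" for x
        unfolding has_real_derivative_iff_has_vector_derivative[symmetric]
        by (rule DERIV_chain2[OF DERIV_exp DERIV_subset[OF F1(1)]]) (use that y in auto)
      then have "((\<lambda>x. exp (m x) * (1 / b 1 x + 1 / b 2 x)) has_integral exp (m y) - exp (m 0)) {0..y}"
        by (intro fundamental_theorem_of_calculus) (use y in auto)
      then have "integral {0..y} (\<lambda>x. exp (m x) / b 1 x + exp (m x) / b 2 x) = exp (m y) - 1"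
        by (simp add: integral_unique m_def distrib_left)
      moreover have "integral {0..y} (\<lambda>x. exp (m x) / b 1 x + exp (m x) / b 2 x) = I 1 y + I 2 y"
        unfolding I_def
        by (rule integral_add; rule integrable_continuous_real; rule continuous_on_subset[OF F1(2)] continuous_on_subset[OF F2(2)]; use y in auto)
      ultimately show ?thesis by simp
    qed
    from this[OF x] this[of 1] have I: "I 1 x = exp (m x) - 1 - I 2 x" "I 1 1 = exp (m 1) - 1 - I 2 1" by auto
    have "J1 x + J2 x = exp (- m x) * (exp (m x) * (exp (m 1) - 1))"
      unfolding J1_def J2_def I by (simp add: algebra_simps)
    then show ?thesis by (simp flip: exp_add mult.assoc)
  qed
  define w where "w i x = (if i = (1::2) then s1 * s2 * (J1 x / b 1 x) else s1 * s2 * (J2 x / b 2 x))" for i x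
  have cJ: "continuous_on {0..1} J1" "continuous_on {0..1} J2"
    by (rule DERIV_continuous_on[OF F1(5)] DERIV_continuous_on[OF F2(5)]; assumption)+
  have cw: "continuous_on {0..1} (w i)" for i
  proof -
    have "continuous_on {0..1} (\<lambda>x. s1 * s2 * (J1 x / b 1 x))" "continuous_on {0..1} (\<lambda>x. s1 * s2 * (J2 x / b 2 x))"
      by (intro continuous_on_mult continuous_on_divide continuous_on_const cJ c ballI nz; assumption)+
    then show ?thesis unfolding w_def[abs_def] by (cases "i = 1") simp_all
  qed
  have pw: "0 < w i x" if x: "x \<in> {0..1}" for i x
  proof -
    have q: "0 < s * t * (y / z)" if "0 < t * y" "0 < s * z" for s t y z :: real
    proof -
      have "z \<noteq> 0" using that(2) by auto
      then have "s * t * (y / z) = (t * y) * (s * z) / z\<^sup>2" by (simp add: power2_eq_square)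
      moreover have "0 < z\<^sup>2" using \<open>z \<noteq> 0\<close> by simp
      ultimately show ?thesis using that by (simp add: zero_less_divide_iff)
    qed
    have "0 < s1 * s2 * (J1 x / b 1 x)" by (rule q[OF F1(3)[OF x] s1(2)[OF x]])
    moreover have "0 < s1 * s2 * (J2 x / b 2 x)"
      using q[OF F2(3)[OF x] s2(2)[OF x]] by (simp only: mult.commute[of s2 s1])
    ultimately show ?thesis unfolding w_def by (cases "i = 1"; simp)
  qed
  have bw: "b 1 y * w 1 y = s1 * s2 * J1 y" "b 2 y * w 2 y = s1 * s2 * J2 y" if "y \<in> {0..1}" for y
    using nz[OF that] by (auto simp: w_def)
  define N where "N = (LINT x|unit_measure. w 1 x + w 2 x)"
  have cN: "continuous_on {0..1} (\<lambda>x. w 1 x + w 2 x)" by (intro continuous_intros cw)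
  have "N > 0"
  proof -
    have "N = integral (cbox 0 1) (\<lambda>x. w 1 x + w 2 x)" using LINT_unit[OF continuous_integrable_unit[OF cN]] by (simp add: N_def)
    moreover have "integral (cbox 0 1) (\<lambda>x. w 1 x + w 2 x) \<noteq> 0"
    proof
      assume "integral (cbox 0 1) (\<lambda>x. w 1 x + w 2 x) = 0"
      then have "\<forall>x\<in>cbox 0 1. w 1 x + w 2 x = 0"
        using cN pw by (intro integral_cbox_eq_0_iff[THEN iffD1]) (auto intro: less_imp_le[OF add_pos_pos])
      then have "w 1 0 + w 2 0 = 0" by (rule bspec[where x = 0]) simp
      then show False using pw[of 0 1] pw[of 0 2] by simp
    qed
    moreover have "0 \<le> integral (cbox 0 1) (\<lambda>x. w 1 x + w 2 x)"
      by (rule Henstock_Kurzweil_Integration.integral_nonneg)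
        (use integrable_continuous_real[OF cN] pw in \<open>auto intro: less_imp_le[OF add_pos_pos]\<close>)
    ultimately show ?thesis by simp
  qed
  define p where "p i x = w i x / N" for i x
  have d1: "((\<lambda>y. b 1 y * p 1 y) has_real_derivative (- p 1 x + p 2 x)) (at x)"
    and d2: "((\<lambda>y. b 2 y * p 2 y) has_real_derivative (p 1 x - p 2 x)) (at x)" if x: "x \<in> {0<..<1}" for x
  proof -
    have x': "x \<in> {0..1}" using x by auto
    have K: "exp (m 1) - 1 = J1 x + J2 x" using sum[OF x'] by simp
    have tr: "((\<lambda>y. b i y * p i y) has_real_derivative d) (at x)"
      if "((\<lambda>y. s1 * s2 * J y / N) has_real_derivative d) (at x)" "\<And>y. y \<in> {0..1} \<Longrightarrow> b i y * w i y = s1 * s2 * J y" for i J d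
      by (rule has_field_derivative_transform_within_open[OF that(1), of "{0<..<1}"])
        (use x that(2) in \<open>auto simp: p_def\<close>)
    show "((\<lambda>y. b 1 y * p 1 y) has_real_derivative (- p 1 x + p 2 x)) (at x)"
    proof (rule tr[OF _ bw(1)])
      have "((\<lambda>y. s1 * s2 * J1 y / N) has_real_derivative s1 * s2 * (- (1 / b 1 x + 1 / b 2 x) * J1 x + (J1 x + J2 x) / b 2 x) / N) (at x)"
        by (intro DERIV_cdivide DERIV_cmult DERIV_interior[OF _ x]) (use F1(5)[OF x'] K in simp)
      moreover have "- (1 / b 1 x + 1 / b 2 x) * J1 x + (J1 x + J2 x) / b 2 x = J2 x / b 2 x - J1 x / b 1 x"
        using nz[OF x'] by (simp add: field_simps)
      ultimately show "((\<lambda>y. s1 * s2 * J1 y / N) has_real_derivative (- p 1 x + p 2 x)) (at x)"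
        by (simp add: p_def w_def right_diff_distrib diff_divide_distrib)
    qed
    show "((\<lambda>y. b 2 y * p 2 y) has_real_derivative (p 1 x - p 2 x)) (at x)"
    proof (rule tr[OF _ bw(2)])
      have "((\<lambda>y. s1 * s2 * J2 y / N) has_real_derivative s1 * s2 * (- (1 / b 2 x + 1 / b 1 x) * J2 x + (J1 x + J2 x) / b 1 x) / N) (at x)"
        by (intro DERIV_cdivide DERIV_cmult DERIV_interior[OF _ x]) (use F2(5)[OF x'] K in simp)
      moreover have "- (1 / b 2 x + 1 / b 1 x) * J2 x + (J1 x + J2 x) / b 1 x = J1 x / b 1 x - J2 x / b 2 x"
        using nz[OF x'] by (simp add: field_simps)
      ultimately show "((\<lambda>y. s1 * s2 * J2 y / N) has_real_derivative (p 1 x - p 2 x)) (at x)"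
        by (simp add: p_def w_def right_diff_distrib diff_divide_distrib)
    qed
  qed
  have per: "b i 0 * p i 0 = b i 1 * p i 1" for i
  proof -
    have "b 1 0 * w 1 0 = b 1 1 * w 1 1" "b 2 0 * w 2 0 = b 2 1 * w 2 1"
      using bw[of 0] bw[of 1] F1(4) F2(4) by auto
    then show ?thesis using exhaust_2[of i] by (auto simp: p_def)
  qed
  have int: "(LINT x|unit_measure. p 1 x + p 2 x) = 1"
  proof -
    have "(LINT x|unit_measure. p 1 x + p 2 x) = (LINT x|unit_measure. (w 1 x + w 2 x) / N)" by (simp add: p_def add_divide_distrib)
    also have "\<dots> = N / N" by (simp add: N_def)
    finally show ?thesis using \<open>N > 0\<close> by simp
  qed
  have cp: "continuous_on {0..1} (p i)" for i
  proof -
    have "continuous_on {0..1} (\<lambda>x. w i x / N)"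
      by (rule continuous_on_divide[OF cw continuous_on_const]) (use \<open>N > 0\<close> in simp)
    then show ?thesis by (simp add: p_def[abs_def])
  qed
  have pp: "0 < p i x" if "x \<in> {0..1}" for i x using pw[OF that] \<open>N > 0\<close> by (simp add: p_def)
  have "normalized_positive_steady_state b p"
    unfolding normalized_positive_steady_state_def steady_state_def
    by (intro conjI allI ballI; (rule cp d1 d2 per pp int; assumption?))
  then show ?thesis by blast
qed

text \<open>
With \<open>f i = q i / w i\<close>, the function \<open>G = \<Sum> b i w i (f i)\<^sup>2\<close> is decreasing with equal end values, hence constant. Its derivative then vanishes, so \<open>f 1 = f 2\<close>,
after which the equations give \<open>f i' = 0\<close>; the normalization fixes the constant.
\<close>
theorem steady_state_unique:
  assumes c: "\<And>i. continuous_on {0..1} (b i)" and nz: "\<And>i x. x \<in> {0..1} \<Longrightarrow> b i x \<noteq> 0"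
    and w: "normalized_positive_steady_state b w" and q: "normalized_positive_steady_state b q"
    and x: "x \<in> {0..1}"
  shows "q i x = w i x"
proof -
  have W: "continuous_on {0..1} (w i)" "x \<in> {0..1} \<Longrightarrow> 0 < w i x" "b i 0 * w i 0 = b i 1 * w i 1"
    and Q: "continuous_on {0..1} (q i)" "x \<in> {0..1} \<Longrightarrow> 0 < q i x" "b i 0 * q i 0 = b i 1 * q i 1" for i x
    using w q by (auto simp: normalized_positive_steady_state_def steady_state_def)
  have W': "x \<in> {0<..<1} \<Longrightarrow> ((\<lambda>y. b 1 y * w 1 y) has_real_derivative (w 2 x - w 1 x)) (at x)"
      "x \<in> {0<..<1} \<Longrightarrow> ((\<lambda>y. b 2 y * w 2 y) has_real_derivative (w 1 x - w 2 x)) (at x)"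
    and Q': "x \<in> {0<..<1} \<Longrightarrow> ((\<lambda>y. b 1 y * q 1 y) has_real_derivative (q 2 x - q 1 x)) (at x)"
      "x \<in> {0<..<1} \<Longrightarrow> ((\<lambda>y. b 2 y * q 2 y) has_real_derivative (q 1 x - q 2 x)) (at x)" for x
    using w q by (auto simp: normalized_positive_steady_state_def steady_state_def)
  define f where "f i x = (b i x * q i x) / (b i x * w i x)" for i x
  have fq: "q i x = f i x * w i x" if "x \<in> {0..1}" for i x using nz[OF that] W(2)[OF that, of i] by (simp add: f_def)
  have bw: "b i x * w i x \<noteq> 0" if "x \<in> {0..1}" for i x using nz[OF that] W(2)[OF that, of i] by simp
  have cf: "continuous_on {0..1} (f i)" for i unfolding f_def by (intro continuous_intros c W Q) (use bw in auto)
  have df: "(f 1 has_real_derivative w 2 x * (f 2 x - f 1 x) / (b 1 x * w 1 x)) (at x)"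
      "(f 2 has_real_derivative w 1 x * (f 1 x - f 2 x) / (b 2 x * w 2 x)) (at x)" if x: "x \<in> {0<..<1}" for x
  proof -
    have x': "x \<in> {0..1}" using x by auto
    have quot: "((\<lambda>x. U x / J x) has_real_derivative (U' - (U x / J x) * J') / J x) (at x)"
      if "(U has_real_derivative U') (at x)" "(J has_real_derivative J') (at x)" "J x \<noteq> 0" for U J :: "real \<Rightarrow> real" and U' J'
      by (rule DERIV_cong[OF DERIV_divide[OF that]]) (use that(3) in \<open>simp add: field_simps\<close>)
    have "(f 1 has_real_derivative ((q 2 x - q 1 x) - f 1 x * (w 2 x - w 1 x)) / (b 1 x * w 1 x)) (at x)"
      using quot[OF Q'(1)[OF x] W'(1)[OF x] bw[OF x']] unfolding f_def[abs_def] .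
    moreover have "(q 2 x - q 1 x) - f 1 x * (w 2 x - w 1 x) = w 2 x * (f 2 x - f 1 x)"
      unfolding fq[OF x'] by (simp add: algebra_simps)
    ultimately show "(f 1 has_real_derivative w 2 x * (f 2 x - f 1 x) / (b 1 x * w 1 x)) (at x)" by simp
    have "(f 2 has_real_derivative ((q 1 x - q 2 x) - f 2 x * (w 1 x - w 2 x)) / (b 2 x * w 2 x)) (at x)"
      using quot[OF Q'(2)[OF x] W'(2)[OF x] bw[OF x']] unfolding f_def[abs_def] .
    moreover have "(q 1 x - q 2 x) - f 2 x * (w 1 x - w 2 x) = w 1 x * (f 1 x - f 2 x)"
      unfolding fq[OF x'] by (simp add: algebra_simps)
    ultimately show "(f 2 has_real_derivative w 1 x * (f 1 x - f 2 x) / (b 2 x * w 2 x)) (at x)" by simp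
  qed
  \<comment> \<open>The entropy flux: its derivative is minus the entropy production.\<close>
  define G where "G x = (b 1 x * w 1 x) * (f 1 x)\<^sup>2 + (b 2 x * w 2 x) * (f 2 x)\<^sup>2" for x
  define G' where "G' x = - (w 1 x + w 2 x) * (f 1 x - f 2 x)\<^sup>2" for x
  have dG: "(G has_real_derivative G' x) (at x)" if x: "x \<in> {0<..<1}" for x
  proof -
    have x': "x \<in> {0..1}" using x by auto
    have cancel: "a * (r / t) * t = a * r" if "t \<noteq> 0" for a r t :: real using that by simp
    have sq: "((\<lambda>x. g x ^ 2) has_real_derivative 2 * g x * d) (at x)" if "(g has_real_derivative d) (at x)" for g :: "real \<Rightarrow> real" and d
      by (rule DERIV_cong[OF DERIV_power[OF that, of 2]]) simp
    have "(G has_real_derivative ((w 2 x - w 1 x) * (f 1 x)\<^sup>2 + (2 * f 1 x * (w 2 x * (f 2 x - f 1 x) / (b 1 x * w 1 x))) * (b 1 x * w 1 x))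
        + ((w 1 x - w 2 x) * (f 2 x)\<^sup>2 + (2 * f 2 x * (w 1 x * (f 1 x - f 2 x) / (b 2 x * w 2 x))) * (b 2 x * w 2 x))) (at x)"
      unfolding G_def by (rule DERIV_add[OF DERIV_mult[OF W'(1)[OF x] sq[OF df(1)[OF x]]] DERIV_mult[OF W'(2)[OF x] sq[OF df(2)[OF x]]]])
    moreover have c1: "2 * f 1 x * (w 2 x * (f 2 x - f 1 x) / (b 1 x * w 1 x)) * (b 1 x * w 1 x) = 2 * f 1 x * (w 2 x * (f 2 x - f 1 x))"
      by (rule cancel[OF bw[OF x']])
    moreover have c2: "2 * f 2 x * (w 1 x * (f 1 x - f 2 x) / (b 2 x * w 2 x)) * (b 2 x * w 2 x) = 2 * f 2 x * (w 1 x * (f 1 x - f 2 x))"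
      by (rule cancel[OF bw[OF x']])
    moreover have "(w 2 x - w 1 x) * (f 1 x)\<^sup>2 + 2 * f 1 x * (w 2 x * (f 2 x - f 1 x)) +
        ((w 1 x - w 2 x) * (f 2 x)\<^sup>2 + 2 * f 2 x * (w 1 x * (f 1 x - f 2 x))) = G' x"
      unfolding G'_def by (simp add: power2_eq_square algebra_simps)
    ultimately show ?thesis by (simp only:)
  qed
  have cG: "continuous_on {0..1} G" unfolding G_def by (intro continuous_intros c W cf)
  have G'0: "G' x \<le> 0" if "x \<in> {0<..<1}" for x
  proof -
    have "0 < w 1 x + w 2 x" using W(2)[of x 1] W(2)[of x 2] that by auto
    then show ?thesis unfolding G'_def by (intro mult_nonpos_nonneg) auto
  qed
  have dec: "G y \<le> G x" if "0 \<le> x" "x \<le> y" "y \<le> 1" for x y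
  proof (rule DERIV_nonpos_imp_decreasing_open[OF that(2)])
    show "\<exists>d. (G has_real_derivative d) (at z) \<and> d \<le> 0" if "x < z" "z < y" for z
      using dG[of z] G'0[of z] that \<open>0 \<le> x\<close> \<open>y \<le> 1\<close> by auto
    show "continuous_on {x..y} G" by (rule continuous_on_subset[OF cG]) (use that in auto)
  qed
  have "G 0 = G 1" using W(3) Q(3) by (simp add: G_def f_def)
  then have Gc: "G x = G 0" if "x \<in> {0..1}" for x
  proof -
    have "G x \<le> G 0" "G 1 \<le> G x" by (rule dec; use that in simp)+
    then show ?thesis using \<open>G 0 = G 1\<close> by linarith
  qed
  have feq: "f 1 x = f 2 x" if x: "x \<in> {0<..<1}" for x
  proof -
    have "((\<lambda>x. G 0) has_real_derivative G' x) (at x)"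
      by (rule has_field_derivative_transform_within_open[OF dG[OF x] _ x]) (simp, rule Gc, simp)
    then have "G' x = 0" by (rule DERIV_unique) simp
    moreover have "0 < w 1 x + w 2 x" using W(2)[of x 1] W(2)[of x 2] x by auto
    ultimately show ?thesis by (auto simp: G'_def)
  qed
  have fc: "f i x = f i 0" if x: "x \<in> {0..1}" for i x
  proof (rule DERIV_isconst2[where f = "f i" and a = 0 and b = 1])
    fix y :: real assume y: "0 < y" "y < 1"
    then have y': "y \<in> {0<..<1}" by simp
    have "(f 1 has_real_derivative 0) (at y)" by (rule DERIV_cong[OF df(1)[OF y']]) (simp add: feq[OF y'])
    moreover have "(f 2 has_real_derivative 0) (at y)" by (rule DERIV_cong[OF df(2)[OF y']]) (simp add: feq[OF y'])
    ultimately show "(f i has_real_derivative 0) (at y)" using exhaust_2[of i] by (elim disjE) simp_all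
  qed (use cf x in auto)
  have f12: "f 1 0 = f 2 0" using feq[of "1/2"] fc[of "1/2" 1] fc[of "1/2" 2] by simp
  define k where "k = f 1 0"
  have qk: "q i x = k * w i x" if "x \<in> {0..1}" for i x
    using fq[OF that, of i] fc[OF that, of i] f12 exhaust_2[of i] by (auto simp: k_def)
  have "1 = (LINT x|unit_measure. q 1 x + q 2 x)" using q by (simp add: normalized_positive_steady_state_def)
  also have "\<dots> = (LINT x|unit_measure. k * (w 1 x + w 2 x))"
    by (rule Bochner_Integration.integral_cong) (auto simp: qk algebra_simps)
  also have "\<dots> = k" using w by (simp add: normalized_positive_steady_state_def)
  finally show ?thesis using qk[OF x] by simp
qed

section \<open>Profiles as elements of a Hilbert space\<close>

lemma continuous_bounded_unit:
  fixes g :: "real \<Rightarrow> 'e::real_normed_vector"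
  assumes "continuous_on {0..1} g"
  obtains C where "0 < C" "\<And>x. x \<in> {0..1} \<Longrightarrow> norm (g x) \<le> C"
proof -
  have "bounded (g ` {0..1})" by (rule compact_imp_bounded[OF compact_continuous_image[OF assms]]) simp
  then obtain C where "0 < C" "\<forall>y\<in>g ` {0..1}. norm y \<le> C" unfolding bounded_pos by blast
  then show thesis by (intro that[of C]) auto
qed

lemma L2_scale_continuous:
  fixes g :: "real \<Rightarrow> real"
  assumes g: "continuous_on {0..1} g" and f: "f \<in> L2 unit_measure"
  shows "(\<lambda>x. g x *\<^sub>R f x) \<in> L2 unit_measure"
proof -
  obtain C where C: "\<And>x. x \<in> {0..1} \<Longrightarrow> norm (g x) \<le> C" using continuous_bounded_unit[OF g] by blast
  note [measurable] = continuous_measurable_unit[OF g] L2D(1)[OF f]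
  show ?thesis
  proof (rule L2_bound[OF _ f])
    show "AE x in unit_measure. cmod (g x *\<^sub>R f x) \<le> C * cmod (f x)"
      by (intro AE_I2) (use C in \<open>auto intro: mult_right_mono\<close>)
  qed measurable
qed

lemma continuous_L2: "continuous_on {0..1} f \<Longrightarrow> f \<in> L2 unit_measure"
proof -
  assume f: "continuous_on {0..1} f"
  have "continuous_on {0..1} (\<lambda>x. (cmod (f x))\<^sup>2)" by (intro continuous_intros f)
  then show "f \<in> L2 unit_measure"
    using continuous_measurable_unit[OF f] continuous_integrable_unit by (auto simp: L2_def)
qed

definition mul :: "(real \<Rightarrow> real) \<Rightarrow> cl2 \<Rightarrow> cl2" where
  "mul g f = cls (\<lambda>x. g x *\<^sub>R rep f x)"

lemma mul_cls:
  assumes g: "continuous_on {0..1} g" and f: "f \<in> L2 unit_measure"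
  shows "mul g (cls f) = cls (\<lambda>x. g x *\<^sub>R f x)"
proof -
  have "AE x in unit_measure. g x *\<^sub>R rep (cls f) x = g x *\<^sub>R f x" using rep_cls[OF f] by eventually_elim simp
  then show ?thesis unfolding mul_def
    by (subst cls_eq_iff) (auto intro: L2_scale_continuous g f rep_L2)
qed

lemma norm_cls_le:
  assumes f: "f \<in> L2 unit_measure" and g: "g \<in> L2 unit_measure" and "0 \<le> C"
    and le: "AE x in unit_measure. cmod (f x) \<le> C * cmod (g x)"
  shows "norm (cls f) \<le> C * norm (cls g)"
proof (rule power2_le_imp_le)
  have "(norm (cls f))\<^sup>2 = (LINT x|unit_measure. (cmod (f x))\<^sup>2)" by (rule norm_cls[OF f])
  also have "\<dots> \<le> (LINT x|unit_measure. C\<^sup>2 * (cmod (g x))\<^sup>2)"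
  proof (rule integral_mono_AE)
    show "AE x in unit_measure. (cmod (f x))\<^sup>2 \<le> C\<^sup>2 * (cmod (g x))\<^sup>2"
      using le
    proof eventually_elim
      case (elim x)
      then have "(cmod (f x))\<^sup>2 \<le> (C * cmod (g x))\<^sup>2" by (intro power_mono) auto
      then show ?case by (simp add: power_mult_distrib)
    qed
  qed (use L2D(2)[OF f] L2D(2)[OF g] in auto)
  also have "\<dots> = (C * norm (cls g))\<^sup>2" by (simp add: norm_cls[OF g] power_mult_distrib)
  finally show "(norm (cls f))\<^sup>2 \<le> (C * norm (cls g))\<^sup>2" .
qed (use \<open>0 \<le> C\<close> in simp)

lemma cls_cong:
  assumes "f \<in> L2 unit_measure" "AE x in unit_measure. f x = g x" "g \<in> L2 unit_measure"
  shows "cls f = cls g"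
  using assms by (simp add: cls_eq_iff)

lemma mul_norm_le:
  assumes g: "continuous_on {0..1} g" and C: "0 \<le> C" "\<And>x. x \<in> {0..1} \<Longrightarrow> \<bar>g x\<bar> \<le> C"
  shows "norm (mul g f) \<le> C * norm f"
proof -
  have "norm (mul g f) \<le> C * norm (cls (rep f))"
    unfolding mul_def
    by (rule norm_cls_le[OF L2_scale_continuous[OF g rep_L2] rep_L2 C(1)])
      (use C(2) in \<open>auto intro!: AE_I2 mult_right_mono\<close>)
  then show ?thesis by simp
qed

lemma mul_bounded_linear:
  assumes g: "continuous_on {0..1} g" shows "bounded_linear (mul g)"
proof -
  obtain C where C: "0 < C" "\<And>x. x \<in> {0..1} \<Longrightarrow> norm (g x) \<le> C" using continuous_bounded_unit[OF g] by blast
  have rep: "f = cls (rep f)" for f by simp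
  show ?thesis
  proof (rule bounded_linear_intro[of _ C])
    fix f h :: cl2 and r :: real
    have "mul g (cls (rep f) + cls (rep h)) = mul g (cls (rep f)) + mul g (cls (rep h))"
      unfolding cls_add[OF rep_L2 rep_L2, symmetric] mul_cls[OF g rep_L2] mul_cls[OF g L2_add[OF rep_L2 rep_L2]]
        cls_add[OF L2_scale_continuous[OF g rep_L2] L2_scale_continuous[OF g rep_L2], symmetric]
      by (simp add: scaleR_add_right)
    then show "mul g (f + h) = mul g f + mul g h" by simp
    have "mul g (r *\<^sub>R cls (rep f)) = r *\<^sub>R mul g (cls (rep f))"
      unfolding cls_scaleR[OF rep_L2, symmetric] mul_cls[OF g rep_L2] mul_cls[OF g L2_scaleR[OF rep_L2]]
        cls_scaleR[OF L2_scale_continuous[OF g rep_L2], symmetric]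
      by (simp add: mult.commute)
    then show "mul g (r *\<^sub>R f) = r *\<^sub>R mul g f" by simp
    show "norm (mul g f) \<le> norm f * C"
      using mul_norm_le[OF g, of C f] C by (simp add: mult.commute)
  qed
qed

text \<open>
A continuous positive weight on a compact interval is bounded above and below, so the weighted and the unweighted spaces have the same elements.
\<close>
lemma L2_measurable_weight:
  assumes "continuous_on {0..1} g" "\<And>x. x \<in> {0..1} \<Longrightarrow> 0 < (g x :: real)"
  shows "L2 (density unit_measure (\<lambda>x. ennreal (g x))) = L2 unit_measure"
proof (rule set_eqI)
  fix f :: "real \<Rightarrow> complex"
  have gm [measurable]: "g \<in> borel_measurable unit_measure" by (rule continuous_measurable_unit[OF assms(1)])
  have meas: "f \<in> borel_measurable (density unit_measure (\<lambda>x. ennreal (g x))) \<longleftrightarrow> f \<in> borel_measurable unit_measure"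
    by (simp add: measurable_density_eq1)
  have "integrable (density unit_measure (\<lambda>x. ennreal (g x))) (\<lambda>x. (cmod (f x))\<^sup>2) \<longleftrightarrow> f \<in> L2 unit_measure"
    if f: "f \<in> borel_measurable unit_measure"
  proof -
    note [measurable] = f
    have "integrable (density unit_measure (\<lambda>x. ennreal (g x))) (\<lambda>x. (cmod (f x))\<^sup>2)
        \<longleftrightarrow> integrable unit_measure (\<lambda>x. g x *\<^sub>R (cmod (f x))\<^sup>2)"
      by (rule integrable_density) (use assms(2) in \<open>auto intro!: AE_I2 less_imp_le\<close>)
    also have "\<dots> \<longleftrightarrow> f \<in> L2 unit_measure"
    proof
      assume i: "integrable unit_measure (\<lambda>x. g x *\<^sub>R (cmod (f x))\<^sup>2)"
      have c: "continuous_on {0..1} (\<lambda>x. sqrt (inverse (g x)))"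
        by (intro continuous_intros assms(1)) (use assms(2) in force)
      have "(\<lambda>x. sqrt (g x) *\<^sub>R f x) \<in> L2 unit_measure"
        unfolding L2_def
      proof (intro CollectI conjI)
        show "(\<lambda>x. sqrt (g x) *\<^sub>R f x) \<in> borel_measurable unit_measure" by measurable
        show "integrable unit_measure (\<lambda>x. (cmod (sqrt (g x) *\<^sub>R f x))\<^sup>2)"
          using i by (rule Bochner_Integration.integrable_cong[OF refl, THEN iffD1, rotated])
            (use assms(2) in \<open>auto simp: power_mult_distrib less_imp_le\<close>)
      qed
      from L2_scale_continuous[OF c this]
      have "(\<lambda>x. sqrt (inverse (g x)) *\<^sub>R sqrt (g x) *\<^sub>R f x) \<in> L2 unit_measure" .
      then show "f \<in> L2 unit_measure"
      proof (rule L2_bound[OF f])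
        show "AE x in unit_measure. cmod (f x) \<le> 1 * cmod (sqrt (inverse (g x)) *\<^sub>R sqrt (g x) *\<^sub>R f x)"
        proof (rule AE_I2)
          fix x assume "x \<in> space unit_measure"
          then have "0 < g x" using assms(2) by simp
          then have "sqrt (inverse (g x)) * sqrt (g x) = 1" by (simp flip: real_sqrt_mult)
          then show "cmod (f x) \<le> 1 * cmod (sqrt (inverse (g x)) *\<^sub>R sqrt (g x) *\<^sub>R f x)" by simp
        qed
      qed
    next
      assume f: "f \<in> L2 unit_measure"
      have "continuous_on {0..1} (\<lambda>x. sqrt (g x))" by (intro continuous_intros assms(1))
      from L2D(2)[OF L2_scale_continuous[OF this f]]
      show "integrable unit_measure (\<lambda>x. g x *\<^sub>R (cmod (f x))\<^sup>2)"
        by (rule Bochner_Integration.integrable_cong[OF refl, THEN iffD1, rotated])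
          (use assms(2) in \<open>auto simp: power_mult_distrib less_imp_le\<close>)
    qed
    finally show ?thesis .
  qed
  note main = this
  show "f \<in> L2 (density unit_measure (\<lambda>x. ennreal (g x))) \<longleftrightarrow> f \<in> L2 unit_measure"
  proof (cases "f \<in> borel_measurable unit_measure")
    case True
    show ?thesis unfolding L2_def[of "density unit_measure (\<lambda>x. ennreal (g x))"] mem_Collect_eq main[OF True] meas
      using True by blast
  next
    case False
    then show ?thesis unfolding L2_def mem_Collect_eq meas by blast
  qed
qed

text \<open>
Here \<open>w\<close> is the normalized positive steady state.
\<close>
locale two_speed =
  fixes b w :: "2 \<Rightarrow> real \<Rightarrow> real"
  assumes b_C1: "C1_unit (b i)"
    and b_nz: "x \<in> {0..1} \<Longrightarrow> b i x \<noteq> 0"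
    and w_steady: "normalized_positive_steady_state b w"
begin

lemma b_cont: "continuous_on {0..1} (b i)" by (rule C1_unit_continuous[OF b_C1])

lemma w_cont: "continuous_on {0..1} (w i)" and w_pos: "x \<in> {0..1} \<Longrightarrow> 0 < w i x"
  and w_nz: "x \<in> {0..1} \<Longrightarrow> w i x \<noteq> 0"
proof -
  have c: "\<forall>i. continuous_on {0..1} (w i)" and p: "\<forall>i. \<forall>x\<in>{0..1}. 0 < w i x"
    by (insert w_steady, unfold normalized_positive_steady_state_def steady_state_def, elim conjE, assumption)+
  show "continuous_on {0..1} (w i)" using c by (rule spec)
  show pos: "0 < w i x" if "x \<in> {0..1}" for x using bspec[OF spec[OF p] that] .
  show "x \<in> {0..1} \<Longrightarrow> w i x \<noteq> 0" using pos by (simp add: less_le)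
qed

lemma X_space_eq: "X_space w = L2_pairs"
proof -
  have "L2 (density unit_measure (\<lambda>x. ennreal (inverse (w i x)))) = L2 unit_measure" for i
  proof (rule L2_measurable_weight)
    show "continuous_on {0..1} (\<lambda>x. inverse (w i x))"
      by (rule continuous_on_inverse[OF w_cont]) (use w_nz in blast)
    show "0 < inverse (w i x)" if "x \<in> {0..1}" for x using w_pos[OF that] by simp
  qed
  then show ?thesis by (simp add: X_space_def L2_pairs_def)
qed

definition rw :: "2 \<Rightarrow> real \<Rightarrow> real" where "rw i x = sqrt (w i x)"

lemma rw_cont: "continuous_on {0..1} (rw i)" and rw_inv_cont: "continuous_on {0..1} (\<lambda>x. inverse (rw i x))"
  and rw_pos: "x \<in> {0..1} \<Longrightarrow> 0 < rw i x" and rw_sq: "x \<in> {0..1} \<Longrightarrow> (rw i x)\<^sup>2 = w i x"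
proof -
  show c: "continuous_on {0..1} (rw i)" unfolding rw_def[abs_def] by (intro continuous_intros w_cont)
  show p: "0 < rw i x" if "x \<in> {0..1}" for x using w_pos[OF that, of i] by (simp add: rw_def)
  show "x \<in> {0..1} \<Longrightarrow> (rw i x)\<^sup>2 = w i x" using w_pos[of x i] by (simp add: rw_def)
  show "continuous_on {0..1} (\<lambda>x. inverse (rw i x))"
  proof (rule continuous_on_inverse[OF c], rule ballI)
    show "rw i x \<noteq> 0" if "x \<in> {0..1}" for x using p[OF that] by simp
  qed
qed

text \<open>
An index of type \<open>2\<close>, as in profiles, is turned into a component of a pair.
\<close>
definition comp :: "2 \<Rightarrow> cl2 \<times> cl2 \<Rightarrow> cl2" where "comp i v = (if i = 1 then fst v else snd v)"

lemma comp_bounded_linear: "bounded_linear (comp i)"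
  unfolding comp_def[abs_def] by (cases "i = 1") (simp_all add: bounded_linear_fst bounded_linear_snd)

lemma comp_eqI: "(\<And>i. comp i u = comp i v) \<Longrightarrow> u = v"
proof -
  assume *: "\<And>i. comp i u = comp i v"
  show "u = v" by (rule prod_eqI) (use *[of 1] *[of 2] in \<open>simp_all add: comp_def\<close>)
qed

lemma norm_comp: "(norm v)\<^sup>2 = (\<Sum>i\<in>UNIV. (norm (comp i v))\<^sup>2)"
  by (simp add: UNIV_2 comp_def norm_prod_def)

lemma inner_comp: "inner u v = (\<Sum>i\<in>UNIV. inner (comp i u) (comp i v))"
  by (simp add: UNIV_2 comp_def inner_prod_def)

text \<open>
Division by the square root of \<open>w\<close> turns the weighted norm of a profile into the norm of the product space; see \<open>X_norm_emb\<close>.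
The map \<open>prof\<close> below chooses a representative of the inverse image.
\<close>
definition emb :: "profile \<Rightarrow> cl2 \<times> cl2" where
  "emb p = (cls (\<lambda>x. inverse (rw 1 x) *\<^sub>R p 1 x), cls (\<lambda>x. inverse (rw 2 x) *\<^sub>R p 2 x))"

definition prof :: "cl2 \<times> cl2 \<Rightarrow> profile" where
  "prof v = (\<lambda>i x. rw i x *\<^sub>R rep (comp i v) x)"

lemma comp_emb: "comp i (emb p) = cls (\<lambda>x. inverse (rw i x) *\<^sub>R p i x)"
  using exhaust_2[of i] by (auto simp: comp_def emb_def)

lemma L2_pairsD: "p \<in> L2_pairs \<Longrightarrow> p i \<in> L2 unit_measure"
  and L2_pairsI: "(\<And>i. p i \<in> L2 unit_measure) \<Longrightarrow> p \<in> L2_pairs"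
  by (simp_all add: L2_pairs_def)

lemma prof_L2: "prof v \<in> L2_pairs"
  unfolding prof_def by (intro L2_pairsI L2_scale_continuous rw_cont rep_L2)

lemma scaled_L2: "p \<in> L2_pairs \<Longrightarrow> (\<lambda>x. inverse (rw i x) *\<^sub>R p i x) \<in> L2 unit_measure"
  by (rule L2_scale_continuous[OF rw_inv_cont L2_pairsD])

lemma emb_prof: "emb (prof v) = v"
proof (rule comp_eqI)
  fix i
  have "comp i (emb (prof v)) = cls (rep (comp i v))"
    unfolding comp_emb
  proof (rule cls_cong[OF scaled_L2[OF prof_L2] _ rep_L2])
    show "AE x in unit_measure. inverse (rw i x) *\<^sub>R prof v i x = rep (comp i v) x"
      by (intro AE_I2) (use rw_pos[of _ i] in \<open>auto simp: prof_def less_le\<close>)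
  qed
  then show "comp i (emb (prof v)) = comp i v" by simp
qed

lemma ae_eq_pointwise: "(\<And>i x. x \<in> {0..1} \<Longrightarrow> p i x = q i x) \<Longrightarrow> ae_eq p q"
  unfolding ae_eq_def by (auto intro!: AE_I2)

lemma prof_emb: assumes p: "p \<in> L2_pairs" shows "ae_eq (prof (emb p)) p"
  unfolding ae_eq_def
proof
  fix i
  show "AE x in unit_measure. prof (emb p) i x = p i x"
    using rep_cls[OF scaled_L2[OF p, of i]] AE_space
  proof eventually_elim
    case (elim x)
    then have "rw i x > 0" using rw_pos[of x i] by simp
    then show ?case using elim(1) by (simp add: prof_def comp_emb)
  qed
qed

lemma emb_eq_iff: 
  assumes "p \<in> L2_pairs" "q \<in> L2_pairs" shows "emb p = emb q \<longleftrightarrow> ae_eq p q"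
proof -
  have "comp i (emb p) = comp i (emb q) \<longleftrightarrow> (AE x in unit_measure. p i x = q i x)" for i
    unfolding comp_emb cls_eq_iff[OF scaled_L2[OF assms(1)] scaled_L2[OF assms(2)]]
  proof
    assume "AE x in unit_measure. inverse (rw i x) *\<^sub>R p i x = inverse (rw i x) *\<^sub>R q i x"
    then show "AE x in unit_measure. p i x = q i x"
      using AE_space
    proof eventually_elim
      case (elim x)
      then have "rw i x \<noteq> 0" using rw_pos[of x i] by simp
      then show ?case using elim(1) by simp
    qed
  next
    assume "AE x in unit_measure. p i x = q i x"
    then show "AE x in unit_measure. inverse (rw i x) *\<^sub>R p i x = inverse (rw i x) *\<^sub>R q i x"
      by eventually_elim simp
  qed
  note iff = this
  show ?thesis
  proof
    assume "emb p = emb q"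
    then have "\<And>i. comp i (emb p) = comp i (emb q)" by simp
    then show "ae_eq p q" unfolding ae_eq_def iff by (rule allI)
  next
    assume "ae_eq p q"
    then have "comp i (emb p) = comp i (emb q)" for i unfolding ae_eq_def iff by (rule spec)
    then show "emb p = emb q" by (rule comp_eqI)
  qed
qed

lemma L2_pairs_add: "p \<in> L2_pairs \<Longrightarrow> q \<in> L2_pairs \<Longrightarrow> (\<lambda>i x. p i x + q i x) \<in> L2_pairs"
  and L2_pairs_diff: "p \<in> L2_pairs \<Longrightarrow> q \<in> L2_pairs \<Longrightarrow> (\<lambda>i x. p i x - q i x) \<in> L2_pairs"
  and L2_pairs_cmult: "p \<in> L2_pairs \<Longrightarrow> (\<lambda>i x. c * p i x) \<in> L2_pairs"
  by (rule L2_pairsI, rule L2_add L2_diff L2_cmult; rule L2_pairsD; assumption)+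

lemma emb_add: "p \<in> L2_pairs \<Longrightarrow> q \<in> L2_pairs \<Longrightarrow> emb (\<lambda>i x. p i x + q i x) = emb p + emb q"
proof (rule comp_eqI)
  fix i assume pq: "p \<in> L2_pairs" "q \<in> L2_pairs"
  show "comp i (emb (\<lambda>i x. p i x + q i x)) = comp i (emb p + emb q)"
    unfolding linear_add[OF bounded_linear.linear[OF comp_bounded_linear]] comp_emb scaleR_add_right
    by (rule cls_add[OF scaled_L2[OF pq(1)] scaled_L2[OF pq(2)]])
qed

lemma emb_diff: "p \<in> L2_pairs \<Longrightarrow> q \<in> L2_pairs \<Longrightarrow> emb (\<lambda>i x. p i x - q i x) = emb p - emb q"
proof (rule comp_eqI)
  fix i assume pq: "p \<in> L2_pairs" "q \<in> L2_pairs"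
  show "comp i (emb (\<lambda>i x. p i x - q i x)) = comp i (emb p - emb q)"
    unfolding linear_diff[OF bounded_linear.linear[OF comp_bounded_linear]] comp_emb scaleR_diff_right
    by (rule cls_diff[OF scaled_L2[OF pq(1)] scaled_L2[OF pq(2)]])
qed

definition cscale :: "complex \<Rightarrow> cl2 \<times> cl2 \<Rightarrow> cl2 \<times> cl2" where
  "cscale c v = emb (\<lambda>i x. c * prof v i x)"

lemma emb_cmult: assumes p: "p \<in> L2_pairs" shows "emb (\<lambda>i x. c * p i x) = cscale c (emb p)"
proof -
  have "ae_eq (\<lambda>i x. c * p i x) (\<lambda>i x. c * prof (emb p) i x)"
    unfolding ae_eq_def
  proof
    fix i
    have "AE x in unit_measure. prof (emb p) i x = p i x" using prof_emb[OF p] unfolding ae_eq_def by (rule spec)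
    then show "AE x in unit_measure. c * p i x = c * prof (emb p) i x" by eventually_elim simp
  qed
  then show ?thesis unfolding cscale_def by (rule iffD2[OF emb_eq_iff[OF L2_pairs_cmult[OF p] L2_pairs_cmult[OF prof_L2]]])
qed

lemma cscale_of_real: "cscale (complex_of_real r) v = r *\<^sub>R v"
proof -
  have s: "inverse (rw i x) *\<^sub>R (complex_of_real r * prof v i x) = r *\<^sub>R (inverse (rw i x) *\<^sub>R prof v i x)" for i x
    by (simp add: scaleR_conv_of_real)
  have "cscale (complex_of_real r) v = r *\<^sub>R emb (prof v)"
    unfolding cscale_def emb_def s cls_scaleR[OF scaled_L2[OF prof_L2]] by simp
  then show ?thesis by (simp add: emb_prof)
qed

lemma X_norm_emb: assumes p: "p \<in> L2_pairs" shows "X_norm w p = norm (emb p)"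
proof -
  have "(norm (comp i (emb p)))\<^sup>2 = (LINT x|unit_measure. (cmod (p i x))\<^sup>2 * inverse (w i x))" for i
    unfolding comp_emb norm_cls[OF scaled_L2[OF p]]
    by (rule Bochner_Integration.integral_cong)
      (use rw_sq[of _ i] rw_pos[of _ i] in \<open>auto simp: power_mult_distrib power_inverse less_imp_le\<close>)
  then have "(norm (emb p))\<^sup>2 = (\<Sum>i\<in>UNIV. LINT x|unit_measure. (cmod (p i x))\<^sup>2 * inverse (w i x))"
    by (simp add: norm_comp)
  then have "X_norm w p = sqrt ((norm (emb p))\<^sup>2)" unfolding X_norm_def by (rule arg_cong[where f = sqrt, OF sym])
  then show ?thesis by simp
qed

lemma cscale_bounded_linear: "bounded_linear (cscale c)"
proof (rule bounded_linear_intro[of _ "cmod c"])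
  fix u v :: "cl2 \<times> cl2" and r :: real
  have "cscale c (emb (prof u) + emb (prof v)) = cscale c (emb (prof u)) + cscale c (emb (prof v))"
    unfolding emb_add[OF prof_L2 prof_L2, symmetric] emb_cmult[OF L2_pairs_add[OF prof_L2 prof_L2], symmetric]
      emb_cmult[OF prof_L2, symmetric] emb_add[OF L2_pairs_cmult[OF prof_L2] L2_pairs_cmult[OF prof_L2], symmetric]
    by (simp add: distrib_left)
  then show "cscale c (u + v) = cscale c u + cscale c v" by (simp add: emb_prof)
  have "cscale c (cscale (complex_of_real r) (emb (prof v))) = cscale (complex_of_real r) (cscale c (emb (prof v)))"
    unfolding emb_cmult[OF prof_L2, symmetric] emb_cmult[OF L2_pairs_cmult[OF prof_L2], symmetric]
    by (simp add: mult.left_commute)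
  then show "cscale c (r *\<^sub>R v) = r *\<^sub>R cscale c v" by (simp add: emb_prof cscale_of_real)
  have "(norm (cscale c v))\<^sup>2 = (\<Sum>i\<in>UNIV. (LINT x|unit_measure. (cmod c)\<^sup>2 * (cmod (inverse (rw i x) *\<^sub>R prof v i x))\<^sup>2))"
    unfolding norm_comp cscale_def comp_emb norm_cls[OF scaled_L2[OF L2_pairs_cmult[OF prof_L2]]]
    by (simp add: norm_mult power_mult_distrib mult_ac)
  also have "\<dots> = (cmod c)\<^sup>2 * (norm (emb (prof v)))\<^sup>2"
    unfolding norm_comp[of "emb (prof v)"] comp_emb norm_cls[OF scaled_L2[OF prof_L2]]
    by (simp add: sum_distrib_left)
  finally have "(norm (cscale c v))\<^sup>2 = (norm v * cmod c)\<^sup>2" by (simp add: emb_prof power_mult_distrib mult.commute)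
  then have "norm (cscale c v) = norm v * cmod c" by (rule power2_eq_imp_eq) auto
  then show "norm (cscale c v) \<le> norm v * cmod c" by simp
qed

end

section \<open>The generator in the Hilbert space\<close>

definition other :: "2 \<Rightarrow> 2" where "other i = (if i = 1 then 2 else 1)"

lemma other_simps [simp]: "other 1 = 2" "other 2 = 1" by (simp_all add: other_def)

definition periodic_ac :: "profile \<Rightarrow> profile \<Rightarrow> bool" where
  "periodic_ac u u' \<longleftrightarrow> (\<forall>i. ac_deriv (u i) (u' i) \<and> u' i \<in> L2 unit_measure \<and> u i 0 = u i 1)"

lemma periodic_acD:
  assumes "periodic_ac u u'"
  shows "ac_deriv (u i) (u' i)" "u' i \<in> L2 unit_measure" "u i 0 = u i 1" "continuous_on {0..1} (u i)" "u i \<in> L2 unit_measure"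
proof -
  show ac: "ac_deriv (u i) (u' i)" and "u' i \<in> L2 unit_measure" "u i 0 = u i 1" using assms unfolding periodic_ac_def by blast+
  show "continuous_on {0..1} (u i)" by (rule ac_deriv_continuous[OF ac])
  then show "u i \<in> L2 unit_measure" by (rule continuous_L2)
qed

lemma periodic_ac_linear:
  assumes "periodic_ac u u'" "bounded_linear h"
  shows "periodic_ac (\<lambda>i x. h (u i x)) (\<lambda>i x. h (u' i x))"
  unfolding periodic_ac_def
proof (intro allI conjI)
  fix i
  obtain K where K: "\<And>x. norm (h x) \<le> norm x * K" using bounded_linear.bounded[OF assms(2)] by blast
  note [measurable] = L2D(1)[OF periodic_acD(2)[OF assms(1), of i]]
  have [measurable]: "h \<in> borel_measurable borel"
    by (rule borel_measurable_continuous_onI[OF linear_continuous_on[OF assms(2)]])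
  show "ac_deriv (\<lambda>x. h (u i x)) (\<lambda>x. h (u' i x))" by (rule ac_deriv_linear[OF assms(2) periodic_acD(1)[OF assms(1)]])
  show "(\<lambda>x. h (u' i x)) \<in> L2 unit_measure"
    by (rule L2_bound[OF _ periodic_acD(2)[OF assms(1), of i], of _ K]) (measurable, use K in \<open>simp add: mult.commute\<close>)
  show "h (u i 0) = h (u i 1)" using periodic_acD(3)[OF assms(1), of i] by simp
qed

lemma periodic_ac_add:
  assumes "periodic_ac u u'" "periodic_ac v v'"
  shows "periodic_ac (\<lambda>i x. u i x + v i x) (\<lambda>i x. u' i x + v' i x)"
  unfolding periodic_ac_def
proof (intro allI conjI)
  fix i
  show "ac_deriv (\<lambda>x. u i x + v i x) (\<lambda>x. u' i x + v' i x)"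
    by (rule ac_deriv_add[OF periodic_acD(1)[OF assms(1)] periodic_acD(1)[OF assms(2)]])
  show "(\<lambda>x. u' i x + v' i x) \<in> L2 unit_measure"
    by (rule L2_add[OF periodic_acD(2)[OF assms(1)] periodic_acD(2)[OF assms(2)]])
  show "u i 0 + v i 0 = u i 1 + v i 1" using periodic_acD(3)[OF assms(1), of i] periodic_acD(3)[OF assms(2), of i] by simp
qed

lemma periodic_ac_scale:
  fixes k k' :: "2 \<Rightarrow> real \<Rightarrow> real"
  assumes u: "periodic_ac u u'" and k: "\<And>i. ac_deriv (k i) (k' i)" "\<And>i. continuous_on {0..1} (k' i)" "\<And>i. k i 0 = k i 1"
  shows "periodic_ac (\<lambda>i x. k i x *\<^sub>R u i x) (\<lambda>i x. k i x *\<^sub>R u' i x + k' i x *\<^sub>R u i x)"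
  unfolding periodic_ac_def
proof (intro allI conjI)
  fix i
  show "ac_deriv (\<lambda>x. k i x *\<^sub>R u i x) (\<lambda>x. k i x *\<^sub>R u' i x + k' i x *\<^sub>R u i x)"
    by (rule ac_deriv_scaleR[OF k(1) periodic_acD(1)[OF u]])
  show "(\<lambda>x. k i x *\<^sub>R u' i x + k' i x *\<^sub>R u i x) \<in> L2 unit_measure"
    by (rule L2_add[OF L2_scale_continuous[OF ac_deriv_continuous[OF k(1)] periodic_acD(2)[OF u]]
          L2_scale_continuous[OF k(2) periodic_acD(5)[OF u]]])
  show "k i 0 *\<^sub>R u i 0 = k i 1 *\<^sub>R u i 1" using k(3)[of i] periodic_acD(3)[OF u, of i] by simp
qed

context two_speed
begin

text \<open>
The flux of the steady state.
\<close>
definition J :: "2 \<Rightarrow> real \<Rightarrow> real" where "J i x = b i x * w i x"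

lemma J_cont: "continuous_on {0..1} (J i)" unfolding J_def[abs_def] by (rule continuous_on_mult[OF b_cont w_cont])

lemma J_nz: "x \<in> {0..1} \<Longrightarrow> J i x \<noteq> 0" using b_nz[of x i] w_nz[of x i] by (simp add: J_def)

lemma J_per: "J i 0 = J i 1"
proof -
  have "\<forall>i. b i 0 * w i 0 = b i 1 * w i 1"
    by (insert w_steady, unfold normalized_positive_steady_state_def steady_state_def, elim conjE, assumption)
  then show ?thesis unfolding J_def by (rule spec)
qed

lemma J_DERIV: "x \<in> {0<..<1} \<Longrightarrow> (J i has_real_derivative (w (other i) x - w i x)) (at x)"
proof -
  assume x: "x \<in> {0<..<1}"
  have "\<forall>x\<in>{0<..<1}. ((\<lambda>y. b 1 y * w 1 y) has_real_derivative (- w 1 x + w 2 x)) (at x)"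
    "\<forall>x\<in>{0<..<1}. ((\<lambda>y. b 2 y * w 2 y) has_real_derivative (w 1 x - w 2 x)) (at x)"
    by (insert w_steady, unfold normalized_positive_steady_state_def steady_state_def, elim conjE, assumption)+
  note d = this[THEN bspec, OF x]
  have "(J 1 has_real_derivative (w (other 1) x - w 1 x)) (at x)"
     "(J 2 has_real_derivative (w (other 2) x - w 2 x)) (at x)"
    unfolding J_def[abs_def] by (rule DERIV_cong[OF d(1)], simp, rule DERIV_cong[OF d(2)], simp)
  then show ?thesis using exhaust_2[of i] by (elim disjE) simp_all
qed

definition J' :: "2 \<Rightarrow> real \<Rightarrow> real" where "J' i x = w (other i) x - w i x"

lemma J'_cont: "continuous_on {0..1} (J' i)" unfolding J'_def[abs_def] by (rule continuous_on_diff[OF w_cont w_cont])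

lemma J_ac: "ac_deriv (J i) (J' i)"
  by (rule ac_deriv_C1[OF J_cont J'_cont])
    (use J_DERIV in \<open>simp add: J'_def flip: has_real_derivative_iff_has_vector_derivative\<close>)

text \<open>
Its reciprocal, which turns a flux \<open>u\<close> into the ratio \<open>u / J\<close> of a density to the steady density.
\<close>
definition Ji :: "2 \<Rightarrow> real \<Rightarrow> real" where "Ji i x = inverse (J i x)"
definition Ji' :: "2 \<Rightarrow> real \<Rightarrow> real" where "Ji' i x = - (Ji i x * J' i x * Ji i x)"

lemma Ji_cont: "continuous_on {0..1} (Ji i)"
  unfolding Ji_def[abs_def] by (rule continuous_on_inverse[OF J_cont]) (rule ballI, rule J_nz)

lemma Ji'_cont: "continuous_on {0..1} (Ji' i)"
  unfolding Ji'_def[abs_def] by (rule continuous_on_minus[OF continuous_on_mult[OF continuous_on_mult[OF Ji_cont J'_cont] Ji_cont]])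

lemma Ji_ac: "ac_deriv (Ji i) (Ji' i)"
proof (rule ac_deriv_C1[OF Ji_cont Ji'_cont])
  fix x :: real assume x: "x \<in> {0<..<1}"
  then have "J i x \<noteq> 0" using J_nz by simp
  from DERIV_inverse'[OF J_DERIV[OF x] this]
  show "(Ji i has_vector_derivative Ji' i x) (at x)"
    unfolding has_real_derivative_iff_has_vector_derivative[symmetric] Ji_def[abs_def] Ji'_def J'_def by simp
qed

lemma A_op_other: "A_op b p i x = - weak_deriv (flux b p i) x - p i x + p (other i) x"
  using exhaust_2[of i] by (auto simp: A_op_def)

definition density_of_flux :: "profile \<Rightarrow> profile" where
  "density_of_flux u = (\<lambda>i x. inverse (b i x) *\<^sub>R u i x)"

lemma bi_cont: "continuous_on {0..1} (\<lambda>x. inverse (b i x))"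
  by (rule continuous_on_inverse[OF b_cont]) (rule ballI, rule b_nz)

text \<open>
Membership in the domain is a statement about the fluxes, in terms of the characterization \<open>H1_periodic_iff\<close>.
\<close>
lemma A_dom_iff:
  assumes p: "p \<in> L2_pairs"
  shows "p \<in> A_dom b w \<longleftrightarrow> (\<exists>u u'. periodic_ac u u' \<and> ae_eq p (density_of_flux u))"
proof -
  have fL: "flux b p i \<in> L2 unit_measure" for i
    using L2_scale_continuous[OF b_cont L2_pairsD[OF p], of i] by (simp add: flux_def scaleR_conv_of_real)
  have ae: "(AE x in unit_measure. flux b p i x = u x) \<longleftrightarrow> (AE x in unit_measure. p i x = inverse (b i x) *\<^sub>R u x)" for i u
  proof
    assume "AE x in unit_measure. flux b p i x = u x"
    then show "AE x in unit_measure. p i x = inverse (b i x) *\<^sub>R u x"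
      using AE_space
    proof eventually_elim
      case (elim x)
      then have "b i x \<noteq> 0" using b_nz by simp
      moreover have "u x = b i x *\<^sub>R p i x" using elim(1) by (simp add: flux_def scaleR_conv_of_real)
      ultimately show ?case by simp
    qed
  next
    assume "AE x in unit_measure. p i x = inverse (b i x) *\<^sub>R u x"
    then show "AE x in unit_measure. flux b p i x = u x"
      using AE_space
    proof eventually_elim
      case (elim x)
      then have "b i x \<noteq> 0" using b_nz by simp
      have "flux b p i x = b i x *\<^sub>R p i x" by (simp add: flux_def scaleR_conv_of_real)
      also have "\<dots> = u x" unfolding elim(1) using \<open>b i x \<noteq> 0\<close> by simp
      finally show ?case .
    qed
  qed
  have "p \<in> A_dom b w \<longleftrightarrow> (\<forall>i. \<exists>u u'. ac_deriv u u' \<and> u' \<in> L2 unit_measure \<and> u 0 = u 1 \<and> (AE x in unit_measure. p i x = inverse (b i x) *\<^sub>R u x))"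
    unfolding A_dom_def X_space_eq mem_Collect_eq H1_periodic_iff ae using p fL by blast
  also have "\<dots> \<longleftrightarrow> (\<exists>u u'. periodic_ac u u' \<and> ae_eq p (density_of_flux u))"
  proof
    assume "\<forall>i. \<exists>u u'. ac_deriv u u' \<and> u' \<in> L2 unit_measure \<and> u 0 = u 1 \<and> (AE x in unit_measure. p i x = inverse (b i x) *\<^sub>R u x)"
    from choice[OF this] obtain u where "\<forall>i. \<exists>u'. ac_deriv (u i) u' \<and> u' \<in> L2 unit_measure \<and> u i 0 = u i 1 \<and> (AE x in unit_measure. p i x = inverse (b i x) *\<^sub>R u i x)" by blast
    from choice[OF this] obtain u' where *: "\<forall>i. ac_deriv (u i) (u' i) \<and> u' i \<in> L2 unit_measure \<and> u i 0 = u i 1 \<and> (AE x in unit_measure. p i x = inverse (b i x) *\<^sub>R u i x)" by blast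
    have "periodic_ac u u'" unfolding periodic_ac_def using * by blast
    moreover have "ae_eq p (density_of_flux u)" unfolding ae_eq_def density_of_flux_def using * by blast
    ultimately show "\<exists>u u'. periodic_ac u u' \<and> ae_eq p (density_of_flux u)" by blast
  next
    assume "\<exists>u u'. periodic_ac u u' \<and> ae_eq p (density_of_flux u)"
    then obtain u u' where "periodic_ac u u'" "ae_eq p (density_of_flux u)" by blast
    then show "\<forall>i. \<exists>u u'. ac_deriv u u' \<and> u' \<in> L2 unit_measure \<and> u 0 = u 1 \<and> (AE x in unit_measure. p i x = inverse (b i x) *\<^sub>R u x)"
      unfolding periodic_ac_def ae_eq_def density_of_flux_def by blast
  qed
  finally show ?thesis .
qed

lemma A_op_flux:
  assumes p: "p \<in> L2_pairs" and u: "periodic_ac u u'" and ae: "ae_eq p (density_of_flux u)"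
  shows "A_op b p \<in> L2_pairs"
    and "ae_eq (A_op b p) (\<lambda>i x. - u' i x - density_of_flux u i x + density_of_flux u (other i) x)"
proof -
  have dom: "p \<in> A_dom b w" using A_dom_iff[OF p] u ae by blast
  have H: "flux b p i \<in> H1" for i using dom unfolding A_dom_def by blast
  have aei: "AE x in unit_measure. p i x = density_of_flux u i x" for i using ae unfolding ae_eq_def by (rule spec)
  have fu: "AE x in unit_measure. flux b p i x = u i x" for i
    using aei[of i] AE_space
  proof eventually_elim
    case (elim x)
    then have "b i x \<noteq> 0" using b_nz by simp
    have "flux b p i x = b i x *\<^sub>R p i x" by (simp add: flux_def scaleR_conv_of_real)
    also have "\<dots> = u i x" unfolding elim(1) density_of_flux_def using \<open>b i x \<noteq> 0\<close> by simp
    finally show ?case .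
  qed
  note wd = weak_deriv_eq[OF H periodic_acD(1)[OF u] fu]
  show "A_op b p \<in> L2_pairs"
  proof (rule L2_pairsI)
    fix i
    have "(\<lambda>x. - weak_deriv (flux b p i) x - p i x + p (other i) x) \<in> L2 unit_measure"
      by (rule L2_add[OF L2_diff[OF L2_uminus[OF wd(1)] L2_pairsD[OF p]] L2_pairsD[OF p]])
    then show "A_op b p i \<in> L2 unit_measure" by (simp add: A_op_other[abs_def])
  qed
  show "ae_eq (A_op b p) (\<lambda>i x. - u' i x - density_of_flux u i x + density_of_flux u (other i) x)"
    unfolding ae_eq_def
  proof
    fix i
    show "AE x in unit_measure. A_op b p i x = - u' i x - density_of_flux u i x + density_of_flux u (other i) x"
      using wd(2)[of i] aei[of i] aei[of "other i"] by eventually_elim (simp add: A_op_other)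
  qed
qed

text \<open>
The operator, transported to the product Hilbert space.
\<close>
definition DH :: "(cl2 \<times> cl2) set" where "DH = {v. prof v \<in> A_dom b w}"
definition AH :: "cl2 \<times> cl2 \<Rightarrow> cl2 \<times> cl2" where "AH v = emb (A_op b (prof v))"

text \<open>
In terms of the ratios \<open>f\<close> of a density to the steady density the operator has no zeroth order term except for the
difference of the two ratios; \<open>A_ratio\<close> is its expression, by \<open>AH_of_ratio\<close>.
\<close>
definition of_ratio :: "profile \<Rightarrow> profile" where "of_ratio f = (\<lambda>i x. w i x *\<^sub>R f i x)"
definition A_ratio :: "profile \<Rightarrow> profile \<Rightarrow> profile" where
  "A_ratio f f' = (\<lambda>i x. - (J i x *\<^sub>R f' i x) + w (other i) x *\<^sub>R (f (other i) x - f i x))"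

lemma density_L2: "periodic_ac u u' \<Longrightarrow> density_of_flux u \<in> L2_pairs"
  unfolding density_of_flux_def by (rule L2_pairsI, rule L2_scale_continuous[OF bi_cont periodic_acD(5)])

lemma of_ratio_L2: "(\<And>i. f i \<in> L2 unit_measure) \<Longrightarrow> of_ratio f \<in> L2_pairs"
  unfolding of_ratio_def by (rule L2_pairsI, rule L2_scale_continuous[OF w_cont])

lemma flux_profile_L2: "periodic_ac u u' \<Longrightarrow>
  (\<lambda>i x. - u' i x - density_of_flux u i x + density_of_flux u (other i) x) \<in> L2_pairs"
  by (rule L2_pairsI, rule L2_add[OF L2_diff[OF L2_uminus[OF periodic_acD(2)] L2_pairsD[OF density_L2]] L2_pairsD[OF density_L2]])

lemma DH_iff_flux: "v \<in> DH \<longleftrightarrow> (\<exists>u u'. periodic_ac u u' \<and> v = emb (density_of_flux u))"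
proof -
  have "v = emb (density_of_flux u) \<longleftrightarrow> ae_eq (prof v) (density_of_flux u)" if "periodic_ac u u'" for u u'
    using emb_eq_iff[OF prof_L2 density_L2[OF that], of v] by (simp add: emb_prof)
  then show ?thesis unfolding DH_def mem_Collect_eq A_dom_iff[OF prof_L2] by blast
qed

lemma AH_flux:
  assumes u: "periodic_ac u u'"
  shows "AH (emb (density_of_flux u)) = emb (\<lambda>i x. - u' i x - density_of_flux u i x + density_of_flux u (other i) x)"
  unfolding AH_def
  by (rule iffD2[OF emb_eq_iff[OF A_op_flux(1)[OF prof_L2 u prof_emb[OF density_L2[OF u]]] flux_profile_L2[OF u]]
      A_op_flux(2)[OF prof_L2 u prof_emb[OF density_L2[OF u]]]])

lemma flux_of_ratio:
  assumes f: "periodic_ac f f'"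
  shows "\<exists>u u'. periodic_ac u u' \<and> density_of_flux u = (\<lambda>i x. inverse (b i x) *\<^sub>R J i x *\<^sub>R f i x) \<and>
     (\<forall>i x. u' i x = J i x *\<^sub>R f' i x + J' i x *\<^sub>R f i x)"
  by (rule exI[of _ "\<lambda>i x. J i x *\<^sub>R f i x"], rule exI[of _ "\<lambda>i x. J i x *\<^sub>R f' i x + J' i x *\<^sub>R f i x"])
    (use periodic_ac_scale[OF f J_ac J'_cont J_per] in \<open>simp add: density_of_flux_def\<close>)

lemma emb_cong: "(\<And>i x. x \<in> {0..1} \<Longrightarrow> p i x = q i x) \<Longrightarrow> p \<in> L2_pairs \<Longrightarrow> q \<in> L2_pairs \<Longrightarrow> emb p = emb q"
  by (rule iffD2[OF emb_eq_iff]) (auto intro: ae_eq_pointwise)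

lemma A_ratio_L2:
  assumes "\<And>i. f i \<in> L2 unit_measure" "\<And>i. f' i \<in> L2 unit_measure" shows "A_ratio f f' \<in> L2_pairs"
  unfolding A_ratio_def
  by (rule L2_pairsI, rule L2_add[OF L2_uminus[OF L2_scale_continuous[OF J_cont assms(2)]]
        L2_scale_continuous[OF w_cont L2_diff[OF assms(1) assms(1)]]])

lemma AH_of_ratio:
  assumes f: "periodic_ac f f'"
  shows "emb (of_ratio f) \<in> DH" "AH (emb (of_ratio f)) = emb (A_ratio f f')"
proof -
  obtain u u' where u: "periodic_ac u u'" "density_of_flux u = (\<lambda>i x. inverse (b i x) *\<^sub>R J i x *\<^sub>R f i x)"
    "\<And>i x. u' i x = J i x *\<^sub>R f' i x + J' i x *\<^sub>R f i x" using flux_of_ratio[OF f] by blast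
  have d: "density_of_flux u i x = of_ratio f i x" if "x \<in> {0..1}" for i x
    using b_nz[OF that, of i] by (simp add: u(2) of_ratio_def J_def)
  have e: "emb (density_of_flux u) = emb (of_ratio f)"
    by (rule emb_cong[OF d density_L2[OF u(1)] of_ratio_L2[OF periodic_acD(5)[OF f]]])
  show "emb (of_ratio f) \<in> DH" unfolding DH_iff_flux e[symmetric] using u(1) by blast
  show "AH (emb (of_ratio f)) = emb (A_ratio f f')"
    unfolding e[symmetric] AH_flux[OF u(1)]
  proof (rule emb_cong[OF _ flux_profile_L2[OF u(1)] A_ratio_L2[OF periodic_acD(5)[OF f] periodic_acD(2)[OF f]]])
    fix i x assume x: "x \<in> {0..(1::real)}"
    show "- u' i x - density_of_flux u i x + density_of_flux u (other i) x = A_ratio f f' i x"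
      unfolding d[OF x] u(3) by (simp add: A_ratio_def of_ratio_def J'_def algebra_simps)
  qed
qed

text \<open>
Since the steady flux is continuously differentiable, periodic and without zeros, periodic absolutely continuous
fluxes and ratios correspond to each other.
\<close>
lemma DH_iff: "v \<in> DH \<longleftrightarrow> (\<exists>f f'. periodic_ac f f' \<and> v = emb (of_ratio f))"
proof
  assume "v \<in> DH"
  then obtain u u' where u: "periodic_ac u u'" "v = emb (density_of_flux u)" unfolding DH_iff_flux by blast
  have Jip: "Ji i 0 = Ji i 1" for i using J_per[of i] by (simp add: Ji_def)
  define f where "f = (\<lambda>i x. Ji i x *\<^sub>R u i x)"
  have f: "periodic_ac f (\<lambda>i x. Ji i x *\<^sub>R u' i x + Ji' i x *\<^sub>R u i x)"
    unfolding f_def by (rule periodic_ac_scale[OF u(1) Ji_ac Ji'_cont Jip])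
  have "emb (density_of_flux u) = emb (of_ratio f)"
  proof (rule emb_cong[OF _ density_L2[OF u(1)] of_ratio_L2[OF periodic_acD(5)[OF f]]])
    fix i x assume x: "x \<in> {0..(1::real)}"
    show "density_of_flux u i x = of_ratio f i x"
      using b_nz[OF x, of i] w_nz[OF x, of i] by (simp add: density_of_flux_def of_ratio_def f_def Ji_def J_def)
  qed
  then show "\<exists>f f'. periodic_ac f f' \<and> v = emb (of_ratio f)" using f u(2) by blast
next
  assume "\<exists>f f'. periodic_ac f f' \<and> v = emb (of_ratio f)"
  then show "v \<in> DH" using AH_of_ratio(1) by blast
qed

lemma inner_emb:
  assumes p: "p \<in> L2_pairs" and q: "q \<in> L2_pairs"
  shows "inner (emb p) (emb q) = (\<Sum>i\<in>UNIV. LINT x|unit_measure. inverse (w i x) * (p i x \<bullet> q i x))"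
  unfolding inner_comp
proof (rule sum.cong[OF refl])
  fix i :: 2
  show "inner (comp i (emb p)) (comp i (emb q)) = (LINT x|unit_measure. inverse (w i x) * (p i x \<bullet> q i x))"
    unfolding comp_emb inner_cls[OF scaled_L2[OF p] scaled_L2[OF q]]
  proof (rule Bochner_Integration.integral_cong[OF refl])
    fix x assume "x \<in> space unit_measure"
    then have "rw i x * rw i x = w i x" using rw_sq[of x i] by (simp add: power2_eq_square)
    then show "inverse (rw i x) *\<^sub>R p i x \<bullet> inverse (rw i x) *\<^sub>R q i x = inverse (w i x) * (p i x \<bullet> q i x)"
      by (simp flip: inverse_mult_distrib mult.assoc)
  qed
qed

text \<open>
The transport terms are, up to total derivatives of periodic functions \<open>J i |f i|\<^sup>2\<close>, equal to \<open>1/2 J i' |f i|\<^sup>2\<close>; here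
\<open>J i' = w j - w i\<close>, and the four quadratic terms combine to a square.
\<close>
lemma energy_identity:
  assumes f: "periodic_ac f f'"
  shows "inner (AH (emb (of_ratio f))) (emb (of_ratio f)) = - (1/2) * (LINT x|unit_measure. (w 1 x + w 2 x) * (cmod (f 1 x - f 2 x))\<^sup>2)"
proof -
  have fL: "f i \<in> L2 unit_measure" "f' i \<in> L2 unit_measure" for i using periodic_acD[OF f] by blast+
  define e where "e i x = J i x *\<^sub>R (f i x \<bullet> f' i x + f' i x \<bullet> f i x) + J' i x *\<^sub>R (f i x \<bullet> f i x)" for i x
  have e: "ac_deriv (\<lambda>x. J i x *\<^sub>R (f i x \<bullet> f i x)) (e i)" for i
    unfolding e_def[abs_def] by (rule ac_deriv_scaleR[OF J_ac ac_deriv_inner[OF periodic_acD(1)[OF f] periodic_acD(1)[OF f]]])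
  have ei: "integrable unit_measure (e i)" for i using ac_derivD(1)[OF e] by (simp add: integrable_unit_iff)
  have e0: "(LINT x|unit_measure. e i x) = 0" for i
    using ac_deriv_integral[OF e, of i] LINT_unit[OF ei, of i] J_per[of i] periodic_acD(3)[OF f, of i] by simp
  define h where "h i x = inverse (w i x) * (A_ratio f f' i x \<bullet> of_ratio f i x)" for i x
  have hi: "integrable unit_measure (h i)" for i
  proof -
    have "(\<lambda>x. inverse (w i x) *\<^sub>R A_ratio f f' i x) \<in> L2 unit_measure"
      by (rule L2_scale_continuous[OF continuous_on_inverse[OF w_cont] L2_pairsD[OF A_ratio_L2[OF fL]]]) (rule ballI, rule w_nz)
    from L2_integrable_inner[OF this L2_pairsD[where i = i, OF of_ratio_L2[OF fL(1)]]] show ?thesis by (simp add: h_def[abs_def])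
  qed
  have "inner (AH (emb (of_ratio f))) (emb (of_ratio f)) = (LINT x|unit_measure. h 1 x) + (LINT x|unit_measure. h 2 x)"
    unfolding AH_of_ratio(2)[OF f] inner_emb[OF A_ratio_L2[OF fL] of_ratio_L2[OF fL(1)]] h_def by (simp add: UNIV_2)
  also have "\<dots> = (LINT x|unit_measure. h 1 x + h 2 x)" using hi by simp
  also have "\<dots> = (LINT x|unit_measure. - (1/2) * (e 1 x + e 2 x) + - (1/2) * ((w 1 x + w 2 x) * (cmod (f 1 x - f 2 x))\<^sup>2))"
  proof (rule Bochner_Integration.integral_cong[OF refl])
    fix x assume "x \<in> space unit_measure"
    then have x: "x \<in> {0..1}" by simp
    have h: "h i x = (- (J i x *\<^sub>R f' i x) + w (other i) x *\<^sub>R (f (other i) x - f i x)) \<bullet> f i x" for i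
      using w_nz[OF x, of i] by (simp add: h_def A_ratio_def of_ratio_def)
    show "h 1 x + h 2 x = - (1/2) * (e 1 x + e 2 x) + - (1/2) * ((w 1 x + w 2 x) * (cmod (f 1 x - f 2 x))\<^sup>2)"
      unfolding h e_def J'_def other_simps power2_norm_eq_inner
      by (simp add: inner_diff_left inner_diff_right inner_add_left inner_commute algebra_simps)
  qed
  also have "\<dots> = - (1/2) * ((LINT x|unit_measure. e 1 x) + (LINT x|unit_measure. e 2 x)) + - (1/2) * (LINT x|unit_measure. (w 1 x + w 2 x) * (cmod (f 1 x - f 2 x))\<^sup>2)"
  proof -
    have "continuous_on {0..1} (\<lambda>x. (w 1 x + w 2 x) * (cmod (f 1 x - f 2 x))\<^sup>2)"
      by (intro continuous_intros w_cont periodic_acD(4)[OF f])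
    from continuous_integrable_unit[OF this] ei show ?thesis by simp
  qed
  finally show ?thesis by (simp add: e0)
qed

end

section \<open>The resolvent equation\<close>

text \<open>
Integrating \<open>(|u|\<^sup>2)' = 2 (F, u) - 2 l c |u|\<^sup>2\<close> over the period leaves only the terms without derivative. The bound improves as \<open>l\<close>
grows, which makes the coupling a small perturbation.
\<close>
lemma periodic_solution_bound:
  assumes u: "ac_deriv u (\<lambda>x. F x - (l * c x) *\<^sub>R u x)" and per: "u 0 = u 1" and F: "F \<in> L2 unit_measure"
    and c: "continuous_on {0..1} c" and \<sigma>: "\<sigma> = 1 \<or> \<sigma> = - 1" "\<And>x. x \<in> {0..1} \<Longrightarrow> \<beta> \<le> \<sigma> * c x"
    and pos: "0 < l" "0 < \<beta>"
  shows "l * \<beta> * norm (cls u) \<le> norm (cls F)"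
proof -
  have uc: "continuous_on {0..1} u" by (rule ac_deriv_continuous[OF u])
  have uL: "u \<in> L2 unit_measure" by (rule continuous_L2[OF uc])
  let ?u' = "\<lambda>x. F x - (l * c x) *\<^sub>R u x"
  have ac: "ac_deriv (\<lambda>x. u x \<bullet> u x) (\<lambda>x. u x \<bullet> ?u' x + ?u' x \<bullet> u x)" by (rule ac_deriv_inner[OF u u])
  have c2: "continuous_on {0..1} (\<lambda>x. c x * (cmod (u x))\<^sup>2)" by (intro continuous_intros c uc)
  have cu: "integrable unit_measure (\<lambda>x. c x * (cmod (u x))\<^sup>2)" by (rule continuous_integrable_unit[OF c2])
  have Fu: "integrable unit_measure (\<lambda>x. F x \<bullet> u x)" by (rule L2_integrable_inner[OF F uL])
  have "(LINT x|unit_measure. u x \<bullet> ?u' x + ?u' x \<bullet> u x) = 0"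
    using LINT_unit[of "\<lambda>x. u x \<bullet> ?u' x + ?u' x \<bullet> u x"] ac_derivD(1)[OF ac] ac_deriv_integral[OF ac] per
    by (simp add: integrable_unit_iff)
  moreover have "(LINT x|unit_measure. u x \<bullet> ?u' x + ?u' x \<bullet> u x) = (LINT x|unit_measure. 2 * (F x \<bullet> u x) - (2 * l) * (c x * (cmod (u x))\<^sup>2))"
    by (rule Bochner_Integration.integral_cong[OF refl])
      (simp add: inner_diff_left inner_diff_right power2_norm_eq_inner inner_commute)
  ultimately have eq: "l * (LINT x|unit_measure. c x * (cmod (u x))\<^sup>2) = (LINT x|unit_measure. F x \<bullet> u x)"
    using Fu cu by simp
  have "\<beta> * (norm (cls u))\<^sup>2 = (LINT x|unit_measure. \<beta> * (cmod (u x))\<^sup>2)" by (simp add: norm_cls[OF uL])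
  also have "\<dots> \<le> (LINT x|unit_measure. \<sigma> * (c x * (cmod (u x))\<^sup>2))"
  proof (rule integral_mono)
    show "integrable unit_measure (\<lambda>x. \<beta> * (cmod (u x))\<^sup>2)" using L2D(2)[OF uL] by simp
    show "integrable unit_measure (\<lambda>x. \<sigma> * (c x * (cmod (u x))\<^sup>2))" using cu by simp
    fix x assume "x \<in> space unit_measure"
    then have "\<beta> * (cmod (u x))\<^sup>2 \<le> (\<sigma> * c x) * (cmod (u x))\<^sup>2" using \<sigma>(2) by (intro mult_right_mono) auto
    then show "\<beta> * (cmod (u x))\<^sup>2 \<le> \<sigma> * (c x * (cmod (u x))\<^sup>2)" by (simp add: mult.assoc)
  qed
  finally have "l * (\<beta> * (norm (cls u))\<^sup>2) \<le> l * (\<sigma> * (LINT x|unit_measure. c x * (cmod (u x))\<^sup>2))"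
    using pos by (intro mult_left_mono) auto
  also have "\<dots> = \<sigma> * (LINT x|unit_measure. F x \<bullet> u x)" unfolding eq[symmetric] by simp
  also have "\<dots> = \<sigma> * inner (cls F) (cls u)" by (simp add: inner_cls[OF F uL])
  also have "\<dots> \<le> \<bar>inner (cls F) (cls u)\<bar>" using \<sigma>(1) by auto
  also have "\<dots> \<le> norm (cls F) * norm (cls u)" by (rule Cauchy_Schwarz_ineq2)
  finally have le: "(l * \<beta> * norm (cls u)) * norm (cls u) \<le> norm (cls F) * norm (cls u)" by (simp add: power2_eq_square mult_ac)
  show ?thesis
  proof (cases "norm (cls u) = 0")
    case False
    then have "0 < norm (cls u)" by simp
    with le show ?thesis by (simp only: mult_le_cancel_right_pos)
  qed simp
qed

text \<open>
Variation of constants; the periodicity condition determines the constant because the integrating factor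
does not return to its initial value.
\<close>
lemma periodic_solution_exists:
  assumes F: "F \<in> L2 unit_measure" and c: "continuous_on {0..1} c"
    and \<sigma>: "\<sigma> = 1 \<or> \<sigma> = - 1" "\<And>x. x \<in> {0..1} \<Longrightarrow> \<beta> \<le> \<sigma> * c x" and pos: "0 < l" "0 < \<beta>"
  shows "\<exists>u. ac_deriv u (\<lambda>x. F x - (l * c x) *\<^sub>R u x) \<and> u 0 = u 1"
proof -
  define m where "m x = integral {0..x} (\<lambda>x. l * c x)" for x
  have cl: "continuous_on {0..1} (\<lambda>x. l * c x)" by (intro continuous_intros c)
  have dm: "(m has_real_derivative l * c x) (at x within {0..1})" if "x \<in> {0..1}" for x
    unfolding m_def by (rule primitive_DERIV[OF cl that])
  have cscale: "continuous_on {0..1} m" by (rule DERIV_continuous_on[OF dm])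
  have m0: "m 0 = 0" by (simp add: m_def)
  have "m 1 \<noteq> 0"
  proof -
    have "integral {0..1} (\<lambda>x :: real. l * \<beta>) \<le> integral {0..1} (\<lambda>x. \<sigma> * (l * c x))"
    proof (rule Henstock_Kurzweil_Integration.integral_le)
      show "(\<lambda>x. \<sigma> * (l * c x)) integrable_on {0..1}" by (intro integrable_continuous_real continuous_intros c)
      fix x :: real assume "x \<in> {0..1}"
      then have "l * \<beta> \<le> l * (\<sigma> * c x)" using \<sigma>(2) pos by (intro mult_left_mono) auto
      then show "l * \<beta> \<le> \<sigma> * (l * c x)" by (simp add: mult_ac)
    qed (rule integrable_continuous_real, rule continuous_on_const)
    moreover have "integral {0..1} (\<lambda>x. \<sigma> * (l * c x)) = \<sigma> * m 1" unfolding m_def by (rule integral_mult_right)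
    moreover have "0 < l * \<beta>" using pos by simp
    ultimately show ?thesis by auto
  qed
  define Em where "Em x = exp (- m x)" for x
  have dEm: "(Em has_real_derivative - (l * c x) * Em x) (at x within {0..1})" if "x \<in> {0..1}" for x
    unfolding Em_def by (rule DERIV_cong[OF DERIV_chain2[OF DERIV_exp DERIV_minus[OF dm[OF that]]]]) simp
  have cEm: "continuous_on {0..1} Em" by (rule DERIV_continuous_on[OF dEm])
  have aEm: "ac_deriv Em (\<lambda>x. - (l * c x) * Em x)"
  proof (rule ac_deriv_C1[OF cEm])
    show "continuous_on {0..1} (\<lambda>x. - (l * c x) * Em x)" by (intro continuous_intros c cEm)
    fix x :: real assume x: "x \<in> {0<..<1}"
    then show "(Em has_vector_derivative - (l * c x) * Em x) (at x)"
      unfolding has_real_derivative_iff_has_vector_derivative[symmetric] using DERIV_interior[OF dEm x] by simp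
  qed
  have EF: "(\<lambda>x. exp (m x) *\<^sub>R F x) absolutely_integrable_on {0..1}"
    using L2_integrable[OF L2_scale_continuous[OF continuous_on_exp[OF cscale] F]] by (simp add: integrable_unit_iff)
  define I where "I x = integral {0..x} (\<lambda>x. exp (m x) *\<^sub>R F x)" for x
  \<comment> \<open>The solution of \<open>k = Em 1 (k + I 1)\<close>, the periodicity condition.\<close>
  define k where "k = (1 / (1 - Em 1)) *\<^sub>R (Em 1 *\<^sub>R I 1)"
  have aI: "ac_deriv (\<lambda>x. k + I x) (\<lambda>x. exp (m x) *\<^sub>R F x)" unfolding I_def by (rule ac_deriv_primitive[OF EF])
  define u where "u x = Em x *\<^sub>R (k + I x)" for x
  have "ac_deriv u (\<lambda>x. F x - (l * c x) *\<^sub>R u x)"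
  proof (rule ac_deriv_cong[OF ac_deriv_scaleR[OF aEm aI]])
    fix x :: real
    have "Em x * exp (m x) = 1" by (simp add: Em_def flip: exp_add)
    then show "Em x *\<^sub>R exp (m x) *\<^sub>R F x + (- (l * c x) * Em x) *\<^sub>R (k + I x) = F x - (l * c x) *\<^sub>R u x"
      by (simp add: u_def)
  qed (simp add: u_def)
  moreover have "u 0 = u 1"
  proof -
    have E1: "Em 1 \<noteq> 1" using \<open>m 1 \<noteq> 0\<close> by (simp add: Em_def)
    have "u 1 = Em 1 *\<^sub>R k + Em 1 *\<^sub>R I 1" by (simp add: u_def scaleR_add_right)
    also have "Em 1 *\<^sub>R I 1 = (1 - Em 1) *\<^sub>R k" using E1 by (simp add: k_def)
    also have "Em 1 *\<^sub>R k + (1 - Em 1) *\<^sub>R k = k" by (simp flip: scaleR_add_left)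
    also have "k = u 0" by (simp add: u_def Em_def m0 I_def)
    finally show ?thesis by simp
  qed
  ultimately show ?thesis by blast
qed

context two_speed
begin

lemma norm_comp_le: "norm (comp i v) \<le> norm v"
  by (cases v) (auto simp: comp_def norm_fst_le norm_snd_le)

text \<open>
In terms of the fluxes \<open>u\<close> the equation is \<open>u i' + l c i u i = F i\<close> with \<open>c i = 1 / b i\<close>, where \<open>F i\<close> contains the coupling. The
solution operator has Lipschitz constant \<open>1 / (l B)\<close> by \<open>periodic_solution_bound\<close> and the coupling \<open>2 M\<close>, so that for large \<open>l\<close>
Banach's fixed point theorem applies.
\<close>
lemma A_surjective: "\<exists>L. \<forall>l\<ge>L. \<forall>g. \<exists>v\<in>DH. l *\<^sub>R v - AH v = g"
proof -
  define c where "c i x = inverse (b i x)" for i x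
  have cc: "continuous_on {0..1} (c i)" for i unfolding c_def[abs_def] by (rule bi_cont)
  have "\<exists>\<sigma>. (\<sigma> = 1 \<or> \<sigma> = - 1) \<and> (\<forall>x\<in>{0..1}. 0 < \<sigma> * c i x)" for i
  proof -
    have nz: "c i x \<noteq> 0" if "x \<in> {0..1}" for x using b_nz[OF that, of i] by (simp add: c_def)
    obtain s where "s = 1 \<or> s = - 1" "\<And>x. x \<in> {0..1} \<Longrightarrow> 0 < s * c i x"
      by (rule nonvanishing_sign[OF cc[of i] nz]) auto
    then show ?thesis by (intro exI[of _ s] conjI ballI)
  qed
  then have "\<forall>i. \<exists>\<sigma>. (\<sigma> = 1 \<or> \<sigma> = - 1) \<and> (\<forall>x\<in>{0..1}. 0 < \<sigma> * c i x)" by (rule allI)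
  from choice[OF this] obtain \<sigma> where s: "\<forall>i. (\<sigma> i = 1 \<or> \<sigma> i = - 1) \<and> (\<forall>x\<in>{0..1}. 0 < \<sigma> i * c i x)" by (rule exE)
  have \<sigma>: "\<sigma> i = 1 \<or> \<sigma> i = - 1" "x \<in> {0..1} \<Longrightarrow> 0 < \<sigma> i * c i x" for i x
    using spec[OF s, of i] by blast+
  have "\<exists>\<beta>>0. \<forall>x\<in>{0..1}. \<beta> \<le> \<sigma> i * c i x" for i
  proof -
    have "continuous_on {0..1} (\<lambda>x. \<sigma> i * c i x)" by (intro continuous_intros cc)
    from continuous_attains_inf[OF _ _ this]
    obtain y where "y \<in> {0..1}" "\<forall>x\<in>{0..1}. \<sigma> i * c i y \<le> \<sigma> i * c i x" by auto
    then show ?thesis using \<sigma>(2)[of y i] by (intro exI[of _ "\<sigma> i * c i y"] conjI)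
  qed
  then have "\<forall>i. \<exists>\<beta>>0. \<forall>x\<in>{0..1}. \<beta> \<le> \<sigma> i * c i x" by (rule allI)
  from choice[OF this] obtain \<beta> where s: "\<forall>i. 0 < \<beta> i \<and> (\<forall>x\<in>{0..1}. \<beta> i \<le> \<sigma> i * c i x)" by (rule exE)
  have \<beta>: "0 < \<beta> i" "x \<in> {0..1} \<Longrightarrow> \<beta> i \<le> \<sigma> i * c i x" for i x using spec[OF s, of i] by blast+
  have "\<exists>K>0. \<forall>f. norm (mul (c i) f) \<le> K * norm f" for i
    using bounded_linear.pos_bounded[OF mul_bounded_linear[OF cc[of i]]] unfolding mult.commute[of "norm _"] .
  then have "\<forall>i. \<exists>K>0. \<forall>f. norm (mul (c i) f) \<le> K * norm f" by (rule allI)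
  from choice[OF this] obtain K where s: "\<forall>i. 0 < K i \<and> (\<forall>f. norm (mul (c i) f) \<le> K i * norm f)" by (rule exE)
  have K: "0 < K i" "norm (mul (c i) f) \<le> K i * norm f" for i f using spec[OF s, of i] by blast+
  define M where "M = K 1 + K 2"
  define B where "B = min (\<beta> 1) (\<beta> 2)"
  have KM: "K i \<le> M" and BB: "B \<le> \<beta> i" for i
    using K(1)[of 1] K(1)[of 2] exhaust_2[of i] by (auto simp: M_def B_def)
  have M0: "0 < M" and B0: "0 < B" using K(1) \<beta>(1) by (auto simp: M_def B_def add_pos_pos)
  \<comment> \<open>The factor eight gives each of the two components the Lipschitz constant 1/4, hence the pair 1/2.\<close>
  have step: "\<exists>v\<in>DH. l *\<^sub>R v - AH v = g" if l: "8 * M / B + 1 \<le> l" for l g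
  proof -
    have "0 \<le> 8 * M / B" using M0 B0 by (intro divide_nonneg_pos) auto
    then have l0: "0 < l" using l by linarith
    define h where "h i = rep (mul (rw i) (comp i g))" for i
    have hL: "h i \<in> L2 unit_measure" for i unfolding h_def by (rule rep_L2)
    define sol where "sol i F = (SOME u. ac_deriv u (\<lambda>x. rep F x - (l * c i x) *\<^sub>R u x) \<and> u 0 = u 1)" for i F
    have sol: "ac_deriv (sol i F) (\<lambda>x. rep F x - (l * c i x) *\<^sub>R sol i F x)" "sol i F 0 = sol i F 1" for i F
    proof -
      have "\<exists>u. ac_deriv u (\<lambda>x. rep F x - (l * c i x) *\<^sub>R u x) \<and> u 0 = u 1"
        by (rule periodic_solution_exists[OF rep_L2 cc \<sigma>(1) \<beta>(2) l0 \<beta>(1)])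
      from someI_ex[OF this] show "ac_deriv (sol i F) (\<lambda>x. rep F x - (l * c i x) *\<^sub>R sol i F x)" "sol i F 0 = sol i F 1"
        unfolding sol_def by blast+
    qed
    have solL: "sol i F \<in> L2 unit_measure" for i F by (rule continuous_L2[OF ac_deriv_continuous[OF sol(1)]])
    have lip: "norm (cls (sol i F) - cls (sol i G)) \<le> norm (F - G) / (l * B)" for i F G
    proof -
      \<comment> \<open>Differences of solutions solve the same equation, so the bound for one solution gives the Lipschitz constant.\<close>
      have ac: "ac_deriv (\<lambda>x. sol i F x - sol i G x) (\<lambda>x. (rep F x - rep G x) - (l * c i x) *\<^sub>R (sol i F x - sol i G x))"
        by (rule ac_deriv_cong[OF ac_deriv_diff[OF sol(1)[of i F] sol(1)[of i G]]]) (auto simp: algebra_simps)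
      have "l * \<beta> i * norm (cls (\<lambda>x. sol i F x - sol i G x)) \<le> norm (cls (\<lambda>x. rep F x - rep G x))"
        by (rule periodic_solution_bound[OF ac _ L2_diff[OF rep_L2 rep_L2] cc \<sigma>(1) \<beta>(2) l0 \<beta>(1)])
          (use sol(2)[of i F] sol(2)[of i G] in simp_all)
      then have *: "l * \<beta> i * norm (cls (sol i F) - cls (sol i G)) \<le> norm (F - G)"
        by (simp add: cls_diff[OF solL solL] cls_diff[OF rep_L2 rep_L2])
      have "l * B * norm (cls (sol i F) - cls (sol i G)) \<le> l * \<beta> i * norm (cls (sol i F) - cls (sol i G))"
        using BB l0 by (intro mult_right_mono mult_left_mono) auto
      with * have "norm (cls (sol i F) - cls (sol i G)) * (l * B) \<le> norm (F - G)" by (simp add: mult_ac)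
      then show ?thesis using l0 B0 by (simp add: pos_le_divide_eq)
    qed
    define F where "F i U = cls (h i) - mul (c i) (comp i U) + mul (c (other i)) (comp (other i) U)" for i U
    define \<Theta> where "\<Theta> U = (cls (sol 1 (F 1 U)), cls (sol 2 (F 2 U)))" for U
    have compT: "comp i (\<Theta> U) = cls (sol i (F i U))" for i U using exhaust_2[of i] by (auto simp: \<Theta>_def comp_def)
    have lipF: "norm (F i U - F i V) \<le> 2 * M * norm (U - V)" for i U V
    proof -
      have nc: "norm (mul (c j) (comp j U - comp j V)) \<le> M * norm (U - V)" for j
      proof -
        have "norm (comp j U - comp j V) \<le> norm (U - V)"
          using norm_comp_le[of j "U - V"] by (simp only: linear_diff[OF bounded_linear.linear[OF comp_bounded_linear]])
        then have "K j * norm (comp j U - comp j V) \<le> M * norm (U - V)" using KM[of j] K(1)[of j] by (intro mult_mono) auto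
        then show ?thesis using K(2)[of j "comp j U - comp j V"] by linarith
      qed
      note lin = linear_diff[OF bounded_linear.linear[OF mul_bounded_linear[OF cc]]]
      have "F i U - F i V = mul (c (other i)) (comp (other i) U - comp (other i) V) - mul (c i) (comp i U - comp i V)"
        by (simp add: F_def lin)
      also have "norm \<dots> \<le> M * norm (U - V) + M * norm (U - V)"
        by (rule order_trans[OF norm_triangle_ineq4 add_mono[OF nc nc]])
      finally show ?thesis by simp
    qed
    have "\<exists>!U. \<Theta> U = U"
    proof (rule banach_fix_type[where c = "1/2"])
      have "dist (\<Theta> U) (\<Theta> V) \<le> 1/2 * dist U V" for U V
      proof -
        have "norm (comp i (\<Theta> U - \<Theta> V)) \<le> norm (U - V) / 4" for i
        proof -
          have "norm (comp i (\<Theta> U - \<Theta> V)) = norm (cls (sol i (F i U)) - cls (sol i (F i V)))"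
            by (simp add: linear_diff[OF bounded_linear.linear[OF comp_bounded_linear]] compT)
          also have "\<dots> \<le> norm (F i U - F i V) / (l * B)" by (rule lip)
          also have "\<dots> \<le> (2 * M * norm (U - V)) / (l * B)" using l0 B0 by (intro divide_right_mono lipF) auto
          also have "\<dots> \<le> norm (U - V) / 4"
          proof -
            have "8 * M / B \<le> l" using l by linarith
            then have "8 * M \<le> l * B" using B0 by (simp only: pos_divide_le_eq)
            then have "8 * M * norm (U - V) \<le> (l * B) * norm (U - V)" by (intro mult_right_mono) auto
            then show ?thesis using l0 B0 by (simp add: pos_divide_le_eq mult_ac)
          qed
          finally show ?thesis .
        qed
        from this[of 1] this[of 2] have "norm (fst (\<Theta> U - \<Theta> V)) \<le> norm (U - V) / 4" "norm (snd (\<Theta> U - \<Theta> V)) \<le> norm (U - V) / 4"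
          by (simp_all add: comp_def)
        moreover have "norm X \<le> norm (fst X) + norm (snd X)" for X :: "cl2 \<times> cl2"
          by (cases X) (simp add: norm_Pair_le)
        from this[of "\<Theta> U - \<Theta> V"] have "norm (\<Theta> U - \<Theta> V) \<le> norm (fst (\<Theta> U - \<Theta> V)) + norm (snd (\<Theta> U - \<Theta> V))" .
        ultimately have "norm (\<Theta> U - \<Theta> V) \<le> 1/2 * norm (U - V)" by linarith
        then show ?thesis by (simp only: dist_norm)
      qed
      then show "\<forall>x. \<forall>y. dist (\<Theta> x) (\<Theta> y) \<le> 1/2 * dist x y" by blast
    qed auto
    then obtain U where U: "\<Theta> U = U" by blast
    define u where "u i = sol i (F i U)" for i
    have uL: "u i \<in> L2 unit_measure" for i unfolding u_def by (rule solL)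
    have Ui: "comp i U = cls (u i)" for i using compT[of i U] by (simp add: U u_def)
    define u' where "u' i x = rep (F i U) x - (l * c i x) *\<^sub>R u i x" for i x
    have lc: "continuous_on {0..1} (\<lambda>x. l * c i x)" for i by (intro continuous_intros cc)
    have per: "periodic_ac u u'"
      unfolding periodic_ac_def
    proof (intro allI conjI)
      fix i
      show "ac_deriv (u i) (u' i)" unfolding u'_def[abs_def] u_def by (rule sol(1))
      show "u' i \<in> L2 unit_measure" unfolding u'_def[abs_def] by (rule L2_diff[OF rep_L2 L2_scale_continuous[OF lc uL]])
      show "u i 0 = u i 1" unfolding u_def by (rule sol(2))
    qed
    define v where "v = emb (density_of_flux u)"
    have "v \<in> DH" unfolding DH_iff_flux v_def using per by blast
    moreover have "l *\<^sub>R v - AH v = g"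
    proof -
      have pL: "density_of_flux u \<in> L2_pairs" by (rule density_L2[OF per])
      have lpL: "(\<lambda>i x. complex_of_real l * density_of_flux u i x) \<in> L2_pairs" by (rule L2_pairs_cmult[OF pL])
      have "l *\<^sub>R v - AH v = emb (\<lambda>i x. complex_of_real l * density_of_flux u i x - (- u' i x - density_of_flux u i x + density_of_flux u (other i) x))"
        unfolding v_def AH_flux[OF per] emb_diff[OF lpL flux_profile_L2[OF per]] emb_cmult[OF pL] cscale_of_real ..
      also have "\<dots> = emb (prof g)"
      proof (rule iffD2[OF emb_eq_iff[OF L2_pairs_diff[OF lpL flux_profile_L2[OF per]] prof_L2]])
        show "ae_eq (\<lambda>i x. complex_of_real l * density_of_flux u i x - (- u' i x - density_of_flux u i x + density_of_flux u (other i) x)) (prof g)"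
          unfolding ae_eq_def
        proof
          fix i
          have mc: "mul (c j) (comp j U) = cls (density_of_flux u j)" for j
            unfolding Ui mul_cls[OF cc uL] density_of_flux_def c_def ..
          have Fi: "F i U = cls (\<lambda>x. h i x - density_of_flux u i x + density_of_flux u (other i) x)"
            unfolding F_def mc cls_add[OF L2_diff[OF hL L2_pairsD[OF pL]] L2_pairsD[OF pL]] cls_diff[OF hL L2_pairsD[OF pL]] ..
          have 1: "AE x in unit_measure. rep (F i U) x = h i x - density_of_flux u i x + density_of_flux u (other i) x"
            unfolding Fi by (rule rep_cls[OF L2_add[OF L2_diff[OF hL L2_pairsD[OF pL]] L2_pairsD[OF pL]]])
          have 2: "AE x in unit_measure. h i x = prof g i x"
            unfolding h_def mul_def prof_def by (rule rep_cls[OF L2_scale_continuous[OF rw_cont rep_L2]])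
          show "AE x in unit_measure. complex_of_real l * density_of_flux u i x - (- u' i x - density_of_flux u i x + density_of_flux u (other i) x) = prof g i x"
            using 1 2
          proof eventually_elim
            case (elim x)
            have "complex_of_real l * density_of_flux u i x = (l * c i x) *\<^sub>R u i x"
              by (simp add: density_of_flux_def c_def scaleR_conv_of_real)
            then show ?case unfolding u'_def elim(1) elim(2)[symmetric] by simp
          qed
        qed
      qed
      finally show ?thesis by (simp add: emb_prof)
    qed
    ultimately show ?thesis by blast
  qed
  then show ?thesis by blast
qed

lemma cscale_DH:
  assumes v: "v \<in> DH" shows "cscale c v \<in> DH" "AH (cscale c v) = cscale c (AH v)"
proof -
  obtain f f' where f: "periodic_ac f f'" "v = emb (of_ratio f)" using v unfolding DH_iff by blast
  note fL = periodic_acD(5)[OF f(1)] periodic_acD(2)[OF f(1)]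
  have cf: "periodic_ac (\<lambda>i x. c * f i x) (\<lambda>i x. c * f' i x)"
    by (rule periodic_ac_linear[OF f(1) bounded_linear_mult_right])
  have e: "cscale c v = emb (of_ratio (\<lambda>i x. c * f i x))"
  proof -
    have "cscale c v = emb (\<lambda>i x. c * of_ratio f i x)" unfolding f(2) by (rule emb_cmult[OF of_ratio_L2[OF fL(1)], symmetric])
    also have "(\<lambda>i x. c * of_ratio f i x) = of_ratio (\<lambda>i x. c * f i x)"
      by (simp add: of_ratio_def fun_eq_iff scaleR_conv_of_real mult.left_commute)
    finally show ?thesis .
  qed
  show "cscale c v \<in> DH" unfolding e by (rule AH_of_ratio(1)[OF cf])
  show "AH (cscale c v) = cscale c (AH v)"
  proof -
    have "AH (cscale c v) = emb (A_ratio (\<lambda>i x. c * f i x) (\<lambda>i x. c * f' i x))" unfolding e by (rule AH_of_ratio(2)[OF cf])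
    also have "A_ratio (\<lambda>i x. c * f i x) (\<lambda>i x. c * f' i x) = (\<lambda>i x. c * A_ratio f f' i x)"
      by (simp add: A_ratio_def fun_eq_iff scaleR_conv_of_real algebra_simps)
    also have "emb \<dots> = cscale c (AH v)"
      unfolding f(2) AH_of_ratio(2)[OF f(1)] by (rule emb_cmult[OF A_ratio_L2[OF fL]])
    finally show ?thesis .
  qed
qed

lemma DH_add:
  assumes v: "v \<in> DH" and u: "u \<in> DH" shows "v + u \<in> DH" "AH (v + u) = AH v + AH u"
proof -
  obtain f f' where f: "periodic_ac f f'" "v = emb (of_ratio f)" using v unfolding DH_iff by blast
  obtain h h' where h: "periodic_ac h h'" "u = emb (of_ratio h)" using u unfolding DH_iff by blast
  note fL = periodic_acD(5)[OF f(1)] periodic_acD(2)[OF f(1)]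
  note hL = periodic_acD(5)[OF h(1)] periodic_acD(2)[OF h(1)]
  note s = periodic_ac_add[OF f(1) h(1)]
  have e: "v + u = emb (of_ratio (\<lambda>i x. f i x + h i x))"
  proof -
    have "v + u = emb (\<lambda>i x. of_ratio f i x + of_ratio h i x)"
      unfolding f(2) h(2) by (rule emb_add[OF of_ratio_L2[OF fL(1)] of_ratio_L2[OF hL(1)], symmetric])
    also have "(\<lambda>i x. of_ratio f i x + of_ratio h i x) = of_ratio (\<lambda>i x. f i x + h i x)" by (simp add: of_ratio_def fun_eq_iff scaleR_add_right)
    finally show ?thesis .
  qed
  show "v + u \<in> DH" unfolding e by (rule AH_of_ratio(1)[OF s])
  show "AH (v + u) = AH v + AH u"
  proof -
    have "AH (v + u) = emb (A_ratio (\<lambda>i x. f i x + h i x) (\<lambda>i x. f' i x + h' i x))" unfolding e by (rule AH_of_ratio(2)[OF s])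
    also have "A_ratio (\<lambda>i x. f i x + h i x) (\<lambda>i x. f' i x + h' i x) = (\<lambda>i x. A_ratio f f' i x + A_ratio h h' i x)"
      by (simp add: A_ratio_def fun_eq_iff algebra_simps)
    also have "emb \<dots> = AH v + AH u"
      unfolding f(2) h(2) AH_of_ratio(2)[OF f(1)] AH_of_ratio(2)[OF h(1)] by (rule emb_add[OF A_ratio_L2[OF fL] A_ratio_L2[OF hL]])
    finally show ?thesis .
  qed
qed

sublocale gen: m_dissipative DH AH
proof
  have sc: "r *\<^sub>R v \<in> DH" "AH (r *\<^sub>R v) = r *\<^sub>R AH v" if "v \<in> DH" for r v
    using cscale_DH[OF that, of "complex_of_real r"] by (simp_all only: cscale_of_real)
  have "periodic_ac (\<lambda>i x. 0) (\<lambda>i x. 0)" by (simp add: periodic_ac_def ac_deriv_const L2_zero)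
  from AH_of_ratio(1)[OF this] have "0 *\<^sub>R emb (of_ratio (\<lambda>i x. 0)) \<in> DH" by (rule sc)
  then have z: "0 \<in> DH" by simp
  show "subspace DH" by (rule subspaceI[OF z DH_add(1) sc(1)])
  show "AH (x + y) = AH x + AH y" if "x \<in> DH" "y \<in> DH" for x y by (rule DH_add(2)[OF that])
  show "AH (c *\<^sub>R x) = c *\<^sub>R AH x" if "x \<in> DH" for x c by (rule sc(2)[OF that])
  show "inner (AH x) x \<le> 0" if x: "x \<in> DH" for x
  proof -
    obtain f f' where f: "periodic_ac f f'" "x = emb (of_ratio f)" using x unfolding DH_iff by blast
    have "0 \<le> (LINT x|unit_measure. (w 1 x + w 2 x) * (cmod (f 1 x - f 2 x))\<^sup>2)"
    proof (rule Bochner_Integration.integral_nonneg)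
      fix x assume "x \<in> space unit_measure"
      then have "0 < w 1 x" "0 < w 2 x" using w_pos by auto
      then show "0 \<le> (w 1 x + w 2 x) * (cmod (f 1 x - f 2 x))\<^sup>2" by simp
    qed
    then show ?thesis unfolding f(2) energy_identity[OF f(1)] by simp
  qed
  show "\<exists>\<Lambda>. \<forall>l\<ge>\<Lambda>. \<forall>f. \<exists>x\<in>DH. l *\<^sub>R x - AH x = f" by (rule A_surjective)
qed

end

section \<open>Integration, primitives and constants as bounded operators\<close>

definition cl2_integral :: "cl2 \<Rightarrow> complex" where "cl2_integral F = (LINT x|unit_measure. rep F x)"

lemma cl2_integral_cls: 
  assumes f: "f \<in> L2 unit_measure" shows "cl2_integral (cls f) = (LINT x|unit_measure. f x)"
  unfolding cl2_integral_def
  by (rule integral_cong_AE[OF L2D(1)[OF rep_L2] L2D(1)[OF f] rep_cls[OF f]])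

lemma cl2_integral_bounded_linear: "bounded_linear cl2_integral"
proof (rule bounded_linear_intro[of _ 1])
  fix F G :: cl2 and r :: real
  note i = L2_integrable[OF rep_L2]
  have "cl2_integral (cls (rep F) + cls (rep G)) = cl2_integral (cls (rep F)) + cl2_integral (cls (rep G))"
    unfolding cls_add[OF rep_L2 rep_L2, symmetric] cl2_integral_cls[OF L2_add[OF rep_L2 rep_L2]] cl2_integral_cls[OF rep_L2]
    by (rule Bochner_Integration.integral_add[OF i i])
  then show "cl2_integral (F + G) = cl2_integral F + cl2_integral G" by simp
  have "cl2_integral (r *\<^sub>R cls (rep F)) = r *\<^sub>R cl2_integral (cls (rep F))"
    unfolding cls_scaleR[OF rep_L2, symmetric] cl2_integral_cls[OF L2_scaleR[OF rep_L2]] cl2_integral_cls[OF rep_L2] by simp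
  then show "cl2_integral (r *\<^sub>R F) = r *\<^sub>R cl2_integral F" by simp
  have "norm (cl2_integral F) \<le> (LINT x|unit_measure. cmod (rep F x))" unfolding cl2_integral_def by (rule integral_norm_bound)
  also have "\<dots> \<le> norm (cls (rep F))" by (rule L2_L1_bound[OF rep_L2])
  finally show "norm (cl2_integral F) \<le> norm F * 1" by simp
qed

definition const_cl2 :: "complex \<Rightarrow> cl2" where "const_cl2 z = cls (\<lambda>x. z)"

lemma norm_const_cl2: "norm (const_cl2 z) = norm z"
proof -
  have "(norm (const_cl2 z))\<^sup>2 = (norm z)\<^sup>2" unfolding const_cl2_def norm_cls[OF L2_const] by simp
  then show ?thesis by (rule power2_eq_imp_eq) auto
qed

lemma const_cl2_bounded_linear: "bounded_linear const_cl2"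
proof (rule bounded_linear_intro[of _ 1])
  show "const_cl2 (x + y) = const_cl2 x + const_cl2 y" for x y unfolding const_cl2_def by (rule cls_add[OF L2_const L2_const])
  show "const_cl2 (r *\<^sub>R x) = r *\<^sub>R const_cl2 x" for r x unfolding const_cl2_def by (rule cls_scaleR[OF L2_const])
  show "norm (const_cl2 x) \<le> norm x * 1" for x by (simp add: norm_const_cl2)
qed

definition primitive_cl2 :: "cl2 \<Rightarrow> cl2" where "primitive_cl2 F = cls (\<lambda>x. integral {0..x} (rep F))"

lemma L2_abs_integrable: "f \<in> L2 unit_measure \<Longrightarrow> f absolutely_integrable_on {0..1}"
  using L2_integrable by (simp add: integrable_unit_iff)

lemma primitive_continuous: "f \<in> L2 unit_measure \<Longrightarrow> continuous_on {0..1} (\<lambda>x. integral {0..x} f)"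
  using ac_deriv_continuous[OF ac_deriv_primitive[OF L2_abs_integrable, of f 0]] by simp

lemma primitive_L2: "f \<in> L2 unit_measure \<Longrightarrow> (\<lambda>x. integral {0..x} f) \<in> L2 unit_measure"
  by (rule continuous_L2[OF primitive_continuous])

text \<open>
Evaluation of a primitive at a point is bounded in terms of the square norm, by way of \<open>L2_L1_bound\<close>.
\<close>
lemma primitive_bound:
  assumes f: "f \<in> L2 unit_measure" and x: "x \<in> {0..1}"
  shows "norm (integral {0..x} f) \<le> norm (cls f)"
proof -
  have ai: "f absolutely_integrable_on {0..1}" by (rule L2_abs_integrable[OF f])
  then have fi: "f integrable_on {0..1}" and ni: "(\<lambda>x. norm (f x)) integrable_on {0..1}" by (auto simp: absolutely_integrable_on_def)
  have sub: "{0..x} \<subseteq> {0..1}" using x by auto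
  have "norm (integral {0..x} f) \<le> integral {0..x} (\<lambda>x. norm (f x))"
    by (rule Henstock_Kurzweil_Integration.integral_norm_bound_integral[OF integrable_on_subinterval[OF fi sub] integrable_on_subinterval[OF ni sub]]) simp
  also have "\<dots> \<le> integral {0..1} (\<lambda>x. norm (f x))"
    by (rule integral_subset_le[OF sub integrable_on_subinterval[OF ni sub] ni]) simp
  also have "\<dots> = (LINT x|unit_measure. cmod (f x))"
    by (rule LINT_unit[symmetric]) (use L2_integrable[OF f] in simp)
  also have "\<dots> \<le> norm (cls f)" by (rule L2_L1_bound[OF f])
  finally show ?thesis .
qed

lemma primitive_cong_AE:
  assumes f: "f \<in> L2 unit_measure" and g: "g \<in> L2 unit_measure" and e: "cls f = cls g" and x: "x \<in> {0..1}"
  shows "integral {0..x} f = integral {0..x} g"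
proof -
  have sub: "{0..x} \<subseteq> {0..1}" using x by auto
  have fi: "f integrable_on {0..x}" "g integrable_on {0..x}"
    by (rule integrable_on_subinterval[OF _ sub]; use L2_abs_integrable[OF f] L2_abs_integrable[OF g] in \<open>simp add: absolutely_integrable_on_def\<close>)+
  have "integral {0..x} f - integral {0..x} g = integral {0..x} (\<lambda>x. f x - g x)"
    by (rule Henstock_Kurzweil_Integration.integral_diff[OF fi, symmetric])
  also have "norm \<dots> \<le> norm (cls (\<lambda>x. f x - g x))" by (rule primitive_bound[OF L2_diff[OF f g] x])
  also have "\<dots> = 0" unfolding cls_diff[OF f g] e by simp
  finally show ?thesis by simp
qed

lemma primitive_cl2_cls:
  assumes f: "f \<in> L2 unit_measure" shows "primitive_cl2 (cls f) = cls (\<lambda>x. integral {0..x} f)"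
  unfolding primitive_cl2_def
  by (rule cls_cong[OF primitive_L2[OF rep_L2] _ primitive_L2[OF f]])
    (rule AE_I2, rule primitive_cong_AE[OF rep_L2 f cls_rep], simp)

lemma primitive_cl2_bounded_linear: "bounded_linear primitive_cl2"
proof (rule bounded_linear_intro[of _ 1])
  have sub: "f integrable_on {0..x}" if "f \<in> L2 unit_measure" "x \<in> {0..1}" for f :: "real \<Rightarrow> complex" and x
    by (rule integrable_on_subinterval[of _ "{0..1}"]) (use L2_abs_integrable[OF that(1)] that(2) in \<open>auto simp: absolutely_integrable_on_def\<close>)
  fix F G :: cl2 and r :: real
  have "primitive_cl2 (cls (rep F) + cls (rep G)) = primitive_cl2 (cls (rep F)) + primitive_cl2 (cls (rep G))"
    unfolding cls_add[OF rep_L2 rep_L2, symmetric] primitive_cl2_cls[OF L2_add[OF rep_L2 rep_L2]] primitive_cl2_cls[OF rep_L2]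
      cls_add[OF primitive_L2[OF rep_L2] primitive_L2[OF rep_L2], symmetric]
    by (rule cls_cong[OF primitive_L2[OF L2_add[OF rep_L2 rep_L2]] _ L2_add[OF primitive_L2[OF rep_L2] primitive_L2[OF rep_L2]]])
      (rule AE_I2, rule integral_add; rule sub[OF rep_L2], simp)
  then show "primitive_cl2 (F + G) = primitive_cl2 F + primitive_cl2 G" by simp
  have "primitive_cl2 (r *\<^sub>R cls (rep F)) = r *\<^sub>R primitive_cl2 (cls (rep F))"
    unfolding cls_scaleR[OF rep_L2, symmetric] primitive_cl2_cls[OF L2_scaleR[OF rep_L2]] primitive_cl2_cls[OF rep_L2]
      cls_scaleR[OF primitive_L2[OF rep_L2], symmetric] by simp
  then show "primitive_cl2 (r *\<^sub>R F) = r *\<^sub>R primitive_cl2 F" by simp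
  have "norm (primitive_cl2 F) \<le> norm F * norm (cls (\<lambda>x. 1))"
    unfolding primitive_cl2_def
    by (rule norm_cls_le[OF primitive_L2[OF rep_L2] L2_const norm_ge_zero]) (rule AE_I2, use primitive_bound[OF rep_L2, of _ F] in simp)
  also have "norm (cls (\<lambda>x. 1)) = 1" using norm_const_cl2[of 1] by (simp add: const_cl2_def)
  finally show "norm (primitive_cl2 F) \<le> norm F * 1" .
qed

lemma inner_mul:
  assumes "continuous_on {0..1} a" "f \<in> L2 unit_measure" "g \<in> L2 unit_measure"
  shows "inner (mul a (cls f)) (cls g) = (LINT x|unit_measure. a x * (f x \<bullet> g x))"
  unfolding mul_cls[OF assms(1,2)] inner_cls[OF L2_scale_continuous[OF assms(1,2)] assms(3)] by simp

lemma inner_mul_sym: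
  assumes a: "continuous_on {0..1} a" shows "inner (mul a F) G = inner (mul a G) F"
  using inner_mul[OF a rep_L2 rep_L2, of F G] inner_mul[OF a rep_L2 rep_L2, of G F] by (simp add: inner_commute)

lemma bounded_bilinear_add:
  assumes A: "bounded_bilinear A" and B: "bounded_bilinear B"
  shows "bounded_bilinear (\<lambda>x y. A x y + B x y)"
proof -
  interpret A: bounded_bilinear A by (rule A)
  interpret B: bounded_bilinear B by (rule B)
  obtain K where K: "\<And>x y. norm (A x y) \<le> norm x * norm y * K" using A.bounded by blast
  obtain L where L: "\<And>x y. norm (B x y) \<le> norm x * norm y * L" using B.bounded by blast
  show ?thesis
  proof
    show "\<exists>K. \<forall>a b. norm (A a b + B a b) \<le> norm a * norm b * K"
    proof (intro exI[of _ "K + L"] allI)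
      fix a b
      have "norm (A a b + B a b) \<le> norm (A a b) + norm (B a b)" by (rule norm_triangle_ineq)
      then show "norm (A a b + B a b) \<le> norm a * norm b * (K + L)" using K[of a b] L[of a b] by (simp add: distrib_left)
    qed
  qed (simp_all add: A.add_left B.add_left A.add_right B.add_right A.scaleR_left B.scaleR_left A.scaleR_right B.scaleR_right scaleR_add_right)
qed

lemma bounded_bilinear_scale:
  assumes A: "bounded_bilinear A" shows "bounded_bilinear (\<lambda>x y. r * (A x y :: real))"
proof -
  interpret A: bounded_bilinear A by (rule A)
  obtain K where K: "\<And>x y. norm (A x y) \<le> norm x * norm y * K" using A.bounded by blast
  show ?thesis
  proof
    show "\<exists>K. \<forall>a b. norm (r * A a b) \<le> norm a * norm b * K"
    proof (intro exI[of _ "\<bar>r\<bar> * K"] allI)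
      fix a b
      have "\<bar>r\<bar> * norm (A a b) \<le> \<bar>r\<bar> * (norm a * norm b * K)" by (intro mult_left_mono K) simp
      then show "norm (r * A a b) \<le> norm a * norm b * (\<bar>r\<bar> * K)" by (simp add: abs_mult mult_ac)
    qed
  qed (simp_all add: A.add_left A.add_right A.scaleR_left A.scaleR_right algebra_simps)
qed

section \<open>The Lyapunov form\<close>

lemma C1_unit_mult: "C1_unit f \<Longrightarrow> C1_unit g \<Longrightarrow> C1_unit (\<lambda>x. f x * g x)"
proof -
  assume f: "C1_unit f" and g: "C1_unit g"
  obtain f' where f': "\<forall>x\<in>{0..1}. (f has_real_derivative f' x) (at x within {0..1})" "continuous_on {0..1} f'" using f unfolding C1_unit_def by blast
  obtain g' where g': "\<forall>x\<in>{0..1}. (g has_real_derivative g' x) (at x within {0..1})" "continuous_on {0..1} g'" using g unfolding C1_unit_def by blast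
  have "continuous_on {0..1} (\<lambda>x. f' x * g x + g' x * f x)"
    by (intro continuous_intros f'(2) g'(2) C1_unit_continuous[OF f] C1_unit_continuous[OF g])
  then show "C1_unit (\<lambda>x. f x * g x)" unfolding C1_unit_def
    by (intro exI[of _ "\<lambda>x. f' x * g x + g' x * f x"] conjI ballI DERIV_mult bspec[OF f'(1)] bspec[OF g'(1)])
qed

lemma C1_unit_diff: "C1_unit f \<Longrightarrow> C1_unit g \<Longrightarrow> C1_unit (\<lambda>x. f x - g x)"
proof -
  assume f: "C1_unit f" and g: "C1_unit g"
  obtain f' where f': "\<forall>x\<in>{0..1}. (f has_real_derivative f' x) (at x within {0..1})" "continuous_on {0..1} f'" using f unfolding C1_unit_def by blast
  obtain g' where g': "\<forall>x\<in>{0..1}. (g has_real_derivative g' x) (at x within {0..1})" "continuous_on {0..1} g'" using g unfolding C1_unit_def by blast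
  have "continuous_on {0..1} (\<lambda>x. f' x - g' x)" by (intro continuous_intros f'(2) g'(2))
  then show "C1_unit (\<lambda>x. f x - g x)" unfolding C1_unit_def
    by (intro exI[of _ "\<lambda>x. f' x - g' x"] conjI ballI DERIV_diff bspec[OF f'(1)] bspec[OF g'(1)])
qed

lemma C1_unit_ac: "C1_unit f \<Longrightarrow> \<exists>f'. continuous_on {0..1} f' \<and> ac_deriv f f'"
proof -
  assume f: "C1_unit f"
  obtain f' where f': "\<forall>x\<in>{0..1}. (f has_real_derivative f' x) (at x within {0..1})" "continuous_on {0..1} f'" using f unfolding C1_unit_def by blast
  have "ac_deriv f f'"
  proof (rule ac_deriv_C1[OF C1_unit_continuous[OF f] f'(2)])
    fix x :: real assume x: "x \<in> {0<..<1}"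
    then have "x \<in> {0..1}" by simp
    from DERIV_interior[OF bspec[OF f'(1) this] x] show "(f has_vector_derivative f' x) (at x)"
      by (simp add: has_real_derivative_iff_has_vector_derivative)
  qed
  with f'(2) show ?thesis by blast
qed

locale distinct_speeds = two_speed +
  assumes distinct: "\<exists>x\<in>{0..1}. b 1 x \<noteq> b 2 x"
begin

text \<open>
The weights of the Lyapunov form. The function \<open>cutoff_gap\<close> vanishes at both ends, which removes boundary terms although the speeds
need not be periodic; \<open>k\<close> is nonnegative and, as the speeds differ somewhere, not identically zero, so its weighted mean \<open>kbar\<close> is positive.
The function \<open>m\<close> is the periodic primitive of \<open>s (k - kbar)\<close>.
\<close>
definition s :: "real \<Rightarrow> real" where "s x = inverse (b 1 x)"
definition \<tau> :: real where "\<tau> = integral {0..1} s"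
definition cutoff_gap :: "real \<Rightarrow> real" where "cutoff_gap x = x * (1 - x) * (b 1 x - b 2 x)"
definition k :: "real \<Rightarrow> real" where "k x = cutoff_gap x * (b 1 x - b 2 x)"
definition k' :: "real \<Rightarrow> real" where "k' = (SOME f'. continuous_on {0..1} f' \<and> ac_deriv k f')"
definition ob' :: "real \<Rightarrow> real" where "ob' = (SOME f'. continuous_on {0..1} f' \<and> ac_deriv (\<lambda>x. cutoff_gap x * b 2 x) f')"
definition kbar :: real where "kbar = integral {0..1} (\<lambda>x. s x * k x) / \<tau>"
definition m :: "real \<Rightarrow> real" where "m x = integral {0..x} (\<lambda>x. s x * (k x - kbar))"

lemma s_cont: "continuous_on {0..1} s" unfolding s_def[abs_def] by (rule bi_cont)

lemma cutoff_gap_C1: "C1_unit cutoff_gap"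
proof -
  have "C1_unit (\<lambda>x. x)" unfolding C1_unit_def by (intro exI[of _ "\<lambda>x. 1"]) (auto intro!: derivative_eq_intros)
  moreover have "C1_unit (\<lambda>x. 1)" unfolding C1_unit_def by (intro exI[of _ "\<lambda>x. 0"]) auto
  ultimately have "C1_unit (\<lambda>x. x * (1 - x) * (b 1 x - b 2 x))"
    by (intro C1_unit_mult C1_unit_diff b_C1)
  then show ?thesis by (simp add: cutoff_gap_def[abs_def])
qed

lemma k_C1: "C1_unit k" unfolding k_def[abs_def] by (intro C1_unit_mult C1_unit_diff b_C1 cutoff_gap_C1)

lemma cutoff_gap_cont: "continuous_on {0..1} cutoff_gap" and k_cont: "continuous_on {0..1} k"
  by (rule C1_unit_continuous[OF cutoff_gap_C1] C1_unit_continuous[OF k_C1])+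

lemma k'_cont: "continuous_on {0..1} k'" and k_ac: "ac_deriv k k'"
  using someI_ex[OF C1_unit_ac[OF k_C1]] unfolding k'_def by blast+

lemma ob'_cont: "continuous_on {0..1} ob'" and ob_ac: "ac_deriv (\<lambda>x. cutoff_gap x * b 2 x) ob'"
  using someI_ex[OF C1_unit_ac[OF C1_unit_mult[OF cutoff_gap_C1 b_C1]]] unfolding ob'_def by blast+

lemma ends: "k 0 = 0" "k 1 = 0" "cutoff_gap 0 = 0" "cutoff_gap 1 = 0" by (simp_all add: k_def cutoff_gap_def)

lemma s_sign: obtains \<sigma> \<beta> where "\<sigma> = 1 \<or> \<sigma> = - 1" "0 < \<beta>" "\<And>x. x \<in> {0..1} \<Longrightarrow> \<beta> \<le> \<sigma> * s x"
proof -
  have nz: "s x \<noteq> 0" if "x \<in> {0..1}" for x using b_nz[OF that, of 1] by (simp add: s_def)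
  obtain \<sigma> where \<sigma>: "\<sigma> = 1 \<or> \<sigma> = - 1" "\<And>x. x \<in> {0..1} \<Longrightarrow> 0 < \<sigma> * s x"
    by (rule nonvanishing_sign[OF s_cont nz]) auto
  have "continuous_on {0..1} (\<lambda>x. \<sigma> * s x)" by (intro continuous_intros s_cont)
  from continuous_attains_inf[OF _ _ this]
  obtain y where "y \<in> {0..1}" "\<forall>x\<in>{0..1}. \<sigma> * s y \<le> \<sigma> * s x" by auto
  then show thesis using \<sigma> that[of \<sigma> "\<sigma> * s y"] by auto
qed

lemma tau_nz: "\<tau> \<noteq> 0" and kbar_pos: "0 < kbar"
proof -
  obtain \<sigma> \<beta> where \<sigma>: "\<sigma> = 1 \<or> \<sigma> = - 1" "0 < \<beta>" "\<And>x. x \<in> {0..1} \<Longrightarrow> \<beta> \<le> \<sigma> * s x" by (rule s_sign) auto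
  have pos: "0 < \<sigma> * s x" if "x \<in> {0..1}" for x using \<sigma>(2) \<sigma>(3)[OF that] by linarith
  have int_pos: "0 < integral {0..1} g" if g: "continuous_on {0..1} g" and nn: "\<And>x. x \<in> {0..1} \<Longrightarrow> 0 \<le> g x" and p: "\<exists>x\<in>{0..1}. g x \<noteq> 0" for g :: "real \<Rightarrow> real"
  proof -
    have "integral (cbox 0 1) g \<noteq> 0"
    proof
      assume "integral (cbox 0 1) g = 0"
      then have "\<forall>x\<in>cbox 0 1. g x = 0" using g nn by (intro integral_cbox_eq_0_iff[THEN iffD1]) auto
      then show False using p by auto
    qed
    moreover have "0 \<le> integral {0..1} g"
      by (rule Henstock_Kurzweil_Integration.integral_nonneg[OF integrable_continuous_real[OF g]]) (rule nn)
    ultimately show ?thesis by simp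
  qed
  have t: "0 < \<sigma> * \<tau>"
  proof -
    have "0 < integral {0..1} (\<lambda>x. \<sigma> * s x)"
    proof (rule int_pos)
      show "continuous_on {0..1} (\<lambda>x. \<sigma> * s x)" by (intro continuous_intros s_cont)
      show "0 \<le> \<sigma> * s x" if "x \<in> {0..1}" for x using pos[OF that] by simp
      show "\<exists>x\<in>{0..1}. \<sigma> * s x \<noteq> 0" using pos[of 0] by (intro bexI[of _ 0]) auto
    qed
    then show ?thesis by (simp add: \<tau>_def)
  qed
  then show "\<tau> \<noteq> 0" by auto
  have sk: "0 < \<sigma> * integral {0..1} (\<lambda>x. s x * k x)"
  proof -
    have kn: "k x = (x * (1 - x)) * (b 1 x - b 2 x)\<^sup>2" for x by (simp add: k_def cutoff_gap_def power2_eq_square)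
    have "0 < integral {0..1} (\<lambda>x. \<sigma> * (s x * k x))"
    proof (rule int_pos)
      show "continuous_on {0..1} (\<lambda>x. \<sigma> * (s x * k x))" by (intro continuous_intros s_cont k_cont)
      show "0 \<le> \<sigma> * (s x * k x)" if x: "x \<in> {0..1}" for x
      proof -
        have "0 \<le> x * (1 - x) * (b 1 x - b 2 x)\<^sup>2" using x by simp
        from mult_nonneg_nonneg[OF less_imp_le[OF pos[OF x]] this] have "0 \<le> (\<sigma> * s x) * k x" unfolding kn .
        then show ?thesis by (simp add: mult.assoc)
      qed
      show "\<exists>x\<in>{0..1}. \<sigma> * (s x * k x) \<noteq> 0"
      proof (rule ccontr)
        assume "\<not> ?thesis"
        then have z: "\<sigma> * (s x * k x) = 0" if "x \<in> {0..1}" for x using that by blast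
        have "b 1 x - b 2 x = 0" if x: "x \<in> {0<..<1}" for x
        proof -
          have "(\<sigma> * s x) * k x = 0" using z[of x] x by simp
          then have "k x = 0" using pos[of x] x by auto
          then show ?thesis using x by (auto simp: kn)
        qed
        then have "b 1 x - b 2 x = 0" if "x \<in> {0..1}" for x
          using continuous_constant_on_closure[of "{0<..<1}" "\<lambda>x. b 1 x - b 2 x" 0 x] b_cont that
          by (auto intro!: continuous_intros)
        then show False using distinct by auto
      qed
    qed
    then show ?thesis by simp
  qed
  have "kbar = (\<sigma> * integral {0..1} (\<lambda>x. s x * k x)) / (\<sigma> * \<tau>)" using \<sigma>(1) by (auto simp: kbar_def)
  then show "0 < kbar" using divide_pos_pos[OF sk t] by (simp only:)
qed

lemma m_ac: "ac_deriv m (\<lambda>x. s x * (k x - kbar))" and m_cont: "continuous_on {0..1} m" and m_ends: "m 0 = 0" "m 1 = 0"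
proof -
  have c: "continuous_on {0..1} (\<lambda>x. s x * (k x - kbar))" by (intro continuous_intros s_cont k_cont)
  show ac: "ac_deriv m (\<lambda>x. s x * (k x - kbar))"
    using ac_deriv_primitive[OF absolutely_integrable_continuous_real[OF c], of 0] by (simp add: m_def[abs_def])
  show "continuous_on {0..1} m" by (rule ac_deriv_continuous[OF ac])
  show "m 0 = 0" by (simp add: m_def)
  have "m 1 = integral {0..1} (\<lambda>x. s x * k x - s x * kbar)" by (simp add: m_def right_diff_distrib)
  also have "\<dots> = integral {0..1} (\<lambda>x. s x * k x) - integral {0..1} (\<lambda>x. s x * kbar)"
    by (rule Henstock_Kurzweil_Integration.integral_diff) (intro integrable_continuous_real continuous_intros s_cont k_cont)+
  also have "integral {0..1} (\<lambda>x. s x * kbar) = \<tau> * kbar" by (simp add: \<tau>_def)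
  finally show "m 1 = 0" using tau_nz by (simp add: kbar_def)
qed

text \<open>
The mean with weight \<open>s = 1 / b\<^sub>1\<close> is the natural one: functions \<open>b\<^sub>1 f'\<close> with \<open>f\<close> periodic have mean zero.
For a centered \<open>F\<close> the function \<open>centered_primitive F\<close> is the periodic centered \<open>H\<close> with \<open>b\<^sub>1 H' = F\<close>.
\<close>
definition wmean :: "cl2 \<Rightarrow> complex" where "wmean F = (1 / \<tau>) *\<^sub>R cl2_integral (mul s F)"
definition centered :: "cl2 \<Rightarrow> cl2" where "centered F = F - const_cl2 (wmean F)"
definition centered_primitive :: "cl2 \<Rightarrow> cl2" where "centered_primitive F = centered (primitive_cl2 (mul s F))"
definition ratio :: "2 \<Rightarrow> cl2 \<times> cl2 \<Rightarrow> cl2" where "ratio i v = mul (\<lambda>x. inverse (rw i x)) (comp i v)"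
definition ratio_dev :: "cl2 \<times> cl2 \<Rightarrow> cl2" where "ratio_dev v = centered (ratio 1 v)"
definition ratio_gap :: "cl2 \<times> cl2 \<Rightarrow> cl2" where "ratio_gap v = ratio 1 v - ratio 2 v"

lemma wmean_bl: "bounded_linear wmean" unfolding wmean_def[abs_def]
  by (rule bounded_linear_const_scaleR[OF bounded_linear_compose[OF cl2_integral_bounded_linear mul_bounded_linear[OF s_cont]]])
lemma centered_bl: "bounded_linear centered" unfolding centered_def[abs_def]
  by (rule bounded_linear_sub[OF bounded_linear_ident bounded_linear_compose[OF const_cl2_bounded_linear wmean_bl]])
lemma centered_primitive_bl: "bounded_linear centered_primitive" unfolding centered_primitive_def[abs_def]
  by (rule bounded_linear_compose[OF centered_bl bounded_linear_compose[OF primitive_cl2_bounded_linear mul_bounded_linear[OF s_cont]]])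
lemma ratio_bl: "bounded_linear (ratio i)" unfolding ratio_def[abs_def]
  by (rule bounded_linear_compose[OF mul_bounded_linear[OF rw_inv_cont] comp_bounded_linear])
lemma ratio_dev_bl: "bounded_linear ratio_dev" unfolding ratio_dev_def[abs_def] by (rule bounded_linear_compose[OF centered_bl ratio_bl])
lemma ratio_gap_bl: "bounded_linear ratio_gap" unfolding ratio_gap_def[abs_def] by (rule bounded_linear_sub[OF ratio_bl ratio_bl])

lemma wmean_cls: "f \<in> L2 unit_measure \<Longrightarrow> wmean (cls f) = (1 / \<tau>) *\<^sub>R integral {0..1} (\<lambda>x. s x *\<^sub>R f x)"
  unfolding wmean_def
  by (simp add: mul_cls[OF s_cont] cl2_integral_cls[OF L2_scale_continuous[OF s_cont]] LINT_unit[OF L2_integrable[OF L2_scale_continuous[OF s_cont]]])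

lemma centered_cls: "f \<in> L2 unit_measure \<Longrightarrow> centered (cls f) = cls (\<lambda>x. f x - wmean (cls f))"
  unfolding centered_def const_cl2_def by (rule cls_diff[OF _ L2_const, symmetric])

lemma wmean_const_cl2: "wmean (const_cl2 z) = z"
proof -
  have "integral {0..1} (\<lambda>x. s x *\<^sub>R z) = integral {0..1} s *\<^sub>R z"
    by (rule integral_unique[OF has_integral_scaleR_left[OF integrable_integral[OF integrable_continuous_real[OF s_cont]]]])
  then show ?thesis unfolding const_cl2_def wmean_cls[OF L2_const] using tau_nz by (simp add: \<tau>_def)
qed

lemma centered_const_cl2: "centered (const_cl2 z) = 0" by (simp add: centered_def wmean_const_cl2)
lemma wmean_ratio_dev: "wmean (ratio_dev v) = 0"
  unfolding ratio_dev_def centered_def linear_diff[OF bounded_linear.linear[OF wmean_bl]] wmean_const_cl2 by simp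

lemma ratio_emb: assumes p: "p \<in> L2_pairs" shows "ratio i (emb p) = cls (\<lambda>x. inverse (w i x) *\<^sub>R p i x)"
  unfolding ratio_def comp_emb mul_cls[OF rw_inv_cont scaled_L2[OF p]]
proof (rule cls_cong[OF L2_scale_continuous[OF rw_inv_cont scaled_L2[OF p]]])
  show "AE x in unit_measure. inverse (rw i x) *\<^sub>R inverse (rw i x) *\<^sub>R p i x = inverse (w i x) *\<^sub>R p i x"
  proof (rule AE_I2)
    fix x assume "x \<in> space unit_measure"
    then have "rw i x * rw i x = w i x" using rw_sq[of x i] by (simp add: power2_eq_square)
    then show "inverse (rw i x) *\<^sub>R inverse (rw i x) *\<^sub>R p i x = inverse (w i x) *\<^sub>R p i x"
      by (simp flip: inverse_mult_distrib)
  qed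
  show "(\<lambda>x. inverse (w i x) *\<^sub>R p i x) \<in> L2 unit_measure"
    by (rule L2_scale_continuous[OF continuous_on_inverse[OF w_cont] L2_pairsD[OF p]]) (rule ballI, rule w_nz)
qed

lemma ratio_of_ratio: assumes "\<And>i. f i \<in> L2 unit_measure" shows "ratio i (emb (of_ratio f)) = cls (f i)"
  unfolding ratio_emb[OF of_ratio_L2[OF assms]]
proof (rule cls_cong[OF _ _ assms])
  show "(\<lambda>x. inverse (w i x) *\<^sub>R of_ratio f i x) \<in> L2 unit_measure"
    by (rule L2_scale_continuous[OF continuous_on_inverse[OF w_cont] L2_pairsD[OF of_ratio_L2[OF assms]]]) (rule ballI, rule w_nz)
  show "AE x in unit_measure. inverse (w i x) *\<^sub>R of_ratio f i x = f i x"
    by (rule AE_I2) (use w_nz[of _ i] in \<open>simp add: of_ratio_def\<close>)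
qed

text \<open>
With \<open>H\<close> the centered primitive of \<open>s h\<close>, the term \<open>- \<integral> k f' H\<close> integrates by parts to \<open>\<integral> k s |h|\<^sup>2 + \<integral> k' h H\<close>. The weight \<open>k s\<close> degenerates;
the term with \<open>m\<close> is, after another integration by parts, \<open>\<integral> s (kbar - k) |h|\<^sup>2\<close>, which replaces \<open>k\<close> by the
constant \<open>kbar\<close>. All boundary terms vanish by periodicity or because \<open>k\<close>, \<open>cutoff_gap\<close> and \<open>m\<close> vanish at the ends.
\<close>
lemma unbounded_part:
  assumes f: "ac_deriv f f'" "f' \<in> L2 unit_measure" "f 0 = f 1"
    and g: "ac_deriv g g'" "g' \<in> L2 unit_measure" "g 0 = g 1"
    and h: "h = (\<lambda>x. f x - z)" and mh: "wmean (cls h) = 0"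
  shows "inner (mul cutoff_gap (cls (\<lambda>x. - ((b 1 x - b 2 x) *\<^sub>R f' x) - b 2 x *\<^sub>R g' x))) (centered_primitive (cls h))
     - 2 * inner (mul (\<lambda>x. s x * m x) (cls h)) (cls (\<lambda>x. - (b 1 x *\<^sub>R f' x)))
     = inner (mul k' (cls h)) (centered_primitive (cls h)) + kbar * inner (mul s (cls h)) (cls h)
       + inner (mul ob' (cls g)) (centered_primitive (cls h)) + inner (mul (\<lambda>x. cutoff_gap x * b 2 x * s x) (cls g)) (cls h)"
proof -
  have hac: "ac_deriv h f'" unfolding h using ac_deriv_diff[OF f(1) ac_deriv_const[of z]] by simp
  have hcn: "continuous_on {0..1} h" and gcn: "continuous_on {0..1} g"
    by (rule ac_deriv_continuous[OF hac] ac_deriv_continuous[OF g(1)])+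
  have hL: "h \<in> L2 unit_measure" and gL: "g \<in> L2 unit_measure" by (rule continuous_L2[OF hcn] continuous_L2[OF gcn])+
  have sh: "(\<lambda>x. s x *\<^sub>R h x) \<in> L2 unit_measure" by (rule L2_scale_continuous[OF s_cont hL])
  define c where "c = wmean (cls (\<lambda>x. integral {0..x} (\<lambda>x. s x *\<^sub>R h x)))"
  define H where "H x = - c + integral {0..x} (\<lambda>x. s x *\<^sub>R h x)" for x
  have Hac: "ac_deriv H (\<lambda>x. s x *\<^sub>R h x)" unfolding H_def by (rule ac_deriv_primitive[OF L2_abs_integrable[OF sh]])
  have Hcn: "continuous_on {0..1} H" by (rule ac_deriv_continuous[OF Hac])
  have HL: "H \<in> L2 unit_measure" by (rule continuous_L2[OF Hcn])
  have HPH: "centered_primitive (cls h) = cls H"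
    unfolding centered_primitive_def mul_cls[OF s_cont hL] primitive_cl2_cls[OF sh] centered_cls[OF primitive_L2[OF sh]] c_def[symmetric]
    by (simp add: H_def[abs_def])
  have H01: "H 0 = H 1"
    using mh tau_nz unfolding wmean_cls[OF hL] by (simp add: H_def)
  have bc: "continuous_on {0..1} (\<lambda>x. b 1 x - b 2 x)" by (intro continuous_intros b_cont)
  have uL: "(\<lambda>x. - ((b 1 x - b 2 x) *\<^sub>R f' x) - b 2 x *\<^sub>R g' x) \<in> L2 unit_measure"
    by (rule L2_diff[OF L2_uminus[OF L2_scale_continuous[OF bc f(2)]] L2_scale_continuous[OF b_cont g(2)]])
  have vL: "(\<lambda>x. - (b 1 x *\<^sub>R f' x)) \<in> L2 unit_measure" by (rule L2_uminus[OF L2_scale_continuous[OF b_cont f(2)]])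
  have smc: "continuous_on {0..1} (\<lambda>x. s x * m x)" by (rule continuous_on_mult[OF s_cont m_cont])
  have obsc: "continuous_on {0..1} (\<lambda>x. cutoff_gap x * b 2 x * s x)" by (intro continuous_intros cutoff_gap_cont b_cont s_cont)
  \<comment> \<open>The derivatives of \<open>k h H\<close>, \<open>cutoff_gap b\<^sub>2 g H\<close> and \<open>m h h\<close>; each integrates to zero.\<close>
  define e1 where "e1 x = k x *\<^sub>R (h x \<bullet> (s x *\<^sub>R h x) + f' x \<bullet> H x) + k' x *\<^sub>R (h x \<bullet> H x)" for x
  define e2 where "e2 x = (cutoff_gap x * b 2 x) *\<^sub>R (g x \<bullet> (s x *\<^sub>R h x) + g' x \<bullet> H x) + ob' x *\<^sub>R (g x \<bullet> H x)" for x
  define e3 where "e3 x = m x *\<^sub>R (h x \<bullet> f' x + f' x \<bullet> h x) + (s x * (k x - kbar)) *\<^sub>R (h x \<bullet> h x)" for x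
  have e1: "ac_deriv (\<lambda>x. k x *\<^sub>R (h x \<bullet> H x)) e1" unfolding e1_def[abs_def] by (rule ac_deriv_scaleR[OF k_ac ac_deriv_inner[OF hac Hac]])
  have e2: "ac_deriv (\<lambda>x. (cutoff_gap x * b 2 x) *\<^sub>R (g x \<bullet> H x)) e2" unfolding e2_def[abs_def] by (rule ac_deriv_scaleR[OF ob_ac ac_deriv_inner[OF g(1) Hac]])
  have e3: "ac_deriv (\<lambda>x. m x *\<^sub>R (h x \<bullet> h x)) e3" unfolding e3_def[abs_def] by (rule ac_deriv_scaleR[OF m_ac ac_deriv_inner[OF hac hac]])
  have ei: "integrable unit_measure e1" "integrable unit_measure e2" "integrable unit_measure e3"
    using ac_derivD(1)[OF e1] ac_derivD(1)[OF e2] ac_derivD(1)[OF e3] by (simp_all add: integrable_unit_iff)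
  have e0: "(LINT x|unit_measure. e1 x) = 0" "(LINT x|unit_measure. e2 x) = 0" "(LINT x|unit_measure. e3 x) = 0"
    unfolding LINT_unit[OF ei(1)] LINT_unit[OF ei(2)] LINT_unit[OF ei(3)]
      ac_deriv_integral[OF e1] ac_deriv_integral[OF e2] ac_deriv_integral[OF e3] by (simp_all add: ends m_ends)
  have ii: "integrable unit_measure (\<lambda>x. a x * (p x \<bullet> q x))"
    if "continuous_on {0..1} a" "p \<in> L2 unit_measure" "q \<in> L2 unit_measure" for a and p q :: "real \<Rightarrow> complex"
    using L2_integrable_inner[OF L2_scale_continuous[OF that(1,2)] that(3)] by simp
  note I = ii[OF cutoff_gap_cont uL HL] ii[OF smc hL vL] ii[OF k'_cont hL HL] ii[OF s_cont hL hL] ii[OF ob'_cont gL HL] ii[OF obsc gL hL]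
  have "(LINT x|unit_measure. cutoff_gap x * ((- ((b 1 x - b 2 x) *\<^sub>R f' x) - b 2 x *\<^sub>R g' x) \<bullet> H x)) - 2 * (LINT x|unit_measure. (s x * m x) * (h x \<bullet> - (b 1 x *\<^sub>R f' x)))
      = (LINT x|unit_measure. cutoff_gap x * ((- ((b 1 x - b 2 x) *\<^sub>R f' x) - b 2 x *\<^sub>R g' x) \<bullet> H x) - 2 * ((s x * m x) * (h x \<bullet> - (b 1 x *\<^sub>R f' x))))"
    using I(1,2) by simp
  also have "\<dots> = (LINT x|unit_measure. (k' x * (h x \<bullet> H x) + kbar * (s x * (h x \<bullet> h x)) + ob' x * (g x \<bullet> H x)
      + (cutoff_gap x * b 2 x * s x) * (g x \<bullet> h x)) - e1 x - e2 x + e3 x)"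
  proof (rule Bochner_Integration.integral_cong[OF refl])
    fix x assume "x \<in> space unit_measure"
    then have "s x * b 1 x = 1" using b_nz[of x 1] by (simp add: s_def)
    then have c1: "(s x * m x) * (h x \<bullet> - (b 1 x *\<^sub>R f' x)) = - (m x * (h x \<bullet> f' x))"
      by (simp add: mult_ac)
    show "cutoff_gap x * ((- ((b 1 x - b 2 x) *\<^sub>R f' x) - b 2 x *\<^sub>R g' x) \<bullet> H x) - 2 * ((s x * m x) * (h x \<bullet> - (b 1 x *\<^sub>R f' x)))
      = (k' x * (h x \<bullet> H x) + kbar * (s x * (h x \<bullet> h x)) + ob' x * (g x \<bullet> H x)
      + (cutoff_gap x * b 2 x * s x) * (g x \<bullet> h x)) - e1 x - e2 x + e3 x"
      unfolding c1 e1_def e2_def e3_def k_def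
      by (simp add: inner_diff_left inner_minus_left inner_commute[of "f' x" "h x"] algebra_simps)
  qed
  also have "\<dots> = (LINT x|unit_measure. k' x * (h x \<bullet> H x)) + kbar * (LINT x|unit_measure. s x * (h x \<bullet> h x))
       + (LINT x|unit_measure. ob' x * (g x \<bullet> H x)) + (LINT x|unit_measure. (cutoff_gap x * b 2 x * s x) * (g x \<bullet> h x))"
    using I(3-6) ei by (simp add: e0)
  finally show ?thesis
    unfolding HPH inner_mul[OF cutoff_gap_cont uL HL] inner_mul[OF smc hL vL] inner_mul[OF k'_cont hL HL]
      inner_mul[OF s_cont hL hL] inner_mul[OF ob'_cont gL HL] inner_mul[OF obsc gL hL] .
qed

end

lemma inner_bounded_linear_bound:
  fixes A :: "'a::real_normed_vector \<Rightarrow> 'c::real_inner" and B :: "'b::real_normed_vector \<Rightarrow> 'c"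
  assumes "bounded_linear A" "bounded_linear B"
  shows "\<exists>K. 0 \<le> K \<and> (\<forall>x y. \<bar>inner (A x) (B y)\<bar> \<le> K * (norm x * norm y))"
proof -
  obtain K where K: "0 \<le> K" "\<forall>x y. norm (inner (A x) (B y)) \<le> norm x * norm y * K"
    using bounded_bilinear.nonneg_bounded[OF bounded_bilinear.comp[OF bounded_bilinear_inner assms]] by blast
  show ?thesis
  proof (rule exI[of _ K], intro conjI allI)
    show "\<bar>inner (A x) (B y)\<bar> \<le> K * (norm x * norm y)" for x y
      using K(2)[rule_format, of x y] by (simp add: mult.commute)
  qed (rule K(1))
qed

context distinct_speeds
begin

definition a1 :: "real \<Rightarrow> real" where "a1 x = - (inverse (w 1 x) * w 2 x)"
definition a3 :: "real \<Rightarrow> real" where "a3 x = inverse (w 2 x) * w 1 x"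

lemma wi_cont: "continuous_on {0..1} (\<lambda>x. inverse (w i x))"
  by (rule continuous_on_inverse[OF w_cont]) (rule ballI, rule w_nz)

lemma a1_cont: "continuous_on {0..1} a1" and a3_cont: "continuous_on {0..1} a3"
  unfolding a1_def[abs_def] a3_def[abs_def] by (intro continuous_on_minus continuous_on_mult wi_cont w_cont)+

text \<open>
Up to terms that contain \<open>g = ratio_gap v\<close>, the components \<open>h = ratio_dev v\<close>, \<open>H = centered_primitive h\<close> and \<open>g\<close> evolve
by \<open>h\<^sub>t = - b\<^sub>1 h'\<close>, \<open>H\<^sub>t = - h\<close> and \<open>g\<^sub>t = - (b\<^sub>1 - b\<^sub>2) h'\<close>. The middle terms therefore produce \<open>\<integral> k s |h|\<^sup>2 + \<integral> k' h H\<close>, the first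
cancels the last integral, and the last makes the weight of \<open>|h|\<^sup>2\<close> equal to \<open>kbar s\<close>.
\<close>
definition psi :: "cl2 \<times> cl2 \<Rightarrow> cl2 \<times> cl2 \<Rightarrow> real" where
  "psi u v = inner (mul k' (centered_primitive (ratio_dev u))) (centered_primitive (ratio_dev v)) + inner (mul cutoff_gap (ratio_gap u)) (centered_primitive (ratio_dev v)) + inner (mul cutoff_gap (ratio_gap v)) (centered_primitive (ratio_dev u))
     - 2 * inner (mul (\<lambda>x. s x * m x) (ratio_dev u)) (ratio_dev v)"

lemma sm_cont: "continuous_on {0..1} (\<lambda>x. s x * m x)" by (rule continuous_on_mult[OF s_cont m_cont])
lemma obs_cont: "continuous_on {0..1} (\<lambda>x. cutoff_gap x * b 2 x * s x)" by (intro continuous_intros cutoff_gap_cont b_cont s_cont)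

lemma psi_sym: "psi u v = psi v u"
  unfolding psi_def using inner_mul_sym[OF k'_cont, of "centered_primitive (ratio_dev u)" "centered_primitive (ratio_dev v)"] inner_mul_sym[OF sm_cont, of "ratio_dev u" "ratio_dev v"] by simp

lemma psi_bb: "bounded_bilinear psi"
proof -
  note HPh = bounded_linear_compose[OF centered_primitive_bl ratio_dev_bl]
  have 1: "bounded_bilinear (\<lambda>u v. inner (mul k' (centered_primitive (ratio_dev u))) (centered_primitive (ratio_dev v)))"
    by (rule bounded_bilinear.comp[OF bounded_bilinear_inner bounded_linear_compose[OF mul_bounded_linear[OF k'_cont] HPh] HPh])
  have 2: "bounded_bilinear (\<lambda>u v. inner (mul cutoff_gap (ratio_gap u)) (centered_primitive (ratio_dev v)))"
    by (rule bounded_bilinear.comp[OF bounded_bilinear_inner bounded_linear_compose[OF mul_bounded_linear[OF cutoff_gap_cont] ratio_gap_bl] HPh])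
  have 3: "bounded_bilinear (\<lambda>u v. inner (mul cutoff_gap (ratio_gap v)) (centered_primitive (ratio_dev u)))" by (rule bounded_bilinear.flip[OF 2])
  have 4: "bounded_bilinear (\<lambda>u v. inner (mul (\<lambda>x. s x * m x) (ratio_dev u)) (ratio_dev v))"
    by (rule bounded_bilinear.comp[OF bounded_bilinear_inner bounded_linear_compose[OF mul_bounded_linear[OF sm_cont] ratio_dev_bl] ratio_dev_bl])
  have "bounded_bilinear (\<lambda>u v. inner (mul k' (centered_primitive (ratio_dev u))) (centered_primitive (ratio_dev v)) + inner (mul cutoff_gap (ratio_gap u)) (centered_primitive (ratio_dev v)) + inner (mul cutoff_gap (ratio_gap v)) (centered_primitive (ratio_dev u))
     + (-2) * inner (mul (\<lambda>x. s x * m x) (ratio_dev u)) (ratio_dev v))"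
    by (rule bounded_bilinear_add[OF bounded_bilinear_add[OF bounded_bilinear_add[OF 1 2] 3] bounded_bilinear_scale[OF 4]])
  then show ?thesis by (simp add: psi_def[abs_def])
qed

lemma collect_terms:
  fixes d1 :: real
  assumes "d1 - 2 * s1 = q + e1 + e2 + e3"
  shows "- q + x1 + (- x2 + x3) + (d1 + (x4 - x5)) - 2 * (s1 + x6) = e1 + e2 + e3 + x1 - x2 + x3 + x4 - x5 - 2 * x6"
  using assms by (simp add: algebra_simps)

text \<open>
The only term that is quadratic in \<open>h\<close> is \<open>kbar \<integral> s |h|\<^sup>2\<close>; every other term contains the factor \<open>G\<close>, on which \<open>rho\<close> depends.
No derivatives are left on the right, so all of it is bounded in the square norm.
\<close>
lemma psi_derivative:
  assumes v: "v \<in> DH"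
  defines "G \<equiv> ratio_gap v" and "h \<equiv> ratio_dev v"
  defines "rho \<equiv> centered (mul a1 (ratio_gap v))"
  shows "psi v (AH v) = kbar * inner (mul s h) h + inner (mul ob' G) (centered_primitive h) + inner (mul (\<lambda>x. cutoff_gap x * b 2 x * s x) G) h
     + inner (mul k' (centered_primitive h)) (centered_primitive rho) - inner (mul cutoff_gap G) h + inner (mul cutoff_gap G) (centered_primitive rho)
     + inner (mul cutoff_gap (mul a1 G)) (centered_primitive h) - inner (mul cutoff_gap (mul a3 G)) (centered_primitive h)
     - 2 * inner (mul (\<lambda>x. s x * m x) h) rho"
proof -
  obtain f f' where f: "periodic_ac f f'" and vf: "v = emb (of_ratio f)" using v unfolding DH_iff by blast
  note fL = periodic_acD(5)[OF f] and f'L = periodic_acD(2)[OF f] and fac = periodic_acD(1)[OF f]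
  have fcv: "ratio i v = cls (f i)" for i unfolding vf by (rule ratio_of_ratio[OF fL])
  define g where "g x = f 1 x - f 2 x" for x
  have gL: "g \<in> L2 unit_measure" unfolding g_def[abs_def] by (rule L2_diff[OF fL fL])
  have Gg: "G = cls g" unfolding G_def ratio_gap_def fcv g_def[abs_def] by (rule cls_diff[OF fL fL, symmetric])
  define z where "z = wmean (cls (f 1))"
  define hf where "hf = (\<lambda>x. f 1 x - z)"
  have hh: "h = cls hf" unfolding h_def ratio_dev_def fcv centered_cls[OF fL] hf_def z_def ..
  define d where "d i x = - (b i x *\<^sub>R f' i x)" for i x
  have dL: "d i \<in> L2 unit_measure" for i unfolding d_def[abs_def] by (rule L2_uminus[OF L2_scale_continuous[OF b_cont f'L]])
  have AfL: "A_ratio f f' \<in> L2_pairs" by (rule A_ratio_L2[OF fL f'L])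
  have fcA: "ratio i (AH v) = cls (d i) + cls (\<lambda>x. (inverse (w i x) * w (other i) x) *\<^sub>R (f (other i) x - f i x))" for i
  proof -
    have c: "continuous_on {0..1} (\<lambda>x. inverse (w i x) * w (other i) x)" by (rule continuous_on_mult[OF wi_cont w_cont])
    note L = L2_scale_continuous[OF c L2_diff[OF fL fL]]
    show ?thesis unfolding vf AH_of_ratio(2)[OF f] ratio_emb[OF AfL] cls_add[OF dL L, symmetric]
    proof (rule cls_cong[OF L2_scale_continuous[OF wi_cont L2_pairsD[OF AfL]] _ L2_add[OF dL L]])
      show "AE x in unit_measure. inverse (w i x) *\<^sub>R A_ratio f f' i x = d i x + (inverse (w i x) * w (other i) x) *\<^sub>R (f (other i) x - f i x)"
      proof (rule AE_I2)
        fix x assume "x \<in> space unit_measure"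
        then have "inverse (w i x) * J i x = b i x" using w_nz[of x i] by (simp add: J_def)
        then show "inverse (w i x) *\<^sub>R A_ratio f f' i x = d i x + (inverse (w i x) * w (other i) x) *\<^sub>R (f (other i) x - f i x)"
          unfolding A_ratio_def d_def scaleR_add_right scaleR_minus_right scaleR_scaleR by simp
      qed
    qed
  qed
  have f1A: "ratio 1 (AH v) = cls (d 1) + mul a1 G"
  proof -
    have "(\<lambda>x. (inverse (w 1 x) * w 2 x) *\<^sub>R (f 2 x - f 1 x)) = (\<lambda>x. a1 x *\<^sub>R g x)"
      by (simp add: fun_eq_iff a1_def g_def algebra_simps)
    then show ?thesis unfolding fcA Gg mul_cls[OF a1_cont gL] by simp
  qed
  have f2A: "ratio 2 (AH v) = cls (d 2) + mul a3 G"
    unfolding fcA Gg mul_cls[OF a3_cont gL] by (simp add: a3_def g_def)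
  have sd: "mul s (cls (d 1)) = cls (\<lambda>x. - f' 1 x)"
    unfolding mul_cls[OF s_cont dL]
  proof (rule cls_cong[OF L2_scale_continuous[OF s_cont dL] _ L2_uminus[OF f'L]])
    show "AE x in unit_measure. s x *\<^sub>R d 1 x = - f' 1 x"
      by (rule AE_I2) (use b_nz[of _ 1] in \<open>simp add: s_def d_def\<close>)
  qed
  have f'int: "integral {0..x} (\<lambda>x. - f' 1 x) = - (f 1 x) + f 1 0" if "x \<in> {0..1}" for x
  proof -
    have "integral {0..x} (f' 1) = f 1 x - f 1 0" using ac_deriv_increment[OF fac, of 0 x 1] that by simp
    then show ?thesis by simp
  qed
  \<comment> \<open>A periodic function has centered image under \<open>b\<^sub>1 d/dx\<close>, so no mean has to be subtracted from the transport term.\<close>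
  have mnd: "wmean (cls (d 1)) = 0"
  proof -
    have "wmean (cls (d 1)) = (1 / \<tau>) *\<^sub>R integral {0..1} (\<lambda>x. - f' 1 x)"
      unfolding wmean_def sd cl2_integral_cls[OF L2_uminus[OF f'L]] LINT_unit[OF L2_integrable[OF L2_uminus[OF f'L]]] ..
    then show ?thesis using f'int[of 1] periodic_acD(3)[OF f, of 1] by simp
  qed
  have hcA: "ratio_dev (AH v) = cls (d 1) + rho"
    unfolding ratio_dev_def f1A linear_add[OF bounded_linear.linear[OF centered_bl]] rho_def G_def
    by (simp add: centered_def[of "cls (d 1)"] mnd const_cl2_def cls_zero)
  have HPd: "centered_primitive (cls (d 1)) = - h"
  proof -
    have "primitive_cl2 (mul s (cls (d 1))) = cls (\<lambda>x. f 1 0 - f 1 x)"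
      unfolding sd primitive_cl2_cls[OF L2_uminus[OF f'L]]
      by (rule cls_cong[OF primitive_L2[OF L2_uminus[OF f'L]] _ L2_diff[OF L2_const fL]])
        (rule AE_I2, use f'int in simp)
    also have "\<dots> = const_cl2 (f 1 0) - ratio 1 v" unfolding const_cl2_def fcv by (rule cls_diff[OF L2_const fL])
    finally show ?thesis
      unfolding centered_primitive_def h_def ratio_dev_def by (simp only: linear_diff[OF bounded_linear.linear[OF centered_bl]] centered_const_cl2 diff_0)
  qed
  have HPA: "centered_primitive (cls (d 1) + rho) = - h + centered_primitive rho" unfolding linear_add[OF bounded_linear.linear[OF centered_primitive_bl]] HPd ..
  define D1 where "D1 x = - ((b 1 x - b 2 x) *\<^sub>R f' 1 x) - b 2 x *\<^sub>R (f' 1 x - f' 2 x)" for x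
  have gcA: "ratio_gap (AH v) = cls D1 + (mul a1 G - mul a3 G)"
  proof -
    have "cls (d 1) - cls (d 2) = cls (\<lambda>x. d 1 x - d 2 x)" by (rule cls_diff[OF dL dL, symmetric])
    also have "(\<lambda>x. d 1 x - d 2 x) = D1" by (simp add: fun_eq_iff d_def D1_def algebra_simps)
    finally show ?thesis unfolding ratio_gap_def f1A f2A by simp
  qed
  have gac: "ac_deriv g (\<lambda>x. f' 1 x - f' 2 x)" unfolding g_def[abs_def] by (rule ac_deriv_diff[OF fac fac])
  have "g 0 = g 1" using periodic_acD(3)[OF f, of 1] periodic_acD(3)[OF f, of 2] by (simp add: g_def)
  have mh: "wmean (cls hf) = 0" using wmean_ratio_dev[of v] hh by (simp add: h_def)
  have U: "inner (mul cutoff_gap (cls D1)) (centered_primitive h) - 2 * inner (mul (\<lambda>x. s x * m x) h) (cls (d 1))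
     = inner (mul k' h) (centered_primitive h) + kbar * inner (mul s h) h + inner (mul ob' G) (centered_primitive h) + inner (mul (\<lambda>x. cutoff_gap x * b 2 x * s x) G) h"
    unfolding hh Gg D1_def[abs_def] d_def[abs_def]
    by (rule unbounded_part[OF fac f'L periodic_acD(3)[OF f] gac L2_diff[OF f'L f'L] \<open>g 0 = g 1\<close> hf_def mh])
  have 1: "psi v (AH v) = inner (mul k' (centered_primitive h)) (- h + centered_primitive rho) + inner (mul cutoff_gap G) (- h + centered_primitive rho)
      + inner (mul cutoff_gap (cls D1 + (mul a1 G - mul a3 G))) (centered_primitive h) - 2 * inner (mul (\<lambda>x. s x * m x) h) (cls (d 1) + rho)"
    unfolding psi_def hcA HPA gcA h_def[symmetric] G_def[symmetric] ..
  have 2: "mul cutoff_gap (cls D1 + (mul a1 G - mul a3 G)) = mul cutoff_gap (cls D1) + (mul cutoff_gap (mul a1 G) - mul cutoff_gap (mul a3 G))"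
    unfolding linear_add[OF bounded_linear.linear[OF mul_bounded_linear[OF cutoff_gap_cont]]]
      linear_diff[OF bounded_linear.linear[OF mul_bounded_linear[OF cutoff_gap_cont]]] ..
  have 3: "inner (mul k' (centered_primitive h)) h = inner (mul k' h) (centered_primitive h)" by (rule inner_mul_sym[OF k'_cont])
  show ?thesis
    unfolding 1 2 inner_add_right inner_add_left inner_diff_left inner_minus_right 3 by (rule collect_terms[OF U])
qed

lemma s_coercive:
  assumes \<sigma>: "\<And>x. x \<in> {0..1} \<Longrightarrow> \<beta> \<le> \<sigma> * s x"
  shows "\<beta> * (norm h)\<^sup>2 \<le> \<sigma> * inner (mul s h) h"
proof -
  have i: "integrable unit_measure (\<lambda>x. s x * (rep h x \<bullet> rep h x))"
    using L2_integrable_inner[OF L2_scale_continuous[OF s_cont rep_L2] rep_L2, of h h] by simp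
  have "\<beta> * (norm (cls (rep h)))\<^sup>2 = (LINT x|unit_measure. \<beta> * (rep h x \<bullet> rep h x))"
    unfolding norm_cls[OF rep_L2] by (simp add: power2_norm_eq_inner)
  also have "\<dots> \<le> (LINT x|unit_measure. \<sigma> * (s x * (rep h x \<bullet> rep h x)))"
  proof (rule integral_mono)
    show "integrable unit_measure (\<lambda>x. \<beta> * (rep h x \<bullet> rep h x))" using L2_integrable_inner[OF rep_L2 rep_L2, of h h] by simp
    show "integrable unit_measure (\<lambda>x. \<sigma> * (s x * (rep h x \<bullet> rep h x)))" using i by simp
    fix x assume "x \<in> space unit_measure"
    then have "\<beta> * (rep h x \<bullet> rep h x) \<le> (\<sigma> * s x) * (rep h x \<bullet> rep h x)" using \<sigma> by (intro mult_right_mono) auto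
    then show "\<beta> * (rep h x \<bullet> rep h x) \<le> \<sigma> * (s x * (rep h x \<bullet> rep h x))" by (simp add: mult.assoc)
  qed
  also have "\<dots> = \<sigma> * inner (mul s (cls (rep h))) (cls (rep h))" unfolding inner_mul[OF s_cont rep_L2 rep_L2] by simp
  finally show ?thesis by simp
qed

text \<open>
The sign \<open>\<sigma>\<close> is that of the first speed, which makes the quadratic term of \<open>psi_derivative\<close> coercive; all other terms there are bounded by
products of norms that contain the gap.
\<close>
lemma psi_lower_bound:
  obtains \<sigma> \<mu> C where "\<sigma> = 1 \<or> \<sigma> = - 1" "0 < \<mu>" "0 \<le> C"
    "\<And>v. v \<in> DH \<Longrightarrow> \<mu> * (norm (ratio_dev v))\<^sup>2 - C * (norm (ratio_gap v) * norm (ratio_dev v) + (norm (ratio_gap v))\<^sup>2) \<le> \<sigma> * psi v (AH v)"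
proof -
  obtain \<sigma> \<beta> where \<sigma>: "\<sigma> = 1 \<or> \<sigma> = - 1" "0 < \<beta>" "\<And>x. x \<in> {0..1} \<Longrightarrow> \<beta> \<le> \<sigma> * s x" by (rule s_sign) auto
  note M = mul_bounded_linear
  have rho: "bounded_linear (\<lambda>G. centered (mul a1 G))" by (rule bounded_linear_compose[OF centered_bl M[OF a1_cont]])
  have HPrho: "bounded_linear (\<lambda>G. centered_primitive (centered (mul a1 G)))" by (rule bounded_linear_compose[OF centered_primitive_bl rho])
  have "\<exists>K\<ge>0. \<forall>x y. \<bar>inner (mul ob' x) (centered_primitive y)\<bar> \<le> K * (norm x * norm y)"
    by (rule inner_bounded_linear_bound[of "mul ob'" "centered_primitive", OF M[OF ob'_cont] centered_primitive_bl])
  then obtain K1 where K1: "0 \<le> K1" "\<And>x y. \<bar>inner (mul ob' x) (centered_primitive y)\<bar> \<le> K1 * (norm x * norm y)" by blast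
  have "\<exists>K\<ge>0. \<forall>x y. \<bar>inner (mul (\<lambda>x. cutoff_gap x * b 2 x * s x) x) y\<bar> \<le> K * (norm x * norm y)"
    by (rule inner_bounded_linear_bound[of "mul (\<lambda>x. cutoff_gap x * b 2 x * s x)" "\<lambda>y. y", OF M[OF obs_cont] bounded_linear_ident])
  then obtain K2 where K2: "0 \<le> K2" "\<And>x y. \<bar>inner (mul (\<lambda>x. cutoff_gap x * b 2 x * s x) x) y\<bar> \<le> K2 * (norm x * norm y)" by blast
  have "\<exists>K\<ge>0. \<forall>y x. \<bar>inner (mul k' (centered_primitive y)) (centered_primitive (centered (mul a1 x)))\<bar> \<le> K * (norm y * norm x)"
    by (rule inner_bounded_linear_bound[of "\<lambda>y. mul k' (centered_primitive y)" "\<lambda>x. centered_primitive (centered (mul a1 x))", OF bounded_linear_compose[OF M[OF k'_cont] centered_primitive_bl] HPrho])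
  then obtain K3 where K3: "0 \<le> K3" "\<And>x y. \<bar>inner (mul k' (centered_primitive y)) (centered_primitive (centered (mul a1 x)))\<bar> \<le> K3 * (norm y * norm x)" by blast
  have "\<exists>K\<ge>0. \<forall>x y. \<bar>inner (mul cutoff_gap x) y\<bar> \<le> K * (norm x * norm y)"
    by (rule inner_bounded_linear_bound[of "mul cutoff_gap" "\<lambda>y. y", OF M[OF cutoff_gap_cont] bounded_linear_ident])
  then obtain K4 where K4: "0 \<le> K4" "\<And>x y. \<bar>inner (mul cutoff_gap x) y\<bar> \<le> K4 * (norm x * norm y)" by blast
  have "\<exists>K\<ge>0. \<forall>x y. \<bar>inner (mul cutoff_gap x) (centered_primitive (centered (mul a1 y)))\<bar> \<le> K * (norm x * norm y)"
    by (rule inner_bounded_linear_bound[of "mul cutoff_gap" "\<lambda>x. centered_primitive (centered (mul a1 x))", OF M[OF cutoff_gap_cont] HPrho])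
  then obtain K5 where K5: "0 \<le> K5" "\<And>x y. \<bar>inner (mul cutoff_gap x) (centered_primitive (centered (mul a1 y)))\<bar> \<le> K5 * (norm x * norm y)" by blast
  have "\<exists>K\<ge>0. \<forall>x y. \<bar>inner (mul cutoff_gap (mul a1 x)) (centered_primitive y)\<bar> \<le> K * (norm x * norm y)"
    by (rule inner_bounded_linear_bound[of "\<lambda>x. mul cutoff_gap (mul a1 x)" "centered_primitive", OF bounded_linear_compose[OF M[OF cutoff_gap_cont] M[OF a1_cont]] centered_primitive_bl])
  then obtain K6 where K6: "0 \<le> K6" "\<And>x y. \<bar>inner (mul cutoff_gap (mul a1 x)) (centered_primitive y)\<bar> \<le> K6 * (norm x * norm y)" by blast
  have "\<exists>K\<ge>0. \<forall>x y. \<bar>inner (mul cutoff_gap (mul a3 x)) (centered_primitive y)\<bar> \<le> K * (norm x * norm y)"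
    by (rule inner_bounded_linear_bound[of "\<lambda>x. mul cutoff_gap (mul a3 x)" "centered_primitive", OF bounded_linear_compose[OF M[OF cutoff_gap_cont] M[OF a3_cont]] centered_primitive_bl])
  then obtain K7 where K7: "0 \<le> K7" "\<And>x y. \<bar>inner (mul cutoff_gap (mul a3 x)) (centered_primitive y)\<bar> \<le> K7 * (norm x * norm y)" by blast
  have "\<exists>K\<ge>0. \<forall>y x. \<bar>inner (mul (\<lambda>x. s x * m x) y) (centered (mul a1 x))\<bar> \<le> K * (norm y * norm x)"
    by (rule inner_bounded_linear_bound[of "mul (\<lambda>x. s x * m x)" "\<lambda>x. centered (mul a1 x)", OF M[OF sm_cont] rho])
  then obtain K8 where K8: "0 \<le> K8" "\<And>x y. \<bar>inner (mul (\<lambda>x. s x * m x) y) (centered (mul a1 x))\<bar> \<le> K8 * (norm y * norm x)" by blast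
  define C where "C = K1 + K2 + K3 + K4 + K5 + K6 + K7 + 2 * K8"
  show thesis
  proof (rule that[OF \<sigma>(1)])
    show "0 < kbar * \<beta>" using kbar_pos \<sigma>(2) by simp
    show "0 \<le> C" using K1 K2 K3 K4 K5 K6 K7 K8 by (simp add: C_def)
    fix v assume v: "v \<in> DH"
    define G h where "G = ratio_gap v" and "h = ratio_dev v"
    define q where "q = norm G * norm h"
    define r where "r = norm G * norm G"
    have q0: "0 \<le> q" "0 \<le> r" by (simp_all add: q_def r_def)
    define t where "t = inner (mul ob' G) (centered_primitive h) + inner (mul (\<lambda>x. cutoff_gap x * b 2 x * s x) G) h
     + inner (mul k' (centered_primitive h)) (centered_primitive (centered (mul a1 G))) - inner (mul cutoff_gap G) h + inner (mul cutoff_gap G) (centered_primitive (centered (mul a1 G)))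
     + inner (mul cutoff_gap (mul a1 G)) (centered_primitive h) - inner (mul cutoff_gap (mul a3 G)) (centered_primitive h)
     - 2 * inner (mul (\<lambda>x. s x * m x) h) (centered (mul a1 G))"
    have p: "psi v (AH v) = kbar * inner (mul s h) h + t"
      unfolding psi_derivative[OF v] t_def G_def h_def by simp
    have "\<bar>t\<bar> \<le> K1 * q + K2 * q + K3 * q + K4 * q + K5 * r + K6 * q + K7 * q + 2 * (K8 * q)"
      using K1(2)[of G h] K2(2)[of G h] K3(2)[of h G] K4(2)[of G h] K5(2)[of G G] K6(2)[of G h] K7(2)[of G h] K8(2)[of h G]
      unfolding t_def q_def r_def mult.commute[of "norm h" "norm G"] by linarith
    also have "\<dots> \<le> C * (q + r)"
    proof -
      have "C * (q + r) = (K1 * q + K2 * q + K3 * q + K4 * q + K5 * r + K6 * q + K7 * q + 2 * (K8 * q))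
         + (K5 * q + (K1 * r + K2 * r + K3 * r + K4 * r + K6 * r + K7 * r + 2 * (K8 * r)))" by (simp add: C_def algebra_simps)
      moreover have "0 \<le> K5 * q + (K1 * r + K2 * r + K3 * r + K4 * r + K6 * r + K7 * r + 2 * (K8 * r))"
        using K1(1) K2(1) K3(1) K4(1) K5(1) K6(1) K7(1) K8(1) q0 by (intro add_nonneg_nonneg mult_nonneg_nonneg) auto
      ultimately show ?thesis by linarith
    qed
    finally have tb: "\<bar>t\<bar> \<le> C * (q + r)" .
    have "kbar * (\<beta> * (norm h)\<^sup>2) \<le> kbar * (\<sigma> * inner (mul s h) h)"
      using kbar_pos s_coercive[OF \<sigma>(3)] by (intro mult_left_mono) auto
    moreover have "\<sigma> * psi v (AH v) = kbar * (\<sigma> * inner (mul s h) h) + \<sigma> * t" unfolding p by (simp add: algebra_simps)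
    moreover have "- \<bar>t\<bar> \<le> \<sigma> * t" using \<sigma>(1) by auto
    ultimately have "kbar * \<beta> * (norm h)\<^sup>2 - C * (q + r) \<le> \<sigma> * psi v (AH v)" using tb by (simp add: mult.assoc)
    then show "kbar * \<beta> * (norm (ratio_dev v))\<^sup>2 - C * (norm (ratio_gap v) * norm (ratio_dev v) + (norm (ratio_gap v))\<^sup>2) \<le> \<sigma> * psi v (AH v)"
      by (simp add: q_def r_def G_def h_def power2_eq_square)
  qed
qed

lemma energy_bound:
  obtains \<omega> where "0 < \<omega>" "\<And>v. v \<in> DH \<Longrightarrow> inner v (AH v) \<le> - \<omega> * (norm (ratio_gap v))\<^sup>2"
proof -
  have wc: "continuous_on {0..1} (\<lambda>x. w 1 x + w 2 x)" by (intro continuous_intros w_cont)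
  from continuous_attains_inf[OF _ _ wc] obtain y where y: "y \<in> {0..1}" "\<forall>x\<in>{0..1}. w 1 y + w 2 y \<le> w 1 x + w 2 x" by auto
  define \<omega> where "\<omega> = w 1 y + w 2 y"
  have "0 < \<omega>" using w_pos[OF y(1), of 1] w_pos[OF y(1), of 2] by (simp add: \<omega>_def)
  moreover have "inner v (AH v) \<le> - (\<omega> / 2) * (norm (ratio_gap v))\<^sup>2" if v: "v \<in> DH" for v
  proof -
    obtain f f' where f: "periodic_ac f f'" and vf: "v = emb (of_ratio f)" using v unfolding DH_iff by blast
    note fL = periodic_acD(5)[OF f]
    have gv: "ratio_gap v = cls (\<lambda>x. f 1 x - f 2 x)" unfolding ratio_gap_def vf ratio_of_ratio[OF fL] by (rule cls_diff[OF fL fL, symmetric])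
    have dc: "continuous_on {0..1} (\<lambda>x. f 1 x - f 2 x)" by (intro continuous_intros periodic_acD(4)[OF f])
    have "\<omega> * (norm (ratio_gap v))\<^sup>2 = (LINT x|unit_measure. \<omega> * (cmod (f 1 x - f 2 x))\<^sup>2)"
      unfolding gv norm_cls[OF L2_diff[OF fL fL]] by simp
    also have "\<dots> \<le> (LINT x|unit_measure. (w 1 x + w 2 x) * (cmod (f 1 x - f 2 x))\<^sup>2)"
    proof (rule integral_mono)
      show "integrable unit_measure (\<lambda>x. \<omega> * (cmod (f 1 x - f 2 x))\<^sup>2)" using L2D(2)[OF L2_diff[OF fL fL]] by simp
      show "integrable unit_measure (\<lambda>x. (w 1 x + w 2 x) * (cmod (f 1 x - f 2 x))\<^sup>2)"
        by (rule continuous_integrable_unit) (intro continuous_intros w_cont dc)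
      fix x assume "x \<in> space unit_measure"
      then show "\<omega> * (cmod (f 1 x - f 2 x))\<^sup>2 \<le> (w 1 x + w 2 x) * (cmod (f 1 x - f 2 x))\<^sup>2"
        using y(2) by (intro mult_right_mono) (auto simp: \<omega>_def)
    qed
    finally show ?thesis unfolding inner_commute[of v] using energy_identity[OF f] unfolding vf[symmetric] by simp
  qed
  ultimately show thesis by (intro that[of "\<omega> / 2"]) auto
qed

end

section \<open>Mass and fluctuations\<close>

context two_speed
begin

definition mass_cl2 :: "cl2 \<times> cl2 \<Rightarrow> complex" where
  "mass_cl2 v = cl2_integral (mul (rw 1) (comp 1 v)) + cl2_integral (mul (rw 2) (comp 2 v))"

text \<open>
The steady state of mass \<open>c\<close>; see \<open>mass_cl2_equilibrium\<close>.
\<close>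
definition equilibrium :: "complex \<Rightarrow> cl2 \<times> cl2" where "equilibrium c = (mul (rw 1) (const_cl2 c), mul (rw 2) (const_cl2 c))"

definition fluct :: "cl2 \<times> cl2 \<Rightarrow> cl2 \<times> cl2" where "fluct v = v - equilibrium (mass_cl2 v)"

lemma mass_cl2_bl: "bounded_linear mass_cl2"
proof -
  have "bounded_linear (\<lambda>v. cl2_integral (mul (rw i) (comp i v)))" for i
    by (rule bounded_linear_compose[OF cl2_integral_bounded_linear bounded_linear_compose[OF mul_bounded_linear[OF rw_cont] comp_bounded_linear]])
  from bounded_linear_add[OF this this] show ?thesis unfolding mass_cl2_def[abs_def] .
qed

lemma equilibrium_bl: "bounded_linear equilibrium"
  unfolding equilibrium_def[abs_def]
  by (rule bounded_linear_Pair; rule bounded_linear_compose[OF mul_bounded_linear[OF rw_cont] const_cl2_bounded_linear])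

lemma eq_mass_bl: "bounded_linear (\<lambda>v. equilibrium (mass_cl2 v))" by (rule bounded_linear_compose[OF equilibrium_bl mass_cl2_bl])

lemma fluct_bl: "bounded_linear fluct"
  unfolding fluct_def[abs_def] by (rule bounded_linear_sub[OF bounded_linear_ident eq_mass_bl])

lemma mul_rw_comp_emb: assumes p: "p \<in> L2_pairs" shows "mul (rw i) (comp i (emb p)) = cls (p i)"
  unfolding comp_emb mul_cls[OF rw_cont scaled_L2[OF p]]
proof (rule cls_cong[OF L2_scale_continuous[OF rw_cont scaled_L2[OF p]] _ L2_pairsD[OF p]])
  show "AE x in unit_measure. rw i x *\<^sub>R inverse (rw i x) *\<^sub>R p i x = p i x"
  proof (rule AE_I2)
    fix x assume "x \<in> space unit_measure"
    then have "rw i x \<noteq> 0" using rw_pos[of x i] by simp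
    then show "rw i x *\<^sub>R inverse (rw i x) *\<^sub>R p i x = p i x" by simp
  qed
qed

lemma mass_cl2_emb: assumes p: "p \<in> L2_pairs" shows "mass_cl2 (emb p) = mass p"
  unfolding mass_cl2_def mul_rw_comp_emb[OF p] cl2_integral_cls[OF L2_pairsD[OF p]] mass_def
  by (rule Bochner_Integration.integral_add[OF L2_integrable[OF L2_pairsD[OF p]] L2_integrable[OF L2_pairsD[OF p]], symmetric])

lemma equilibrium_of_ratio: "equilibrium c = emb (of_ratio (\<lambda>i x. c))"
proof (rule comp_eqI)
  fix i
  have "comp i (equilibrium c) = mul (rw i) (const_cl2 c)" using exhaust_2[of i] by (auto simp: comp_def equilibrium_def)
  also have "\<dots> = cls (\<lambda>x. rw i x *\<^sub>R c)" unfolding const_cl2_def by (rule mul_cls[OF rw_cont L2_const])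
  also have "\<dots> = cls (\<lambda>x. inverse (rw i x) *\<^sub>R of_ratio (\<lambda>i x. c) i x)"
  proof (rule cls_cong[OF L2_scale_continuous[OF rw_cont L2_const] _ scaled_L2[OF of_ratio_L2[OF L2_const]]])
    show "AE x in unit_measure. rw i x *\<^sub>R c = inverse (rw i x) *\<^sub>R of_ratio (\<lambda>i x. c) i x"
    proof (rule AE_I2)
      fix x assume "x \<in> space unit_measure"
      then have x: "x \<in> {0..1}" by simp
      have "rw i x = inverse (rw i x) * w i x" using rw_pos[OF x, of i] unfolding rw_sq[OF x, symmetric] by (simp add: power2_eq_square)
      then show "rw i x *\<^sub>R c = inverse (rw i x) *\<^sub>R of_ratio (\<lambda>i x. c) i x" unfolding of_ratio_def scaleR_scaleR by (rule arg_cong)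
    qed
  qed
  also have "\<dots> = comp i (emb (of_ratio (\<lambda>i x. c)))" by (rule comp_emb[symmetric])
  finally show "comp i (equilibrium c) = comp i (emb (of_ratio (\<lambda>i x. c)))" .
qed

lemma equilibrium_equilibrium: "equilibrium c \<in> DH" "AH (equilibrium c) = 0"
proof -
  have c: "periodic_ac (\<lambda>i x. c) (\<lambda>i x. 0)" by (simp add: periodic_ac_def ac_deriv_const L2_zero)
  have "A_ratio (\<lambda>i x. c) (\<lambda>i x. 0) = (\<lambda>i x. 0)" by (simp add: A_ratio_def)
  moreover have "emb (\<lambda>i x. 0) = 0" by (simp add: emb_def cls_zero zero_prod_def)
  ultimately show "equilibrium c \<in> DH" "AH (equilibrium c) = 0" unfolding equilibrium_of_ratio using AH_of_ratio[OF c] by simp_all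
qed

lemma mass_cl2_equilibrium: "mass_cl2 (equilibrium c) = c"
proof -
  have one: "(LINT x|unit_measure. w 1 x + w 2 x) = 1"
    using w_steady by (simp add: normalized_positive_steady_state_def)
  have i: "integrable unit_measure (\<lambda>x. w 1 x + w 2 x)"
    by (rule continuous_integrable_unit[OF continuous_on_add[OF w_cont w_cont]])
  have "mass_cl2 (equilibrium c) = (LINT x|unit_measure. (w 1 x + w 2 x) *\<^sub>R c)"
    unfolding equilibrium_of_ratio mass_cl2_emb[OF of_ratio_L2[OF L2_const]] mass_def by (simp add: of_ratio_def scaleR_add_left)
  also have "\<dots> = (LINT x|unit_measure. w 1 x + w 2 x) *\<^sub>R c" by (rule integral_scaleR_left[OF i])
  finally show ?thesis by (simp add: one)
qed

text \<open>
Adding the two equations leaves the derivative of \<open>- J\<^sub>1 f\<^sub>1 - J\<^sub>2 f\<^sub>2\<close>, which is periodic.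
\<close>
lemma mass_cl2_AH: assumes v: "v \<in> DH" shows "mass_cl2 (AH v) = 0"
proof -
  obtain f f' where f: "periodic_ac f f'" and vf: "v = emb (of_ratio f)" using v unfolding DH_iff by blast
  have A: "A_ratio f f' \<in> L2_pairs" by (rule A_ratio_L2[OF periodic_acD(5)[OF f] periodic_acD(2)[OF f]])
  define e where "e x = (J 1 x *\<^sub>R f' 1 x + J' 1 x *\<^sub>R f 1 x) + (J 2 x *\<^sub>R f' 2 x + J' 2 x *\<^sub>R f 2 x)" for x
  have e: "ac_deriv (\<lambda>x. J 1 x *\<^sub>R f 1 x + J 2 x *\<^sub>R f 2 x) e"
    unfolding e_def[abs_def]
    by (rule ac_deriv_add; rule ac_deriv_scaleR[OF J_ac periodic_acD(1)[OF f]])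
  have "mass_cl2 (AH v) = (LINT x|unit_measure. A_ratio f f' 1 x + A_ratio f f' 2 x)"
    unfolding vf AH_of_ratio(2)[OF f] mass_cl2_emb[OF A] mass_def ..
  also have "(\<lambda>x. A_ratio f f' 1 x + A_ratio f f' 2 x) = (\<lambda>x. - e x)"
    by (simp add: fun_eq_iff A_ratio_def e_def J'_def algebra_simps)
  also have "(LINT x|unit_measure. - e x) = - (LINT x|unit_measure. e x)" by simp
  also have "(LINT x|unit_measure. e x) = integral {0..1} e"
    by (rule LINT_unit) (use ac_derivD(1)[OF e] in \<open>simp add: integrable_unit_iff\<close>)
  also have "\<dots> = 0" unfolding ac_deriv_integral[OF e]
    using J_per[of 1] J_per[of 2] periodic_acD(3)[OF f, of 1] periodic_acD(3)[OF f, of 2] by simp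
  finally show ?thesis by simp
qed

lemma fluct_idem: "fluct (fluct v) = fluct v"
  unfolding fluct_def linear_diff[OF bounded_linear.linear[OF mass_cl2_bl]] mass_cl2_equilibrium
  by (simp add: linear_0[OF bounded_linear.linear[OF equilibrium_bl]])

lemma fluct_DH: assumes v: "v \<in> DH" shows "fluct v \<in> DH \<and> AH (fluct v) = fluct (AH v)"
proof -
  have "fluct v = v + equilibrium (- mass_cl2 v)"
    unfolding fluct_def linear_neg[OF bounded_linear.linear[OF equilibrium_bl]] by simp
  then show ?thesis using DH_add[OF v equilibrium_equilibrium(1)] 
    by (simp add: equilibrium_equilibrium(2)) (simp add: fluct_def mass_cl2_AH[OF v] linear_0[OF bounded_linear.linear[OF equilibrium_bl]])
qed

lemma gen_equilibrium: assumes t: "0 \<le> t" shows "gen.T t (equilibrium c) = equilibrium c"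
proof -
  have "((\<lambda>t. gen.T t (equilibrium c)) has_vector_derivative 0) (at s within {0..})" if s: "s \<in> {0..}" for s
  proof -
    have "AH (gen.T s (equilibrium c)) = gen.T s 0" using gen.T_invariant(2)[OF equilibrium_equilibrium(1), of s c] s
      unfolding equilibrium_equilibrium(2) by simp
    also have "\<dots> = 0" using linear_0[OF bounded_linear.linear[OF gen.T_bounded_linear]] s by simp
    finally show ?thesis using gen.T_deriv[OF equilibrium_equilibrium(1), of s c] s by simp
  qed
  from has_vector_derivative_zero_constant[OF convex_real_interval(1) this]
  obtain z where "\<And>s. s \<in> {0..} \<Longrightarrow> gen.T s (equilibrium c) = z" by blast
  from this[of t] this[of 0] t show ?thesis by (simp add: gen.T_at_0)
qed

text \<open>
The map \<open>v \<mapsto> equilibrium (mass_cl2 v)\<close> commutes with the generator, hence with the semigroup, which fixes equilibria.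
\<close>
lemma mass_cl2_invariant: assumes t: "0 \<le> t" shows "mass_cl2 (gen.T t v) = mass_cl2 v"
proof -
  have c: "equilibrium (mass_cl2 v) \<in> DH \<and> AH (equilibrium (mass_cl2 v)) = equilibrium (mass_cl2 (AH v))" if "v \<in> DH" for v
    by (simp add: equilibrium_equilibrium mass_cl2_AH[OF that] linear_0[OF bounded_linear.linear[OF equilibrium_bl]])
  have "equilibrium (mass_cl2 (gen.T t v)) = equilibrium (mass_cl2 v)"
    using gen.T_commute[OF eq_mass_bl c t, of v] unfolding gen_equilibrium[OF t] by (rule sym)
  then have "mass_cl2 (equilibrium (mass_cl2 (gen.T t v))) = mass_cl2 (equilibrium (mass_cl2 v))" by (rule arg_cong)
  then show ?thesis unfolding mass_cl2_equilibrium .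
qed

end

context distinct_speeds
begin

lemma mul_rw_inverse: "mul (rw i) (mul (\<lambda>x. inverse (rw i x)) F) = F"
proof -
  have L: "(\<lambda>x. inverse (rw i x) *\<^sub>R rep F x) \<in> L2 unit_measure" by (rule L2_scale_continuous[OF rw_inv_cont rep_L2])
  have "mul (rw i) (mul (\<lambda>x. inverse (rw i x)) F) = cls (\<lambda>x. rw i x *\<^sub>R inverse (rw i x) *\<^sub>R rep F x)"
    unfolding mul_def[of "\<lambda>x. inverse (rw i x)"] by (rule mul_cls[OF rw_cont L])
  also have "\<dots> = cls (rep F)"
  proof (rule cls_cong[OF L2_scale_continuous[OF rw_cont L] _ rep_L2])
    show "AE x in unit_measure. rw i x *\<^sub>R inverse (rw i x) *\<^sub>R rep F x = rep F x"
    proof (rule AE_I2)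
      fix x assume "x \<in> space unit_measure"
      then have "rw i x \<noteq> 0" using rw_pos[of x i] by simp
      then show "rw i x *\<^sub>R inverse (rw i x) *\<^sub>R rep F x = rep F x" by simp
    qed
  qed
  finally show ?thesis by simp
qed

text \<open>
The second ratio is recovered from the first one and the gap, and the first one from its mean and its deviation.
\<close>
lemma decomposition: "v = equilibrium (wmean (ratio 1 v)) + (mul (rw 1) (ratio_dev v), mul (rw 2) (ratio_dev v - ratio_gap v))"
proof -
  note add = linear_add[OF bounded_linear.linear[OF mul_bounded_linear[OF rw_cont]]]
  have 1: "const_cl2 (wmean (ratio 1 v)) + ratio_dev v = ratio 1 v" by (simp add: ratio_dev_def centered_def)
  have 2: "const_cl2 (wmean (ratio 1 v)) + (ratio_dev v - ratio_gap v) = ratio 2 v" using 1 by (simp add: ratio_gap_def algebra_simps)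
  have c: "mul (rw i) (ratio i v) = comp i v" for i unfolding ratio_def by (rule mul_rw_inverse)
  show ?thesis unfolding equilibrium_def add_Pair add[symmetric] 1 2 c by (simp add: comp_def)
qed

text \<open>
The equilibrium part of the decomposition is removed by \<open>fluct\<close>, which leaves a bounded function of
\<open>ratio_dev v\<close> and \<open>ratio_gap v\<close>.
\<close>
lemma poincare:
  obtains C where "0 < C" "\<And>v. norm (fluct v) \<le> C * (norm (ratio_dev v) + norm (ratio_gap v))"
proof -
  obtain Kq where Kq: "0 < Kq" "\<And>v. norm (fluct v) \<le> norm v * Kq" using bounded_linear.pos_bounded[OF fluct_bl] by blast
  obtain K1 where K1: "0 < K1" "\<And>F. norm (mul (rw 1) F) \<le> norm F * K1"
    using bounded_linear.pos_bounded[OF mul_bounded_linear[OF rw_cont[of 1]]] by blast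
  obtain K2 where K2: "0 < K2" "\<And>F. norm (mul (rw 2) F) \<le> norm F * K2"
    using bounded_linear.pos_bounded[OF mul_bounded_linear[OF rw_cont[of 2]]] by blast
  have "norm (fluct v) \<le> ((K1 + K2) * Kq) * (norm (ratio_dev v) + norm (ratio_gap v))" for v
  proof -
    define N where "N = (mul (rw 1) (ratio_dev v), mul (rw 2) (ratio_dev v - ratio_gap v))"
    have "fluct v = fluct (equilibrium (wmean (ratio 1 v))) + fluct N"
      unfolding linear_add[OF bounded_linear.linear[OF fluct_bl], symmetric] N_def using decomposition[of v] by (rule arg_cong)
    also have "fluct (equilibrium (wmean (ratio 1 v))) = 0" by (simp add: fluct_def mass_cl2_equilibrium)
    finally have "norm (fluct v) \<le> norm N * Kq" using Kq(2)[of N] by simp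
    moreover have "norm N \<le> norm (ratio_dev v) * K1 + (norm (ratio_dev v) + norm (ratio_gap v)) * K2"
    proof -
      have "norm N \<le> norm (mul (rw 1) (ratio_dev v)) + norm (mul (rw 2) (ratio_dev v - ratio_gap v))" unfolding N_def by (rule norm_Pair_le)
      moreover have "norm (ratio_dev v - ratio_gap v) * K2 \<le> (norm (ratio_dev v) + norm (ratio_gap v)) * K2"
        using K2(1) norm_triangle_ineq4[of "ratio_dev v" "ratio_gap v"] by (intro mult_right_mono) auto
      ultimately show ?thesis using K1(2)[of "ratio_dev v"] K2(2)[of "ratio_dev v - ratio_gap v"] by linarith
    qed
    moreover have "norm (ratio_dev v) * K1 + (norm (ratio_dev v) + norm (ratio_gap v)) * K2 \<le> (K1 + K2) * (norm (ratio_dev v) + norm (ratio_gap v))"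
      using K1(1) by (simp add: algebra_simps)
    ultimately have "norm N * Kq \<le> ((K1 + K2) * (norm (ratio_dev v) + norm (ratio_gap v))) * Kq"
      using Kq(1) by (intro mult_right_mono) auto
    then show ?thesis using \<open>norm (fluct v) \<le> norm N * Kq\<close> by (simp add: mult_ac)
  qed
  moreover have "0 < (K1 + K2) * Kq" using K1(1) K2(1) Kq(1) by simp
  ultimately show thesis using that by blast
qed

lemma young_bound:
  fixes h g :: real
  assumes "0 < \<mu>" shows "C * (g * h) \<le> \<mu> / 2 * h\<^sup>2 + C\<^sup>2 / (2 * \<mu>) * g\<^sup>2"
proof -
  have "0 \<le> (\<mu> * h - C * g)\<^sup>2 / (2 * \<mu>)" using assms by simp
  also have "(\<mu> * h - C * g)\<^sup>2 / (2 * \<mu>) = \<mu> / 2 * h\<^sup>2 + C\<^sup>2 / (2 * \<mu>) * g\<^sup>2 - C * (g * h)"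
    using assms by (simp add: field_simps power2_eq_square)
  finally show ?thesis by simp
qed

text \<open>
A large multiple of the inner product absorbs, through the energy identity, the terms with \<open>ratio_gap\<close> that \<open>psi\<close> leaves uncontrolled.
\<close>
theorem fluctuation_decay:
  "\<exists>\<alpha>>0. \<forall>v. \<forall>t\<ge>0. norm (gen.T t (fluct v)) \<le> exp (pi / 2) * exp (- \<alpha> * t) * norm (fluct v)"
proof -
  obtain \<sigma> \<mu> C where \<sigma>: "\<sigma> = 1 \<or> \<sigma> = - 1" and \<mu>: "0 < \<mu>" and C: "0 \<le> C"
    and psi: "\<And>v. v \<in> DH \<Longrightarrow> \<mu> * (norm (ratio_dev v))\<^sup>2 - C * (norm (ratio_gap v) * norm (ratio_dev v) + (norm (ratio_gap v))\<^sup>2) \<le> \<sigma> * psi v (AH v)"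
    using psi_lower_bound by blast
  obtain \<omega> where \<omega>: "0 < \<omega>" and en: "\<And>v. v \<in> DH \<Longrightarrow> inner v (AH v) \<le> - \<omega> * (norm (ratio_gap v))\<^sup>2"
    using energy_bound by blast
  obtain P where P: "0 < P" "\<And>v. norm (fluct v) \<le> P * (norm (ratio_dev v) + norm (ratio_gap v))" using poincare by blast
  obtain K where K: "0 \<le> K" "\<forall>u v. norm (psi u v) \<le> norm u * norm v * K"
    using bounded_bilinear.nonneg_bounded[OF psi_bb] by blast
  \<comment> \<open>The summand \<open>K + 1\<close> makes the form bound the squared norm; the quotient absorbs the gap terms, including those from Young's inequality with weight \<open>\<mu> / 2\<close>.\<close>
  define \<Lambda> where "\<Lambda> = K + 1 + (C + C\<^sup>2 / (2 * \<mu>) + \<mu> / 2) / \<omega>"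
  have \<Lambda>1: "K + 1 \<le> \<Lambda>" using C \<mu> \<omega> by (simp add: \<Lambda>_def)
  have "\<Lambda> * \<omega> = (K + 1) * \<omega> + (C + C\<^sup>2 / (2 * \<mu>) + \<mu> / 2)" using \<omega> by (simp add: \<Lambda>_def field_simps)
  then have \<Lambda>2: "C + C\<^sup>2 / (2 * \<mu>) + \<mu> / 2 \<le> \<Lambda> * \<omega>" using K(1) \<omega> by simp
  define B where "B = (\<lambda>u v. \<Lambda> * inner u v + (- \<sigma>) * psi u v)"
  have Bb: "bounded_bilinear B" unfolding B_def
    by (rule bounded_bilinear_add[OF bounded_bilinear_scale[OF bounded_bilinear_inner] bounded_bilinear_scale[OF psi_bb]])
  have Bs: "B u v = B v u" for u v unfolding B_def psi_sym[of u v] inner_commute[of u v] ..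
  have low: "1 * (norm v)\<^sup>2 \<le> B v v" for v
  proof -
    have "\<bar>\<sigma> * psi v v\<bar> = \<bar>psi v v\<bar>" using \<sigma> by auto
    also have "\<dots> \<le> K * (norm v)\<^sup>2" using K(2)[rule_format, of v v] by (simp add: power2_eq_square mult_ac)
    finally have "\<sigma> * psi v v \<le> K * (norm v)\<^sup>2" by linarith
    moreover have "(K + 1) * (norm v)\<^sup>2 \<le> \<Lambda> * (norm v)\<^sup>2" using \<Lambda>1 by (rule mult_right_mono) simp
    ultimately show ?thesis by (simp add: B_def power2_norm_eq_inner algebra_simps)
  qed
  define \<kappa> where "\<kappa> = \<mu> / (4 * P\<^sup>2)"
  have \<kappa>: "0 < \<kappa>" using \<mu> P(1) by (simp add: \<kappa>_def)
  have neg: "B v (AH v) \<le> - \<kappa> * (norm v)\<^sup>2" if v: "v \<in> DH" "fluct v = v" for v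
  proof -
    define h g where "h = norm (ratio_dev v)" and "g = norm (ratio_gap v)"
    have K0: "0 \<le> \<Lambda>" using \<Lambda>1 K(1) by simp
    have 1: "\<Lambda> * inner v (AH v) \<le> - (\<Lambda> * \<omega> * g\<^sup>2)"
      using mult_left_mono[OF en[OF v(1)] K0] by (simp add: g_def mult_ac)
    have 2: "\<mu> * h\<^sup>2 - C * (g * h) - C * g\<^sup>2 \<le> \<sigma> * psi v (AH v)"
      using psi[OF v(1)] by (simp add: g_def h_def algebra_simps)
    have 3: "(C + C\<^sup>2 / (2 * \<mu>) + \<mu> / 2) * g\<^sup>2 \<le> \<Lambda> * \<omega> * g\<^sup>2" using \<Lambda>2 by (rule mult_right_mono) simp
    have "B v (AH v) \<le> - (C + C\<^sup>2 / (2 * \<mu>) + \<mu> / 2) * g\<^sup>2 - (\<mu> * h\<^sup>2 - C * (g * h) - C * g\<^sup>2)"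
      using 1 2 3 unfolding B_def by (simp add: algebra_simps)
    also have "\<dots> = C * (g * h) - \<mu> * h\<^sup>2 - C\<^sup>2 / (2 * \<mu>) * g\<^sup>2 - \<mu> / 2 * g\<^sup>2" by (simp add: algebra_simps)
    also have "\<dots> \<le> - (\<mu> / 2) * (h\<^sup>2 + g\<^sup>2)" using young_bound[OF \<mu>, of C g h] by (simp add: algebra_simps)
    also have "\<dots> \<le> - (\<mu> / 4) * (h + g)\<^sup>2"
    proof -
      have "(h + g)\<^sup>2 \<le> 2 * (h\<^sup>2 + g\<^sup>2)" using sum_squares_bound[of h g] by (simp add: power2_sum)
      then have "(\<mu> / 4) * (h + g)\<^sup>2 \<le> (\<mu> / 4) * (2 * (h\<^sup>2 + g\<^sup>2))" using \<mu> by (intro mult_left_mono) auto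
      then show ?thesis by (simp add: algebra_simps)
    qed
    also have "\<dots> \<le> - \<kappa> * (norm v)\<^sup>2"
    proof -
      have "norm v \<le> P * (h + g)" using P(2)[of v] v(2) by (simp add: h_def g_def)
      then have "(norm v)\<^sup>2 \<le> (P * (h + g))\<^sup>2" by (rule power_mono) simp
      then have "\<kappa> * (norm v)\<^sup>2 \<le> \<kappa> * (P * (h + g))\<^sup>2" using \<kappa> by (intro mult_left_mono) auto
      also have "\<dots> = (\<mu> / 4) * (h + g)\<^sup>2" using P(1) by (simp add: \<kappa>_def power_mult_distrib)
      finally show ?thesis by simp
    qed
    finally show ?thesis .
  qed
  show ?thesis
    by (rule gen.exponential_decay[OF fluct_bl fluct_DH fluct_idem Bb Bs zero_less_one low \<kappa> neg]) simp_all
qed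

end

section \<open>Mild solutions\<close>

lemma ae_eq_refl: "ae_eq p p" by (simp add: ae_eq_def)

lemma ae_eq_sym: "ae_eq p q \<Longrightarrow> ae_eq q p" by (simp add: ae_eq_def eq_commute)

lemma ae_eq_trans: assumes "ae_eq p q" "ae_eq q r" shows "ae_eq p r"
  unfolding ae_eq_def
proof
  fix i
  have "AE x in unit_measure. p i x = q i x" "AE x in unit_measure. q i x = r i x" using assms by (simp_all add: ae_eq_def)
  then show "AE x in unit_measure. p i x = r i x" by eventually_elim simp
qed

lemma bounded_linear_swap_scale:
  assumes "0 < K" "norm y \<le> norm x * K" shows "inverse K * norm y \<le> norm x"
  using assms by (simp add: field_simps)

context two_speed
begin

lemma norm_equivalence:
  "\<exists>c>0. \<exists>d>0. \<forall>p\<in>L2_pairs. c * L2_norm p \<le> X_norm w p \<and> X_norm w p \<le> d * L2_norm p"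
proof -
  define F where "F v = (mul (rw 1) (comp 1 v), mul (rw 2) (comp 2 v))" for v
  define G where "G v = (mul (\<lambda>x. inverse (rw 1 x)) (comp 1 v), mul (\<lambda>x. inverse (rw 2 x)) (comp 2 v))" for v
  have F: "bounded_linear F" unfolding F_def[abs_def]
    by (rule bounded_linear_Pair; rule bounded_linear_compose[OF mul_bounded_linear[OF rw_cont] comp_bounded_linear])
  have G: "bounded_linear G" unfolding G_def[abs_def]
    by (rule bounded_linear_Pair; rule bounded_linear_compose[OF mul_bounded_linear[OF rw_inv_cont] comp_bounded_linear])
  obtain K where K: "0 < K" "\<And>v. norm (F v) \<le> norm v * K" using bounded_linear.pos_bounded[OF F] by blast
  obtain L where L: "0 < L" "\<And>v. norm (G v) \<le> norm v * L" using bounded_linear.pos_bounded[OF G] by blast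
  have "inverse K * L2_norm p \<le> X_norm w p \<and> X_norm w p \<le> L * L2_norm p" if p: "p \<in> L2_pairs" for p
  proof -
    define P where "P = (cls (p 1), cls (p 2))"
    have cP: "comp i P = cls (p i)" for i using exhaust_2[of i] by (auto simp: comp_def P_def)
    have nP: "norm P = L2_norm p"
      unfolding L2_norm_def norm_cls[OF L2_pairsD[OF p], symmetric] cP[symmetric] norm_comp[symmetric] by simp
    have FP: "F (emb p) = P" unfolding F_def mul_rw_comp_emb[OF p] P_def ..
    have GP: "G P = emb p" unfolding G_def cP mul_cls[OF rw_inv_cont L2_pairsD[OF p]] emb_def ..
    show ?thesis unfolding X_norm_emb[OF p] nP[symmetric]
      using bounded_linear_swap_scale[OF K(1) K(2)[of "emb p", unfolded FP]] L(2)[of P] unfolding GP by (simp add: mult.commute)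
  qed
  moreover have "0 < inverse K" using K(1) by simp
  ultimately show ?thesis using L(1) by blast
qed

lemma emb_DH_iff: assumes p: "p \<in> L2_pairs" shows "emb p \<in> DH \<longleftrightarrow> p \<in> A_dom b w"
proof -
  have "ae_eq (prof (emb p)) u \<longleftrightarrow> ae_eq p u" for u
    using prof_emb[OF p] ae_eq_trans ae_eq_sym by blast
  then show ?thesis unfolding DH_def mem_Collect_eq A_dom_iff[OF p] A_dom_iff[OF prof_L2] by simp
qed

text \<open>
Passing through a different representative of the same class changes neither domain nor value.
\<close>
lemma AH_emb: assumes p: "p \<in> A_dom b w"
  shows "p \<in> L2_pairs" "A_op b p \<in> L2_pairs" "AH (emb p) = emb (A_op b p)"
proof -
  show pL: "p \<in> L2_pairs" using p unfolding A_dom_def X_space_eq by simp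
  obtain u u' where u: "periodic_ac u u'" "ae_eq p (density_of_flux u)" using p unfolding A_dom_iff[OF pL] by blast
  have u2: "ae_eq (prof (emb p)) (density_of_flux u)" by (rule ae_eq_trans[OF prof_emb[OF pL] u(2)])
  show AL: "A_op b p \<in> L2_pairs" by (rule A_op_flux(1)[OF pL u])
  have "ae_eq (A_op b (prof (emb p))) (A_op b p)"
    by (rule ae_eq_trans[OF A_op_flux(2)[OF prof_L2 u(1) u2] ae_eq_sym[OF A_op_flux(2)[OF pL u]]])
  then show "AH (emb p) = emb (A_op b p)"
    unfolding AH_def emb_eq_iff[OF A_op_flux(1)[OF prof_L2 u(1) u2] AL] .
qed

text \<open>
The notion of generator for profiles is the one in the Hilbert space.
\<close>
lemma generator_limit_iff:
  assumes p: "p \<in> L2_pairs" and g: "g \<in> L2_pairs" and S: "\<And>h. 0 \<le> h \<Longrightarrow> S h p \<in> L2_pairs"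
  shows "generator_limit w S p g \<longleftrightarrow> ((\<lambda>h. (emb (S h p) - emb p) /\<^sub>R h) \<longlongrightarrow> emb g) (at_right 0)"
proof -
  have "X_norm w (\<lambda>i x. (S h p i x - p i x) / complex_of_real h - g i x) = norm ((emb (S h p) - emb p) /\<^sub>R h - emb g)"
    if h: "0 < h" for h
  proof -
    have d: "(\<lambda>i x. S h p i x - p i x) \<in> L2_pairs" by (rule L2_pairs_diff[OF S p]) (use h in simp)
    have eq: "(\<lambda>i x. (S h p i x - p i x) / complex_of_real h - g i x)
        = (\<lambda>i x. complex_of_real (inverse h) * (S h p i x - p i x) - g i x)"
      by (simp add: divide_inverse mult.commute)
    have "emb (\<lambda>i x. complex_of_real (inverse h) * (S h p i x - p i x) - g i x)
        = cscale (complex_of_real (inverse h)) (emb (S h p) - emb p) - emb g"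
      unfolding emb_diff[OF L2_pairs_cmult[OF d] g] emb_cmult[OF d] emb_diff[OF S[OF less_imp_le[OF h]] p] ..
    then show ?thesis unfolding eq X_norm_emb[OF L2_pairs_diff[OF L2_pairs_cmult[OF d] g]] cscale_of_real by simp
  qed
  then have "generator_limit w S p g \<longleftrightarrow> ((\<lambda>h. norm ((emb (S h p) - emb p) /\<^sub>R h - emb g)) \<longlongrightarrow> 0) (at_right 0)"
    unfolding generator_limit_def
    by (intro tendsto_cong) (simp add: eventually_at_right_less eventually_at_filter)
  also have "\<dots> \<longleftrightarrow> ((\<lambda>h. (emb (S h p) - emb p) /\<^sub>R h) \<longlongrightarrow> emb g) (at_right 0)"
    unfolding tendsto_norm_zero_iff by (rule LIM_zero_iff)
  finally show ?thesis .
qed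

lemma generator_range:
  assumes p: "p \<in> L2_pairs" and S: "\<And>h. 0 \<le> h \<Longrightarrow> S h p \<in> L2_pairs"
  shows "(\<exists>g\<in>L2_pairs. generator_limit w S p g) \<longleftrightarrow> (\<exists>y. ((\<lambda>h. (emb (S h p) - emb p) /\<^sub>R h) \<longlongrightarrow> y) (at_right 0))"
proof
  assume "\<exists>g\<in>L2_pairs. generator_limit w S p g"
  then show "\<exists>y. ((\<lambda>h. (emb (S h p) - emb p) /\<^sub>R h) \<longlongrightarrow> y) (at_right 0)"
    using generator_limit_iff[where S = S, OF p _ S] by blast
next
  assume "\<exists>y. ((\<lambda>h. (emb (S h p) - emb p) /\<^sub>R h) \<longlongrightarrow> y) (at_right 0)"
  then obtain y where "((\<lambda>h. (emb (S h p) - emb p) /\<^sub>R h) \<longlongrightarrow> emb (prof y)) (at_right 0)" unfolding emb_prof by blast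
  then have "generator_limit w S p (prof y)" using generator_limit_iff[where S = S, OF p prof_L2 S] by blast
  then show "\<exists>g\<in>L2_pairs. generator_limit w S p g" using prof_L2 by blast
qed

definition flow :: "real \<Rightarrow> profile \<Rightarrow> profile" where "flow t p = prof (gen.T t (emb p))"

lemma emb_flow: "emb (flow t p) = gen.T t (emb p)" by (simp add: flow_def emb_prof)

lemma flow_L2: "flow t p \<in> L2_pairs" by (simp add: flow_def prof_L2)

lemma flow_bounded_operator: assumes t: "0 \<le> t" shows "bounded_operator_on_X w (flow t)"
  unfolding bounded_operator_on_X_def X_space_eq
proof (intro conjI ballI allI exI[of _ 1])
  fix p q c assume p: "p \<in> L2_pairs"
  show "flow t p \<in> L2_pairs" by (rule flow_L2)
  show "ae_eq (flow t (\<lambda>i x. c * p i x)) (\<lambda>i x. c * flow t p i x)"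
    unfolding emb_eq_iff[OF flow_L2 L2_pairs_cmult[OF flow_L2], symmetric] emb_cmult[OF flow_L2] emb_flow emb_cmult[OF p]
    by (rule gen.T_commute[OF cscale_bounded_linear _ t]) (simp add: cscale_DH)
  show "X_norm w (flow t p) \<le> 1 * X_norm w p"
    unfolding X_norm_emb[OF p] X_norm_emb[OF flow_L2] emb_flow using gen.T_contraction[OF t] by simp
  assume q: "q \<in> L2_pairs"
  show "ae_eq (flow t (\<lambda>i x. p i x + q i x)) (\<lambda>i x. flow t p i x + flow t q i x)"
    unfolding emb_eq_iff[OF flow_L2 L2_pairs_add[OF flow_L2 flow_L2], symmetric] emb_add[OF flow_L2 flow_L2] emb_flow emb_add[OF p q]
    by (rule gen.T_plus[OF t])
qed

lemma flow_C0: "C0_semigroup w flow"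
  unfolding C0_semigroup_def X_space_eq
proof (intro conjI allI impI ballI)
  show "bounded_operator_on_X w (flow t)" if "0 \<le> t" for t by (rule flow_bounded_operator[OF that])
  fix p assume p: "p \<in> L2_pairs"
  show "ae_eq (flow 0 p) p" unfolding emb_eq_iff[OF flow_L2 p, symmetric] emb_flow by (rule gen.T_at_0)
  show "ae_eq (flow (s + t) p) (flow s (flow t p))" if "0 \<le> s" "0 \<le> t" for s t
    unfolding emb_eq_iff[OF flow_L2 flow_L2, symmetric] emb_flow by (rule gen.T_semigroup[OF that])
  show "((\<lambda>t. X_norm w (\<lambda>i x. flow t p i x - p i x)) \<longlongrightarrow> 0) (at_right 0)"
    unfolding X_norm_emb[OF L2_pairs_diff[OF flow_L2 p]] emb_diff[OF flow_L2 p] emb_flow tendsto_norm_zero_iff LIM_zero_iff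
    by (rule gen.T_tendsto_0)
qed

lemma flow_generated: "A_generates b w flow"
  unfolding A_generates_def X_space_eq
proof (intro conjI ballI flow_C0)
  have "p \<in> A_dom b w \<longleftrightarrow> (\<exists>g\<in>L2_pairs. generator_limit w flow p g)" if p: "p \<in> L2_pairs" for p
    unfolding generator_range[where S = flow, OF p flow_L2] emb_flow emb_DH_iff[OF p, symmetric]
    using gen.T_generator[of "emb p"] gen.generator_domain[of "emb p"] by blast
  then show "A_dom b w = {p \<in> L2_pairs. \<exists>g\<in>L2_pairs. generator_limit w flow p g}"
    using AH_emb(1) by blast
  fix p assume p: "p \<in> A_dom b w"
  show "generator_limit w flow p (A_op b p)"
    unfolding generator_limit_iff[where S = flow, OF AH_emb(1,2)[OF p] flow_L2] emb_flow AH_emb(3)[OF p, symmetric]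
    by (rule gen.T_generator) (use emb_DH_iff[OF AH_emb(1)[OF p]] p in simp)
qed

text \<open>
A bounded operator on profiles respects almost everywhere equality, as the image of a null profile has norm zero. It therefore
induces a bounded linear operator on the Hilbert space.
\<close>
lemma bounded_operator_lift:
  assumes S: "bounded_operator_on_X w S"
  shows "p \<in> L2_pairs \<Longrightarrow> S p \<in> L2_pairs"
    and "p \<in> L2_pairs \<Longrightarrow> emb (S p) = emb (S (prof (emb p)))"
    and "bounded_linear (\<lambda>v. emb (S (prof v)))"
proof -
  have SL: "S p \<in> L2_pairs" if "p \<in> L2_pairs" for p
    using S that unfolding bounded_operator_on_X_def X_space_eq by blast
  then show "p \<in> L2_pairs \<Longrightarrow> S p \<in> L2_pairs" .
  have add: "emb (S (\<lambda>i x. p i x + q i x)) = emb (S p) + emb (S q)" if "p \<in> L2_pairs" "q \<in> L2_pairs" for p q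
  proof -
    have "ae_eq (S (\<lambda>i x. p i x + q i x)) (\<lambda>i x. S p i x + S q i x)"
      using S that unfolding bounded_operator_on_X_def X_space_eq by blast
    then show ?thesis
      unfolding emb_eq_iff[OF SL[OF L2_pairs_add[OF that]] L2_pairs_add[OF SL[OF that(1)] SL[OF that(2)]], symmetric]
        emb_add[OF SL[OF that(1)] SL[OF that(2)]] .
  qed
  have sc: "emb (S (\<lambda>i x. c * p i x)) = cscale c (emb (S p))" if "p \<in> L2_pairs" for p c
  proof -
    have "ae_eq (S (\<lambda>i x. c * p i x)) (\<lambda>i x. c * S p i x)"
      using S that unfolding bounded_operator_on_X_def X_space_eq by blast
    then show ?thesis
      unfolding emb_eq_iff[OF SL[OF L2_pairs_cmult[OF that]] L2_pairs_cmult[OF SL[OF that]], symmetric] emb_cmult[OF SL[OF that]] .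
  qed
  obtain K where K: "\<And>p. p \<in> L2_pairs \<Longrightarrow> X_norm w (S p) \<le> K * X_norm w p"
    using S unfolding bounded_operator_on_X_def X_space_eq by blast
  have bd: "norm (emb (S p)) \<le> K * norm (emb p)" if "p \<in> L2_pairs" for p
    using K[OF that] unfolding X_norm_emb[OF that] X_norm_emb[OF SL[OF that]] .
  have cong: "emb (S p) = emb (S q)" if p: "p \<in> L2_pairs" and q: "q \<in> L2_pairs" and e: "emb p = emb q" for p q
  proof -
    have m: "cscale (- 1) v = - v" for v using cscale_of_real[of "- 1" v] by simp
    note q' = L2_pairs_cmult[OF q, of "- 1"]
    have "norm (emb (S (\<lambda>i x. p i x + - 1 * q i x))) \<le> K * norm (emb (\<lambda>i x. p i x + - 1 * q i x))"
      by (rule bd[OF L2_pairs_add[OF p q']])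
    then show ?thesis unfolding add[OF p q'] sc[OF q] emb_add[OF p q'] emb_cmult[OF q] m e by simp
  qed
  show "emb (S p) = emb (S (prof (emb p)))" if "p \<in> L2_pairs"
    by (rule cong[OF that prof_L2]) (simp add: emb_prof)
  show "bounded_linear (\<lambda>v. emb (S (prof v)))"
  proof (rule bounded_linear_intro[of _ K])
    fix u v :: "cl2 \<times> cl2" and r :: real
    have "emb (S (prof (u + v))) = emb (S (\<lambda>i x. prof u i x + prof v i x))"
      by (rule cong[OF prof_L2 L2_pairs_add[OF prof_L2 prof_L2]]) (simp add: emb_prof emb_add prof_L2)
    then show "emb (S (prof (u + v))) = emb (S (prof u)) + emb (S (prof v))" unfolding add[OF prof_L2 prof_L2] .
    have "emb (S (prof (r *\<^sub>R v))) = emb (S (\<lambda>i x. complex_of_real r * prof v i x))"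
      by (rule cong[OF prof_L2 L2_pairs_cmult[OF prof_L2]]) (simp add: emb_prof emb_cmult prof_L2 cscale_of_real)
    then show "emb (S (prof (r *\<^sub>R v))) = r *\<^sub>R emb (S (prof v))" unfolding sc[OF prof_L2] cscale_of_real .
    show "norm (emb (S (prof v))) \<le> norm v * K" using bd[OF prof_L2[of v]] by (simp add: emb_prof mult.commute)
  qed
qed

text \<open>
Any semigroup of profiles generated by the operator induces a strongly continuous semigroup on the Hilbert space with the same
generator, to which \<open>generated_semigroup_unique\<close> applies.
\<close>
lemma generated_flow_unique:
  assumes T: "A_generates b w T" and p: "p \<in> L2_pairs" and t: "0 \<le> t"
  shows "ae_eq (T t p) (flow t p)"
proof -
  define S where "S s v = emb (T s (prof v))" for s v
  have C0: "C0_semigroup w T" and dom: "A_dom b w = {p \<in> L2_pairs. \<exists>g\<in>L2_pairs. generator_limit w T p g}"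
    and gl: "\<And>p. p \<in> A_dom b w \<Longrightarrow> generator_limit w T p (A_op b p)"
    using T unfolding A_generates_def X_space_eq by blast+
  have bo: "bounded_operator_on_X w (T s)" if "0 \<le> s" for s using C0 that unfolding C0_semigroup_def by blast
  note lift = bounded_operator_lift[OF bo]
  have id: "ae_eq (T 0 q) q" if "q \<in> L2_pairs" for q using C0 that unfolding C0_semigroup_def X_space_eq by blast
  have add: "ae_eq (T (r + s) q) (T r (T s q))" if "q \<in> L2_pairs" "0 \<le> r" "0 \<le> s" for q r s
    using C0 that unfolding C0_semigroup_def X_space_eq by blast
  have ct: "((\<lambda>t. X_norm w (\<lambda>i x. T t q i x - q i x)) \<longlongrightarrow> 0) (at_right 0)" if "q \<in> L2_pairs" for q
    using C0 that unfolding C0_semigroup_def X_space_eq by blast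
  have S: "c0_semigroup S"
  proof (rule c0_semigroup.intro)
    show "bounded_linear (S s)" if "0 \<le> s" for s unfolding S_def[abs_def] by (rule lift(3)[OF that])
    fix v
    show "S 0 v = v" using id[OF prof_L2[of v]] unfolding S_def emb_eq_iff[OF lift(1)[OF order_refl prof_L2] prof_L2, symmetric] emb_prof .
    show "S (r + s) v = S r (S s v)" if r: "0 \<le> r" and s: "0 \<le> s" for r s
    proof -
      have rs: "0 \<le> r + s" using r s by simp
      have "emb (T (r + s) (prof v)) = emb (T r (T s (prof v)))"
        using add[OF prof_L2[of v] r s]
        unfolding emb_eq_iff[OF lift(1)[OF rs prof_L2] lift(1)[OF r lift(1)[OF s prof_L2]]] .
      also have "\<dots> = S r (S s v)" unfolding S_def by (rule lift(2)[OF r lift(1)[OF s prof_L2]])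
      finally show ?thesis unfolding S_def .
    qed
    have "eventually (\<lambda>h. X_norm w (\<lambda>i x. T h (prof v) i x - prof v i x) = norm (S h v - v)) (at_right 0)"
      using eventually_at_right_less
    proof eventually_elim
      case (elim h)
      then have "0 \<le> h" by simp
      then show ?case
        unfolding X_norm_emb[OF L2_pairs_diff[OF lift(1)[OF \<open>0 \<le> h\<close> prof_L2] prof_L2]] emb_diff[OF lift(1)[OF \<open>0 \<le> h\<close> prof_L2] prof_L2]
        by (simp add: S_def emb_prof)
    qed
    then have "((\<lambda>h. norm (S h v - v)) \<longlongrightarrow> 0) (at_right 0)"
      by (rule tendsto_cong[THEN iffD1]) (rule ct[OF prof_L2])
    then show "((\<lambda>h. S h v) \<longlongrightarrow> v) (at_right 0)" unfolding tendsto_norm_zero_iff LIM_zero_iff .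
  qed
  have limit_iff: "generator_limit w T (prof v) g \<longleftrightarrow> ((\<lambda>h. (emb (T h (prof v)) - emb (prof v)) /\<^sub>R h) \<longlongrightarrow> emb g) (at_right 0)"
    if "g \<in> L2_pairs" for v g by (rule generator_limit_iff[where S = T, OF prof_L2 that lift(1)[OF _ prof_L2]])
  have range_iff: "(\<exists>g\<in>L2_pairs. generator_limit w T (prof v) g) \<longleftrightarrow>
      (\<exists>y. ((\<lambda>h. (emb (T h (prof v)) - emb (prof v)) /\<^sub>R h) \<longlongrightarrow> y) (at_right 0))"
    for v by (rule generator_range[where S = T, OF prof_L2 lift(1)[OF _ prof_L2]])
  have gen: "((\<lambda>h. (S h v - v) /\<^sub>R h) \<longlongrightarrow> AH v) (at_right 0)" if v: "v \<in> DH" for v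
  proof -
    have pv: "prof v \<in> A_dom b w" using v unfolding DH_def by simp
    show ?thesis
      using gl[OF pv] unfolding limit_iff[OF AH_emb(2)[OF pv]] emb_prof AH_def S_def .
  qed
  have domS: "v \<in> DH" if "((\<lambda>h. (S h v - v) /\<^sub>R h) \<longlongrightarrow> y) (at_right 0)" for v y
  proof -
    have "\<exists>y. ((\<lambda>h. (emb (T h (prof v)) - emb (prof v)) /\<^sub>R h) \<longlongrightarrow> y) (at_right 0)"
      using that unfolding emb_prof S_def by blast
    then have "\<exists>g\<in>L2_pairs. generator_limit w T (prof v) g"
      unfolding range_iff .
    then show ?thesis unfolding DH_def dom using prof_L2 by blast
  qed
  have "S t (emb p) = gen.T t (emb p)" by (rule gen.generated_semigroup_unique[OF S gen domS t])
  then have "emb (T t p) = emb (flow t p)" unfolding emb_flow S_def lift(2)[OF t p] .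
  then show ?thesis unfolding emb_eq_iff[OF lift(1)[OF t p] flow_L2] .
qed

lemma mild_solution_flow: "p \<in> L2_pairs \<Longrightarrow> mild_solution b w p (\<lambda>t. flow t p)"
  unfolding mild_solution_def X_space_eq using flow_generated ae_eq_refl by blast

lemma mild_solution_unique:
  assumes q: "mild_solution b w p q" and t: "0 \<le> t" shows "ae_eq (q t) (flow t p)"
proof -
  obtain T where T: "A_generates b w T" "ae_eq (q t) (T t p)" and p: "p \<in> L2_pairs"
    using q t unfolding mild_solution_def X_space_eq by blast
  show ?thesis by (rule ae_eq_trans[OF T(2) generated_flow_unique[OF T(1) p t]])
qed

lemma mass_flow: "p \<in> L2_pairs \<Longrightarrow> 0 \<le> t \<Longrightarrow> mass (flow t p) = mass p"
  using mass_cl2_invariant[of t "emb p"] unfolding emb_flow[symmetric] by (simp add: mass_cl2_emb flow_L2)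

lemma fluctuation_norm:
  assumes p: "p \<in> L2_pairs" and t: "0 \<le> t"
  shows "X_norm w (\<lambda>i x. flow t p i x - Proj w (flow t p) i x) = norm (gen.T t (fluct (emb p)))"
proof -
  have P: "Proj w q = of_ratio (\<lambda>i x. mass q)" for q
    by (simp add: Proj_def of_ratio_def scaleR_conv_of_real mult.commute)
  have PL: "Proj w q \<in> L2_pairs" for q unfolding P by (rule of_ratio_L2[OF L2_const])
  have "emb (Proj w (flow t p)) = equilibrium (mass_cl2 (gen.T t (emb p)))"
    unfolding P equilibrium_of_ratio mass_cl2_emb[OF flow_L2, of t p, symmetric] emb_flow ..
  then have "X_norm w (\<lambda>i x. flow t p i x - Proj w (flow t p) i x) = norm (fluct (gen.T t (emb p)))"
    unfolding X_norm_emb[OF L2_pairs_diff[OF flow_L2 PL]] emb_diff[OF flow_L2 PL] emb_flow fluct_def by simp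
  also have "fluct (gen.T t (emb p)) = gen.T t (fluct (emb p))"
    by (rule gen.T_commute[OF fluct_bl fluct_DH t, symmetric])
  finally show ?thesis .
qed

end

theorem theorem1:
  fixes b :: "2 \<Rightarrow> real \<Rightarrow> real"
  assumes "\<And>i. C1_unit (b i)"
    and "\<And>i x. x \<in> {0..1} \<Longrightarrow> b i x \<noteq> 0"
    and "\<exists>x\<in>{0..1}. b 1 x \<noteq> b 2 x"
  shows "(\<exists>pinf. normalized_positive_steady_state b pinf
            \<and> (\<forall>q. normalized_positive_steady_state b q \<longrightarrow>
                   (\<forall>i. \<forall>x\<in>{0..1}. q i x = pinf i x)))
       \<and> (\<forall>pinf. normalized_positive_steady_state b pinf \<longrightarrow>
            X_space pinf = L2_pairs
          \<and> (\<exists>c>0. \<exists>d>0. \<forall>p\<in>L2_pairs.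
                c * L2_norm p \<le> X_norm pinf p \<and> X_norm pinf p \<le> d * L2_norm p)
          \<and> (\<exists>C \<alpha>. C = exp (pi / 2) \<and> C > 1 \<and> \<alpha> > 0
              \<and> (\<forall>pinit\<in>L2_pairs.
                   \<exists>p. mild_solution b pinf pinit p
                     \<and> (\<forall>q. mild_solution b pinf pinit q \<longrightarrow> (\<forall>t\<ge>0. ae_eq (q t) (p t)))
                     \<and> (\<forall>t\<ge>0. Proj pinf (p t) = Proj pinf pinit)
                     \<and> (\<forall>t\<ge>0. X_norm pinf (\<lambda>i x. p t i x - Proj pinf (p t) i x)
                            \<le> C * exp (- \<alpha> * t)
                               * X_norm pinf (\<lambda>i x. p 0 i x - Proj pinf (p 0) i x)))))"
proof (intro conjI allI impI)
  have bc: "continuous_on {0..1} (b i)" for i by (rule C1_unit_continuous[OF assms(1)])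
  have "\<exists>p. normalized_positive_steady_state b p" by (rule steady_state_exists[OF bc assms(2)])
  then obtain pinf where pinf: "normalized_positive_steady_state b pinf" by blast
  show "\<exists>pinf. normalized_positive_steady_state b pinf
            \<and> (\<forall>q. normalized_positive_steady_state b q \<longrightarrow>
                   (\<forall>i. \<forall>x\<in>{0..1}. q i x = pinf i x))"
  proof (rule exI[of _ pinf], intro conjI allI impI ballI)
    show "normalized_positive_steady_state b pinf" by (rule pinf)
    show "q i x = pinf i x" if "normalized_positive_steady_state b q" "x \<in> {0..1}" for q i x
      by (rule steady_state_unique[OF bc assms(2) pinf that])
  qed
next
  fix w assume w: "normalized_positive_steady_state b w"
  interpret distinct_speeds b w by unfold_locales (fact assms w)+
  show "X_space w = L2_pairs" by (rule X_space_eq)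
  show "\<exists>c>0. \<exists>d>0. \<forall>p\<in>L2_pairs. c * L2_norm p \<le> X_norm w p \<and> X_norm w p \<le> d * L2_norm p"
    by (rule norm_equivalence)
  obtain \<alpha> where \<alpha>: "0 < \<alpha>" "\<And>v t. 0 \<le> t \<Longrightarrow> norm (gen.T t (fluct v)) \<le> exp (pi / 2) * exp (- \<alpha> * t) * norm (fluct v)"
    using fluctuation_decay by blast
  show "\<exists>C \<alpha>. C = exp (pi / 2) \<and> C > 1 \<and> \<alpha> > 0
              \<and> (\<forall>pinit\<in>L2_pairs.
                   \<exists>p. mild_solution b w pinit p
                     \<and> (\<forall>q. mild_solution b w pinit q \<longrightarrow> (\<forall>t\<ge>0. ae_eq (q t) (p t)))
                     \<and> (\<forall>t\<ge>0. Proj w (p t) = Proj w pinit)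
                     \<and> (\<forall>t\<ge>0. X_norm w (\<lambda>i x. p t i x - Proj w (p t) i x)
                            \<le> C * exp (- \<alpha> * t)
                               * X_norm w (\<lambda>i x. p 0 i x - Proj w (p 0) i x)))"
  proof (rule exI[of _ "exp (pi / 2)"], rule exI[of _ \<alpha>], intro conjI ballI refl)
    show "1 < exp (pi / 2)" by simp
    show "0 < \<alpha>" by (rule \<alpha>(1))
    fix p assume p: "p \<in> L2_pairs"
    show "\<exists>q. mild_solution b w p q
                     \<and> (\<forall>q'. mild_solution b w p q' \<longrightarrow> (\<forall>t\<ge>0. ae_eq (q' t) (q t)))
                     \<and> (\<forall>t\<ge>0. Proj w (q t) = Proj w p)
                     \<and> (\<forall>t\<ge>0. X_norm w (\<lambda>i x. q t i x - Proj w (q t) i x)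
                            \<le> exp (pi / 2) * exp (- \<alpha> * t)
                               * X_norm w (\<lambda>i x. q 0 i x - Proj w (q 0) i x))"
    proof (intro exI[of _ "\<lambda>t. flow t p"] conjI allI impI)
      show "mild_solution b w p (\<lambda>t. flow t p)" by (rule mild_solution_flow[OF p])
      show "ae_eq (q t) (flow t p)" if "mild_solution b w p q" "0 \<le> t" for q t by (rule mild_solution_unique[OF that])
      show "Proj w (flow t p) = Proj w p" if "0 \<le> t" for t unfolding Proj_def mass_flow[OF p that] ..
      show "X_norm w (\<lambda>i x. flow t p i x - Proj w (flow t p) i x)
          \<le> exp (pi / 2) * exp (- \<alpha> * t) * X_norm w (\<lambda>i x. flow 0 p i x - Proj w (flow 0 p) i x)" if t: "0 \<le> t" for t
        unfolding fluctuation_norm[OF p t] fluctuation_norm[OF p order_refl] gen.T_at_0 by (rule \<alpha>(2)[OF t])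
    qed
  qed
qed

end
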